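(* Let $(\delta_n)_{n\ge1}$ be a family of alternate gap lengths on $\mathcal H^{o}=L^2(S^1,\mathbb C)$. (i) If $q\in\mathcal H^w$ with $w\in\mathcal M$, then $$\sum_{n\ge N}w_n^2|\delta_n(q)|^2\le4\|T_Nq\|_w^2+\frac{256}{N}\|q\|_w^4$$ for all sufficiently large $N$, where $T_Nq=\sum_{|n|\ge N}q_ne^{2n\pi ix}$. (ii) Conversely, let $w$ be a normalized weight and suppose $q\in\mathcal H^{o}$ satisfies $$\sum_{n\ge1}w_n^2\bigl(|\gamma_n(q)|+|\delta_n(q)|\bigr)^2<\infty.$$ If $w$ is strictly subexponential, then $q\in\mathcal H^w$. On the other hand, if $w$ is exponential, then $q$ is analytic.
   Context: Let $S^1=\mathbb R/\mathbb Z$. A normalized weight is a function $w:\mathbb Z\to\mathbb R$, $n\mapsto w_n=w(n)$, with $w_n=w_{-n}\ge1$ for all $n$. $\mathcal M$ is the class of submultiplicative normalized weights: $w_{n+m}\le w_nw_m$ for all $n,m$. An exponential weight is a $w\in\mathcal M$ with $\liminf_{n\to\infty}\frac{\log w(n)}{n}>0$. A normalized weight is strictly subexponential if $\frac{\log w(n)}{n}\to0$ as $n\to\infty$ in an eventually monotone manner, and $w(n)$ is nondecreasing for $n\ge0$. For $q=\sum_{n\in\mathbb Z}q_ne^{2n\pi ix}$ put $\|q\|_w^2=\sum_{n\in\mathbb Z}w_n^2|q_n|^2$, and $\mathcal H^w=\{q\in L^2(S^1,\mathbb C):\|q\|_w<\infty\}$. Let $\|\cdot\|_{o}$ be the usual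 norm of $\mathcal H^{o}=L^2(S^1,\mathbb C)$ (weight $w\equiv1$). For complex $q\in\mathcal H^{o}$, the periodic eigenvalues are the eigenvalues of $L=-\frac{d^2}{dx^2}+q$ on $[0,1]$ with periodic or anti-periodic boundary conditions (both types taken together; equivalently the eigenvalues of $-\frac{d^2}{dx^2}+q$ on functions of period 2), listed with algebraic multiplicity and ordered lexicographically (first by real part, then by imaginary part): $\lambda_0(q)\prec\lambda_1^-(q)\preceq\lambda_1^+(q)\prec\dots\prec\lambda_n^-(q)\preceq\lambda_n^+(q)\prec\cdots$. The gap lengths are $\gamma_n(q)=\lambda_n^+(q)-\lambda_n^-(q)$, $n\ge1$. A family of alternate gap lengths is a family of continuously differentiable functions $\delta_n:\mathcal H^{o}\to\mathbb C$, $n\ge1$, such that: (a) $\delta_n(q)=0$ whenever $\lambda_n^+(q)=\lambda_n^-(q)$ and this eigenvalue also has geometric multiplicity 2; (b) there are real numbers $\xi_n$ such that, with $t_n(x)=\cos 2n\pi(x+\xi_n)$, the gradients satisfy $d\delta_n=t_n+O(1/n)$ uniformly on bounded subsets of $\mathcal H^{o}$, that is, $\|d_q\delta_n-t_n\|_{o}\le C_\delta(\|q\|_{o})/n$ with $C_\delta$ depending only on $\|q\|_{o}$. Here the gradient $d_q\delta_n\in L^2(S^1,\mathbb C)$ represents the derivative at $q$ via $h\mapsto\int_0^1(d_q\delta_n)\,h\,dx$. "Analytic" for an $L^2$-function means that it agrees almost everywhere with an analytic function on $S^1$. *)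

theory Defs
  imports "HOL-Analysis.Analysis" "HOL-Library.Function_Algebras"
begin

text \<open>
  An element of \<open>L\<^sup>2(S\<^sup>1, \<complex>)\<close> is represented by any of its 1-periodic representatives
  \<open>real \<Rightarrow> complex\<close>; two representatives denote the same element iff they agree
  almost everywhere.
\<close>

definition L2 :: "(real \<Rightarrow> complex) set" where
  "L2 = {q \<in> borel_measurable lebesgue.
          (\<forall>x. q (x + 1) = q x) \<and> set_integrable lebesgue {0..1} (\<lambda>x. (cmod (q x))\<^sup>2)}"

definition L2_norm :: "(real \<Rightarrow> complex) \<Rightarrow> real" where
  "L2_norm q = sqrt (LINT x:{0..1}|lebesgue. (cmod (q x))\<^sup>2)"

definition fourier :: "(real \<Rightarrow> complex) \<Rightarrow> int \<Rightarrow> complex" where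
  "fourier q n = (LINT x:{0..1}|lebesgue. q x * cis (- (2 * pi * of_int n * x)))"

definition normalized_weight :: "(int \<Rightarrow> real) \<Rightarrow> bool" where
  "normalized_weight w \<longleftrightarrow> (\<forall>n. w (- n) = w n \<and> w n \<ge> 1)"

definition submult_weight :: "(int \<Rightarrow> real) \<Rightarrow> bool" where
  "submult_weight w \<longleftrightarrow> normalized_weight w \<and> (\<forall>n m. w (n + m) \<le> w n * w m)"

definition exponential_weight :: "(int \<Rightarrow> real) \<Rightarrow> bool" where
  "exponential_weight w \<longleftrightarrow>
     submult_weight w \<and> liminf (\<lambda>n. ereal (ln (w (int n)) / real n)) > 0"

definition strictly_subexponential :: "(int \<Rightarrow> real) \<Rightarrow> bool" where
  "strictly_subexponential w \<longleftrightarrow>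
     normalized_weight w \<and>
     (\<lambda>n. ln (w (int n)) / real n) \<longlonglongrightarrow> 0 \<and>
     (\<exists>N. monoseq (\<lambda>n. ln (w (int (n + N))) / real (n + N))) \<and>
     mono_on {0..} w"

text \<open>
  The weighted norm and the truncation \<open>T\<^sub>N\<close> depend on \<open>q\<close> only through its Fourier
  coefficients, so both are defined on coefficient sequences.
\<close>

definition weighted_norm :: "(int \<Rightarrow> real) \<Rightarrow> (int \<Rightarrow> complex) \<Rightarrow> real" where
  "weighted_norm w a = sqrt (\<Sum>\<^sub>\<infinity>n. (w n)\<^sup>2 * (cmod (a n))\<^sup>2)"

definition trunc :: "nat \<Rightarrow> (int \<Rightarrow> complex) \<Rightarrow> int \<Rightarrow> complex" where
  "trunc N a = (\<lambda>n. if \<bar>n\<bar> \<ge> int N then a n else 0)"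

definition H_weighted :: "(int \<Rightarrow> real) \<Rightarrow> (real \<Rightarrow> complex) set" where
  "H_weighted w = {q \<in> L2. (\<lambda>n. (w n)\<^sup>2 * (cmod (fourier q n))\<^sup>2) summable_on UNIV}"

definition analytic_circle :: "(real \<Rightarrow> complex) \<Rightarrow> bool" where
  "analytic_circle q \<longleftrightarrow>
     (\<exists>f. (\<forall>x. f (x + 1) = f x) \<and>
          (\<forall>x\<^sub>0. \<exists>a r. r > 0 \<and>
             (\<forall>x. \<bar>x - x\<^sub>0\<bar> < r \<longrightarrow> (\<lambda>k. a k * complex_of_real (x - x\<^sub>0) ^ k) sums f x)) \<and>
          (AE x in lebesgue. q x = f x))"

text \<open>
  \<open>hill_op q f v\<close> says that \<open>f\<close> lies in the domain of \<open>L = - d\<^sup>2/dx\<^sup>2 + q\<close> on functions of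
  period 2 and that \<open>L f = v\<close> almost everywhere. The domain is \<open>H\<^sup>2\<close>: \<open>f\<close> is continuously
  differentiable, and its derivative \<open>f'\<close> is an indefinite integral of a locally square
  integrable function \<open>f''\<close>.
\<close>

definition hill_op :: "(real \<Rightarrow> complex) \<Rightarrow> (real \<Rightarrow> complex) \<Rightarrow> (real \<Rightarrow> complex) \<Rightarrow> bool" where
  "hill_op q f v \<longleftrightarrow>
     (\<forall>x. f (x + 2) = f x) \<and>
     (\<exists>f' f''.
        (\<forall>x. (f has_vector_derivative f' x) (at x)) \<and>
        f'' \<in> borel_measurable lebesgue \<and>
        (\<forall>a b. set_integrable lebesgue {a..b} (\<lambda>x. (cmod (f'' x))\<^sup>2)) \<and>
        (\<forall>a b. a \<le> b \<longrightarrow> (f'' has_integral (f' b - f' a)) {a..b}) \<and>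
        (AE x in lebesgue. v x = - f'' x + q x * f x))"

text \<open>\<open>root_kernel q z k\<close> is the kernel of \<open>(L - z)\<^sup>k\<close>.\<close>

primrec root_kernel :: "(real \<Rightarrow> complex) \<Rightarrow> complex \<Rightarrow> nat \<Rightarrow> (real \<Rightarrow> complex) set" where
  "root_kernel q z 0 = {0}"
| "root_kernel q z (Suc k) =
     {f. \<exists>v \<in> root_kernel q z k. hill_op q f (\<lambda>x. z * f x + v x)}"

interpretation cfun: vector_space "\<lambda>(c::complex) (f::real \<Rightarrow> complex) x. c * f x"
  by unfold_locales (auto simp: fun_eq_iff algebra_simps)

definition geometric_mult :: "(real \<Rightarrow> complex) \<Rightarrow> complex \<Rightarrow> nat" where
  "geometric_mult q z = cfun.dim {f. hill_op q f (\<lambda>x. z * f x)}"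

definition algebraic_mult :: "(real \<Rightarrow> complex) \<Rightarrow> complex \<Rightarrow> nat" where
  "algebraic_mult q z = cfun.dim (\<Union>k. root_kernel q z k)"

definition lex_le :: "complex \<Rightarrow> complex \<Rightarrow> bool" where
  "lex_le z z' \<longleftrightarrow> Re z < Re z' \<or> (Re z = Re z' \<and> Im z \<le> Im z')"

text \<open>
  Only weak lexicographic monotonicity is required: for complex \<open>q\<close> an eigenvalue may have
  algebraic multiplicity greater than 2, and then consecutive pairs share an eigenvalue.
\<close>

definition lists_periodic_eigenvalues :: "(real \<Rightarrow> complex) \<Rightarrow> (nat \<Rightarrow> complex) \<Rightarrow> bool" where
  "lists_periodic_eigenvalues q \<mu> \<longleftrightarrow>
     (\<forall>k. lex_le (\<mu> k) (\<mu> (Suc k))) \<and>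
     (\<forall>z. finite {k. \<mu> k = z} \<and> card {k. \<mu> k = z} = algebraic_mult q z)"

lemma lists_periodic_eigenvalues_unique:
  assumes "lists_periodic_eigenvalues q \<mu>" "lists_periodic_eigenvalues q \<nu>"
  shows "\<mu> = \<nu>"
proof -
  have mono: "lex_le (\<rho> i) (\<rho> j)" if "lists_periodic_eigenvalues q \<rho>" "i \<le> j" for \<rho> i j
    using that(2)
  proof (induction rule: dec_induct)
    case base
    show ?case by (simp add: lex_le_def)
  next
    case (step m)
    have "lex_le (\<rho> m) (\<rho> (Suc m))"
      using that(1) by (simp add: lists_periodic_eigenvalues_def)
    with step.IH show ?case by (auto simp: lex_le_def)
  qed
  have no_drop: False
    if \<rho>: "lists_periodic_eigenvalues q \<rho>" and \<sigma>: "lists_periodic_eigenvalues q \<sigma>"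
      and eq: "\<And>j. j < k \<Longrightarrow> \<rho> j = \<sigma> j" and ne: "\<rho> k \<noteq> \<sigma> k" and le: "lex_le (\<rho> k) (\<sigma> k)"
    for \<rho> \<sigma> k
  proof -
    have "j < k" if "\<sigma> j = \<rho> k" for j
    proof (rule ccontr)
      assume "\<not> j < k"
      then have "lex_le (\<sigma> k) (\<rho> k)" using mono[OF \<sigma>, of k j] that by simp
      with le ne show False by (auto simp: lex_le_def complex_eq_iff)
    qed
    then have "{j. \<sigma> j = \<rho> k} \<subset> {j. \<rho> j = \<rho> k}" using eq ne by force
    moreover have "finite {j. \<rho> j = \<rho> k}"
      using \<rho> by (simp add: lists_periodic_eigenvalues_def)
    ultimately have "card {j. \<sigma> j = \<rho> k} < card {j. \<rho> j = \<rho> k}" by (rule psubset_card_mono[rotated])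
    with \<rho> \<sigma> show False by (simp add: lists_periodic_eigenvalues_def)
  qed
  have "\<mu> k = \<nu> k" for k
  proof (induction k rule: less_induct)
    case (less k)
    have "lex_le (\<mu> k) (\<nu> k) \<or> lex_le (\<nu> k) (\<mu> k)" by (auto simp: lex_le_def)
    then show ?case
      using no_drop[OF assms, of k] no_drop[OF assms(2,1), of k] less by metis
  qed
  then show ?thesis by blast
qed

definition periodic_eigenvalue :: "(real \<Rightarrow> complex) \<Rightarrow> nat \<Rightarrow> complex" where
  "periodic_eigenvalue q = (THE \<mu>. lists_periodic_eigenvalues q \<mu>)"

text \<open>
  Position 0 of the list is \<open>\<lambda>\<^sub>0\<close>; for \<open>n \<ge> 1\<close>, positions \<open>2n - 1\<close> and \<open>2n\<close> are
  \<open>\<lambda>\<^sub>n\<^sup>-\<close> and \<open>\<lambda>\<^sub>n\<^sup>+\<close>.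
\<close>

definition lambda_minus :: "nat \<Rightarrow> (real \<Rightarrow> complex) \<Rightarrow> complex" where
  "lambda_minus n q = periodic_eigenvalue q (2 * n - 1)"

definition lambda_plus :: "nat \<Rightarrow> (real \<Rightarrow> complex) \<Rightarrow> complex" where
  "lambda_plus n q = periodic_eigenvalue q (2 * n)"

definition gap_length :: "nat \<Rightarrow> (real \<Rightarrow> complex) \<Rightarrow> complex" where
  "gap_length n q = lambda_plus n q - lambda_minus n q"

text \<open>
  \<open>has_gradient f q g\<close>: the functional \<open>f\<close> on \<open>L\<^sup>2\<close> is Frechet differentiable at \<open>q\<close> with
  derivative \<open>h \<mapsto> \<integral>\<^sub>0\<^sup>1 g h dx\<close> (no complex conjugation).
\<close>

definition has_gradient ::
  "((real \<Rightarrow> complex) \<Rightarrow> complex) \<Rightarrow> (real \<Rightarrow> complex) \<Rightarrow> (real \<Rightarrow> complex) \<Rightarrow> bool" where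
  "has_gradient f q g \<longleftrightarrow>
     g \<in> L2 \<and>
     (\<forall>\<epsilon>>0. \<exists>d>0. \<forall>h\<in>L2. L2_norm h < d \<longrightarrow>
        cmod (f (\<lambda>x. q x + h x) - f q - (LINT x:{0..1}|lebesgue. g x * h x)) \<le> \<epsilon> * L2_norm h)"

definition cont_diff_with_gradient ::
  "((real \<Rightarrow> complex) \<Rightarrow> complex) \<Rightarrow> ((real \<Rightarrow> complex) \<Rightarrow> real \<Rightarrow> complex) \<Rightarrow> bool" where
  "cont_diff_with_gradient f G \<longleftrightarrow>
     (\<forall>p\<in>L2. \<forall>q\<in>L2. (AE x in lebesgue. p x = q x) \<longrightarrow> f p = f q) \<and>
     (\<forall>q\<in>L2. has_gradient f q (G q)) \<and>
     (\<forall>q\<in>L2. \<forall>\<epsilon>>0. \<exists>d>0. \<forall>p\<in>L2.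
        L2_norm (\<lambda>x. p x - q x) < d \<longrightarrow> L2_norm (\<lambda>x. G p x - G q x) < \<epsilon>)"

text \<open>
  \<open>C\<close> below is uniform over each ball of \<open>L\<^sup>2\<close>, i.e. a nondecreasing function of the norm of \<open>q\<close>.
\<close>

definition alternate_gap_lengths :: "(nat \<Rightarrow> (real \<Rightarrow> complex) \<Rightarrow> complex) \<Rightarrow> bool" where
  "alternate_gap_lengths \<delta> \<longleftrightarrow>
     (\<exists>G (\<xi> :: nat \<Rightarrow> real).
        (\<forall>n\<ge>1. cont_diff_with_gradient (\<delta> n) (G n)) \<and>
        (\<forall>n\<ge>1. \<forall>q\<in>L2.
           lambda_plus n q = lambda_minus n q \<and> geometric_mult q (lambda_plus n q) = 2
           \<longrightarrow> \<delta> n q = 0) \<and>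
        (\<forall>R. \<exists>C. \<forall>n\<ge>1. \<forall>q\<in>L2. L2_norm q \<le> R \<longrightarrow>
           L2_norm (\<lambda>x. G n q x - complex_of_real (cos (2 * real n * pi * (x + \<xi> n))))
             \<le> C / real n))"

end

theory Submission
  imports Defs "HOL-Computational_Algebra.Fundamental_Theorem_Algebra"
begin

text \<open>
  On functions of period 2 the operator \<open>- d\<^sup>2/dx\<^sup>2 + q\<close> acts on Fourier coefficients by
  \<open>a\<^sub>k \<mapsto> \<pi>\<^sup>2k\<^sup>2 a\<^sub>k + (V * a)\<^sub>k\<close>. For \<open>z\<close> near \<open>\<pi>\<^sup>2n\<^sup>2\<close> a Lyapunov-Schmidt reduction to the modes \<open>\<plusminus>n\<close>
  leaves a \<open>2 \<times> 2\<close> system whose off-diagonal entries \<open>c\<^sub>+, c\<^sub>-\<close> are the Fourier coefficients \<open>q\<^bsub>\<plusminus>n\<^esub>\<close> up to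
  \<open>O(1/n)\<close>, also in weighted norms. Changing only \<open>q\<^bsub>\<plusminus>n\<^esub>\<close> one reaches, by a contraction, a potential \<open>p\<close> for
  which the whole system vanishes. Its \<open>n\<close>-th eigenvalue is geometrically double, so \<open>\<delta>\<^sub>n(p) = 0\<close>, and the
  mean value theorem gives \<open>\<delta>\<^sub>n(q) = \<integral> t\<^sub>n (q - p) + O(|q - p|/n)\<close>. This yields (i). That the two
  eigenvalues near \<open>\<pi>\<^sup>2n\<^sup>2\<close> really are \<open>\<lambda>\<^sub>n\<^sup>-\<close> and \<open>\<lambda>\<^sub>n\<^sup>+\<close> is seen by counting: the root vectors to the left of
  a large vertical line span an invariant graph over the low modes, found from a Riccati equation.

  For (ii), if \<open>\<gamma>\<^sub>n\<close> is small then \<open>c\<^sub>+c\<^sub>-\<close> is small compared with \<open>max(|c\<^sub>+|, |c\<^sub>-|)\<^sup>2\<close>, and then no cancellation occurs in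
  \<open>\<integral> t\<^sub>n (q - p)\<close>; hence \<open>|c\<^sub>\<plusminus>| \<le> 16 (|\<gamma>\<^sub>n| + |\<delta>\<^sub>n|)\<close> at \<open>z = \<lambda>\<^sub>n\<^sup>-\<close>. The high modes of \<open>q\<close> are the fixed point of
  \<open>q\<^sub>n \<mapsto> c\<^sub>n - (c\<^sub>n(q) - q\<^sub>n)\<close>, a contraction that preserves balls of \<open>\<H>\<^sup>u\<close> once the low modes and
  the \<open>c\<^sub>n\<close> have bounded norm there. This holds for weights \<open>u \<le> w\<close> growing at a small exponential rate.
\<close>

section \<open>Square-summable sequences\<close>

text \<open>One mechanism carries all estimates. Off the block the reciprocal divisors
  \<open>Bres\<close> have \<open>ell2\<close> norm at most \<open>1 / n\<close>, so multiplying by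
  them and then convolving with \<open>V\<close> is a contraction in the supremum norm once
  \<open>n\<close> is large. Submultiplicativity lets a weight pass through the convolution with the
  same constant. Fixed points are found in weighted boxes but are unique among all bounded
  sequences, so any solution known only to be bounded inherits the weighted bound. The obstacle is
  that \<open>q\<close> is complex. The operator is not self-adjoint, Jordan blocks occur, and the
  two off-diagonal entries are unrelated: the gap length sees little more than their product, which
  may vanish while one factor is large. The alternate gap lengths supply the second relation.
  Multiplicities are counted without determinants or contour integrals, by linear algebra on a space
  of dimension \<open>2 * K + 1\<close>; this counting is also what allows a perturbed potential to
  be tested against condition (a), which speaks of positions in the ordered list.\<close>

definition ell2 :: "('i \<Rightarrow> 'b::real_normed_vector) \<Rightarrow> real \<Rightarrow> bool" where
  "ell2 a A \<longleftrightarrow> 0 \<le> A \<and> (\<forall>F. finite F \<longrightarrow> (\<Sum>j\<in>F. (norm (a j))\<^sup>2) \<le> A\<^sup>2)"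

lemma ell2_nonneg: "ell2 a A \<Longrightarrow> 0 \<le> A"
  by (simp add: ell2_def)

lemma ell2_mono: "ell2 a A \<Longrightarrow> A \<le> B \<Longrightarrow> ell2 a B"
  unfolding ell2_def by (meson order.trans power_mono)

lemma ell2_le:
  assumes "ell2 b B" "\<And>j. norm (a j) \<le> norm (b j)"
  shows "ell2 a B"
  unfolding ell2_def
proof (intro conjI allI impI)
  show "0 \<le> B" using assms(1) by (simp add: ell2_def)
  fix F :: "'a set" assume "finite F"
  have "(\<Sum>j\<in>F. (norm (a j))\<^sup>2) \<le> (\<Sum>j\<in>F. (norm (b j))\<^sup>2)"
    by (intro sum_mono power_mono assms) auto
  then show "(\<Sum>j\<in>F. (norm (a j))\<^sup>2) \<le> B\<^sup>2"
    using assms(1) \<open>finite F\<close> unfolding ell2_def by (meson order.trans)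
qed

lemma ell2_point:
  assumes "ell2 a A" shows "norm (a j) \<le> A"
proof -
  have "(\<Sum>j\<in>{j}. (norm (a j))\<^sup>2) \<le> A\<^sup>2" using assms unfolding ell2_def by blast
  then show ?thesis using assms by (simp add: ell2_def abs_le_square_iff[symmetric])
qed

lemma ell2_reindex:
  assumes "ell2 a A" "inj f"
  shows "ell2 (\<lambda>j. a (f j)) A"
  unfolding ell2_def
proof (intro conjI allI impI)
  show "0 \<le> A" using assms(1) by (simp add: ell2_def)
  fix F :: "'c set" assume "finite F"
  have "(\<Sum>j\<in>F. (norm (a (f j)))\<^sup>2) = (\<Sum>j\<in>f ` F. (norm (a j))\<^sup>2)"
    using assms(2) by (subst sum.reindex) (auto intro: inj_on_subset)
  then show "(\<Sum>j\<in>F. (norm (a (f j)))\<^sup>2) \<le> A\<^sup>2"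
    using assms(1) \<open>finite F\<close> unfolding ell2_def by auto
qed

lemma ell2_shift: "ell2 a A \<Longrightarrow> ell2 (\<lambda>j::int. a (k - j)) A"
  by (erule ell2_reindex) (auto simp: inj_def)

lemma ell2_scale:
  assumes "ell2 a A" "0 \<le> c" "\<And>j. norm (b j) \<le> c * norm (a j)"
  shows "ell2 b (c * A)"
  unfolding ell2_def
proof (intro conjI allI impI)
  show "0 \<le> c * A" using assms by (simp add: ell2_def)
  fix F :: "'a set" assume "finite F"
  have "(\<Sum>j\<in>F. (norm (b j))\<^sup>2) \<le> (\<Sum>j\<in>F. (c * norm (a j))\<^sup>2)"
    by (intro sum_mono power_mono assms) auto
  also have "\<dots> = c\<^sup>2 * (\<Sum>j\<in>F. (norm (a j))\<^sup>2)"
    by (simp add: power_mult_distrib sum_distrib_left)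
  also have "\<dots> \<le> c\<^sup>2 * A\<^sup>2"
    using assms(1) \<open>finite F\<close> unfolding ell2_def by (intro mult_left_mono) auto
  finally show "(\<Sum>j\<in>F. (norm (b j))\<^sup>2) \<le> (c * A)\<^sup>2" by (simp add: power_mult_distrib)
qed

lemma ell2_add:
  assumes "ell2 a A" "ell2 b B"
  shows "ell2 (\<lambda>j. a j + b j) (A + B)"
  unfolding ell2_def
proof (intro conjI allI impI)
  have AB: "0 \<le> A" "0 \<le> B" using assms by (auto simp: ell2_def)
  then show "0 \<le> A + B" by simp
  fix F :: "'a set" assume F: "finite F"
  have sA: "L2_set (\<lambda>j. norm (a j)) F \<le> A" and sB: "L2_set (\<lambda>j. norm (b j)) F \<le> B"
    using assms F AB unfolding ell2_def L2_set_def by (auto intro: real_le_lsqrt)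
  have "L2_set (\<lambda>j. norm (a j + b j)) F \<le> L2_set (\<lambda>j. norm (a j) + norm (b j)) F"
    by (rule L2_set_mono) (auto simp: norm_triangle_ineq)
  also have "\<dots> \<le> A + B"
    using L2_set_triangle_ineq[of "\<lambda>j. norm (a j)" "\<lambda>j. norm (b j)" F] sA sB by linarith
  finally show "(\<Sum>j\<in>F. (norm (a j + b j))\<^sup>2) \<le> (A + B)\<^sup>2"
    unfolding L2_set_def using sqrt_le_D by blast
qed

lemma ell2_summable:
  assumes "ell2 a A" shows "(\<lambda>j. (norm (a j))\<^sup>2) summable_on UNIV"
  using assms unfolding ell2_def
  by (intro nonneg_bdd_above_summable_on bdd_aboveI2[where M = "A\<^sup>2"]) auto

lemma ell2I_summable:
  assumes "(\<lambda>j. (norm (a j))\<^sup>2) summable_on UNIV"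
  shows "ell2 a (sqrt (\<Sum>\<^sub>\<infinity>j. (norm (a j))\<^sup>2))"
  unfolding ell2_def
proof (intro conjI allI impI)
  have nn: "0 \<le> (\<Sum>\<^sub>\<infinity>j. (norm (a j))\<^sup>2)" by (intro infsum_nonneg) auto
  then show "0 \<le> sqrt (\<Sum>\<^sub>\<infinity>j. (norm (a j))\<^sup>2)" by simp
  fix F :: "'a set" assume F: "finite F"
  have "(\<Sum>j\<in>F. (norm (a j))\<^sup>2) \<le> (\<Sum>\<^sub>\<infinity>j. (norm (a j))\<^sup>2)"
    by (rule finite_sum_le_infsum[OF assms F]) auto
  then show "(\<Sum>j\<in>F. (norm (a j))\<^sup>2) \<le> (sqrt (\<Sum>\<^sub>\<infinity>j. (norm (a j))\<^sup>2))\<^sup>2"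
    using nn by simp
qed

lemma ell2_CS_finite:
  assumes "ell2 a A" "ell2 b B" "finite F"
  shows "(\<Sum>j\<in>F. norm (a j) * norm (b j)) \<le> A * B"
proof -
  have AB: "0 \<le> A" "0 \<le> B" using assms by (auto simp: ell2_def)
  have sA: "L2_set (\<lambda>j. norm (a j)) F \<le> A" and sB: "L2_set (\<lambda>j. norm (b j)) F \<le> B"
    using assms AB unfolding ell2_def L2_set_def by (auto intro: real_le_lsqrt)
  have "(\<Sum>j\<in>F. norm (a j) * norm (b j)) \<le> L2_set (\<lambda>j. norm (a j)) F * L2_set (\<lambda>j. norm (b j)) F"
    using L2_set_mult_ineq[of "\<lambda>j. norm (a j)" "\<lambda>j. norm (b j)" F] by simp
  also have "\<dots> \<le> A * B" using sA sB AB by (intro mult_mono) (auto simp: L2_set_nonneg)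
  finally show ?thesis .
qed

lemma sum_bound_abs:
  fixes f :: "'i \<Rightarrow> complex"
  assumes "\<And>F. finite F \<Longrightarrow> (\<Sum>j\<in>F. norm (f j)) \<le> M"
  shows "f summable_on UNIV" "norm (\<Sum>\<^sub>\<infinity>j. f j) \<le> M"
proof -
  have s: "(\<lambda>j. norm (f j)) summable_on UNIV"
    by (intro nonneg_bdd_above_summable_on bdd_aboveI2[where M = M]) (auto intro: assms)
  show "f summable_on UNIV" using s by (rule abs_summable_summable)
  have "norm (\<Sum>\<^sub>\<infinity>j. f j) \<le> (\<Sum>\<^sub>\<infinity>j. norm (f j))" by (rule norm_infsum_bound[OF s])
  also have "\<dots> \<le> M" by (rule infsum_le_finite_sums[OF s]) (auto intro: assms)
  finally show "norm (\<Sum>\<^sub>\<infinity>j. f j) \<le> M" .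
qed

text \<open>The weighted form of Cauchy--Schwarz lets the weight \<open>c\<close> of the output be distributed
  over the factors of a convolution.\<close>

lemma ell2_CS_weighted:
  fixes f :: "'i \<Rightarrow> complex" and a :: "'i \<Rightarrow> 'b::real_normed_vector" and b :: "'i \<Rightarrow> 'c::real_normed_vector"
  assumes a: "ell2 a A" and b: "ell2 b B" and "0 < c" "0 \<le> D"
    and le: "\<And>j. c * norm (f j) \<le> D * (norm (a j) * norm (b j))"
  shows "f summable_on UNIV" "c * norm (\<Sum>\<^sub>\<infinity>j. f j) \<le> A * B * D"
proof -
  have bd: "(\<Sum>j\<in>F. norm (f j)) \<le> A * B * D / c" if F: "finite F" for F
  proof -
    have "c * (\<Sum>j\<in>F. norm (f j)) \<le> D * (\<Sum>j\<in>F. norm (a j) * norm (b j))"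
      unfolding sum_distrib_left by (intro sum_mono le)
    also have "\<dots> \<le> D * (A * B)"
      by (intro mult_left_mono ell2_CS_finite[OF a b F] \<open>0 \<le> D\<close>)
    finally show ?thesis using \<open>0 < c\<close> by (simp add: field_simps)
  qed
  show "f summable_on UNIV" by (rule sum_bound_abs(1)[OF bd])
  have "norm (\<Sum>\<^sub>\<infinity>j. f j) \<le> A * B * D / c" by (rule sum_bound_abs(2)[OF bd])
  then show "c * norm (\<Sum>\<^sub>\<infinity>j. f j) \<le> A * B * D" using \<open>0 < c\<close> by (simp add: field_simps)
qed

lemmas ell2_CS = ell2_CS_weighted[where c = 1, simplified]

section \<open>Sums of inverse squares\<close>

lemma inverse_square_telescope:
  assumes "1 \<le> m"
  shows "1 / (real (Suc m))\<^sup>2 \<le> 1 / real m - 1 / real (Suc m)"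
proof -
  have "1 / real m - 1 / real (Suc m) = 1 / (real m * real (Suc m))"
    using assms by (simp add: field_simps)
  moreover have "1 / (real (Suc m))\<^sup>2 \<le> 1 / (real m * real (Suc m))"
    using assms by (intro divide_left_mono) (auto simp: power2_eq_square intro!: mult_right_mono)
  ultimately show ?thesis by simp
qed

lemma inverse_squares_sum_le:
  assumes "finite F" "\<And>k. k \<in> F \<Longrightarrow> 1 \<le> k"
  shows "(\<Sum>k\<in>F. 1 / (real k)\<^sup>2) \<le> 2"
proof -
  have *: "(\<Sum>k\<in>{1..n}. 1 / (real k)\<^sup>2) \<le> 2 - 1 / real n" if "1 \<le> n" for n
    using that
  proof (induction n rule: dec_induct)
    case (step m)
    have "1 / (real (Suc m))\<^sup>2 \<le> 1 / real m - 1 / real (Suc m)"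
      using step by (intro inverse_square_telescope) simp
    then show ?case using step by simp
  qed auto
  obtain n where n: "F \<subseteq> {..n}" using assms(1) finite_nat_iff_bounded_le by blast
  have "(\<Sum>k\<in>F. 1 / (real k)\<^sup>2) \<le> (\<Sum>k\<in>{1..Suc n}. 1 / (real k)\<^sup>2)"
    using n assms by (intro sum_mono2) force+
  also have "\<dots> \<le> 2" using *[of "Suc n"] by (smt (verit) divide_nonneg_nonneg of_nat_0_le_iff le_Suc_eq le_add1 plus_1_eq_Suc)
  finally show ?thesis .
qed

lemma inverse_squares_tail_le:
  assumes "finite F" "\<And>k. k \<in> F \<Longrightarrow> N \<le> k" "1 \<le> N"
  shows "(\<Sum>k\<in>F. 1 / (real k)\<^sup>2) \<le> 2 / real N"
proof -
  have *: "(\<Sum>k\<in>{N..n}. 1 / (real k)\<^sup>2) \<le> 2 / real N - 1 / real n" if "N \<le> n" for n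
    using that
  proof (induction n rule: dec_induct)
    case base
    have "1 / (real N)\<^sup>2 \<le> 1 / real N" using assms(3) by (simp add: field_simps power2_eq_square)
    then show ?case by simp
  next
    case (step m)
    have "1 / (real (Suc m))\<^sup>2 \<le> 1 / real m - 1 / real (Suc m)"
      using step assms by (intro inverse_square_telescope) simp
    then show ?case using step by (simp)
  qed
  obtain n where n: "F \<subseteq> {..n}" using assms(1) finite_nat_iff_bounded_le by blast
  have "(\<Sum>k\<in>F. 1 / (real k)\<^sup>2) \<le> (\<Sum>k\<in>{N..n+N}. 1 / (real k)\<^sup>2)"
    using n assms by (intro sum_mono2) force+
  also have "\<dots> \<le> 2 / real N" using *[of "n+N"] by (smt (verit) divide_nonneg_nonneg of_nat_0_le_iff le_add2)
  finally show ?thesis .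
qed

text \<open>Sums over integers reduce to sums over naturals, because an absolute value merges at
  most two indices; the price is a factor 2.\<close>

lemma inverse_squares_two_to_one:
  fixes s :: "'i \<Rightarrow> nat"
  assumes "finite F" "\<And>j. j \<in> F \<Longrightarrow> N \<le> s j" "1 \<le> N" "\<And>k. card {j\<in>F. s j = k} \<le> 2"
  shows "(\<Sum>j\<in>F. 1 / (real (s j))\<^sup>2) \<le> 2 * (\<Sum>k\<in>s ` F. 1 / (real k)\<^sup>2)"
proof -
  have "(\<Sum>j\<in>F. 1 / (real (s j))\<^sup>2) = (\<Sum>k\<in>s ` F. \<Sum>j\<in>{j\<in>F. s j = k}. 1 / (real (s j))\<^sup>2)"
    by (rule sum.image_gen[OF assms(1)])
  also have "\<dots> = (\<Sum>k\<in>s ` F. real (card {j\<in>F. s j = k}) * (1 / (real k)\<^sup>2))"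
    by (intro sum.cong) auto
  also have "\<dots> \<le> (\<Sum>k\<in>s ` F. 2 * (1 / (real k)\<^sup>2))"
  proof (intro sum_mono mult_right_mono)
    fix k show "real (card {j\<in>F. s j = k}) \<le> 2" using assms(4)[of k] by linarith
  qed auto
  finally show ?thesis by (simp add: sum_distrib_left)
qed

lemma card_abs_eq_le: "card {j\<in>F. nat \<bar>j + c\<bar> = k} \<le> 2" for c :: int
proof -
  have "{j\<in>F. nat \<bar>j + c\<bar> = k} \<subseteq> {int k - c, - int k - c}" by auto
  then have "card {j\<in>F. nat \<bar>j + c\<bar> = k} \<le> card {int k - c, - int k - c}" by (intro card_mono) auto
  also have "\<dots> \<le> 2" by (simp add: card_insert_if)
  finally show ?thesis .
qed

lemma inverse_squares_int:
  assumes "finite (F::int set)" "- c \<notin> F"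
  shows "(\<Sum>j\<in>F. 1 / (real_of_int (j + c))\<^sup>2) \<le> 4"
proof -
  have "(\<Sum>j\<in>F. 1 / (real_of_int (j + c))\<^sup>2) = (\<Sum>j\<in>F. 1 / (real (nat \<bar>j + c\<bar>))\<^sup>2)"
    by (intro sum.cong) auto
  also have "\<dots> \<le> 2 * (\<Sum>k\<in>(\<lambda>j. nat \<bar>j + c\<bar>) ` F. 1 / (real k)\<^sup>2)"
  proof (rule inverse_squares_two_to_one[OF assms(1), where N = 1])
    fix j assume "j \<in> F"
    then have "j + c \<noteq> 0" using assms(2) by (metis add_eq_0_iff add.commute)
    then show "1 \<le> nat \<bar>j + c\<bar>" by linarith
  qed (auto intro: card_abs_eq_le)
  also have "(\<Sum>k\<in>(\<lambda>j. nat \<bar>j + c\<bar>) ` F. 1 / (real k)\<^sup>2) \<le> 2"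
  proof (rule inverse_squares_sum_le)
    fix k assume "k \<in> (\<lambda>j. nat \<bar>j + c\<bar>) ` F"
    then obtain j where "j \<in> F" "k = nat \<bar>j + c\<bar>" by auto
    moreover then have "j + c \<noteq> 0" using assms(2) by (metis add_eq_0_iff add.commute)
    ultimately show "1 \<le> k" by linarith
  qed (use assms in auto)
  finally show ?thesis by simp
qed

text \<open>Iterating the contraction estimate bounds the distance of two fixed points by
  \<open>D / 2 ^ k\<close>. The set \<open>S\<close> may be larger than the box in which existence
  is shown; this is how a weighted fixed point gets identified with one known only to be
  bounded.\<close>

lemma sup_contraction_unique:
  fixes F :: "('i \<Rightarrow> complex) \<Rightarrow> ('i \<Rightarrow> complex)"
  assumes contr: "\<And>x y D. x \<in> S \<Longrightarrow> y \<in> S \<Longrightarrow> 0 \<le> D \<Longrightarrow> (\<And>i. cmod (x i - y i) \<le> D) \<Longrightarrow>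
      (\<And>i. cmod (F x i - F y i) \<le> D / 2)"
    and x: "x \<in> S" "F x = x" and y: "y \<in> S" "F y = y"
    and bd: "\<And>i. cmod (x i - y i) \<le> D"
  shows "x = y"
proof -
  have D: "0 \<le> D" using bd norm_ge_zero order_trans by blast
  have "cmod (x i - y i) \<le> D / 2 ^ k" for i k
  proof (induction k arbitrary: i)
    case (Suc k)
    have "cmod (F x i - F y i) \<le> (D / 2 ^ k) / 2"
      by (rule contr[OF x(1) y(1)]) (use D Suc in auto)
    then show ?case using x y by simp
  qed (use bd in simp)
  moreover have "(\<lambda>k. D / 2 ^ k) \<longlonglongrightarrow> 0"
    using LIMSEQ_divide_realpow_zero[of 2 D] by simp
  ultimately have "cmod (x i - y i) \<le> 0" for i
    by (meson LIMSEQ_le_const2 tendsto_const LIMSEQ_le_const)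
  then show ?thesis by (auto simp: fun_eq_iff)
qed

text \<open>A box with coordinatewise radii is closed under pointwise limits, so the coordinatewise
  limit of the iterates stays in it and no complete space has to be set up. Weighted balls are the
  boxes with radii \<open>c / W i\<close>, while the contraction is measured in the unweighted
  norm.\<close>

lemma sup_contraction_fixpoint:
  fixes F :: "('i \<Rightarrow> complex) \<Rightarrow> ('i \<Rightarrow> complex)" and \<rho> :: "'i \<Rightarrow> real"
  defines "S \<equiv> {x. \<forall>i. cmod (x i) \<le> \<rho> i}"
  assumes nn: "\<And>i. 0 \<le> \<rho> i" and R: "\<And>i. \<rho> i \<le> R"
    and maps: "\<And>x. x \<in> S \<Longrightarrow> F x \<in> S"
    and contr: "\<And>x y D. x \<in> S \<Longrightarrow> y \<in> S \<Longrightarrow> 0 \<le> D \<Longrightarrow> (\<And>i. cmod (x i - y i) \<le> D) \<Longrightarrow>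
      (\<And>i. cmod (F x i - F y i) \<le> D / 2)"
  obtains x where "x \<in> S" "F x = x"
proof -
  define X where "X k = (F ^^ k) (\<lambda>_. 0)" for k
  have XS: "X k \<in> S" for k
    by (induction k) (auto simp: X_def S_def nn intro: maps[unfolded S_def, simplified, rule_format])
  have R0: "0 \<le> R" using nn R order_trans by blast
  have step: "cmod (X (Suc k) i - X k i) \<le> 2 * R / 2 ^ k" for k i
  proof (induction k arbitrary: i)
    case 0
    have "cmod (X (Suc 0) i) \<le> \<rho> i" "cmod (X 0 i) \<le> \<rho> i" using XS unfolding S_def by auto
    then show ?case using R[of i] norm_triangle_ineq4[of "X (Suc 0) i" "X 0 i"] by simp
  next
    case (Suc k)
    have "cmod (F (X (Suc k)) i - F (X k) i) \<le> (2 * R / 2 ^ k) / 2"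
      by (rule contr[OF XS XS]) (use R0 Suc in auto)
    then show ?case by (simp add: X_def)
  qed
  \<comment> \<open>The right-hand side is the exact partial sum of the geometric series, so the
    induction on \<open>m\<close> closes without loss.\<close>
  have far: "cmod (X (k + m) i - X k i) \<le> 4 * R / 2 ^ k - 4 * R / 2 ^ (k + m)" for k m i
  proof (induction m)
    case (Suc m)
    have "X (k + Suc m) i - X k i = (X (Suc (k + m)) i - X (k + m) i) + (X (k + m) i - X k i)"
      by simp
    then have "cmod (X (k + Suc m) i - X k i)
        \<le> cmod (X (Suc (k + m)) i - X (k + m) i) + cmod (X (k + m) i - X k i)"
      by (metis norm_triangle_ineq)
    also have "\<dots> \<le> 2 * R / 2 ^ (k + m) + (4 * R / 2 ^ k - 4 * R / 2 ^ (k + m))"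
      using step[of "k+m" i] Suc by linarith
    also have "\<dots> = 4 * R / 2 ^ k - 4 * R / 2 ^ (k + Suc m)"
      by (simp add: field_simps)
    finally show ?case .
  qed simp
  have tend: "(\<lambda>k. 4 * R / 2 ^ k) \<longlonglongrightarrow> 0"
    using LIMSEQ_divide_realpow_zero[of 2 "4 * R"] by simp
  have far': "cmod (X m i - X k i) \<le> 4 * R / 2 ^ k" if "k \<le> m" for k m i
  proof -
    have "0 \<le> 4 * R / 2 ^ m" using R0 by simp
    then show ?thesis using far[of k "m - k" i] that by simp
  qed
  have "Cauchy (\<lambda>k. X k i)" for i
  proof (rule metric_CauchyI)
    fix e :: real assume "0 < e"
    then obtain M where M: "\<And>k. k \<ge> M \<Longrightarrow> 4 * R / 2 ^ k < e / 2"
      using order_tendstoD(2)[OF tend, of "e/2"] unfolding eventually_sequentially by auto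
    have "dist (X m i) (X n i) < e" if "m \<ge> M" "n \<ge> M" for m n
      using far'[OF that(1), of i] far'[OF that(2), of i] M[of M]
      using dist_triangle2[of "X m i" "X n i" "X M i"] by (simp add: dist_norm)
    then show "\<exists>M. \<forall>m\<ge>M. \<forall>n\<ge>M. dist (X m i) (X n i) < e" by blast
  qed
  then have conv: "convergent (\<lambda>k. X k i)" for i by (simp add: Cauchy_convergent)
  define x where "x i = lim (\<lambda>k. X k i)" for i
  have lim: "(\<lambda>k. X k i) \<longlonglongrightarrow> x i" for i
    using conv unfolding x_def by (simp add: convergent_LIMSEQ_iff)
  have xX: "cmod (x i - X k i) \<le> 4 * R / 2 ^ k" for i k
  proof (rule LIMSEQ_le_const2)
    show "(\<lambda>m. cmod (X m i - X k i)) \<longlonglongrightarrow> cmod (x i - X k i)"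
      by (intro tendsto_intros lim)
  qed (use far' in blast)
  have xS: "x \<in> S"
    unfolding S_def
  proof (intro CollectI allI)
    fix i show "cmod (x i) \<le> \<rho> i"
      by (rule LIMSEQ_le_const2[OF tendsto_norm[OF lim]]) (use XS in \<open>auto simp: S_def\<close>)
  qed
  have "cmod (F x i - x i) \<le> 8 * R / 2 ^ k" for i k
  proof -
    have "cmod (F x i - F (X k) i) \<le> (4 * R / 2 ^ k) / 2"
      by (rule contr[OF xS XS]) (use R0 xX in auto)
    moreover have "cmod (x i - F (X k) i) \<le> 4 * R / 2 ^ (Suc k)"
      using xX[of i "Suc k"] by (simp add: X_def)
    ultimately have "cmod (F x i - x i) \<le> (4 * R / 2 ^ k) / 2 + 4 * R / 2 ^ (Suc k)"
      using norm_triangle_ineq4[of "F x i - F (X k) i" "x i - F (X k) i"] by simp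
    also have "\<dots> \<le> 8 * R / 2 ^ k" using R0 by (simp add: field_simps)
    finally show ?thesis .
  qed
  moreover have "(\<lambda>k. 8 * R / 2 ^ k) \<longlonglongrightarrow> 0"
    using LIMSEQ_divide_realpow_zero[of 2 "8 * R"] by simp
  ultimately have "cmod (F x i - x i) \<le> 0" for i
    by (meson LIMSEQ_le_const)
  then have "F x = x" by (auto simp: fun_eq_iff)
  then show ?thesis using that xS by blast
qed

text \<open>With the supremum \<open>s\<close> of \<open>X\<close>, the hypothesis gives
  \<open>s \<le> K + s / 2\<close>. The crude bound \<open>c\<close> serves only to make
  \<open>s\<close> finite; the conclusion does not depend on its size.\<close>

lemma half_absorb:
  fixes X :: "'i \<Rightarrow> real"
  assumes "\<And>i. X i \<le> c" "\<And>C i. (\<And>i. X i \<le> C) \<Longrightarrow> X i \<le> K + C / 2"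
  shows "X i \<le> 2 * K"
proof -
  have "bdd_above (range X)" using assms(1) by (intro bdd_aboveI[where M = c]) auto
  then have up: "X j \<le> (SUP i. X i)" for j by (simp add: cSUP_upper)
  have "(SUP i. X i) \<le> K + (SUP i. X i) / 2" by (intro cSUP_least assms(2) up) auto
  then show ?thesis using up[of i] by linarith
qed

lemma infsum_diff:
  fixes f g :: "'i \<Rightarrow> complex"
  assumes "f summable_on A" "g summable_on A"
  shows "infsum (\<lambda>i. f i - g i) A = infsum f A - infsum g A"
  using infsum_add[OF assms(1) summable_on_uminus[THEN iffD2, OF assms(2)]] by (simp add: infsum_uminus)

section \<open>Convolution and the linear equation off the block\<close>

definition conv :: "(int \<Rightarrow> complex) \<Rightarrow> (int \<Rightarrow> complex) \<Rightarrow> int \<Rightarrow> complex" where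
  "conv V a k = (\<Sum>\<^sub>\<infinity>j. V (k - j) * a j)"

definition bounded_seq :: "('i \<Rightarrow> complex) \<Rightarrow> bool" where
  "bounded_seq a \<longleftrightarrow> (\<exists>C. \<forall>j. cmod (a j) \<le> C)"

lemma bounded_seqI: "(\<And>j. cmod (a j) \<le> C) \<Longrightarrow> bounded_seq a"
  by (auto simp: bounded_seq_def)

lemma bounded_seq_add: "bounded_seq a \<Longrightarrow> bounded_seq b \<Longrightarrow> bounded_seq (\<lambda>j. a j + b j)"
  unfolding bounded_seq_def by (meson add_mono norm_triangle_le)

lemma bounded_seq_scale: "bounded_seq a \<Longrightarrow> bounded_seq (\<lambda>j. c * a j)"
  unfolding bounded_seq_def by (metis norm_mult mult_left_mono norm_ge_zero)

abbreviation ellw :: "(int \<Rightarrow> real) \<Rightarrow> (int \<Rightarrow> complex) \<Rightarrow> real \<Rightarrow> bool" where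
  "ellw W V v \<equiv> ell2 (\<lambda>j. W j * cmod (V j)) v"

lemma ellw_1 [simp]: "ell2 (\<lambda>j. cmod (V j)) v = ell2 V v"
  by (simp add: ell2_def)

lemma ellw_one: "ell2 V v \<Longrightarrow> ellw (\<lambda>_. 1) V v"
  by simp

lemma submult_one: "submult_weight (\<lambda>_. 1)"
  by (simp add: submult_weight_def normalized_weight_def)

lemma submultD:
  assumes "submult_weight W"
  shows "1 \<le> W k" "0 < W k" "W k \<le> W (k - j) * W j" "W (- k) = W k"
proof -
  show *: "1 \<le> W k" "W (- k) = W k" using assms by (auto simp: submult_weight_def normalized_weight_def)
  then show "0 < W k" by linarith
  have "W ((k - j) + j) \<le> W (k - j) * W j" using assms unfolding submult_weight_def by blast
  then show "W k \<le> W (k - j) * W j" by simp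
qed

lemma ellw_ell2:
  assumes "submult_weight W" "ellw W V v" shows "ell2 V v"
  using assms(2)
proof (rule ell2_le)
  fix j show "cmod (V j) \<le> norm (W j * cmod (V j))"
    using submultD(1)[OF assms(1), of j] mult_right_mono[of 1 "W j" "cmod (V j)"] by (simp add: abs_mult)
qed

lemma conv_summable:
  assumes "ell2 V v" "ell2 a A"
  shows "(\<lambda>j. V (k - j) * a j) summable_on UNIV" "cmod (conv V a k) \<le> v * A"
proof -
  note * = ell2_CS[where D = 1, OF ell2_shift[OF assms(1), of k] assms(2)]
  show "(\<lambda>j. V (k - j) * a j) summable_on UNIV" by (rule *) (auto simp: norm_mult)
  show "cmod (conv V a k) \<le> v * A" unfolding conv_def using *(2)[of "\<lambda>j. V (k - j) * a j"] by (auto simp: norm_mult)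
qed

text \<open>The inequality \<open>W k \<le> W (k - i) * W i\<close> distributes the weight: one
  factor goes to \<open>V\<close>, which is square summable with it, the other to \<open>y\<close>,
  which is bounded with it. \<open>B\<close> stays unweighted, so its smallness is available for
  every weight at once.\<close>

lemma conv_B:
  assumes W: "submult_weight W" and V: "ellw W V v" and B: "ell2 B \<beta>"
    and y: "\<And>j. W j * cmod (y j) \<le> D"
  shows "(\<lambda>i. V (k - i) * (B i * y i)) summable_on UNIV"
    "W k * cmod (conv V (\<lambda>i. B i * y i) k) \<le> v * \<beta> * D"
proof -
  have D: "0 \<le> D" using y[of 0] submultD(2)[OF W, of 0] by (meson mult_nonneg_nonneg norm_ge_zero less_imp_le order_trans)
  have Wk: "0 < W k" by (rule submultD(2)[OF W])
  have le: "W k * cmod (V (k - i) * (B i * y i)) \<le> D * (norm (W (k - i) * cmod (V (k - i))) * norm (B i))" for i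
  proof -
    have "W k * cmod (V (k - i) * (B i * y i)) \<le> (W (k - i) * W i) * cmod (V (k - i) * (B i * y i))"
      by (intro mult_right_mono submultD(3)[OF W]) auto
    also have "\<dots> = (W i * cmod (y i)) * (W (k - i) * cmod (V (k - i)) * cmod (B i))"
      by (simp add: norm_mult)
    also have "\<dots> \<le> D * (W (k - i) * cmod (V (k - i)) * cmod (B i))"
      using submultD(2)[OF W, of "k - i"] by (intro mult_right_mono y) auto
    finally show ?thesis using submultD(2)[OF W, of "k - i"] by (simp add: abs_mult)
  qed
  note * = ell2_CS_weighted[OF ell2_shift[OF V, of k] B Wk D le]
  show "(\<lambda>i. V (k - i) * (B i * y i)) summable_on UNIV" by (rule *(1))
  show "W k * cmod (conv V (\<lambda>i. B i * y i) k) \<le> v * \<beta> * D" unfolding conv_def by (rule *(2))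
qed

lemmas conv_B1 = conv_B[OF submult_one, simplified]

lemma conv_B_diff:
  assumes V: "ell2 V v" and B: "ell2 B \<beta>" and x: "bounded_seq x" and y: "bounded_seq y"
  shows "conv V (\<lambda>i. B i * x i) k - conv V (\<lambda>i. B i * y i) k = conv V (\<lambda>i. B i * (x i - y i)) k"
proof -
  obtain C where C: "\<And>j. cmod (x j) \<le> C" using x unfolding bounded_seq_def by blast
  obtain D where D: "\<And>j. cmod (y j) \<le> D" using y unfolding bounded_seq_def by blast
  show ?thesis unfolding conv_def
    by (subst infsum_diff[symmetric])
      (auto simp: algebra_simps intro!: conv_B1(1)[OF V B C, simplified] conv_B1(1)[OF V B D, simplified]
        infsum_cong)
qed

text \<open>The unknown is \<open>y = V * a\<close> rather than the eigenvector \<open>a\<close>,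
  with \<open>a = B y\<close> off the block. Such a \<open>y\<close> is merely bounded, and asking
  for boundedness is what makes the solution unique.\<close>

definition solves :: "(int \<Rightarrow> complex) \<Rightarrow> (int \<Rightarrow> complex) \<Rightarrow> (int \<Rightarrow> complex) \<Rightarrow> (int \<Rightarrow> complex) \<Rightarrow> bool" where
  "solves V B b y \<longleftrightarrow> bounded_seq y \<and> (\<forall>j. y j = b j + conv V (\<lambda>i. B i * y i) j)"

lemma solves_bounded: "solves V B b y \<Longrightarrow> bounded_seq y"
  by (simp add: solves_def)

lemma solves_diff:
  assumes "solves V B b y" shows "y j - b j = conv V (\<lambda>i. B i * y i) j"
proof -
  have "y j = b j + conv V (\<lambda>i. B i * y i) j" using assms unfolding solves_def by blast
  then show ?thesis by (simp only: diff_eq_eq add.commute)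
qed

definition lsol :: "(int \<Rightarrow> complex) \<Rightarrow> (int \<Rightarrow> complex) \<Rightarrow> (int \<Rightarrow> complex) \<Rightarrow> int \<Rightarrow> complex" where
  "lsol V B b = (SOME y. solves V B b y)"

lemma solves_unique:
  assumes V: "ell2 V v" and B: "ell2 B \<beta>" and vB: "v * \<beta> \<le> 1/2"
    and x: "solves V B b x" and y: "solves V B b y"
  shows "x = y"
proof -
  have bx: "bounded_seq x" and bY: "bounded_seq y" using x y by (auto simp: solves_def)
  obtain C where C: "\<And>j. cmod (x j) \<le> C" using bx unfolding bounded_seq_def by blast
  obtain D where D: "\<And>j. cmod (y j) \<le> D" using bY unfolding bounded_seq_def by blast
  show ?thesis
  proof (rule sup_contraction_unique[where F = "\<lambda>y j. b j + conv V (\<lambda>i. B i * y i) j" and S = "Collect bounded_seq"])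
    fix i show "cmod (x i - y i) \<le> C + D" using C D norm_triangle_le_diff add_mono by blast
  next
    fix x y :: "int \<Rightarrow> complex" and E i assume *: "x \<in> Collect bounded_seq" "y \<in> Collect bounded_seq" "0 \<le> (E::real)" "\<And>i. cmod (x i - y i) \<le> E"
    have "cmod (conv V (\<lambda>i. B i * (x i - y i)) i) \<le> v * \<beta> * E"
      using conv_B1(2)[OF V B *(4)] .
    also have "\<dots> \<le> E / 2" using mult_right_mono[OF vB *(3)] by simp
    finally show "cmod ((b i + conv V (\<lambda>i. B i * x i) i) - (b i + conv V (\<lambda>i. B i * y i) i)) \<le> E / 2"
      using * by (simp add: conv_B_diff[OF V B])
  next
    show "(\<lambda>j. b j + conv V (\<lambda>i. B i * x i) j) = x" "(\<lambda>j. b j + conv V (\<lambda>i. B i * y i) j) = y"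
      using x y unfolding solves_def by (intro ext; metis)+
  qed (use bx bY in auto)
qed

text \<open>A weighted ball of twice the radius of \<open>b\<close> is mapped into itself because
  \<open>c + (1/2) * 2 * c = 2 * c\<close>. Since \<open>W \<ge> 1\<close>, it lies in the ordinary
  ball of radius \<open>2 * c\<close>, where the contraction estimate holds.\<close>

lemma solves_exists:
  assumes W: "submult_weight W" and V: "ellw W V v" and B: "ell2 B \<beta>" and vB: "v * \<beta> \<le> 1/2"
    and b: "\<And>j. W j * cmod (b j) \<le> c"
  obtains y where "solves V B b y" "\<And>j. W j * cmod (y j) \<le> 2 * c"
proof -
  have V': "ell2 V v" by (rule ellw_ell2[OF W V])
  have W1: "1 \<le> W j" "0 < W j" for j using submultD[OF W] by auto
  have c: "0 \<le> c" using b[of 0] W1(2)[of 0] by (meson mult_nonneg_nonneg norm_ge_zero less_imp_le order_trans)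
  have iff: "W j * t \<le> 2 * c \<longleftrightarrow> t \<le> 2 * c / W j" for j t using W1(2)[of j] by (simp add: field_simps)
  have cW: "2 * c / W i \<le> 2 * c" for i using W1(1)[of i] c
    by (metis div_by_1 divide_left_mono mult_nonneg_nonneg zero_le_numeral zero_less_one mult_pos_pos W1(2))
  let ?F = "\<lambda>y j. b j + conv V (\<lambda>i. B i * y i) j"
  let ?S = "{x. \<forall>i. cmod (x i) \<le> 2 * c / W i}"
  have bS: "bounded_seq x" if "x \<in> ?S" for x
    by (rule bounded_seqI[where C = "2 * c"]) (use that cW order_trans in blast)
  obtain y where y: "y \<in> ?S" "?F y = y"
  proof (rule sup_contraction_fixpoint[where F = ?F and \<rho> = "\<lambda>i. 2 * c / W i" and R = "2 * c"])
    show "0 \<le> 2 * c / W i" for i using c W1(2)[of i] by simp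
    show "2 * c / W i \<le> 2 * c" for i by (rule cW)
    fix x assume "x \<in> ?S"
    then have x: "W j * cmod (x j) \<le> 2 * c" for j by (auto simp: iff)
    have "W j * cmod (?F x j) \<le> 2 * c" for j
    proof -
      have "W j * cmod (?F x j) \<le> W j * cmod (b j) + W j * cmod (conv V (\<lambda>i. B i * x i) j)"
        using W1(2)[of j] by (metis distrib_left less_imp_le mult_left_mono norm_triangle_ineq)
      also have "\<dots> \<le> c + v * \<beta> * (2 * c)" by (intro add_mono b conv_B(2)[OF W V B x])
      also have "\<dots> \<le> 2 * c" using mult_right_mono[OF vB, of "2 * c"] c by simp
      finally show ?thesis .
    qed
    then show "?F x \<in> ?S" by (auto simp: iff)
  next
    fix x y :: "int \<Rightarrow> complex" and E i assume *: "x \<in> ?S" "y \<in> ?S" "0 \<le> (E::real)" "\<And>i. cmod (x i - y i) \<le> E"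
    have "cmod (conv V (\<lambda>i. B i * (x i - y i)) i) \<le> v * \<beta> * E"
      using conv_B1(2)[OF V' B *(4)] .
    also have "\<dots> \<le> E / 2" using mult_right_mono[OF vB *(3)] by simp
    finally show "cmod (?F x i - ?F y i) \<le> E / 2"
      by (simp add: conv_B_diff[OF V' B bS[OF *(1)] bS[OF *(2)]])
  qed (use that in auto)
  show ?thesis
  proof (rule that)
    show "solves V B b y" using y bS[OF y(1)] unfolding solves_def by (metis (no_types, lifting))
    show "W j * cmod (y j) \<le> 2 * c" for j using y(1) by (auto simp: iff)
  qed
qed

context
  fixes V :: "int \<Rightarrow> complex" and v :: real and B :: "int \<Rightarrow> complex" and \<beta> :: real
  assumes V: "ell2 V v" and B: "ell2 B \<beta>" and vB: "v * \<beta> \<le> 1/2"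
begin

lemma lsol_solves:
  assumes "bounded_seq b" shows "solves V B b (lsol V B b)"
proof -
  obtain c where c: "\<And>j. 1 * cmod (b j) \<le> c" using assms unfolding bounded_seq_def by auto
  have V1: "ellw (\<lambda>_. 1) V v" using V by simp
  obtain y where "solves V B b y"
    by (rule solves_exists[OF submult_one V1 B vB c])
  then show ?thesis unfolding lsol_def by (rule someI[of "solves V B b" y])
qed

lemma lsol_eqI: "solves V B b y \<Longrightarrow> lsol V B b = y"
  using solves_unique[OF V B vB] unfolding lsol_def by (metis someI)

text \<open>\<open>lsol\<close> knows nothing of weights. The solution constructed in the weighted
  ball is bounded, so uniqueness identifies it with \<open>lsol\<close>.\<close>

lemma lsol_weighted:
  assumes "submult_weight W" "ellw W V v'" "v' * \<beta> \<le> 1/2" "\<And>j. W j * cmod (b j) \<le> c"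
  shows "W j * cmod (lsol V B b j) \<le> 2 * c"
proof -
  obtain y where y: "solves V B b y" "\<And>j. W j * cmod (y j) \<le> 2 * c"
    using solves_exists[OF assms(1,2) B assms(3,4)] by blast
  then show ?thesis using lsol_eqI by blast
qed

lemma lsol_bound:
  assumes "\<And>j. cmod (b j) \<le> c" shows "cmod (lsol V B b j) \<le> 2 * c"
proof -
  have b: "1 * cmod (b j) \<le> c" for j using assms by simp
  have "1 * cmod (lsol V B b j) \<le> 2 * c"
    by (rule lsol_weighted[OF submult_one ellw_one[OF V] vB b])
  then show ?thesis by simp
qed

lemma lsol_lin:
  assumes "bounded_seq b" "bounded_seq b'"
  shows "lsol V B (\<lambda>j. s * b j + t * b' j) = (\<lambda>j. s * lsol V B b j + t * lsol V B b' j)"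
proof (rule lsol_eqI)
  let ?y = "lsol V B b" and ?y' = "lsol V B b'"
  have y: "bounded_seq ?y" "\<And>j. ?y j = b j + conv V (\<lambda>i. B i * ?y i) j"
    using lsol_solves[OF assms(1)] unfolding solves_def by blast+
  have y': "bounded_seq ?y'" "\<And>j. ?y' j = b' j + conv V (\<lambda>i. B i * ?y' i) j"
    using lsol_solves[OF assms(2)] unfolding solves_def by blast+
  obtain C where C: "\<And>j. cmod (?y j) \<le> C" using y(1) unfolding bounded_seq_def by blast
  obtain D where D: "\<And>j. cmod (?y' j) \<le> D" using y'(1) unfolding bounded_seq_def by blast
  have c: "conv V (\<lambda>i. B i * (s * ?y i + t * ?y' i)) j = s * conv V (\<lambda>i. B i * ?y i) j + t * conv V (\<lambda>i. B i * ?y' i) j" for j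
  proof -
    have S: "(\<lambda>i. V (j - i) * (B i * ?y i)) summable_on UNIV" "(\<lambda>i. V (j - i) * (B i * ?y' i)) summable_on UNIV"
      by (rule conv_B1(1)[OF V B C] conv_B1(1)[OF V B D])+
    have "conv V (\<lambda>i. B i * (s * ?y i + t * ?y' i)) j
        = (\<Sum>\<^sub>\<infinity>i. s * (V (j - i) * (B i * ?y i)) + t * (V (j - i) * (B i * ?y' i)))"
      unfolding conv_def by (intro infsum_cong) (simp add: algebra_simps)
    also have "\<dots> = s * conv V (\<lambda>i. B i * ?y i) j + t * conv V (\<lambda>i. B i * ?y' i) j"
      unfolding conv_def by (subst infsum_add) (auto intro!: summable_on_cmult_right S simp: infsum_cmult_right S)
    finally show ?thesis .
  qed
  show "solves V B (\<lambda>j. s * b j + t * b' j) (\<lambda>j. s * ?y j + t * ?y' j)"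
    unfolding solves_def
  proof (intro conjI allI)
    show "bounded_seq (\<lambda>j. s * ?y j + t * ?y' j)" by (intro bounded_seq_add bounded_seq_scale y y')
    show "s * ?y j + t * ?y' j = s * b j + t * b' j + conv V (\<lambda>i. B i * (s * ?y i + t * ?y' i)) j" for j
      unfolding c by (subst y(2), subst y'(2)) (simp add: algebra_simps)
  qed
qed

end

text \<open>When the right-hand side is \<open>V\<close> itself, \<open>lsol - V\<close> is the part
  of second order in \<open>V\<close>, and it carries the factor \<open>\<beta>\<close>. With
  \<open>\<beta> = 1 / n\<close> this is the source of every \<open>O(1/n)\<close> correction, in
  all weighted norms.\<close>

lemma lsol_self_bound:
  assumes W: "submult_weight W" and V: "ellw W V v" and B: "ell2 B \<beta>" and vB: "v * \<beta> \<le> 1/2"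
  shows "W j * cmod (lsol V B V j) \<le> 2 * v" "W j * cmod (lsol V B V j - V j) \<le> 2 * v\<^sup>2 * \<beta>"
proof -
  have V': "ell2 V v" by (rule ellw_ell2[OF W V])
  have p: "W j * cmod (V j) \<le> v" for j using ell2_point[OF V, of j] submultD(2)[OF W, of j] by (simp add: abs_mult)
  show *: "W j * cmod (lsol V B V j) \<le> 2 * v" for j
    by (rule lsol_weighted[OF V' B vB W V vB p])
  have "lsol V B V j - V j = conv V (\<lambda>i. B i * lsol V B V i) j"
    by (rule solves_diff[OF lsol_solves[OF V' B vB bounded_seqI[OF ell2_point[OF V']]]])
  then show "W j * cmod (lsol V B V j - V j) \<le> 2 * v\<^sup>2 * \<beta>"
    using conv_B(2)[OF W V B *, of j] by (simp add: power2_eq_square algebra_simps)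
qed

text \<open>Only the second-order parts are compared, so that the result is small even where
  \<open>V\<close> and \<open>V'\<close> differ at first order. The difference \<open>X\<close> of
  these parts reappears through \<open>Y - Y' = X + (V - V')\<close> with a factor at most
  \<open>1/2\<close>, and is absorbed.\<close>

lemma lsol_perturb:
  assumes V: "ell2 V v" and V': "ell2 V' v" and B: "ell2 B \<beta>" and B': "ell2 B' \<beta>" and vB: "v * \<beta> \<le> 1/2"
    and d: "ell2 (\<lambda>j. V j - V' j) d" and e: "ell2 (\<lambda>j. B j - B' j) e"
  shows "cmod ((lsol V B V j - V j) - (lsol V' B' V' j - V' j)) \<le> 6 * v * \<beta> * d + 4 * v\<^sup>2 * e"
proof -
  define Y where "Y = lsol V B V"
  define Y' where "Y' = lsol V' B' V'"
  have bV: "bounded_seq V" "bounded_seq V'"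
    by (rule bounded_seqI[OF ell2_point[OF V]] bounded_seqI[OF ell2_point[OF V']])+
  have Y: "bounded_seq Y" "\<And>j. Y j - V j = conv V (\<lambda>i. B i * Y i) j"
    unfolding Y_def by (rule solves_bounded[OF lsol_solves[OF V B vB bV(1)]] solves_diff[OF lsol_solves[OF V B vB bV(1)]])+
  have Y': "bounded_seq Y'" "\<And>j. Y' j - V' j = conv V' (\<lambda>i. B' i * Y' i) j"
    unfolding Y'_def by (rule solves_bounded[OF lsol_solves[OF V' B' vB bV(2)]] solves_diff[OF lsol_solves[OF V' B' vB bV(2)]])+
  have Y'b: "cmod (Y' j) \<le> 2 * v" for j
    using lsol_self_bound(1)[OF submult_one ellw_one[OF V'] B' vB, of j] by (simp add: Y'_def)
  have Yb: "cmod (Y j) \<le> 2 * v" for j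
    using lsol_self_bound(1)[OF submult_one ellw_one[OF V] B vB, of j] by (simp add: Y_def)
  define X where "X j = (Y j - V j) - (Y' j - V' j)" for j
  have YY: "cmod (Y j - Y' j) \<le> 4 * v" for j
    using norm_triangle_ineq4[of "Y j" "Y' j"] Yb[of j] Y'b[of j] by linarith
  have s: "(\<lambda>i. V (j - i) * (B i * Y i)) summable_on UNIV" "(\<lambda>i. V' (j - i) * (B' i * Y' i)) summable_on UNIV"
     "(\<lambda>i. V (j - i) * (B i * (Y i - Y' i))) summable_on UNIV" "(\<lambda>i. V (j - i) * ((B i - B' i) * Y' i)) summable_on UNIV"
     "(\<lambda>i. (V (j - i) - V' (j - i)) * (B' i * Y' i)) summable_on UNIV" for j
    by (rule conv_B1(1)[OF V B Yb] conv_B1(1)[OF V' B' Y'b] conv_B1(1)[OF V B YY] conv_B1(1)[OF V e Y'b] conv_B1(1)[OF d B' Y'b])+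
  have X: "X j = conv V (\<lambda>i. B i * (Y i - Y' i)) j + conv V (\<lambda>i. (B i - B' i) * Y' i) j +
      conv (\<lambda>j. V j - V' j) (\<lambda>i. B' i * Y' i) j" for j
  proof -
    have "X j = (\<Sum>\<^sub>\<infinity>i. V (j - i) * (B i * Y i) - V' (j - i) * (B' i * Y' i))"
      unfolding X_def Y(2) Y'(2) conv_def by (rule infsum_diff[symmetric]) (rule s)+
    also have "\<dots> = (\<Sum>\<^sub>\<infinity>i. V (j - i) * (B i * (Y i - Y' i)) + V (j - i) * ((B i - B' i) * Y' i) + (V (j - i) - V' (j - i)) * (B' i * Y' i))"
      by (intro infsum_cong) (simp add: algebra_simps)
    also have "\<dots> = conv V (\<lambda>i. B i * (Y i - Y' i)) j + conv V (\<lambda>i. (B i - B' i) * Y' i) j +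
      conv (\<lambda>j. V j - V' j) (\<lambda>i. B' i * Y' i) j"
      unfolding conv_def by (simp add: infsum_add summable_on_add s)
    finally show ?thesis .
  qed
  have v0: "0 \<le> v" "0 \<le> \<beta>" "0 \<le> d" "0 \<le> e" using V B d e by (auto simp: ell2_def)
  have dp: "cmod (V j - V' j) \<le> d" for j using ell2_point[OF d] by simp
  \<comment> \<open>The three terms come from varying \<open>Y\<close>, then \<open>B\<close>, then
    \<open>V\<close>; the leading 2 is the price of absorbing \<open>X\<close>.\<close>
  have "cmod (X j) \<le> 2 * (v * \<beta> * d + v * e * (2 * v) + d * \<beta> * (2 * v))"
  proof (rule half_absorb[where X = "\<lambda>i. cmod (X i)" and c = "6 * v" and i = j])
    fix i
    have "cmod (X i) \<le> (cmod (Y i) + cmod (V i)) + (cmod (Y' i) + cmod (V' i))"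
      unfolding X_def by (meson add_mono norm_triangle_ineq4 order_trans)
    then show "cmod (X i) \<le> 6 * v" using Yb[of i] Y'b[of i] ell2_point[OF V, of i] ell2_point[OF V', of i] by linarith
  next
    fix C i assume C: "\<And>i. cmod (X i) \<le> C"
    have "Y i - Y' i = X i + (V i - V' i)" for i by (simp add: X_def)
    then have "cmod (Y i - Y' i) \<le> C + d" for i using C dp by (metis add_mono norm_triangle_le)
    then have "cmod (conv V (\<lambda>i. B i * (Y i - Y' i)) i) \<le> v * \<beta> * (C + d)" by (rule conv_B1(2)[OF V B])
    moreover have "0 \<le> C" using C norm_ge_zero order_trans by blast
    then have "v * \<beta> * C \<le> C / 2" using mult_right_mono[OF vB, of C] by simp
    moreover have "cmod (X i) \<le> cmod (conv V (\<lambda>i. B i * (Y i - Y' i)) i) + cmod (conv V (\<lambda>i. (B i - B' i) * Y' i) i) +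
      cmod (conv (\<lambda>j. V j - V' j) (\<lambda>i. B' i * Y' i) i)" unfolding X by (intro norm_triangle_le add_right_mono norm_triangle_ineq)
    ultimately show "cmod (X i) \<le> (v * \<beta> * d + v * e * (2 * v) + d * \<beta> * (2 * v)) + C / 2"
      using conv_B1(2)[OF V e, where y = Y' and k = i, OF Y'b] conv_B1(2)[OF d B', where y = Y' and k = i, OF Y'b]
      by (simp add: algebra_simps)
  qed
  also have "\<dots> = 6 * v * \<beta> * d + 4 * v\<^sup>2 * e" by (simp add: power2_eq_square algebra_simps)
  finally show ?thesis by (simp add: X_def Y_def Y'_def)
qed

lemma cmod_le_Re: "\<bar>Re z - r\<bar> \<le> cmod (z - complex_of_real r)"
  using abs_Re_le_cmod[of "z - complex_of_real r"] by simp

section \<open>Reduction to a two-dimensional block\<close>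

text \<open>The modes of the block are \<open>\<plusminus>n\<close>; indices are shifted by \<open>n\<close>, so that they become
  \<open>0\<close> and \<open>2 * n\<close> and the weights need no shift.\<close>

definition Bres :: "int \<Rightarrow> complex \<Rightarrow> int \<Rightarrow> complex" where
  "Bres n z j = (if j = 0 \<or> j = 2 * n then 0 else 1 / (z - of_real (pi\<^sup>2 * (real_of_int (j - n))\<^sup>2)))"

text \<open>The edges lie at \<open>\<pi>\<^sup>2 (n\<^sup>2 \<plusminus> n)\<close>, so the upper
  edge for \<open>n\<close> is the lower edge for \<open>n + 1\<close> and the strips leave no gaps.
  Only the real part is restricted, since eigenvalues are complex and ordered by it first.\<close>

definition in_strip :: "int \<Rightarrow> complex \<Rightarrow> bool" where
  "in_strip n z \<longleftrightarrow> 2 \<le> n \<and> \<bar>Re z - pi\<^sup>2 * (real_of_int n)\<^sup>2\<bar> \<le> pi\<^sup>2 * real_of_int n"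

lemma pi_squared_ge: "9 \<le> pi\<^sup>2"
proof -
  have "3\<^sup>2 \<le> pi\<^sup>2" using pi_gt3 by (intro power_mono) auto
  then show ?thesis by simp
qed

lemma abs_mult_int_ge:
  fixes j n :: int
  assumes "2 \<le> n" "j \<noteq> 0" "j \<noteq> 2 * n"
  shows "2 * n - 1 \<le> \<bar>j * (j - 2 * n)\<bar>"
proof -
  have "1 \<le> \<bar>j\<bar>" "1 \<le> \<bar>j - 2 * n\<bar>" using assms by auto
  moreover have "a + b - 1 \<le> a * b" if "1 \<le> a" "1 \<le> b" for a b :: int
  proof -
    have "0 \<le> (a - 1) * (b - 1)" using that by simp
    then show ?thesis by (simp add: algebra_simps)
  qed
  ultimately have "\<bar>j\<bar> + \<bar>j - 2 * n\<bar> - 1 \<le> \<bar>j * (j - 2 * n)\<bar>" unfolding abs_mult by blast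
  then show ?thesis by linarith
qed

text \<open>Here \<open>(j - n)\<^sup>2 - n\<^sup>2 = j (j - 2 n)\<close>, and off the block its
  modulus is at least \<open>2 n - 1 \<ge> 3 n / 2\<close>. The half width
  \<open>\<pi>\<^sup>2 n\<close> of the strip therefore consumes at most two thirds of the distance,
  and \<open>\<pi>\<^sup>2 \<ge> 9\<close> turns the remaining third into the factor 3.\<close>

lemma in_strip_denominator:
  assumes "in_strip n z" "j \<noteq> 0" "j \<noteq> 2 * n"
  shows "3 * \<bar>real_of_int j * real_of_int (j - 2 * n)\<bar> \<le> cmod (z - of_real (pi\<^sup>2 * (real_of_int (j - n))\<^sup>2))"
proof -
  define m where "m = real_of_int (j * (j - 2 * n))"
  have n: "2 \<le> n" using assms by (simp add: in_strip_def)
  have sq: "(real_of_int (j - n))\<^sup>2 = (real_of_int n)\<^sup>2 + m"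
    by (simp add: m_def power2_eq_square algebra_simps)
  have "3 * n \<le> 2 * \<bar>j * (j - 2 * n)\<bar>" using abs_mult_int_ge[OF n assms(2,3)] n by linarith
  then have m: "real_of_int n \<le> 2/3 * \<bar>m\<bar>" unfolding m_def by linarith
  have "\<bar>pi\<^sup>2 * m\<bar> - pi\<^sup>2 * real_of_int n \<le> \<bar>Re z - pi\<^sup>2 * (real_of_int (j - n))\<^sup>2\<bar>"
    using assms(1) unfolding in_strip_def sq by (simp only: distrib_left) linarith
  moreover have "pi\<^sup>2 * real_of_int n \<le> 2/3 * (pi\<^sup>2 * \<bar>m\<bar>)"
    using mult_left_mono[OF m, of "pi\<^sup>2"] by simp
  moreover have "\<bar>pi\<^sup>2 * m\<bar> = pi\<^sup>2 * \<bar>m\<bar>" by (simp add: abs_mult)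
  ultimately have "pi\<^sup>2 * \<bar>m\<bar> / 3 \<le> \<bar>Re z - pi\<^sup>2 * (real_of_int (j - n))\<^sup>2\<bar>" by linarith
  moreover have "9 * \<bar>m\<bar> \<le> pi\<^sup>2 * \<bar>m\<bar>" using pi_squared_ge by (intro mult_right_mono) auto
  ultimately have "3 * \<bar>m\<bar> \<le> cmod (z - of_real (pi\<^sup>2 * (real_of_int (j - n))\<^sup>2))"
    using cmod_le_Re[of z "pi\<^sup>2 * (real_of_int (j - n))\<^sup>2"] by linarith
  then show ?thesis by (simp add: m_def)
qed

lemma Bres_le:
  assumes "in_strip n z" "j \<noteq> 0" "j \<noteq> 2 * n"
  shows "cmod (Bres n z j) \<le> 1 / (3 * \<bar>real_of_int j * real_of_int (j - 2 * n)\<bar>)"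
proof -
  have p: "0 < 3 * \<bar>real_of_int j * real_of_int (j - 2 * n)\<bar>" using assms by auto
  have "cmod (Bres n z j) = 1 / cmod (z - of_real (pi\<^sup>2 * (real_of_int (j - n))\<^sup>2))"
    using assms by (simp add: Bres_def norm_divide)
  also have "\<dots> \<le> 1 / (3 * \<bar>real_of_int j * real_of_int (j - 2 * n)\<bar>)"
    by (rule divide_left_mono[OF in_strip_denominator[OF assms]])
       (use p in_strip_denominator[OF assms] in \<open>auto intro!: mult_pos_pos simp del: abs_mult of_int_diff\<close>)
  finally show ?thesis .
qed

text \<open>Partial fractions: since \<open>\<bar>j\<bar> + \<bar>j - 2 n\<bar> \<ge> 2 n\<close>,
  the product of two reciprocals is \<open>1 / n\<close> times a sum of two, each square summable
  uniformly in \<open>n\<close>. This is where the gain \<open>1 / n\<close> arises.\<close>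

lemma inverse_product_le:
  assumes "2 \<le> n" "j \<noteq> 0" "j \<noteq> 2 * n"
  shows "1 / (3 * \<bar>real_of_int j * real_of_int (j - 2 * n)\<bar>)
     \<le> (1 / (6 * real_of_int n)) * (1 / \<bar>real_of_int j\<bar> + 1 / \<bar>real_of_int (j - 2 * n)\<bar>)"
proof -
  let ?a = "\<bar>real_of_int j\<bar>" and ?b = "\<bar>real_of_int (j - 2 * n)\<bar>"
  have p: "0 < ?a" "0 < ?b" "0 < real_of_int n" using assms by auto
  have "2 * real_of_int n \<le> ?a + ?b" by simp
  then have "1 / (3 * (?a * ?b)) \<le> (?a + ?b) / (6 * real_of_int n * (?a * ?b))"
    using p by (simp add: field_simps)
  also have "\<dots> = (1 / (6 * real_of_int n)) * (1 / ?a + 1 / ?b)" using p by (simp add: field_simps)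
  finally show ?thesis by (simp only: abs_mult)
qed

lemma ell2_inverse_int: "ell2 (\<lambda>j. if j = c then 0 else 1 / \<bar>real_of_int (j - c)\<bar>) 2"
  unfolding ell2_def
proof (intro conjI allI impI)
  fix F :: "int set" assume F: "finite F"
  have "(\<Sum>j\<in>F. (norm (if j = c then 0 else 1 / \<bar>real_of_int (j - c)\<bar>))\<^sup>2)
      = (\<Sum>j\<in>F - {c}. 1 / (real_of_int (j + - c))\<^sup>2)"
    using F by (intro sum.mono_neutral_cong_right) (auto simp: power_divide)
  also have "\<dots> \<le> 4" using F by (intro inverse_squares_int) auto
  finally show "(\<Sum>j\<in>F. (norm (if j = c then 0 else 1 / \<bar>real_of_int (j - c)\<bar>))\<^sup>2) \<le> 2\<^sup>2" by simp
qed simp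

lemma Bres_ell2:
  assumes "in_strip n z" shows "ell2 (Bres n z) (1 / real_of_int n)"
proof -
  have n: "2 \<le> n" using assms by (simp add: in_strip_def)
  let ?h = "\<lambda>j. (if j = 0 then 0 else 1 / \<bar>real_of_int (j - 0)\<bar>) + (if j = 2 * n then 0 else 1 / \<bar>real_of_int (j - 2 * n)\<bar>)"
  have "ell2 ?h (2 + 2)" by (rule ell2_add[OF ell2_inverse_int ell2_inverse_int])
  then have "ell2 (Bres n z) ((1 / (6 * real_of_int n)) * (2 + 2))"
  proof (rule ell2_scale)
    show "0 \<le> 1 / (6 * real_of_int n)" using n by simp
    fix j
    show "norm (Bres n z j) \<le> (1 / (6 * real_of_int n)) * norm (?h j)"
    proof (cases "j = 0 \<or> j = 2 * n")
      case False
      then show ?thesis using Bres_le[OF assms, of j] inverse_product_le[OF n, of j] by simp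
    qed (use n in \<open>auto simp: Bres_def\<close>)
  qed
  then show ?thesis by (rule ell2_mono) (use n in \<open>simp add: field_simps\<close>)
qed

text \<open>Absolute summability, stronger than \<open>ell2\<close>, is what later permits
  exchanging two summations in \<open>coefA_reflect\<close>.\<close>

lemma Bres_abs_summable:
  assumes "in_strip n z" shows "(\<lambda>j. cmod (Bres n z j)) summable_on UNIV"
proof -
  let ?f = "\<lambda>j. complex_of_real (cmod (Bres n z j))"
  let ?a = "\<lambda>j. if j = 0 then 0 else 1 / \<bar>real_of_int (j - 0)\<bar>"
  let ?b = "\<lambda>j. if j = 2 * n then 0 else 1 / \<bar>real_of_int (j - 2 * n)\<bar>"
  have "?f summable_on UNIV"
  proof (rule ell2_CS(1)[OF ell2_inverse_int ell2_inverse_int, of 1 ?f 0 "2 * n"])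
    fix j
    show "cmod (?f j) \<le> 1 * (norm (?a j) * norm (?b j))"
    proof (cases "j = 0 \<or> j = 2 * n")
      case False
      then have "cmod (Bres n z j) \<le> 1 / (3 * \<bar>real_of_int j * real_of_int (j - 2 * n)\<bar>)" by (intro Bres_le assms) auto
      also have "\<dots> \<le> 1 / \<bar>real_of_int j * real_of_int (j - 2 * n)\<bar>" by (simp add: divide_simps)
      finally show ?thesis using False by (simp add: abs_mult)
    qed (auto simp: Bres_def)
  qed simp
  then show ?thesis by (simp add: summable_on_iff_abs_summable_on_complex)
qed

lemma Bres_reflect: "Bres n z (2 * n - j) = Bres n z j"
proof -
  have "(real_of_int (2 * n - j - n))\<^sup>2 = (real_of_int (j - n))\<^sup>2" by (simp add: power2_commute)
  then show ?thesis unfolding Bres_def by auto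
qed

text \<open>The resolvent identity makes the difference \<open>(z' - z)\<close> times a product of
  two reciprocals; one is bounded pointwise by \<open>1 / n\<close>, the other in
  \<open>ell2\<close>.\<close>

lemma Bres_diff_ell2:
  assumes "in_strip n z" "in_strip n z'"
  shows "ell2 (\<lambda>j. Bres n z j - Bres n z' j) (cmod (z - z') / (real_of_int n)\<^sup>2)"
proof -
  have n: "2 \<le> n" using assms by (simp add: in_strip_def)
  have "ell2 (\<lambda>j. Bres n z j - Bres n z' j) ((cmod (z - z') / real_of_int n) * (1 / real_of_int n))"
  proof (rule ell2_scale[OF Bres_ell2[OF assms(2)]])
    fix j
    have nz: "z - of_real (pi\<^sup>2 * (real_of_int (j - n))\<^sup>2) \<noteq> 0" "z' - of_real (pi\<^sup>2 * (real_of_int (j - n))\<^sup>2) \<noteq> 0"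
      if "j \<noteq> 0" "j \<noteq> 2 * n"
      using in_strip_denominator[OF assms(1) that] in_strip_denominator[OF assms(2) that] that by (auto simp del: of_int_diff)
    have "Bres n z j - Bres n z' j = (z' - z) * (Bres n z j * Bres n z' j)"
      using nz by (auto simp: Bres_def divide_simps simp del: of_int_diff)
    then have "cmod (Bres n z j - Bres n z' j) = cmod (z - z') * cmod (Bres n z j) * cmod (Bres n z' j)"
      by (simp add: norm_mult norm_minus_commute)
    also have "\<dots> \<le> cmod (z - z') * (1 / real_of_int n) * cmod (Bres n z' j)"
      using ell2_point[OF Bres_ell2[OF assms(1)], of j] by (intro mult_right_mono mult_left_mono) auto
    finally show "cmod (Bres n z j - Bres n z' j) \<le> cmod (z - z') / real_of_int n * cmod (Bres n z' j)" by simp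
  qed (use n in auto)
  then show ?thesis by (simp add: power2_eq_square)
qed

lemma summable_on_norm_product:
  fixes f :: "'i \<Rightarrow> complex" and g :: "'j \<Rightarrow> complex"
  assumes "(\<lambda>i. norm (f i)) summable_on A" "(\<lambda>j. norm (g j)) summable_on B"
  shows "(\<lambda>p. norm (case p of (i, j) \<Rightarrow> f i * g j)) summable_on (A \<times> B)"
proof -
  have "(\<lambda>p. norm (f (fst p) * g (snd p))) summable_on (A \<times> B)"
  proof (rule summable_on_SigmaI)
    show "((\<lambda>j. norm (f (fst (i, j)) * g (snd (i, j)))) has_sum (norm (f i) * infsum (\<lambda>j. norm (g j)) B)) B" if "i \<in> A" for i
      unfolding norm_mult fst_conv snd_conv by (intro has_sum_cmult_right has_sum_infsum assms(2))
    show "(\<lambda>i. norm (f i) * infsum (\<lambda>j. norm (g j)) B) summable_on A"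
      by (intro summable_on_cmult_left assms(1))
  qed auto
  then show ?thesis by (simp add: case_prod_unfold)
qed

definition reflect :: "(int \<Rightarrow> complex) \<Rightarrow> int \<Rightarrow> complex" where "reflect V j = V (- j)"

lemma reflect_ell2: "ell2 V v \<Longrightarrow> ell2 (reflect V) v"
  unfolding reflect_def by (erule ell2_reindex) (auto simp: inj_def)

lemma reflect_ellw:
  assumes "submult_weight W" "ellw W V v" shows "ellw W (reflect V) v"
proof -
  have "ell2 (\<lambda>j. W (- j) * cmod (V (- j))) v"
    by (rule ell2_reindex[OF assms(2)]) (auto simp: inj_def)
  then show ?thesis using submultD(4)[OF assms(1)] by (simp add: reflect_def)
qed

text \<open>The values of \<open>V * a\<close>, with shifted index, when the amplitude of the mode
  \<open>- n\<close> is 1 and that of \<open>n\<close> is 0. Exchanging the two modes is the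
  reflection \<open>j \<mapsto> 2 * n - j\<close>, which replaces \<open>V\<close> by
  \<open>reflect V\<close>; \<open>Y1\<close> is obtained in that way.\<close>

definition Y0 :: "(int \<Rightarrow> complex) \<Rightarrow> int \<Rightarrow> complex \<Rightarrow> int \<Rightarrow> complex" where
  "Y0 V n z = lsol V (Bres n z) V"

definition Y1 :: "(int \<Rightarrow> complex) \<Rightarrow> int \<Rightarrow> complex \<Rightarrow> int \<Rightarrow> complex" where
  "Y1 V n z j = Y0 (reflect V) n z (2 * n - j)"

text \<open>Solving for the modes other than \<open>\<plusminus>n\<close> turns \<open>(L - z) a = 0\<close> into a \<open>2 \<times> 2\<close> system for \<open>a\<^bsub>\<plusminus>n\<^esub>\<close> with diagonal
  entries \<open>z - \<pi>\<^sup>2n\<^sup>2 - coefA\<close> and off-diagonal entries \<open>- coefC V\<close> and \<open>- coefC (reflect V)\<close>.\<close>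

definition coefA :: "(int \<Rightarrow> complex) \<Rightarrow> int \<Rightarrow> complex \<Rightarrow> complex" where
  "coefA V n z = Y0 V n z 0"

definition coefC :: "(int \<Rightarrow> complex) \<Rightarrow> int \<Rightarrow> complex \<Rightarrow> complex" where
  "coefC V n z = Y0 V n z (2 * n)"

context
  fixes V :: "int \<Rightarrow> complex" and v :: real and n :: int and z :: complex
  assumes V: "ell2 V v" and z: "in_strip n z" and vn: "2 * v \<le> real_of_int n"
begin

lemma block_small: "v * (1 / real_of_int n) \<le> 1/2"
  using vn z by (simp add: field_simps in_strip_def)

lemma bounded_V: "bounded_seq V" "bounded_seq (reflect V)"
  using bounded_seqI[OF ell2_point[OF V]] bounded_seqI[OF ell2_point[OF reflect_ell2[OF V]]] .

lemma Y0_solves: "solves V (Bres n z) V (Y0 V n z)"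
  unfolding Y0_def by (rule lsol_solves[OF V Bres_ell2[OF z] block_small bounded_V(1)])

lemma Y0r_solves: "solves (reflect V) (Bres n z) (reflect V) (Y0 (reflect V) n z)"
  unfolding Y0_def by (rule lsol_solves[OF reflect_ell2[OF V] Bres_ell2[OF z] block_small bounded_V(2)])

lemma Y1_solves: "solves V (Bres n z) (\<lambda>j. V (j - 2 * n)) (Y1 V n z)"
  unfolding solves_def
proof (intro conjI allI)
  have y: "bounded_seq (Y0 (reflect V) n z)" by (rule solves_bounded[OF Y0r_solves])
  then show "bounded_seq (Y1 V n z)" unfolding bounded_seq_def Y1_def by blast
  fix j
  have y1: "Y1 V n z j = reflect V (2 * n - j) + conv (reflect V) (\<lambda>i. Bres n z i * Y0 (reflect V) n z i) (2 * n - j)"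
    unfolding Y1_def using Y0r_solves unfolding solves_def by blast
  have e: "reflect V (2 * n - j - i) = V (j - (2 * n - i))" for i by (simp add: reflect_def algebra_simps)
  have "conv (reflect V) (\<lambda>i. Bres n z i * Y0 (reflect V) n z i) (2 * n - j)
      = conv V (\<lambda>i. Bres n z i * Y1 V n z i) j"
    unfolding conv_def
    by (rule infsum_reindex_bij_witness[of _ "\<lambda>i. 2 * n - i" "\<lambda>i. 2 * n - i"])
      (auto simp: Y1_def e Bres_reflect)
  moreover have "reflect V (2 * n - j) = V (j - 2 * n)" by (simp add: reflect_def)
  ultimately show "Y1 V n z j = V (j - 2 * n) + conv V (\<lambda>i. Bres n z i * Y1 V n z i) j"
    using y1 by simp
qed

text \<open>\<open>- d\<^sup>2/dx\<^sup>2 + q\<close> is symmetric with respect to the bilinear form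
  \<open>\<integral> f g\<close>, which pairs the mode \<open>k\<close> with the mode \<open>- k\<close>. Hence both diagonal entries of the
  reduced \<open>2 \<times> 2\<close> system agree.\<close>

lemma coefA_reflect: "coefA (reflect V) n z = coefA V n z"
proof -
  let ?B = "Bres n z" and ?y = "Y0 V n z" and ?x = "Y0 (reflect V) n z"
  obtain C where C: "\<And>j. cmod (?y j) \<le> C" using solves_bounded[OF Y0_solves] unfolding bounded_seq_def by blast
  obtain D where D: "\<And>j. cmod (?x j) \<le> D" using solves_bounded[OF Y0r_solves] unfolding bounded_seq_def by blast
  have C0: "0 \<le> C" "0 \<le> D" using C D norm_ge_zero order_trans by blast+
  \<comment> \<open>The two solutions paired through \<open>V\<close>. Summing over \<open>j\<close>
    first invokes the equation of \<open>?y\<close>, summing over \<open>i\<close> first that of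
    \<open>?x\<close>.\<close>
  define P where "P i j = ?B i * ?x i * V (i - j) * (?B j * ?y j)" for i j
  have sB: "(\<lambda>p. norm (case p of (i, j) \<Rightarrow> ?B i * ?B j)) summable_on (UNIV \<times> UNIV)"
    by (rule summable_on_norm_product) (rule Bres_abs_summable[OF z])+
  have sP: "(\<lambda>(i, j). P i j) summable_on (UNIV \<times> UNIV)"
  proof (rule abs_summable_summable[OF Infinite_Sum.abs_summable_on_comparison_test])
    show "(\<lambda>p. norm (case p of (i, j) \<Rightarrow> (complex_of_real (C * D * v)) * (?B i * ?B j))) summable_on (UNIV \<times> UNIV)"
      using summable_on_cmult_right[OF sB, of "cmod (complex_of_real (C * D * v))"] by (simp add: case_prod_unfold norm_mult)
    fix p :: "int \<times> int"
    obtain i j where p: "p = (i, j)" by force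
    have "cmod (P i j) = (cmod (?y j) * cmod (?x i) * cmod (V (i - j))) * (cmod (?B i) * cmod (?B j))"
      by (simp add: P_def norm_mult)
    also have "\<dots> \<le> (C * D * v) * (cmod (?B i) * cmod (?B j))"
      using C0 by (intro mult_right_mono mult_mono C D ell2_point[OF V]) auto
    finally show "norm (case p of (i, j) \<Rightarrow> P i j) \<le> norm (case p of (i, j) \<Rightarrow> (complex_of_real (C * D * v)) * (?B i * ?B j))"
      using C0 ell2_nonneg[OF V] by (simp add: p norm_mult)
  qed
  have swap: "(\<Sum>\<^sub>\<infinity>i. \<Sum>\<^sub>\<infinity>j. P i j) = (\<Sum>\<^sub>\<infinity>j. \<Sum>\<^sub>\<infinity>i. P i j)"
    using infsum_swap_banach[of P UNIV UNIV] sP by simp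
  have sxy: "(\<lambda>i. ?B i * ?x i * ?y i) summable_on UNIV"
  proof (rule abs_summable_summable[OF Infinite_Sum.abs_summable_on_comparison_test])
    show "(\<lambda>i. norm ((complex_of_real (C * D)) * ?B i)) summable_on UNIV"
      using summable_on_cmult_right[OF Bres_abs_summable[OF z], of "C * D"] C0 by (simp add: norm_mult)
    fix i
    have "cmod (?B i * ?x i * ?y i) = cmod (?y i) * cmod (?x i) * cmod (?B i)" by (simp add: norm_mult)
    also have "\<dots> \<le> C * D * cmod (?B i)" using C0 by (intro mult_right_mono mult_mono C D) auto
    finally show "norm (?B i * ?x i * ?y i) \<le> norm (complex_of_real (C * D) * ?B i)"
      using C0 by (simp add: norm_mult)
  qed
  have r1: "(\<Sum>\<^sub>\<infinity>j. P i j) = ?B i * ?x i * (?y i - V i)" for i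
  proof -
    have "(\<Sum>\<^sub>\<infinity>j. P i j) = (\<Sum>\<^sub>\<infinity>j. ?B i * ?x i * (V (i - j) * (?B j * ?y j)))"
      by (simp add: P_def mult.assoc)
    also have "\<dots> = ?B i * ?x i * conv V (\<lambda>j. ?B j * ?y j) i"
      unfolding conv_def by (rule infsum_cmult_right) (rule conv_B1(1)[OF V Bres_ell2[OF z] C])
    finally show ?thesis using solves_diff[OF Y0_solves] by simp
  qed
  have r2: "(\<Sum>\<^sub>\<infinity>i. P i j) = ?B j * ?y j * (?x j - reflect V j)" for j
  proof -
    have "(\<Sum>\<^sub>\<infinity>i. P i j) = (\<Sum>\<^sub>\<infinity>i. ?B j * ?y j * (reflect V (j - i) * (?B i * ?x i)))"
      by (simp add: P_def reflect_def mult_ac)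
    also have "\<dots> = ?B j * ?y j * conv (reflect V) (\<lambda>i. ?B i * ?x i) j"
      unfolding conv_def by (rule infsum_cmult_right) (rule conv_B1(1)[OF reflect_ell2[OF V] Bres_ell2[OF z] D])
    finally show ?thesis using solves_diff[OF Y0r_solves] by simp
  qed
  have sV: "(\<lambda>i. ?B i * ?x i * V i) summable_on UNIV"
    using conv_B1(1)[OF reflect_ell2[OF V] Bres_ell2[OF z] D, of 0] by (simp add: reflect_def mult_ac)
  have sV': "(\<lambda>i. ?B i * ?y i * reflect V i) summable_on UNIV"
    using conv_B1(1)[OF V Bres_ell2[OF z] C, of 0] by (simp add: reflect_def mult_ac)
  have "(\<Sum>\<^sub>\<infinity>i. ?B i * ?x i * (?y i - V i)) = (\<Sum>\<^sub>\<infinity>i. ?B i * ?x i * ?y i) - (\<Sum>\<^sub>\<infinity>i. ?B i * ?x i * V i)"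
    unfolding right_diff_distrib by (rule infsum_diff[OF sxy sV])
  moreover have "(\<Sum>\<^sub>\<infinity>i. ?B i * ?y i * (?x i - reflect V i)) = (\<Sum>\<^sub>\<infinity>i. ?B i * ?y i * ?x i) - (\<Sum>\<^sub>\<infinity>i. ?B i * ?y i * reflect V i)"
    unfolding right_diff_distrib by (rule infsum_diff[OF _ sV']) (use sxy in \<open>simp add: mult_ac\<close>)
  \<comment> \<open>The sum of \<open>?B i * ?x i * ?y i\<close> occurs in both evaluations of the
    double sum and cancels.\<close>
  ultimately have "(\<Sum>\<^sub>\<infinity>i. ?B i * ?x i * V i) = (\<Sum>\<^sub>\<infinity>i. ?B i * ?y i * reflect V i)"
    using swap unfolding r1 r2 by (simp add: mult_ac)
  moreover have "(\<Sum>\<^sub>\<infinity>i. ?B i * ?x i * V i) = ?x 0 - reflect V 0"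
    unfolding solves_diff[OF Y0r_solves] conv_def by (intro infsum_cong) (simp add: reflect_def mult_ac)
  moreover have "(\<Sum>\<^sub>\<infinity>i. ?B i * ?y i * reflect V i) = ?y 0 - V 0"
    unfolding solves_diff[OF Y0_solves] conv_def by (intro infsum_cong) (simp add: reflect_def mult_ac)
  ultimately show ?thesis by (simp add: coefA_def reflect_def)
qed

lemma Y1_0: "Y1 V n z 0 = coefC (reflect V) n z"
  by (simp add: Y1_def coefC_def)

lemma Y1_2n: "Y1 V n z (2 * n) = coefA V n z"
  using coefA_reflect by (simp add: Y1_def coefA_def)

end

text \<open>Stands in for the domain of the operator on the coefficient side: functions in the
  domain have such coefficients, such coefficients give an absolutely convergent series, and the
  differential equation returns the remaining regularity in \<open>seq_imp_hill_op\<close>.\<close>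

definition decays :: "(int \<Rightarrow> complex) \<Rightarrow> bool" where
  "decays a \<longleftrightarrow> (\<exists>C. \<forall>k. (1 + (real_of_int k)\<^sup>2) * cmod (a k) \<le> C)"

definition hill_seq :: "(int \<Rightarrow> complex) \<Rightarrow> (int \<Rightarrow> complex) \<Rightarrow> int \<Rightarrow> complex" where
  "hill_seq V a k = of_real (pi\<^sup>2 * (real_of_int k)\<^sup>2) * a k + conv V a k"

lemma decaysE:
  assumes "decays a" obtains C where "0 \<le> C" "\<And>k. cmod (a k) \<le> C / (1 + (real_of_int k)\<^sup>2)"
proof -
  obtain C where C: "\<And>k. (1 + (real_of_int k)\<^sup>2) * cmod (a k) \<le> C" using assms by (auto simp: decays_def)
  have "0 \<le> C" using C[of 0] norm_ge_zero[of "a 0"] by (simp del: norm_ge_zero)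
  moreover have "cmod (a k) \<le> C / (1 + (real_of_int k)\<^sup>2)" for k
    using C[of k] zero_le_power2[of "real_of_int k"] by (simp add: pos_le_divide_eq add_pos_nonneg mult.commute)
  ultimately show ?thesis using that by blast
qed

lemma decays_bounded: "decays a \<Longrightarrow> bounded_seq a"
proof -
  assume "decays a"
  then obtain C where C: "0 \<le> C" "\<And>k. cmod (a k) \<le> C / (1 + (real_of_int k)\<^sup>2)" by (rule decaysE) blast
  have "cmod (a k) \<le> C" for k
  proof -
    have "C / (1 + (real_of_int k)\<^sup>2) \<le> C / 1" using C(1) by (intro divide_left_mono) (auto simp: add_pos_nonneg)
    then show ?thesis using C(2)[of k] by simp
  qed
  then show ?thesis by (rule bounded_seqI)
qed

lemma decays_zero [simp]: "decays (\<lambda>_. 0)" "decays 0"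
  by (auto simp: decays_def)

lemma decays_add:
  assumes "decays a" "decays b" shows "decays (\<lambda>k. a k + b k)"
proof -
  obtain C D where "\<And>k. (1 + (real_of_int k)\<^sup>2) * cmod (a k) \<le> C" "\<And>k. (1 + (real_of_int k)\<^sup>2) * cmod (b k) \<le> D"
    using assms by (auto simp: decays_def)
  then have "(1 + (real_of_int k)\<^sup>2) * (cmod (a k) + cmod (b k)) \<le> C + D" for k
    by (simp add: distrib_left add_mono)
  moreover have "(1 + (real_of_int k)\<^sup>2) * cmod (a k + b k) \<le> (1 + (real_of_int k)\<^sup>2) * (cmod (a k) + cmod (b k))" for k
    by (intro mult_left_mono norm_triangle_ineq) auto
  ultimately show ?thesis unfolding decays_def by (meson order_trans)
qed

lemma decays_scale:
  assumes "decays a" shows "decays (\<lambda>k. c * a k)"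
proof -
  obtain C where "\<And>k. (1 + (real_of_int k)\<^sup>2) * cmod (a k) \<le> C" using assms by (auto simp: decays_def)
  then have "cmod c * ((1 + (real_of_int k)\<^sup>2) * cmod (a k)) \<le> cmod c * C" for k by (intro mult_left_mono) auto
  then show ?thesis unfolding decays_def norm_mult by (metis mult.left_commute)
qed

lemma decays_finite_support:
  assumes "finite {k. a k \<noteq> 0}" shows "decays a"
proof -
  let ?f = "\<lambda>k. (1 + (real_of_int k)\<^sup>2) * cmod (a k)"
  have "?f k \<le> (\<Sum>j\<in>{k. a k \<noteq> 0}. ?f j)" for k
  proof (cases "a k = 0")
    case True then show ?thesis by (auto intro!: sum_nonneg)
  next
    case False then show ?thesis by (intro member_le_sum assms) auto
  qed
  then show ?thesis unfolding decays_def by blast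
qed

lemma decays_ell2:
  assumes "decays a" obtains A where "ell2 a A"
proof -
  obtain C where C: "0 \<le> C" "\<And>k. cmod (a k) \<le> C / (1 + (real_of_int k)\<^sup>2)" using assms by (rule decaysE) blast
  let ?b = "\<lambda>j. (if j = 0 then 0 else 1 / \<bar>real_of_int (j - 0)\<bar>) + (if j = 0 then 1 else 0)"
  have "ell2 (\<lambda>j::int. if j = 0 then 1::real else 0) 1"
    unfolding ell2_def
  proof (intro conjI allI impI)
    fix F :: "int set" assume "finite F"
    then have "(\<Sum>j\<in>F. (norm (if j = 0 then 1::real else 0))\<^sup>2) = (\<Sum>j\<in>F \<inter> {0}. 1)"
      by (intro sum.mono_neutral_cong_right) auto
    also have "\<dots> \<le> 1" by (simp add: card_insert_if Int_insert_right)
    finally show "(\<Sum>j\<in>F. (norm (if j = 0 then 1::real else 0))\<^sup>2) \<le> 1\<^sup>2" by simp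
  qed simp
  then have "ell2 ?b (2 + 1)" by (intro ell2_add ell2_inverse_int)
  then have "ell2 a (C * (2 + 1))"
  proof (rule ell2_scale)
    fix j :: int
    have "C / (1 + (real_of_int j)\<^sup>2) \<le> C * norm (?b j)"
    proof (cases "j = 0")
      case False
      have "\<bar>real_of_int j\<bar> * 1 \<le> \<bar>real_of_int j\<bar> * \<bar>real_of_int j\<bar>" using False by (intro mult_left_mono) auto
      then have "\<bar>real_of_int j\<bar> \<le> 1 + (real_of_int j)\<^sup>2" by (simp add: power2_eq_square abs_mult[symmetric])
      then have "C / (1 + (real_of_int j)\<^sup>2) \<le> C / \<bar>real_of_int j\<bar>"
        using C(1) False by (intro divide_left_mono mult_pos_pos) (auto simp: add_pos_nonneg)
      then show ?thesis using False by simp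
    qed (use C in simp)
    then show "cmod (a j) \<le> C * norm (?b j)" using C(2)[of j] by linarith
  qed (use C in auto)
  then show ?thesis using that by blast
qed

lemma decays_abs_summable:
  assumes "decays a" shows "(\<lambda>k. cmod (a k)) summable_on UNIV"
proof -
  obtain C where C: "0 \<le> C" "\<And>k. cmod (a k) \<le> C / (1 + (real_of_int k)\<^sup>2)" using assms by (rule decaysE) blast
  have "(\<Sum>k\<in>F. cmod (a k)) \<le> 5 * C" if F: "finite F" for F
  proof -
    have "(\<Sum>k\<in>F. cmod (a k)) \<le> (\<Sum>k\<in>F - {0}. cmod (a k)) + cmod (a 0)"
      using F by (cases "0 \<in> F") (auto simp: sum.remove)
    also have "(\<Sum>k\<in>F - {0}. cmod (a k)) \<le> (\<Sum>k\<in>F - {0}. C * (1 / (real_of_int (k + 0))\<^sup>2))"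
    proof (rule sum_mono)
      fix k assume "k \<in> F - {0}"
      then have "C / (1 + (real_of_int k)\<^sup>2) \<le> C / (real_of_int k)\<^sup>2"
        using C(1) by (intro divide_left_mono mult_pos_pos) (auto simp: add_pos_nonneg)
      then show "cmod (a k) \<le> C * (1 / (real_of_int (k + 0))\<^sup>2)" using C(2)[of k] by simp
    qed
    also have "\<dots> \<le> C * 4" unfolding sum_distrib_left[symmetric]
      using C(1) F by (intro mult_left_mono inverse_squares_int) auto
    finally show ?thesis using C(2)[of 0] by simp
  qed
  then show ?thesis by (intro nonneg_bdd_above_summable_on bdd_aboveI2[where M = "5 * C"]) auto
qed

lemma conv_shift: "conv V a (j - n) = conv V (\<lambda>i. a (i - n)) j"
  unfolding conv_def
  by (rule infsum_reindex_bij_witness[of _ "\<lambda>i. i - n" "\<lambda>i. i + n"]) (auto simp: algebra_simps)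

lemma conv_lin:
  assumes "ell2 V v" "ell2 a A" "ell2 b B"
  shows "conv V (\<lambda>k. s * a k + t * b k) j = s * conv V a j + t * conv V b j"
proof -
  note S = conv_summable(1)[OF assms(1,2), of j] conv_summable(1)[OF assms(1,3), of j]
  have "conv V (\<lambda>k. s * a k + t * b k) j = (\<Sum>\<^sub>\<infinity>i. s * (V (j - i) * a i) + t * (V (j - i) * b i))"
    unfolding conv_def by (intro infsum_cong) (simp add: algebra_simps)
  also have "\<dots> = s * conv V a j + t * conv V b j"
    unfolding conv_def by (subst infsum_add) (auto intro!: summable_on_cmult_right S simp: infsum_cmult_right S)
  finally show ?thesis .
qed

lemma hill_seq_lin:
  assumes "ell2 V v" "decays a" "decays b"
  shows "hill_seq V (\<lambda>k. s * a k + t * b k) k = s * hill_seq V a k + t * hill_seq V b k"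
proof -
  obtain A where "ell2 a A" using assms(2) by (rule decays_ell2)
  moreover obtain B where "ell2 b B" using assms(3) by (rule decays_ell2)
  ultimately show ?thesis unfolding hill_seq_def by (subst conv_lin[OF assms(1)]) (auto simp: algebra_simps)
qed

lemma infsum_two:
  assumes "(p::int) \<noteq> q"
  shows "(\<Sum>\<^sub>\<infinity>i. (if i = p then s else if i = q then t else 0)) = s + (t::complex)"
    "(\<lambda>i. if i = p then s else if i = q then t else 0) summable_on UNIV"
proof -
  have "((\<lambda>i. if i = p then s else if i = q then t else 0) has_sum (\<Sum>i\<in>{p, q}. if i = p then s else if i = q then t else 0)) UNIV"
    by (rule has_sum_finite_neutralI) auto
  then show "(\<Sum>\<^sub>\<infinity>i. (if i = p then s else if i = q then t else 0)) = s + t"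
    "(\<lambda>i. if i = p then s else if i = q then t else 0) summable_on UNIV"
    using assms by (auto dest: infsumI simp: summable_on_def)
qed

context
  fixes V :: "int \<Rightarrow> complex" and v :: real and n :: int and z :: complex
  assumes V: "ell2 V v" and z: "in_strip n z" and vn: "2 * v \<le> real_of_int n"
begin

text \<open>The share of an inhomogeneity \<open>f\<close> in \<open>V * a\<close> that passes
  through the modes off the block. It enters with a minus sign because there
  \<open>a = B (y - f)\<close>.\<close>

definition block_rest :: "(int \<Rightarrow> complex) \<Rightarrow> int \<Rightarrow> complex" where
  "block_rest f = lsol V (Bres n z) (conv V (\<lambda>i. Bres n z i * f (i - n)))"

private lemma n2: "2 \<le> n" "0 \<noteq> 2 * n" using z by (auto simp: in_strip_def)

private lemmas B = Bres_ell2[OF z]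
private lemmas small = block_small[OF V z vn]

lemma conv_block:
  assumes y: "bounded_seq y" and ay: "\<And>i. i \<noteq> 0 \<Longrightarrow> i \<noteq> 2 * n \<Longrightarrow> a (i - n) = Bres n z i * y i"
  shows "conv V a (j - n) = V j * a (- n) + V (j - 2 * n) * a n + conv V (\<lambda>i. Bres n z i * y i) j"
proof -
  obtain C where C: "\<And>j. cmod (y j) \<le> C" using y unfolding bounded_seq_def by blast
  have "conv V a (j - n) = (\<Sum>\<^sub>\<infinity>i. (if i = 0 then V j * a (- n) else if i = 2 * n then V (j - 2 * n) * a n else 0)
      + V (j - i) * (Bres n z i * y i))"
    unfolding conv_shift unfolding conv_def
  proof (rule infsum_cong)
    fix i
    show "V (j - i) * a (i - n) = (if i = 0 then V j * a (- n) else if i = 2 * n then V (j - 2 * n) * a n else 0)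
      + V (j - i) * (Bres n z i * y i)"
      using ay[of i] n2 by (cases "i = 0 \<or> i = 2 * n") (auto simp: Bres_def)
  qed
  also have "\<dots> = V j * a (- n) + V (j - 2 * n) * a n + conv V (\<lambda>i. Bres n z i * y i) j"
    unfolding conv_def using infsum_two[OF n2(2)] by (subst infsum_add) (auto intro: conv_B1(1)[OF V B C])
  finally show ?thesis .
qed

lemma block_rest_scale:
  assumes "bounded_seq f" shows "block_rest (\<lambda>k. c * f k) = (\<lambda>j. c * block_rest f j)"
proof -
  obtain C where C: "\<And>j. cmod (f j) \<le> C" using assms unfolding bounded_seq_def by blast
  then have Cs: "\<And>i. cmod (f (i - n)) \<le> C" by simp
  have bs: "bounded_seq (conv V (\<lambda>i. Bres n z i * f (i - n)))"
    by (rule bounded_seqI, rule conv_B1(2)[OF V B Cs])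
  have "conv V (\<lambda>i. Bres n z i * (c * f (i - n))) = (\<lambda>j. c * conv V (\<lambda>i. Bres n z i * f (i - n)) j + 0 * conv V (\<lambda>i. Bres n z i * f (i - n)) j)"
    unfolding conv_def fun_eq_iff using infsum_cmult_right[OF conv_B1(1)[OF V B Cs], of c] by (simp add: mult_ac)
  then show ?thesis
    unfolding block_rest_def using lsol_lin[OF V B small bs bs, of c 0] by simp
qed

lemma block_rest_bound:
  assumes "\<And>k. cmod (f k) \<le> s"
  shows "cmod (block_rest f j) \<le> 2 * v / real_of_int n * s"
proof -
  have "cmod (block_rest f j) \<le> 2 * (v * (1 / real_of_int n) * s)"
    unfolding block_rest_def using assms by (intro lsol_bound[OF V B small] conv_B1(2)[OF V B])
  then show ?thesis by simp
qed

text \<open>The inhomogeneity is kept because pairs of eigenvalues and Jordan chains are later fed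
  in through it. Off the block the divisor is invertible, so \<open>V * a\<close> satisfies the
  linear equation, and its unique solution is the stated combination; the two remaining equations,
  at the modes of the block, are the reduced system.\<close>

lemma block_of_solution:
  assumes a: "decays a" and f: "bounded_seq f" and eq: "\<And>k. hill_seq V a k = z * a k + f k"
  defines "y \<equiv> \<lambda>j. a (- n) * Y0 V n z j + a n * Y1 V n z j - block_rest f j"
  shows "conv V a (j - n) = y j"
    and "\<And>j. j \<noteq> 0 \<Longrightarrow> j \<noteq> 2 * n \<Longrightarrow> a (j - n) = Bres n z j * (y j - f (j - n))"
    and "(z - of_real (pi\<^sup>2 * (real_of_int n)\<^sup>2) - coefA V n z) * a (- n) = coefC (reflect V) n z * a n - block_rest f 0 - f (- n)"
    and "(z - of_real (pi\<^sup>2 * (real_of_int n)\<^sup>2) - coefA V n z) * a n = coefC V n z * a (- n) - block_rest f (2 * n) - f n"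
proof -
  define x where "x j = conv V a (j - n)" for j
  obtain A where A: "ell2 a A" using a by (rule decays_ell2)
  have bx: "bounded_seq x" unfolding x_def by (rule bounded_seqI, rule conv_summable(2)[OF V A])
  obtain C where C: "\<And>j. cmod (f j) \<le> C" using f unfolding bounded_seq_def by blast
  have bf: "bounded_seq (\<lambda>i. f (i - n))" using C by (rule bounded_seqI)
  have eq': "(z - of_real (pi\<^sup>2 * (real_of_int (j - n))\<^sup>2)) * a (j - n) = x j - f (j - n)" for j
    using eq[of "j - n"] unfolding hill_seq_def x_def by (simp add: algebra_simps)
  have inv: "Bres n z j * (z - of_real (pi\<^sup>2 * (real_of_int (j - n))\<^sup>2)) = 1" if "j \<noteq> 0" "j \<noteq> 2 * n" for j
    using in_strip_denominator[OF z that] that by (auto simp: Bres_def simp del: of_int_diff)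
  have ax: "a (j - n) = Bres n z j * (x j - f (j - n))" if "j \<noteq> 0" "j \<noteq> 2 * n" for j
    using inv[OF that] unfolding eq'[symmetric] by (simp add: mult.assoc[symmetric])
  obtain D where D: "\<And>j. cmod (x j) \<le> D" using bx unfolding bounded_seq_def by blast
  have bxf: "bounded_seq (\<lambda>j. x j - f (j - n))"
    using bounded_seq_add[OF bx bounded_seq_scale[OF bf, of "-1"]] by simp
  define b1 where "b1 j = a (- n) * V j + a n * V (j - 2 * n)" for j
  define b2 where "b2 = conv V (\<lambda>i. Bres n z i * f (i - n))"
  have bV: "bounded_seq V" "bounded_seq (\<lambda>j. V (j - 2 * n))"
    by (rule bounded_seqI, rule ell2_point[OF V])+
  have bb1: "bounded_seq b1" unfolding b1_def by (intro bounded_seq_add bounded_seq_scale bV)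
  have bb2: "bounded_seq b2" unfolding b2_def by (rule bounded_seqI, rule conv_B1(2)[OF V B C])
  \<comment> \<open>The sum defining \<open>V * a\<close> is split into the two modes of the block,
    which form \<open>b1\<close>, and the rest, where \<open>a\<close> is expressed through
    \<open>x - f\<close>.\<close>
  have "solves V (Bres n z) (\<lambda>j. 1 * b1 j + (-1) * b2 j) x"
    unfolding solves_def
  proof (intro conjI allI bx)
    fix j
    have "x j = V j * a (- n) + V (j - 2 * n) * a n + conv V (\<lambda>i. Bres n z i * (x i - f (i - n))) j"
      unfolding x_def by (rule conv_block[OF bxf[unfolded x_def]]) (use ax in \<open>simp add: x_def\<close>)
    also have "conv V (\<lambda>i. Bres n z i * (x i - f (i - n))) j = conv V (\<lambda>i. Bres n z i * x i) j - b2 j"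
      unfolding b2_def by (rule conv_B_diff[OF V B bx bf, symmetric])
    finally show "x j = 1 * b1 j + (-1) * b2 j + conv V (\<lambda>i. Bres n z i * x i) j" by (simp add: b1_def)
  qed
  then have "x = lsol V (Bres n z) (\<lambda>j. 1 * b1 j + (-1) * b2 j)" by (rule lsol_eqI[OF V B small, symmetric])
  also have "\<dots> = (\<lambda>j. 1 * lsol V (Bres n z) b1 j + (-1) * lsol V (Bres n z) b2 j)"
    by (rule lsol_lin[OF V B small bb1 bb2])
  also have "lsol V (Bres n z) b1 = (\<lambda>j. a (- n) * Y0 V n z j + a n * Y1 V n z j)"
    unfolding b1_def lsol_lin[OF V B small bV]
    using lsol_eqI[OF V B small Y1_solves[OF V z vn]] by (simp add: Y0_def)
  finally have xy: "x = y" by (simp add: y_def block_rest_def b2_def fun_eq_iff)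
  then show "conv V a (j - n) = y j" by (simp add: x_def fun_eq_iff)
  show "a (j - n) = Bres n z j * (y j - f (j - n))" if "j \<noteq> 0" "j \<noteq> 2 * n" for j
    using ax[OF that] by (simp add: xy)
  show "(z - of_real (pi\<^sup>2 * (real_of_int n)\<^sup>2) - coefA V n z) * a (- n) = coefC (reflect V) n z * a n - block_rest f 0 - f (- n)"
    using eq'[of 0] by (simp add: xy y_def Y1_0[OF V z vn] coefA_def algebra_simps)
  show "(z - of_real (pi\<^sup>2 * (real_of_int n)\<^sup>2) - coefA V n z) * a n = coefC V n z * a (- n) - block_rest f (2 * n) - f n"
  proof -
    have "(z - of_real (pi\<^sup>2 * (real_of_int n)\<^sup>2)) * a n = y (2 * n) - f n" using eq'[of "2 * n"] by (simp add: xy)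
    then show ?thesis unfolding y_def Y1_2n[OF V z vn] coefC_def[symmetric] Y0_def[symmetric] by (simp add: algebra_simps)
  qed
qed

lemma block_rest_zero: "block_rest (\<lambda>_. 0) = (\<lambda>_. 0)"
  using block_rest_scale[of "\<lambda>_. 0" 0] bounded_seqI[of "\<lambda>_. 0" 0] by simp

lemma block_of_eigen:
  assumes a: "decays a" and eq: "\<And>k. hill_seq V a k = z * a k"
  shows "\<And>j. j \<noteq> 0 \<Longrightarrow> j \<noteq> 2 * n \<Longrightarrow> a (j - n) = Bres n z j * (a (- n) * Y0 V n z j + a n * Y1 V n z j)"
    and "(z - of_real (pi\<^sup>2 * (real_of_int n)\<^sup>2) - coefA V n z) * a (- n) = coefC (reflect V) n z * a n"
    and "(z - of_real (pi\<^sup>2 * (real_of_int n)\<^sup>2) - coefA V n z) * a n = coefC V n z * a (- n)"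
  using block_of_solution[OF a, of "\<lambda>_. 0"] bounded_seqI[of "\<lambda>_. 0" 0] eq by (auto simp: block_rest_zero)

lemma Y_bound: "cmod (Y0 V n z j) \<le> 2 * v" "cmod (Y1 V n z j) \<le> 2 * v"
proof -
  have *: "cmod (Y0 U n z i) \<le> 2 * v" if "ell2 U v" for U i
    using lsol_self_bound(1)[OF submult_one ellw_one[OF that] B small, of i] by (simp add: Y0_def)
  show "cmod (Y0 V n z j) \<le> 2 * v" "cmod (Y1 V n z j) \<le> 2 * v"
    unfolding Y1_def by (intro * V reflect_ell2[OF V])+
qed

text \<open>Off the block an eigenvector carries the factor \<open>1 / n\<close> times two responses
  of size \<open>2 * v\<close>, at most 1 in total. Eigenvectors can therefore be normalized by
  their entries on the block.\<close>

lemma block_eigen_sup: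
  assumes a: "decays a" and eq: "\<And>k. hill_seq V a k = z * a k" and v4: "4 * v \<le> real_of_int n"
  shows "cmod (a k) \<le> max (cmod (a (- n))) (cmod (a n))"
proof (cases "k = n \<or> k = - n")
  case False
  let ?U = "max (cmod (a (- n))) (cmod (a n))"
  have U: "0 \<le> ?U" by (simp add: le_max_iff_disj)
  have "a k = Bres n z (k + n) * (a (- n) * Y0 V n z (k + n) + a n * Y1 V n z (k + n))"
    using block_of_eigen(1)[OF a eq, of "k + n"] False by auto
  then have "cmod (a k) = cmod (Bres n z (k + n)) * cmod (a (- n) * Y0 V n z (k + n) + a n * Y1 V n z (k + n))"
    by (simp add: norm_mult)
  also have "\<dots> \<le> (1 / real_of_int n) * (?U * (2 * v) + ?U * (2 * v))"
  proof (rule mult_mono)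
    show "cmod (a (- n) * Y0 V n z (k + n) + a n * Y1 V n z (k + n)) \<le> ?U * (2 * v) + ?U * (2 * v)"
      using U unfolding norm_mult[symmetric]
      by (intro norm_triangle_le add_mono) (auto simp: norm_mult intro!: mult_mono Y_bound)
  qed (use ell2_point[OF B] n2 in auto)
  also have "\<dots> = (4 * v / real_of_int n) * ?U" by simp
  also have "\<dots> \<le> 1 * ?U" using v4 n2 U by (intro mult_right_mono) auto
  finally show ?thesis by simp
qed auto

lemma block_eigen_zero:
  assumes a: "decays a" and eq: "\<And>k. hill_seq V a k = z * a k" and "a (- n) = 0" "a n = 0"
  shows "a k = 0"
  using block_of_eigen(1)[OF a eq, of "k + n"] assms(3,4) by (cases "k = n \<or> k = - n") auto

text \<open>The converse of the reduction: a kernel vector of the \<open>2 \<times> 2\<close> system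
  prescribes the amplitudes on the block, and the responses fill in the other modes. The decay comes
  from the reciprocal divisors, since the responses are only bounded.\<close>

lemma eigen_of_block:
  assumes "(z - of_real (pi\<^sup>2 * (real_of_int n)\<^sup>2) - coefA V n z) * u0 = coefC (reflect V) n z * u1"
    and "(z - of_real (pi\<^sup>2 * (real_of_int n)\<^sup>2) - coefA V n z) * u1 = coefC V n z * u0"
  obtains a where "decays a" "\<And>k. hill_seq V a k = z * a k" "a (- n) = u0" "a n = u1"
proof -
  define y where "y j = u0 * Y0 V n z j + u1 * Y1 V n z j" for j
  define a where "a k = (if k = - n then u0 else if k = n then u1 else Bres n z (k + n) * y (k + n))" for k
  have an: "a (- n) = u0" "a n = u1" using n2 by (auto simp: a_def)
  have ybd: "bounded_seq y" unfolding y_def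
    by (intro bounded_seq_add bounded_seq_scale bounded_seqI[OF Y_bound(1)] bounded_seqI[OF Y_bound(2)])
  obtain D where D: "\<And>j. cmod (y j) \<le> D" using ybd unfolding bounded_seq_def by blast
  have D0: "0 \<le> D" using D[of 0] norm_ge_zero order_trans by blast
  have ay: "a (i - n) = Bres n z i * y i" if "i \<noteq> 0" "i \<noteq> 2 * n" for i
    using that by (auto simp: a_def)
  have sy: "y j = conv V a (j - n)" for j
  proof -
    have bV: "bounded_seq V" "bounded_seq (\<lambda>j. V (j - 2 * n))"
      by (rule bounded_seqI, rule ell2_point[OF V])+
    have "y = lsol V (Bres n z) (\<lambda>j. u0 * V j + u1 * V (j - 2 * n))"
      unfolding lsol_lin[OF V B small bV]
      using lsol_eqI[OF V B small Y1_solves[OF V z vn]] by (simp add: Y0_def y_def fun_eq_iff)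
    then have "solves V (Bres n z) (\<lambda>j. u0 * V j + u1 * V (j - 2 * n)) y"
      using lsol_solves[OF V B small, of "\<lambda>j. u0 * V j + u1 * V (j - 2 * n)"]
      by (simp add: bounded_seq_add bounded_seq_scale bV)
    then have "y j = u0 * V j + u1 * V (j - 2 * n) + conv V (\<lambda>i. Bres n z i * y i) j"
      unfolding solves_def by blast
    also have "\<dots> = conv V a (j - n)"
      using conv_block[OF ybd ay, of j] ay by (simp add: an)
    finally show ?thesis .
  qed
  show ?thesis
  proof (rule that)
    show "a (- n) = u0" "a n = u1" by (fact an)+
    show "decays a"
    proof -
      have nn: "1 \<le> (real_of_int n)\<^sup>2 + 2" by (simp add: add_increasing)
      let ?d = "\<lambda>k. if k = - n then u0 else if k = n then u1 else 0"
      have "finite {k. ?d k \<noteq> 0}" by (rule finite_subset[of _ "{n, - n}"]) auto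
      then have "decays ?d" by (rule decays_finite_support)
      moreover have "decays (\<lambda>k. Bres n z (k + n) * y (k + n))"
        unfolding decays_def
      proof (intro exI allI)
        fix k
        show "(1 + (real_of_int k)\<^sup>2) * cmod (Bres n z (k + n) * y (k + n)) \<le> ((real_of_int n)\<^sup>2 + 2) * D"
        proof (cases "k = n \<or> k = - n")
          case False
          let ?m = "(k + n) * (k + n - 2 * n)"
          have j: "k + n \<noteq> 0" "k + n \<noteq> 2 * n" using False by auto
          have m: "?m = k\<^sup>2 - n\<^sup>2" by (simp add: power2_eq_square algebra_simps)
          have "?m \<noteq> 0" using j by simp
          then have "1 \<le> \<bar>?m\<bar>" by linarith
          define mm where "mm = real_of_int ?m"
          have m1: "1 \<le> \<bar>mm\<bar>" using \<open>1 \<le> \<bar>?m\<bar>\<close> unfolding mm_def by linarith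
          \<comment> \<open>As \<open>mm\<close> is a nonzero integer, the constant
            \<open>1 + n\<^sup>2\<close> may be multiplied by \<open>\<bar>mm\<bar>\<close>, which
            bounds \<open>1 + k\<^sup>2\<close> by a multiple of the divisor alone.\<close>
          have "mm = (real_of_int k)\<^sup>2 - (real_of_int n)\<^sup>2" unfolding mm_def m by simp
          then have "1 + (real_of_int k)\<^sup>2 \<le> (1 + (real_of_int n)\<^sup>2) * 1 + \<bar>mm\<bar>" using abs_ge_self[of mm] by simp
          also have "\<dots> \<le> (1 + (real_of_int n)\<^sup>2) * \<bar>mm\<bar> + \<bar>mm\<bar>"
            using m1 by (intro add_right_mono mult_left_mono) auto
          finally have k: "1 + (real_of_int k)\<^sup>2 \<le> ((real_of_int n)\<^sup>2 + 2) * \<bar>mm\<bar>" by (simp add: algebra_simps)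
          have "cmod (Bres n z (k + n)) \<le> 1 / (3 * \<bar>mm\<bar>)" using Bres_le[OF z j] by (simp add: mm_def)
          also have "\<dots> \<le> 1 / \<bar>mm\<bar>" using m1 by (intro divide_left_mono mult_pos_pos) linarith+
          finally have "(1 + (real_of_int k)\<^sup>2) * cmod (Bres n z (k + n)) \<le> (((real_of_int n)\<^sup>2 + 2) * \<bar>mm\<bar>) * (1 / \<bar>mm\<bar>)"
            using k by (intro mult_mono) (auto intro: mult_nonneg_nonneg add_nonneg_nonneg)
          also have "\<dots> = (real_of_int n)\<^sup>2 + 2" using m1 by simp
          finally have "(1 + (real_of_int k)\<^sup>2) * cmod (Bres n z (k + n)) * cmod (y (k + n)) \<le> ((real_of_int n)\<^sup>2 + 2) * D"
            by (intro mult_mono D) auto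
          then show ?thesis by (simp add: norm_mult mult.assoc)
        qed (use D0 in \<open>auto simp: Bres_def\<close>)
      qed
      ultimately have "decays (\<lambda>k. ?d k + Bres n z (k + n) * y (k + n))" by (rule decays_add)
      moreover have "?d k + Bres n z (k + n) * y (k + n) = a k" for k using n2 by (auto simp: a_def Bres_def)
      ultimately show ?thesis by simp
    qed
    fix k
    have c: "conv V a k = y (k + n)" using sy[of "k + n"] by simp
    consider "k = - n" | "k = n" | "k + n \<noteq> 0" "k + n \<noteq> 2 * n" by linarith
    then show "hill_seq V a k = z * a k"
    proof cases
      case 1
      then show ?thesis using assms(1) unfolding hill_seq_def c
        by (simp add: an y_def Y1_0[OF V z vn] coefA_def algebra_simps)
    next
      case 2
      then have "k + n = 2 * n" by simp
      then have "y (k + n) = u0 * coefC V n z + u1 * coefA V n z"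
        unfolding y_def coefC_def by (simp only: Y1_2n[OF V z vn])
      then show ?thesis using assms(2) 2 unfolding hill_seq_def c
        by (simp add: an algebra_simps)
    next
      case 3
      have "Bres n z (k + n) * (z - of_real (pi\<^sup>2 * (real_of_int k)\<^sup>2)) = 1"
        using in_strip_denominator[OF z 3] 3 by (auto simp: Bres_def simp del: of_int_diff)
      then have "y (k + n) = (z - of_real (pi\<^sup>2 * (real_of_int k)\<^sup>2)) * a k"
        using ay[OF 3] by (simp add: mult.assoc[symmetric] mult.commute)
      then show ?thesis unfolding hill_seq_def c by (simp add: algebra_simps)
    qed
  qed
qed

end

section \<open>Estimates for the reduced system\<close>

definition defect :: "(int \<Rightarrow> complex) \<Rightarrow> int \<Rightarrow> complex \<Rightarrow> complex" where
  "defect V n z = z - of_real (pi\<^sup>2 * (real_of_int n)\<^sup>2) - coefA V n z"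

lemma coef_bounds:
  assumes W: "submult_weight W" and V: "ellw W V v" and z: "in_strip n z" and vn: "2 * v \<le> real_of_int n"
  shows "W 0 * cmod (coefA V n z - V 0) \<le> 2 * v\<^sup>2 / real_of_int n"
    and "W (2 * n) * cmod (coefC V n z - V (2 * n)) \<le> 2 * v\<^sup>2 / real_of_int n"
    and "W (2 * n) * cmod (coefC (reflect V) n z - V (- (2 * n))) \<le> 2 * v\<^sup>2 / real_of_int n"
proof -
  note small = block_small[OF ellw_ell2[OF W V] z vn]
  note * = lsol_self_bound(2)[OF W V Bres_ell2[OF z] small, folded Y0_def]
    and ** = lsol_self_bound(2)[OF W reflect_ellw[OF W V] Bres_ell2[OF z] small, folded Y0_def]
  show "W 0 * cmod (coefA V n z - V 0) \<le> 2 * v\<^sup>2 / real_of_int n"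
    using *[of 0] by (simp add: coefA_def)
  show "W (2 * n) * cmod (coefC V n z - V (2 * n)) \<le> 2 * v\<^sup>2 / real_of_int n"
    using *[of "2 * n"] by (simp add: coefC_def)
  have "reflect V (2 * n) = V (- (2 * n))" by (simp add: reflect_def)
  then show "W (2 * n) * cmod (coefC (reflect V) n z - V (- (2 * n))) \<le> 2 * v\<^sup>2 / real_of_int n"
    using **[of "2 * n"] by (simp add: coefC_def)
qed

lemma coef_perturb:
  assumes V: "ell2 V v" and V': "ell2 V' v" and z: "in_strip n z" and z': "in_strip n z'"
    and vn: "2 * v \<le> real_of_int n" and d: "ell2 (\<lambda>j. V j - V' j) d"
  defines "e \<equiv> 6 * v / real_of_int n * d + 4 * v\<^sup>2 / (real_of_int n)\<^sup>2 * cmod (z - z')"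
  shows "cmod ((coefA V n z - V 0) - (coefA V' n z' - V' 0)) \<le> e"
    and "cmod ((coefC V n z - V (2 * n)) - (coefC V' n z' - V' (2 * n))) \<le> e"
    and "cmod ((coefC (reflect V) n z - V (- (2 * n))) - (coefC (reflect V') n z' - V' (- (2 * n)))) \<le> e"
proof -
  have small: "v * (1 / real_of_int n) \<le> 1 / 2" by (rule block_small[OF V z vn])
  have dr: "ell2 (\<lambda>j. reflect V j - reflect V' j) d"
    using reflect_ell2[OF d] unfolding reflect_def .
  have *: "cmod ((Y0 U n z j - U j) - (Y0 U' n z' j - U' j)) \<le> e"
    if "ell2 U v" "ell2 U' v" "ell2 (\<lambda>j. U j - U' j) d" for U U' j
    using lsol_perturb[OF that(1,2) Bres_ell2[OF z] Bres_ell2[OF z'] small that(3) Bres_diff_ell2[OF z z'], of j]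
    by (simp add: Y0_def e_def)
  show "cmod ((coefA V n z - V 0) - (coefA V' n z' - V' 0)) \<le> e"
    "cmod ((coefC V n z - V (2 * n)) - (coefC V' n z' - V' (2 * n))) \<le> e"
    "cmod ((coefC (reflect V) n z - V (- (2 * n))) - (coefC (reflect V') n z' - V' (- (2 * n)))) \<le> e"
    using *[OF V V' d, of 0] *[OF V V' d, of "2 * n"] *[OF reflect_ell2[OF V] reflect_ell2[OF V'] dr, of "2 * n"]
    unfolding coefA_def[symmetric] coefC_def[symmetric] reflect_def[of _ "2 * n"] by auto
qed

text \<open>An eigenvector that vanishes on the block vanishes, so the reduced system has a
  nontrivial kernel and its determinant is zero.\<close>

lemma defect_square:
  assumes V: "ell2 V v" and z: "in_strip n z" and vn: "2 * v \<le> real_of_int n"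
    and a: "decays a" "\<And>k. hill_seq V a k = z * a k" "a \<noteq> (\<lambda>_. 0)"
  shows "(defect V n z)\<^sup>2 = coefC V n z * coefC (reflect V) n z"
proof -
  note e = block_of_eigen(2,3)[OF V z vn a(1,2), folded defect_def]
  have "a (- n) \<noteq> 0 \<or> a n \<noteq> 0" using block_eigen_zero[OF V z vn a(1,2)] a(3) by blast
  then show ?thesis
  proof
    assume u: "a (- n) \<noteq> 0"
    have "(defect V n z)\<^sup>2 * a (- n) = defect V n z * (defect V n z * a (- n))" by (simp add: power2_eq_square)
    also have "\<dots> = coefC (reflect V) n z * (defect V n z * a n)" unfolding e(1) by (simp add: mult_ac)
    also have "\<dots> = coefC V n z * coefC (reflect V) n z * a (- n)" unfolding e(2) by (simp add: mult_ac)
    finally have "(defect V n z)\<^sup>2 * a (- n) = coefC V n z * coefC (reflect V) n z * a (- n)" .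
    then show ?thesis using u by simp
  next
    assume u: "a n \<noteq> 0"
    have "(defect V n z)\<^sup>2 * a n = defect V n z * (defect V n z * a n)" by (simp add: power2_eq_square)
    also have "\<dots> = coefC V n z * (defect V n z * a (- n))" unfolding e(2) by (simp add: mult_ac)
    also have "\<dots> = coefC V n z * coefC (reflect V) n z * a n" unfolding e(1) by (simp add: mult_ac)
    finally have "(defect V n z)\<^sup>2 * a n = coefC V n z * coefC (reflect V) n z * a n" .
    then show ?thesis using u by simp
  qed
qed

text \<open>The pair \<open>a2\<close>, \<open>a1 = (L - z) a2\<close> covers two situations at once: distinct eigenvalues
  \<open>z \<noteq> z'\<close> with \<open>a2\<close> an eigenvector of \<open>z'\<close>, and a Jordan block when \<open>z = z'\<close>. The adjugate of the
  reduced \<open>2 \<times> 2\<close> matrix at \<open>z\<close> annihilates its range, and it differs from the negative of the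
  matrix only by its trace, twice the defect.\<close>

lemma defect_bound:
  assumes V: "ell2 V v" and z: "in_strip n z" and z': "in_strip n z'" and vn: "4 * v \<le> real_of_int n"
    and a0: "decays a0" "\<And>k. hill_seq V a0 k = z * a0 k" "a0 \<noteq> (\<lambda>_. 0)"
    and a1: "decays a1" "\<And>k. hill_seq V a1 k = z' * a1 k" "a1 \<noteq> (\<lambda>_. 0)"
    and a2: "decays a2" "\<And>k. hill_seq V a2 k = z * a2 k + a1 k"
  defines "M \<equiv> max (cmod (coefC V n z)) (cmod (coefC (reflect V) n z))"
  shows "2 * cmod (defect V n z) \<le> 2 * v / real_of_int n * (cmod (defect V n z) + M) + 2 * cmod (z' - z)"
proof -
  have v0: "0 \<le> v" using V by (rule ell2_nonneg)
  have n2: "2 \<le> n" using z by (simp add: in_strip_def)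
  have vn2: "2 * v \<le> real_of_int n" using vn v0 by linarith
  define g where "g = defect V n z"
  define p where "p = coefC V n z"
  define m where "m = coefC (reflect V) n z"
  define U where "U = max (cmod (a1 (- n))) (cmod (a1 n))"
  define \<epsilon> where "\<epsilon> = 2 * v / real_of_int n"
  have \<epsilon>: "0 \<le> \<epsilon>" "\<epsilon> \<le> 1" using v0 n2 vn2 by (auto simp: \<epsilon>_def)
  define r where "r = block_rest V n z a1"
  have b1: "bounded_seq a1" by (rule decays_bounded[OF a1(1)])
  have U: "cmod (a1 k) \<le> U" for k unfolding U_def by (rule block_eigen_sup[OF V z' vn2 a1(1,2) vn])
  have U0: "0 < U"
  proof -
    obtain k where "a1 k \<noteq> 0" using a1(3) by blast
    then show ?thesis using U[of k] by (metis norm_le_zero_iff not_less order_trans)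
  qed
  have r: "cmod (r j) \<le> \<epsilon> * U" for j
    unfolding r_def \<epsilon>_def by (rule block_rest_bound[OF V z vn2 U])
  have gg: "g * g = p * m"
    using defect_square[OF V z vn2 a0] by (simp add: g_def p_def m_def power2_eq_square)
  \<comment> \<open>The eigenvector of \<open>z'\<close> is read as a solution at \<open>z\<close>
    with inhomogeneity \<open>(z' - z) * a1\<close>, so both vectors are reduced at the same
    point.\<close>
  have s: "hill_seq V a1 k = z * a1 k + (z' - z) * a1 k" for k using a1(2)[of k] by (simp add: algebra_simps)
  have e1: "g * a1 (- n) = m * a1 n - (z' - z) * r 0 - (z' - z) * a1 (- n)"
    "g * a1 n = p * a1 (- n) - (z' - z) * r (2 * n) - (z' - z) * a1 n"
    using block_of_solution(3,4)[OF V z vn2 a1(1) bounded_seq_scale[OF b1] s]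
    unfolding g_def defect_def p_def m_def r_def block_rest_scale[OF V z vn2 b1] by auto
  have e2: "g * a2 (- n) = m * a2 n - r 0 - a1 (- n)" "g * a2 n = p * a2 (- n) - r (2 * n) - a1 n"
    using block_of_solution(3,4)[OF V z vn2 a2(1) b1 a2(2)]
    unfolding g_def defect_def p_def m_def r_def by auto
  have s1: "r 0 + a1 (- n) = m * a2 n - g * a2 (- n)" "r (2 * n) + a1 n = p * a2 (- n) - g * a2 n"
    using e2 by (simp_all add: algebra_simps)
  \<comment> \<open>A row of the adjugate applied to a vector in the range of the matrix gives the
    determinant \<open>p * m - g * g\<close> times an entry, hence 0.\<close>
  have "g * (r 0 + a1 (- n)) + m * (r (2 * n) + a1 n) = (p * m - g * g) * a2 (- n)"
    unfolding s1 by (simp add: algebra_simps)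
  then have k1: "g * (r 0 + a1 (- n)) + m * (r (2 * n) + a1 n) = 0" by (simp add: gg)
  have "p * (r 0 + a1 (- n)) + g * (r (2 * n) + a1 n) = (p * m - g * g) * a2 n"
    unfolding s1 by (simp add: algebra_simps)
  then have k2: "p * (r 0 + a1 (- n)) + g * (r (2 * n) + a1 n) = 0" by (simp add: gg)
  \<comment> \<open>One copy of \<open>g * a1 (- n)\<close> is rewritten by the equation of
    \<open>a1\<close>, the other by the adjugate relation. The terms \<open>m * a1 n\<close> cancel,
    leaving only products with the small \<open>r\<close> or with \<open>z' - z\<close>.\<close>
  have f1: "2 * g * a1 (- n) = - (g * r 0 + m * r (2 * n)) - (z' - z) * (r 0 + a1 (- n))"
  proof -
    have "2 * g * a1 (- n) = g * a1 (- n) + (- g * r 0 - m * (r (2 * n) + a1 n))"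
      using k1 by (simp add: algebra_simps)
    then show ?thesis unfolding e1(1) by (simp add: algebra_simps)
  qed
  have f2: "2 * g * a1 n = - (g * r (2 * n) + p * r 0) - (z' - z) * (r (2 * n) + a1 n)"
  proof -
    have "2 * g * a1 n = g * a1 n + (- g * r (2 * n) - p * (r 0 + a1 (- n)))"
      using k2 by (simp add: algebra_simps)
    then show ?thesis unfolding e1(2) by (simp add: algebra_simps)
  qed
  have est: "cmod (2 * g * w) \<le> (\<epsilon> * (cmod g + M) + 2 * cmod (z' - z)) * U"
    if "2 * g * w = - (g * s + c * t) - (z' - z) * (s + w)" "cmod c \<le> M" "cmod s \<le> \<epsilon> * U" "cmod t \<le> \<epsilon> * U" "cmod w \<le> U"
    for w s t c
  proof -
    have sU: "cmod s \<le> U" using that(3) \<epsilon> U0 mult_right_mono[of \<epsilon> 1 U] by linarith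
    have "cmod (2 * g * w) \<le> cmod (g * s + c * t) + cmod ((z' - z) * (s + w))"
      unfolding that(1) by (metis norm_minus_cancel norm_triangle_ineq4)
    also have "\<dots> \<le> (cmod (g * s) + cmod (c * t)) + cmod (z' - z) * (cmod s + cmod w)"
      unfolding norm_mult[of "z' - z"] by (intro add_mono norm_triangle_ineq mult_left_mono) auto
    also have "\<dots> \<le> (cmod g * (\<epsilon> * U) + M * (\<epsilon> * U)) + cmod (z' - z) * (U + U)"
      unfolding norm_mult using that sU U0 \<epsilon> by (intro add_mono mult_mono mult_left_mono) (auto intro: order_trans[OF norm_ge_zero])
    finally show ?thesis by (simp add: algebra_simps)
  qed
  have pm: "cmod p \<le> M" "cmod m \<le> M" by (auto simp: M_def p_def m_def)
  \<comment> \<open>\<open>U\<close> is attained at one of the two modes of the block, so dividing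
    by it is harmless.\<close>
  have "2 * cmod g * U = max (cmod (2 * g * a1 (- n))) (cmod (2 * g * a1 n))"
    unfolding U_def norm_mult by (simp add: max_mult_distrib_left)
  also have "\<dots> \<le> (\<epsilon> * (cmod g + M) + 2 * cmod (z' - z)) * U"
    using est[OF f1 pm(2) r r U] est[OF f2 pm(1) r r U] by simp
  finally show ?thesis using U0 by (simp add: g_def \<epsilon>_def)
qed

text \<open>Restriction to the block is injective on eigenvectors, so two independent ones have a
  nonzero determinant \<open>D\<close> there. A \<open>2 \<times> 2\<close> matrix that annihilates
  two independent vectors is zero.\<close>

lemma defect_double:
  assumes V: "ell2 V v" and z: "in_strip n z" and vn: "2 * v \<le> real_of_int n"
    and a: "decays a" "\<And>k. hill_seq V a k = z * a k"
    and b: "decays b" "\<And>k. hill_seq V b k = z * b k"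
    and indep: "\<And>s t. (\<And>k. s * a k + t * b k = 0) \<Longrightarrow> s = 0 \<and> t = 0"
  shows "coefC V n z = 0" "coefC (reflect V) n z = 0" "defect V n z = 0"
proof -
  have comb: "s = 0 \<and> t = 0" if "s * a (- n) + t * b (- n) = 0" "s * a n + t * b n = 0" for s t
  proof (rule indep)
    fix k
    have "decays (\<lambda>k. s * a k + t * b k)" by (intro decays_add decays_scale a b)
    moreover have "hill_seq V (\<lambda>k. s * a k + t * b k) k = z * (s * a k + t * b k)" for k
      using a(2)[of k] b(2)[of k] by (simp add: hill_seq_lin[OF V a(1) b(1)] algebra_simps)
    ultimately show "s * a k + t * b k = 0" using block_eigen_zero[OF V z vn _ _ that] by blast
  qed
  define g where "g = defect V n z"
  define p where "p = coefC V n z"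
  define m where "m = coefC (reflect V) n z"
  define D where "D = a (- n) * b n - a n * b (- n)"
  have ea: "g * a (- n) = m * a n" "g * a n = p * a (- n)"
    using block_of_eigen(2,3)[OF V z vn a] by (auto simp: g_def p_def m_def defect_def)
  have eb: "g * b (- n) = m * b n" "g * b n = p * b (- n)"
    using block_of_eigen(2,3)[OF V z vn b] by (auto simp: g_def p_def m_def defect_def)
  have D: "D \<noteq> 0"
  proof
    assume D0: "D = 0"
    have "b n = 0 \<and> - a n = 0" using comb[of "b n" "- a n"] D0 by (simp add: D_def algebra_simps)
    moreover have "b (- n) = 0 \<and> - a (- n) = 0" using comb[of "b (- n)" "- a (- n)"] D0 by (simp add: D_def algebra_simps)
    ultimately show False using comb[of 1 0] by simp
  qed
  have "g * D = (g * a (- n)) * b n - a n * (g * b (- n))" by (simp add: D_def algebra_simps)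
  also have "\<dots> = 0" unfolding ea eb by simp
  finally have g: "g = 0" using D by simp
  have "m * D = a (- n) * (m * b n) - (m * a n) * b (- n)" "p * D = (p * a (- n)) * b n - a n * (p * b (- n))"
    by (simp_all add: D_def algebra_simps)
  then have "m * D = 0" "p * D = 0" unfolding ea[symmetric] eb[symmetric] by (simp_all add: g)
  then show "coefC V n z = 0" "coefC (reflect V) n z = 0" "defect V n z = 0"
    using D g by (auto simp: g_def p_def m_def)
qed

section \<open>Two-periodic Fourier coefficients\<close>

definition locint :: "(real \<Rightarrow> complex) \<Rightarrow> bool" where
  "locint \<phi> \<longleftrightarrow> (\<forall>a b. \<phi> absolutely_integrable_on {a..b})"

lemma locintD: "locint \<phi> \<Longrightarrow> \<phi> absolutely_integrable_on {a..b}" "locint \<phi> \<Longrightarrow> \<phi> integrable_on {a..b}"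
  "locint \<phi> \<Longrightarrow> (\<lambda>x. cmod (\<phi> x)) integrable_on {a..b}"
  by (auto simp: locint_def absolutely_integrable_on_def)

lemma locint_diff: "locint \<phi> \<Longrightarrow> locint \<psi> \<Longrightarrow> locint (\<lambda>x. \<phi> x - \<psi> x)"
  unfolding locint_def by (auto intro: set_integral_diff(1))

lemma locint_mult_cont:
  assumes "locint \<phi>" "continuous_on UNIV e"
  shows "locint (\<lambda>x. \<phi> x * e x)"
  unfolding locint_def
proof (intro allI)
  fix a b :: real
  have c: "continuous_on {a..b} e" using assms(2) continuous_on_subset by blast
  have "(\<lambda>x. e x * \<phi> x) absolutely_integrable_on {a..b}"
  proof (rule absolutely_integrable_bounded_measurable_product[where h = "(*)"])
    show "bilinear ((*) :: complex \<Rightarrow> _)" using bounded_bilinear_mult bilinear_conv_bounded_bilinear by blast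
    show "e \<in> borel_measurable (lebesgue_on {a..b})"
      by (rule continuous_imp_measurable_on_sets_lebesgue[OF c]) auto
    show "bounded (e ` {a..b})" using c by (intro compact_imp_bounded compact_continuous_image) auto
  qed (use assms(1) in \<open>auto simp: locint_def\<close>)
  then show "(\<lambda>x. \<phi> x * e x) absolutely_integrable_on {a..b}" by (simp add: mult.commute)
qed

lemma locint_cont: "continuous_on UNIV e \<Longrightarrow> locint e"
  unfolding locint_def by (metis absolutely_integrable_continuous_real continuous_on_subset subset_UNIV)

lemma locint_square:
  assumes "\<phi> \<in> borel_measurable lebesgue" "\<And>a b. (\<lambda>x. (cmod (\<phi> x))\<^sup>2) integrable_on {a..b}"
  shows "locint \<phi>"
  unfolding locint_def
proof (intro allI)
  fix a b :: real
  show "\<phi> absolutely_integrable_on {a..b}"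
  proof (rule measurable_bounded_by_integrable_imp_absolutely_integrable[where g = "\<lambda>x. 1 + (cmod (\<phi> x))\<^sup>2"])
    show "\<phi> \<in> borel_measurable (lebesgue_on {a..b})" using assms(1) by (rule measurable_restrict_space1)
    show "(\<lambda>x. 1 + (cmod (\<phi> x))\<^sup>2) integrable_on {a..b}" by (intro integrable_add assms(2)) auto
    fix x
    have "0 \<le> (cmod (\<phi> x) - 1)\<^sup>2" by simp
    then have "2 * cmod (\<phi> x) \<le> 1 + (cmod (\<phi> x))\<^sup>2" by (simp add: power2_diff)
    then show "cmod (\<phi> x) \<le> 1 + (cmod (\<phi> x))\<^sup>2" using norm_ge_zero[of "\<phi> x"] by linarith
  qed auto
qed

text \<open>Replaces differentiation almost everywhere in the integration by parts below.\<close>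

lemma second_order_increments:
  fixes D :: "real \<Rightarrow> complex" and \<Phi> :: "real \<Rightarrow> real"
  assumes ab: "a \<le> b"
    and D: "\<And>x y. a \<le> x \<Longrightarrow> x \<le> y \<Longrightarrow> y \<le> b \<Longrightarrow> cmod (D y - D x) \<le> K * (y - x) * (\<Phi> y - \<Phi> x)"
  shows "D b = D a"
proof -
  have le: "cmod (D b - D a) \<le> (K * (b - a) * (\<Phi> b - \<Phi> a)) / real (Suc N)" for N
  proof -
    define h where "h = (b - a) / real (Suc N)"
    define x where "x i = a + real i * h" for i :: nat
    have h: "0 \<le> h" "real (Suc N) * h = b - a" using ab by (auto simp: h_def)
    have xb: "x i \<le> b" if "i \<le> Suc N" for i
      using mult_right_mono[of "real i" "real (Suc N)" h] that h unfolding x_def by simp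
    have x0: "x 0 = a" "x (Suc N) = b" using h by (auto simp: x_def)
    have "D b - D a = (\<Sum>i<Suc N. D (x (Suc i)) - D (x i))"
      using sum_lessThan_telescope[of "\<lambda>i. D (x i)" "Suc N"] x0 by simp
    then have "cmod (D b - D a) \<le> (\<Sum>i<Suc N. cmod (D (x (Suc i)) - D (x i)))" using norm_sum by metis
    also have "\<dots> \<le> (\<Sum>i<Suc N. K * h * (\<Phi> (x (Suc i)) - \<Phi> (x i)))"
    proof (rule sum_mono)
      fix i assume "i \<in> {..<Suc N}"
      then have "cmod (D (x (Suc i)) - D (x i)) \<le> K * (x (Suc i) - x i) * (\<Phi> (x (Suc i)) - \<Phi> (x i))"
        using h by (intro D xb) (auto simp: x_def intro!: mult_right_mono)
      moreover have "x (Suc i) - x i = h" by (simp add: x_def algebra_simps)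
      ultimately show "cmod (D (x (Suc i)) - D (x i)) \<le> K * h * (\<Phi> (x (Suc i)) - \<Phi> (x i))" by simp
    qed
    also have "\<dots> = K * h * (\<Phi> b - \<Phi> a)"
      unfolding sum_distrib_left[symmetric] using sum_lessThan_telescope[of "\<lambda>i. \<Phi> (x i)" "Suc N"] x0 by simp
    also have "\<dots> = (K * (b - a) * (\<Phi> b - \<Phi> a)) / real (Suc N)" by (simp add: h_def)
    finally show ?thesis .
  qed
  \<comment> \<open>The increments of \<open>\<Phi>\<close> add up to
    \<open>\<Phi> b - \<Phi> a\<close> while the mesh contributes a factor
    \<open>1 / (N + 1)\<close>, so refining the partition forces the difference to 0.\<close>
  have "(\<lambda>N. (K * (b - a) * (\<Phi> b - \<Phi> a)) / real (Suc N)) \<longlonglongrightarrow> 0"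
    by (rule LIMSEQ_Suc[OF lim_const_over_n])
  then have "cmod (D b - D a) \<le> 0" using le by (meson LIMSEQ_le_const)
  then show ?thesis by simp
qed

text \<open>\<open>\<phi>\<close> is only integrable, so \<open>F * e\<close> need not be
  differentiable anywhere in particular. Instead the discrepancy \<open>D\<close> of the two sides,
  as a function of the upper limit, is shown to have increments of second order and hence to be
  constant.\<close>

lemma integral_by_parts_primitive:
  assumes \<phi>: "locint \<phi>" and F: "\<And>x y. x \<le> y \<Longrightarrow> (\<phi> has_integral (F y - F x)) {x..y}"
    and e: "\<And>x. (e has_vector_derivative e' x) (at x)" and e': "continuous_on UNIV e'" and ab: "a \<le> b"
  shows "integral {a..b} (\<lambda>x. \<phi> x * e x) = F b * e b - F a * e a - integral {a..b} (\<lambda>x. F x * e' x)"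
proof -
  have ce: "continuous_on UNIV e"
    using e by (meson continuous_at_imp_continuous_on has_vector_derivative_continuous)
  have cF: "continuous_on {a..b} F"
  proof -
    have "F x = F a + integral {a..x} \<phi>" if "x \<in> {a..b}" for x
      using integral_unique[OF F[of a x]] that by simp
    moreover have "continuous_on {a..b} (\<lambda>x. F a + integral {a..x} \<phi>)"
      by (intro continuous_intros indefinite_integral_continuous_1 locintD(2)[OF \<phi>])
    ultimately show ?thesis using continuous_on_cong by (metis (no_types, lifting))
  qed
  have i1: "(\<lambda>x. \<phi> x * e x) integrable_on {x..y}" for x y
    by (rule locintD(2)[OF locint_mult_cont[OF \<phi> ce]])
  have cFe: "continuous_on {a..b} (\<lambda>x. F x * e' x)"
    using cF e' by (intro continuous_intros) (auto intro: continuous_on_subset)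
  have i2: "(\<lambda>x. F x * e' x) integrable_on {x..y}" if "a \<le> x" "y \<le> b" for x y
    by (rule integrable_continuous_real[OF continuous_on_subset[OF cFe]]) (use that in auto)
  define \<Phi> where "\<Phi> x = integral {a..x} (\<lambda>t. cmod (\<phi> t))" for x
  have \<Phi>: "\<Phi> y - \<Phi> x = integral {x..y} (\<lambda>t. cmod (\<phi> t))" if "a \<le> x" "x \<le> y" for x y
    using Henstock_Kurzweil_Integration.integral_combine[OF that locintD(3)[OF \<phi>]] by (simp add: \<Phi>_def)
  define D where "D x = integral {a..x} (\<lambda>t. \<phi> t * e t) - F x * e x + integral {a..x} (\<lambda>t. F t * e' t)" for x
  have "bounded (e' ` {a..b})" using e' by (intro compact_imp_bounded compact_continuous_image) (auto intro: continuous_on_subset)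
  then obtain E where E: "\<And>x. x \<in> {a..b} \<Longrightarrow> cmod (e' x) \<le> E" unfolding bounded_iff by blast
  have E0: "0 \<le> E" using order_trans[OF norm_ge_zero E[of a]] ab by simp
  have "D b = D a"
  proof (rule second_order_increments[OF ab, where K = "2 * E" and \<Phi> = \<Phi>])
    fix x y assume xy: "a \<le> x" "x \<le> y" "y \<le> b"
    have en: "cmod (e y - e t) \<le> E * (y - x)" if t: "t \<in> {x..y}" for t
    proof -
      have "(e' has_integral (e y - e t)) {t..y}"
        by (rule fundamental_theorem_of_calculus) (use t in \<open>auto intro: has_vector_derivative_at_within e\<close>)
      then have "cmod (e y - e t) \<le> E * measure lborel {t..y}"
        using has_integral_bound[OF E0, of e' "e y - e t" t y] t xy E by simp
      also have "\<dots> = E * (y - t)" using t by simp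
      also have "\<dots> \<le> E * (y - x)" using t E0 by (simp add: mult.commute mult_left_mono)
      finally show ?thesis .
    qed
    have Ft: "cmod (F t - F x) \<le> \<Phi> y - \<Phi> x" if t: "t \<in> {x..y}" for t
    proof -
      have "cmod (F t - F x) = cmod (integral {x..t} \<phi>)" using integral_unique[OF F[of x t]] t by simp
      also have "\<dots> \<le> integral {x..t} (\<lambda>t. cmod (\<phi> t))"
        by (rule integral_norm_bound_integral) (auto intro: locintD \<phi>)
      also have "\<dots> \<le> integral {x..y} (\<lambda>t. cmod (\<phi> t))"
        using t by (intro integral_subset_le) (auto intro: locintD \<phi>)
      finally show ?thesis using \<Phi> xy by simp
    qed
    have c1: "integral {a..y} (\<lambda>t. \<phi> t * e t) - integral {a..x} (\<lambda>t. \<phi> t * e t) = integral {x..y} (\<lambda>t. \<phi> t * e t)"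
      using Henstock_Kurzweil_Integration.integral_combine[OF xy(1,2) i1] by (simp add: algebra_simps)
    have c2: "integral {a..y} (\<lambda>t. F t * e' t) - integral {a..x} (\<lambda>t. F t * e' t) = integral {x..y} (\<lambda>t. F t * e' t)"
      using Henstock_Kurzweil_Integration.integral_combine[OF xy(1,2) i2] xy by (simp add: algebra_simps)
    have h1: "((\<lambda>t. \<phi> t * (e t - e y)) has_integral (integral {x..y} (\<lambda>t. \<phi> t * e t) - (F y - F x) * e y)) {x..y}"
      unfolding right_diff_distrib
      by (intro has_integral_diff integrable_integral i1 has_integral_mult_left F xy)
    have "(e' has_integral (e y - e x)) {x..y}"
      by (rule fundamental_theorem_of_calculus) (use xy e in \<open>auto intro: has_vector_derivative_at_within\<close>)
    then have h2: "((\<lambda>t. (F t - F x) * e' t) has_integral (integral {x..y} (\<lambda>t. F t * e' t) - F x * (e y - e x))) {x..y}"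
      unfolding left_diff_distrib
      by (intro has_integral_diff integrable_integral i2 has_integral_mult_right) (use xy in auto)
    \<comment> \<open>Centring \<open>e\<close> at \<open>y\<close> and \<open>F\<close> at
      \<open>x\<close> makes both integrands products with an increment: that of \<open>e\<close> is
      of order \<open>y - x\<close>, that of \<open>F\<close> at most
      \<open>\<Phi> y - \<Phi> x\<close>, and integration of the other factor supplies what is
      missing.\<close>
    have "D y - D x = integral {x..y} (\<lambda>t. \<phi> t * (e t - e y)) + integral {x..y} (\<lambda>t. (F t - F x) * e' t)"
      unfolding integral_unique[OF h1] integral_unique[OF h2] c1[symmetric] c2[symmetric] D_def by (simp add: algebra_simps)
    also have "cmod \<dots> \<le> cmod (integral {x..y} (\<lambda>t. \<phi> t * (e t - e y))) + cmod (integral {x..y} (\<lambda>t. (F t - F x) * e' t))"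
      by (rule norm_triangle_ineq)
    also have "\<dots> \<le> E * (y - x) * (\<Phi> y - \<Phi> x) + (\<Phi> y - \<Phi> x) * E * (y - x)"
    proof (rule add_mono)
      have "cmod (integral {x..y} (\<lambda>t. \<phi> t * (e t - e y))) \<le> integral {x..y} (\<lambda>t. E * (y - x) * cmod (\<phi> t))"
      proof (rule integral_norm_bound_integral)
        show "(\<lambda>t. \<phi> t * (e t - e y)) integrable_on {x..y}" using h1 by (rule has_integral_integrable)
        show "(\<lambda>t. E * (y - x) * cmod (\<phi> t)) integrable_on {x..y}"
          using integrable_on_cmult_left[OF locintD(3)[OF \<phi>], of "E * (y - x)" x y] by simp
        fix t assume "t \<in> {x..y}"
        then show "cmod (\<phi> t * (e t - e y)) \<le> E * (y - x) * cmod (\<phi> t)"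
          using mult_right_mono[OF en, of t "cmod (\<phi> t)"] by (simp add: norm_mult norm_minus_commute mult.commute)
      qed
      also have "\<dots> = E * (y - x) * (\<Phi> y - \<Phi> x)" using \<Phi>[of x y] xy by simp
      finally show "cmod (integral {x..y} (\<lambda>t. \<phi> t * (e t - e y))) \<le> E * (y - x) * (\<Phi> y - \<Phi> x)" .
      have "cmod (integral {x..y} (\<lambda>t. (F t - F x) * e' t)) \<le> integral {x..y} (\<lambda>t. (\<Phi> y - \<Phi> x) * E)"
      proof (rule integral_norm_bound_integral)
        show "(\<lambda>t. (F t - F x) * e' t) integrable_on {x..y}" using h2 by (rule has_integral_integrable)
        fix t assume t: "t \<in> {x..y}"
        show "cmod ((F t - F x) * e' t) \<le> (\<Phi> y - \<Phi> x) * E"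
          unfolding norm_mult using t Ft[OF t] E[of t] xy order_trans[OF norm_ge_zero Ft[OF t]] by (intro mult_mono) auto
      qed auto
      then show "cmod (integral {x..y} (\<lambda>t. (F t - F x) * e' t)) \<le> (\<Phi> y - \<Phi> x) * E * (y - x)" using xy by (simp add: mult_ac)
    qed
    finally show "cmod (D y - D x) \<le> 2 * E * (y - x) * (\<Phi> y - \<Phi> x)" by (simp add: algebra_simps)
  qed
  then show ?thesis by (simp add: D_def algebra_simps)
qed

text \<open>The exponentials of period 2 treat periodic and antiperiodic boundary conditions
  together; those with even index have period 1.\<close>

definition mode :: "int \<Rightarrow> real \<Rightarrow> complex" where
  "mode k x = cis (pi * real_of_int k * x)"

definition cf :: "(real \<Rightarrow> complex) \<Rightarrow> int \<Rightarrow> complex" where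
  "cf f k = integral {0..2} (\<lambda>x. f x * mode (- k) x) / 2"

lemma mode_mult: "mode j x * mode k x = mode (j + k) x"
  by (simp add: mode_def cis_mult algebra_simps)

lemma mode_0 [simp]: "mode 0 x = 1" "mode k 0 = 1"
  by (simp_all add: mode_def)

lemma mode_periodic [simp]: "mode k (x + 2) = mode k x" "mode k 2 = 1"
proof -
  have *: "cis (pi * real_of_int k * 2) = 1"
    using cis_multiple_2pi[of "real_of_int k"] by (simp add: mult_ac)
  show "mode k 2 = 1" using * by (simp add: mode_def)
  have "cis (pi * real_of_int k * (x + 2)) = cis (pi * real_of_int k * x) * cis (pi * real_of_int k * 2)"
    by (simp add: cis_mult algebra_simps)
  then show "mode k (x + 2) = mode k x" by (simp add: mode_def *)
qed

lemma norm_mode [simp]: "cmod (mode k x) = 1"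
  by (simp add: mode_def)

lemma mode_deriv: "(mode k has_vector_derivative (\<i> * of_real (pi * real_of_int k) * mode k x)) (at x)"
proof -
  have "((\<lambda>x. cis (pi * real_of_int k * x)) has_vector_derivative (\<i> * of_real (pi * real_of_int k) * mode k x)) (at x)"
    unfolding cis_conv_exp mode_def
    by (auto intro!: derivative_eq_intros has_vector_derivative_real_field simp: algebra_simps)
  then show ?thesis by (simp add: mode_def[abs_def])
qed

lemma continuous_mode [continuous_intros]: "continuous_on S (mode k)"
  unfolding mode_def[abs_def] by (intro continuous_intros)

lemma integral_mode: "integral {0..2} (mode k) = (if k = 0 then 2 else 0)"
proof (cases "k = 0")
  case False
  have "((\<lambda>x. \<i> * of_real (pi * real_of_int k) * mode k x) has_integral (mode k 2 - mode k 0)) {0..2}"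
    by (rule fundamental_theorem_of_calculus) (simp, rule has_vector_derivative_at_within[OF mode_deriv])
  then have "(mode k has_integral 0) {0..2}"
    using has_integral_mult_right[of "\<lambda>x. \<i> * of_real (pi * real_of_int k) * mode k x" 0 "{0..2}" "1 / (\<i> * of_real (pi * real_of_int k))"] False
    by (simp add: mult.assoc[symmetric])
  then show ?thesis using False by (simp add: integral_unique)
qed (simp add: mode_def[abs_def] scaleR_conv_of_real)

lemma cf_integrable: "locint f \<Longrightarrow> (\<lambda>x. f x * mode k x) integrable_on {a..b}"
  by (intro locintD(2) locint_mult_cont continuous_intros)

lemma cf_lin:
  assumes "locint f" "locint g"
  shows "cf (\<lambda>x. s * f x + t * g x) k = s * cf f k + t * cf g k"
proof -
  have "((\<lambda>x. s * (f x * mode (- k) x) + t * (g x * mode (- k) x)) has_integral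
      s * integral {0..2} (\<lambda>x. f x * mode (- k) x) + t * integral {0..2} (\<lambda>x. g x * mode (- k) x)) {0..2}"
    by (intro has_integral_add has_integral_mult_right integrable_integral cf_integrable assms)
  then have "integral {0..2} (\<lambda>x. (s * f x + t * g x) * mode (- k) x) =
      s * integral {0..2} (\<lambda>x. f x * mode (- k) x) + t * integral {0..2} (\<lambda>x. g x * mode (- k) x)"
    by (intro integral_unique) (simp add: algebra_simps)
  then show ?thesis by (simp add: cf_def add_divide_distrib)
qed

lemma cf_bound:
  assumes "locint f" shows "cmod (cf f k) \<le> integral {0..2} (\<lambda>x. cmod (f x))"
proof -
  have "cmod (integral {0..2} (\<lambda>x. f x * mode (- k) x)) \<le> integral {0..2} (\<lambda>x. cmod (f x))"
    by (rule integral_norm_bound_integral) (auto intro: cf_integrable locintD assms simp: norm_mult)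
  moreover have "0 \<le> integral {0..2} (\<lambda>x. cmod (f x))" by (intro integral_nonneg locintD assms) auto
  ultimately show ?thesis by (simp add: cf_def norm_divide)
qed

lemma cf_primitive:
  assumes \<phi>: "locint \<phi>" and F: "\<And>x y. x \<le> y \<Longrightarrow> (\<phi> has_integral (F y - F x)) {x..y}" and per: "F 2 = F 0"
  shows "cf \<phi> k = \<i> * of_real (pi * real_of_int k) * cf F k"
proof -
  have "integral {0..2} (\<lambda>x. \<phi> x * mode (- k) x)
    = F 2 * mode (- k) 2 - F 0 * mode (- k) 0 - integral {0..2} (\<lambda>x. F x * (\<i> * of_real (pi * real_of_int (- k)) * mode (- k) x))"
    by (rule integral_by_parts_primitive[OF \<phi> F mode_deriv]) (auto intro!: continuous_intros)
  also have "\<dots> = - integral {0..2} (\<lambda>x. (\<i> * of_real (pi * real_of_int (- k))) * (F x * mode (- k) x))"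
    by (simp add: per mult_ac)
  also have "\<dots> = \<i> * of_real (pi * real_of_int k) * integral {0..2} (\<lambda>x. F x * mode (- k) x)"
    by (subst integral_mult_right) auto
  finally show ?thesis by (simp add: cf_def)
qed

text \<open>The cosine is a combination of the modes 1 and -1, so each further power only shifts the
  index \<open>k\<close>; hence the statement is proved for all \<open>k\<close> at once.\<close>

lemma trig_power_orthogonal:
  assumes f: "continuous_on UNIV f" and z: "\<And>k. integral {0..2} (\<lambda>x. f x * mode k x) = 0"
  shows "integral {0..2} (\<lambda>x. f x * of_real (((1 + cos (pi * (x - x0))) / 2) ^ n) * mode k x) = 0"
proof (induction n arbitrary: k)
  case 0 then show ?case using z by simp
next
  case (Suc n)
  let ?t = "\<lambda>x. (1 + cos (pi * (x - x0))) / 2"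
  let ?g = "\<lambda>k x. f x * of_real (?t x ^ n) * mode k x"
  have gi: "?g k integrable_on {0..2}" for k
    by (intro integrable_continuous_real continuous_intros continuous_on_subset[OF f]) auto
  have c: "of_real (cos (pi * (x - x0))) = (cis (- pi * x0) * mode 1 x + cis (pi * x0) * mode (-1) x) / 2" for x
  proof -
    have "complex_of_real (cos (pi * (x - x0))) = (cis (pi * (x - x0)) + cis (- (pi * (x - x0)))) / 2"
      by (simp add: complex_eq_iff)
    then show ?thesis by (simp add: mode_def cis_mult algebra_simps)
  qed
  have e: "f x * of_real (?t x ^ Suc n) * mode k x
     = (1/2) * ?g k x + (cis (- pi * x0) / 4) * ?g (k + 1) x + (cis (pi * x0) / 4) * ?g (k - 1) x" for x
  proof -
    have m: "mode (k + 1) x = mode k x * mode 1 x" "mode (k - 1) x = mode k x * mode (-1) x" by (simp_all add: mode_mult)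
    have "complex_of_real (?t x ^ Suc n) = of_real (?t x ^ n) * ((1 + of_real (cos (pi * (x - x0)))) / 2)"
      by simp
    then have "f x * of_real (?t x ^ Suc n) * mode k x = f x * (of_real (?t x ^ n) * ((1 + (cis (- pi * x0) * mode 1 x + cis (pi * x0) * mode (-1) x) / 2) / 2)) * mode k x"
      by (simp only: c)
    then show ?thesis unfolding m by (simp add: algebra_simps add_divide_distrib)
  qed
  show ?case unfolding e
    using has_integral_add[OF has_integral_add[OF has_integral_mult_right[OF integrable_integral[OF gi[of k]], of "1/2"]
      has_integral_mult_right[OF integrable_integral[OF gi[of "k+1"]], of "cis (- pi * x0) / 4"]]
      has_integral_mult_right[OF integrable_integral[OF gi[of "k-1"]], of "cis (pi * x0) / 4"]] Suc.IH
    by (intro integral_unique) simp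
qed

lemma cos_pi_abs: "cos (pi * \<bar>x\<bar>) = cos (pi * x)"
  by (cases "0 \<le> x") (auto simp: abs_if)

lemma cos_pi_le:
  assumes "0 \<le> d" "d \<le> \<bar>x\<bar>" "\<bar>x\<bar> \<le> 2 - d"
  shows "cos (pi * x) \<le> cos (pi * d)"
proof -
  have "cos (pi * x) = cos (pi * \<bar>x\<bar>)" by (simp add: cos_pi_abs)
  also have "\<dots> \<le> cos (pi * d)"
  proof (cases "\<bar>x\<bar> \<le> 1")
    case True
    then show ?thesis using assms by (intro cos_monotone_0_pi_le) (auto simp: mult_left_mono)
  next
    case False
    have "cos (pi * \<bar>x\<bar>) = cos (2 * pi - pi * \<bar>x\<bar>)" by (simp add: cos_diff)
    also have "\<dots> = cos (pi * (2 - \<bar>x\<bar>))" by (simp add: algebra_simps)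
    also have "\<dots> \<le> cos (pi * d)"
      using assms False by (intro cos_monotone_0_pi_le) (auto simp: mult_left_mono)
    finally show ?thesis .
  qed
  finally show ?thesis .
qed

text \<open>The powers of \<open>(1 + cos (\<pi> (x - x0))) / 2\<close> concentrate at \<open>x0\<close>.\<close>

lemma continuous_zero_coefficients:
  assumes f: "continuous_on UNIV f" and per: "\<And>x. f (x + 2) = f x"
    and z: "\<And>k. cf f k = 0"
  shows "f x = 0"
proof -
  have z': "integral {0..2} (\<lambda>x. f x * mode k x) = 0" for k using z[of "- k"] by (simp add: cf_def)
  have int: "f x0 = 0" if x0: "0 < x0" "x0 < 2" for x0
  proof (rule ccontr)
    assume c: "f x0 \<noteq> 0"
    \<comment> \<open>Multiplying by the conjugate of \<open>f x0\<close> reduces to a real function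
      that is positive at \<open>x0\<close>, so that signs can be compared.\<close>
    define h where "h x = Re (cnj (f x0) * f x)" for x
    have hc: "continuous_on UNIV h" unfolding h_def by (intro continuous_intros f)
    have h0: "0 < h x0" using c by (simp add: h_def complex_mult_cnj mult.commute[of "cnj _"] complex_eq_iff sum_power2_gt_zero_iff flip: power2_eq_square)
    then obtain d0 where d0: "0 < d0" "\<And>x. \<bar>x - x0\<bar> < d0 \<Longrightarrow> \<bar>h x - h x0\<bar> < h x0 / 2"
      using hc unfolding continuous_on_iff dist_real_def by (metis UNIV_I half_gt_zero)
    \<comment> \<open>Within \<open>d0\<close> the function \<open>h\<close> exceeds half its value
      at \<open>x0\<close>; \<open>d \<le> 1/2\<close> keeps the cosine at distance \<open>d\<close>
      nonnegative, so \<open>r > 0\<close>; the last two terms keep the interval inside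
      \<open>[0, 2]\<close>.\<close>
    define d where "d = min (d0 / 2) (min (1/2) (min x0 (2 - x0)))"
    have d: "0 < d" "d < d0" "d \<le> 1/2" "d \<le> x0" "d \<le> 2 - x0" using d0 x0 by (auto simp: d_def min_def)
    define t where "t x = (1 + cos (pi * (x - x0))) / 2" for x
    \<comment> \<open>The kernel is at most \<open>r\<close> outside distance \<open>d\<close> and
      at least \<open>s\<close> within distance \<open>d / 2\<close>. Between the two distances the
      integrand is nonnegative and is dropped.\<close>
    define r where "r = (1 + cos (pi * d)) / 2"
    define s where "s = (1 + cos (pi * (d / 2))) / 2"
    have t0: "0 \<le> t x" for x
    proof -
      have "0 \<le> 1 + cos (pi * (x - x0))" using cos_ge_minus_one[of "pi * (x - x0)"] by linarith
      then show ?thesis by (simp add: t_def)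
    qed
    have "cos (pi * d) < cos (pi * (d / 2))" using d by (intro cos_monotone_0_pi) (auto intro: order_trans[of _ "pi * 1"])
    moreover have "0 \<le> cos (pi * d)" using d by (intro cos_ge_zero) (auto simp: mult_left_mono[of d "1/2" pi, simplified] intro: order_trans[of _ 0])
    ultimately have rs: "0 < r" "r < s" by (auto simp: r_def s_def)
    have "bounded (h ` {0..2})" using hc by (intro compact_imp_bounded compact_continuous_image) (auto intro: continuous_on_subset)
    then obtain H where H: "\<And>x. x \<in> {0..2} \<Longrightarrow> \<bar>h x\<bar> \<le> H" unfolding bounded_iff real_norm_def by blast
    have H0: "0 \<le> H" using order_trans[OF abs_ge_zero H[of 0]] by simp
    let ?J = "{x0 - d/2 .. x0 + d/2}"
    \<comment> \<open>The peak contributes at least \<open>d * (h x0 / 2) * s ^ n\<close>,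
      everything else at least \<open>- 2 * H * r ^ n\<close>, and the total integral is 0. As
      \<open>s > r\<close>, this fails for large \<open>n\<close>.\<close>
    have key: "d * (h x0 / 2 * s ^ n) - 2 * (H * r ^ n) \<le> 0" for n
    proof -
      have tc: "continuous_on S t" for S unfolding t_def[abs_def] by (intro continuous_intros) auto
      have "((\<lambda>x. f x * of_real (t x ^ n) * mode 0 x) has_integral 0) {0..2}"
      proof -
        have gi: "(\<lambda>x. f x * of_real (t x ^ n) * mode 0 x) integrable_on {0..2}"
          by (intro integrable_continuous_real continuous_intros continuous_on_subset[OF f] tc) auto
        have "integral {0..2} (\<lambda>x. f x * of_real (t x ^ n) * mode 0 x) = 0"
          unfolding t_def by (rule trig_power_orthogonal[OF f z'])
        then show ?thesis using integrable_integral[OF gi] by simp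
      qed
      from has_integral_mult_right[OF this, of "cnj (f x0)"]
      have "((\<lambda>x. cnj (f x0) * (f x * of_real (t x ^ n))) has_integral 0) {0..2}"
        unfolding mode_0(1) mult_1_right mult_zero_right .
      from has_integral_Re[OF this]
      have *: "((\<lambda>x. Re (cnj (f x0) * (f x * of_real (t x ^ n)))) has_integral 0) {0..2}" by (simp only: zero_complex.simps)
      have 0: "((\<lambda>x. h x * t x ^ n) has_integral 0) {0..2}"
      proof -
        have "Re (w * (u * of_real y)) = Re (w * u) * y" for w u y by (simp add: algebra_simps)
        then show ?thesis using * by (simp only: h_def)
      qed
      have "((\<lambda>x. if x \<in> ?J then h x0 / 2 * s ^ n else 0) has_integral (d * (h x0 / 2 * s ^ n))) {0..2}"
      proof -
        have "((\<lambda>x. h x0 / 2 * s ^ n) has_integral (d * (h x0 / 2 * s ^ n))) ?J"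
          using has_integral_const_real[of "h x0 / 2 * s ^ n" "x0 - d/2" "x0 + d/2"] d by simp
        moreover have "?J \<subseteq> {0..2}" using d by auto
        ultimately show ?thesis by (simp only: has_integral_restrict)
      qed
      moreover have "((\<lambda>x. H * r ^ n) has_integral (2 * (H * r ^ n))) {0..2::real}"
        using has_integral_const_real[of "H * r ^ n" 0 "2::real"] by simp
      ultimately have "((\<lambda>x. (if x \<in> ?J then h x0 / 2 * s ^ n else 0) - H * r ^ n) has_integral (d * (h x0 / 2 * s ^ n) - 2 * (H * r ^ n))) {0..2}"
        by (rule has_integral_diff)
      then show ?thesis
      proof (rule has_integral_le[OF _ 0])
        fix x :: real assume x: "x \<in> {0..2}"
        show "(if x \<in> ?J then h x0 / 2 * s ^ n else 0) - H * r ^ n \<le> h x * t x ^ n"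
        proof (cases "\<bar>x - x0\<bar> < d")
          case True
          then have hx: "h x0 / 2 \<le> h x" using d0(2)[of x] d(2) by linarith
          have Hr: "0 \<le> H * r ^ n" using H0 rs by simp
          show ?thesis
          proof (cases "x \<in> ?J")
            case xJ: True
            have "cos (pi * (d / 2)) \<le> cos (pi * \<bar>x - x0\<bar>)"
              using xJ d by (intro cos_monotone_0_pi_le) (auto simp: abs_if intro!: mult_left_mono intro: order_trans[of _ "pi * 1"])
            also have "\<dots> = cos (pi * (x - x0))" by (rule cos_pi_abs)
            finally have "s \<le> t x" by (simp add: s_def t_def)
            then have "h x0 / 2 * s ^ n \<le> h x * t x ^ n" using hx h0 rs by (intro mult_mono power_mono) auto
            then show ?thesis unfolding if_P[OF xJ] using Hr by linarith
          next
            case False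
            have "0 \<le> h x * t x ^ n" using hx h0 t0 by simp
            then show ?thesis unfolding if_not_P[OF False] using Hr by linarith
          qed
        next
          case False
          have "cos (pi * (x - x0)) \<le> cos (pi * d)" by (rule cos_pi_le) (use False x d in auto)
          then have "t x ^ n \<le> r ^ n" using t0 by (intro power_mono) (auto simp: t_def r_def)
          then have "\<bar>h x\<bar> * t x ^ n \<le> H * r ^ n" using H[OF x] t0 H0 by (intro mult_mono) auto
          then have "\<bar>h x * t x ^ n\<bar> \<le> H * r ^ n" using t0[of x] by (simp add: abs_mult)
          then have "- (H * r ^ n) \<le> h x * t x ^ n" by linarith
          moreover have nJ: "x \<notin> ?J" using False d by (auto simp: abs_if split: if_splits)
          ultimately show ?thesis unfolding if_not_P[OF nJ] by linarith
        qed
      qed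
    qed
    have "(s / r) ^ n \<le> 4 * H / (d * h x0)" for n
    proof -
      have "s ^ n * (d * h x0) \<le> (4 * H) * r ^ n" using key[of n] by (simp add: algebra_simps)
      then show ?thesis using rs d h0 by (simp add: power_divide divide_simps mult_ac)
    qed
    moreover obtain n where "4 * H / (d * h x0) < (s / r) ^ n"
      using real_arch_pow[of "s / r" "4 * H / (d * h x0)"] rs by auto
    ultimately show False by (meson not_less)
  qed
  \<comment> \<open>The peak needs room on both sides of \<open>x0\<close>; the end points follow by
    continuity.\<close>
  have int0: "f y = 0" if "y \<in> {0..2}" for y
  proof (rule continuous_constant_on_closure[of "{0<..<2}" f 0])
    show "continuous_on (closure {0<..<2}) f" using f continuous_on_subset by blast
    show "y \<in> closure {0<..<2}" using that by simp
  qed (use int in auto)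
  have pern: "f (x + 2 * of_nat n) = f x" for x n
  proof (induction n)
    case (Suc n)
    have "f (x + 2 * real (Suc n)) = f ((x + 2 * real n) + 2)" by (simp add: algebra_simps)
    then show ?case using per Suc by simp
  qed simp
  define m where "m = \<lfloor>x / 2\<rfloor>"
  define y where "y = x - 2 * of_int m"
  have "of_int m \<le> x / 2" "x / 2 < of_int m + 1"
    unfolding m_def by (rule of_int_floor_le) (rule real_of_int_floor_add_one_gt)
  then have y: "y \<in> {0..2}" by (auto simp: y_def)
  have "f x = f y"
  proof (cases "0 \<le> m")
    case True
    then show ?thesis using pern[of y "nat m"] by (simp add: y_def)
  next
    case False
    then show ?thesis using pern[of x "nat (- m)"] by (simp add: y_def)
  qed
  then show ?thesis using int0[OF y] by simp
qed

definition synth :: "(int \<Rightarrow> complex) \<Rightarrow> real \<Rightarrow> complex" where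
  "synth a x = (\<Sum>\<^sub>\<infinity>k. a k * mode k x)"

lemma synth_summable: "decays a \<Longrightarrow> (\<lambda>k. a k * mode k x) summable_on UNIV"
  by (simp add: summable_on_iff_abs_summable_on_complex norm_mult decays_abs_summable)

lemma synth_uniform:
  assumes "decays a"
  shows "uniform_limit UNIV (\<lambda>F x. \<Sum>k\<in>F. a k * mode k x) (synth a) (finite_subsets_at_top UNIV)"
  unfolding synth_def
  by (rule Weierstrass_m_test_general[where M = "\<lambda>k. cmod (a k)"])
    (auto simp: norm_mult decays_abs_summable[OF assms])

lemma synth_continuous: "decays a \<Longrightarrow> continuous_on S (synth a)"
  by (rule continuous_on_subset[OF uniform_limit_theorem[OF _ synth_uniform]])
    (auto intro!: always_eventually continuous_intros)

lemma synth_periodic: "synth a (x + 2) = synth a x"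
  by (simp add: synth_def)

lemma synth_lin:
  assumes "decays a" "decays b"
  shows "synth (\<lambda>k. s * a k + t * b k) x = s * synth a x + t * synth b x"
proof -
  have "synth (\<lambda>k. s * a k + t * b k) x = (\<Sum>\<^sub>\<infinity>k. s * (a k * mode k x) + t * (b k * mode k x))"
    unfolding synth_def by (intro infsum_cong) (simp add: algebra_simps)
  also have "\<dots> = s * synth a x + t * synth b x"
    unfolding synth_def by (subst infsum_add)
      (auto intro!: summable_on_cmult_right synth_summable assms simp: infsum_cmult_right synth_summable assms)
  finally show ?thesis .
qed

lemma cf_one: "cf (\<lambda>_. 1) m = (if m = 0 then 1 else 0)"
  by (simp add: cf_def integral_mode)

lemma cf_sum:
  assumes "finite F" "\<And>j. j \<in> F \<Longrightarrow> locint (g j)"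
  shows "cf (\<lambda>x. \<Sum>j\<in>F. g j x) k = (\<Sum>j\<in>F. cf (g j) k)"
proof -
  have "integral {0..2} (\<lambda>x. \<Sum>j\<in>F. g j x * mode (- k) x) = (\<Sum>j\<in>F. integral {0..2} (\<lambda>x. g j x * mode (- k) x))"
    by (intro integral_sum assms cf_integrable)
  then show ?thesis by (simp add: cf_def sum_distrib_right sum_divide_distrib)
qed

lemma cf_mult_mode: "cf (\<lambda>x. \<phi> x * (c * mode j x)) k = c * cf \<phi> (k - j)"
proof -
  have "(\<lambda>x. \<phi> x * (c * mode j x) * mode (- k) x) = (\<lambda>x. c * (\<phi> x * mode (- (k - j)) x))"
    using mode_mult[of j _ "- k"] by (auto simp: fun_eq_iff mult_ac)
  then show ?thesis by (simp add: cf_def)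
qed

text \<open>The series of \<open>a\<close> converges uniformly and \<open>\<phi>\<close> is
  integrable, so the coefficients of the partial products converge; for a finite partial sum the
  identity is the shift \<open>cf_mult_mode\<close>.\<close>

lemma cf_mult_synth:
  assumes \<phi>: "locint \<phi>" and a: "decays a"
  shows "cf (\<lambda>x. \<phi> x * synth a x) k = conv (cf \<phi>) a k"
proof -
  let ?I = "integral {0..2} (\<lambda>x. cmod (\<phi> x))"
  let ?S = "\<lambda>F x. \<Sum>j\<in>F. a j * mode j x"
  have I0: "0 \<le> ?I" by (intro integral_nonneg locintD \<phi>) auto
  have lS: "locint (\<lambda>x. \<phi> x * synth a x)" by (intro locint_mult_cont \<phi> synth_continuous a)
  have lF: "locint (\<lambda>x. \<phi> x * ?S F x)" for F by (intro locint_mult_cont \<phi> continuous_intros)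
  have SF: "cf (\<lambda>x. \<phi> x * ?S F x) k = (\<Sum>j\<in>F. cf \<phi> (k - j) * a j)" if "finite F" for F
    unfolding sum_distrib_left
    by (subst cf_sum[OF that]) (auto simp: cf_mult_mode mult.commute intro!: locint_mult_cont \<phi> continuous_intros)
  have "((\<lambda>j. cf \<phi> (k - j) * a j) has_sum cf (\<lambda>x. \<phi> x * synth a x) k) UNIV"
    unfolding has_sum_def
  proof (rule tendstoI)
    fix e :: real assume e: "0 < e"
    have "\<forall>\<^sub>F F in finite_subsets_at_top UNIV. \<forall>x\<in>UNIV. dist (?S F x) (synth a x) < e / (?I + 1)"
      using synth_uniform[OF a] e I0 by (intro uniform_limitD) auto
    moreover have "\<forall>\<^sub>F F in finite_subsets_at_top (UNIV::int set). finite F"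
      by (simp add: eventually_finite_subsets_at_top_weakI)
    ultimately show "\<forall>\<^sub>F F in finite_subsets_at_top UNIV. dist (\<Sum>j\<in>F. cf \<phi> (k - j) * a j) (cf (\<lambda>x. \<phi> x * synth a x) k) < e"
    proof eventually_elim
      case (elim F)
      let ?d = "\<lambda>x. \<phi> x * ?S F x - \<phi> x * synth a x"
      have "(\<Sum>j\<in>F. cf \<phi> (k - j) * a j) - cf (\<lambda>x. \<phi> x * synth a x) k = cf ?d k"
        using cf_lin[OF lF lS, of 1 F "-1" k] SF[OF elim(2)] by simp
      also have "cmod \<dots> \<le> integral {0..2} (\<lambda>x. cmod (?d x))"
        by (intro cf_bound locint_diff lF lS)
      also have "\<dots> \<le> integral {0..2} (\<lambda>x. cmod (\<phi> x) * (e / (?I + 1)))"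
      proof (rule integral_le)
        show "(\<lambda>x. cmod (?d x)) integrable_on {0..2}" by (intro locintD locint_diff lF lS)
        show "(\<lambda>x. cmod (\<phi> x) * (e / (?I + 1))) integrable_on {0..2}"
          by (rule integrable_on_mult_left[OF locintD(3)[OF \<phi>]])
        fix x :: real
        have "?d x = \<phi> x * (?S F x - synth a x)" by (simp add: algebra_simps)
        then show "cmod (?d x) \<le> cmod (\<phi> x) * (e / (?I + 1))"
          using elim(1) unfolding dist_norm by (simp only: norm_mult) (intro mult_left_mono, auto intro: less_imp_le)
      qed
      also have "\<dots> = ?I * (e / (?I + 1))" by simp
      also have "\<dots> < e" using e I0 by (simp add: field_simps)
      finally show ?case by (simp add: dist_norm)
    qed
  qed
  then show ?thesis unfolding conv_def by (rule infsumI[symmetric])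
qed

lemma cf_synth:
  assumes "decays a" shows "cf (synth a) k = a k"
proof -
  have "cf (synth a) k = conv (cf (\<lambda>_. 1)) a k"
    using cf_mult_synth[of "\<lambda>_. 1" a k] assms by (simp add: locint_cont)
  also have "\<dots> = (\<Sum>\<^sub>\<infinity>j\<in>{k}. a j)"
    unfolding conv_def cf_one by (rule infsum_cong_neutral) auto
  finally show ?thesis by simp
qed

lemma synth_inj: "decays a \<Longrightarrow> decays b \<Longrightarrow> synth a = synth b \<Longrightarrow> a = b"
  by (metis cf_synth ext)

lemma continuous_eqI_cf:
  assumes "continuous_on UNIV f" "continuous_on UNIV g" "\<And>x. f (x + 2) = f x" "\<And>x. g (x + 2) = g x"
    and "\<And>k. cf f k = cf g k"
  shows "f = g"
proof
  fix x
  have "f x - g x = 0"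
  proof (rule continuous_zero_coefficients[of "\<lambda>x. f x - g x"])
    show "cf (\<lambda>x. f x - g x) k = 0" for k
      using cf_lin[OF locint_cont[OF assms(1)] locint_cont[OF assms(2)], of 1 "-1" k] assms(5) by simp
  qed (use assms in \<open>auto intro: continuous_intros\<close>)
  then show "f x = g x" by simp
qed

section \<open>Primitives of locally integrable functions\<close>

lemma primitive_exists:
  assumes "locint \<phi>" obtains G where "\<And>x y. x \<le> y \<Longrightarrow> (\<phi> has_integral (G y - G x)) {x..y}"
proof -
  define G where "G x = (if 0 \<le> x then integral {0..x} \<phi> else - integral {x..0} \<phi>)" for x
  have "G y - G x = integral {x..y} \<phi>" if "x \<le> y" for x y
    using Henstock_Kurzweil_Integration.integral_combine[of 0 x y \<phi>] Henstock_Kurzweil_Integration.integral_combine[of x 0 y \<phi>]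
      Henstock_Kurzweil_Integration.integral_combine[of x y 0 \<phi>] that locintD(2)[OF assms]
    by (auto simp: G_def algebra_simps)
  then have "(\<phi> has_integral (G y - G x)) {x..y}" if "x \<le> y" for x y
    using integrable_integral[OF locintD(2)[OF assms, of x y]] that by simp
  then show ?thesis using that by blast
qed

lemma primitive_continuous:
  assumes \<phi>: "locint \<phi>" and G: "\<And>x y. x \<le> y \<Longrightarrow> (\<phi> has_integral (G y - G x)) {x..y}"
  shows "continuous_on UNIV G"
proof (rule continuous_at_imp_continuous_on, intro ballI)
  fix x0 :: real
  let ?J = "{x0 - 1..x0 + 1}"
  have "G x = G (x0 - 1) + integral {x0 - 1..x} \<phi>" if "x \<in> ?J" for x
    using integral_unique[OF G[of "x0 - 1" x]] that by simp
  moreover have "continuous_on ?J (\<lambda>x. G (x0 - 1) + integral {x0 - 1..x} \<phi>)"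
    by (intro continuous_intros indefinite_integral_continuous_1 locintD(2)[OF \<phi>])
  ultimately have "continuous_on ?J G" using continuous_on_cong by (metis (no_types, lifting))
  then show "isCont G x0" by (rule continuous_on_interior) simp
qed

lemma primitive_derivative:
  fixes \<phi> :: "real \<Rightarrow> complex"
  assumes \<phi>: "continuous_on UNIV \<phi>" and G: "\<And>x y. x \<le> y \<Longrightarrow> (\<phi> has_integral (G y - G x)) {x..y}"
  shows "(G has_vector_derivative \<phi> x) (at x)"
proof -
  let ?J = "{x - 1..x + 1}"
  have "((\<lambda>u. integral {x - 1..u} \<phi>) has_vector_derivative \<phi> x) (at x within ?J)"
    by (rule Henstock_Kurzweil_Integration.integral_has_vector_derivative) (auto intro: continuous_on_subset[OF \<phi>])
  then have "((\<lambda>u. G (x - 1) + integral {x - 1..u} \<phi>) has_vector_derivative \<phi> x) (at x within ?J)"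
    using has_vector_derivative_add[OF has_vector_derivative_const] by fastforce
  then have "(G has_vector_derivative \<phi> x) (at x within ?J)"
    by (rule has_vector_derivative_transform[rotated 2]) (use integral_unique[OF G] in auto)
  then show ?thesis using at_within_interior[of x ?J] by simp
qed

lemma primitive_periodic:
  assumes \<phi>: "locint \<phi>" and G: "\<And>x y. x \<le> y \<Longrightarrow> (\<phi> has_integral (G y - G x)) {x..y}"
    and per: "\<And>x. \<phi> (x + 2) = \<phi> x" and z: "integral {0..2} \<phi> = 0"
  shows "G (x + 2) = G x"
proof -
  have *: "G (y + 2) - G (x + 2) = G y - G x" if "x \<le> y" for x y
  proof -
    have "G (y + 2) - G (x + 2) = integral {x + 2..y + 2} \<phi>" using integral_unique[OF G[of "x + 2" "y + 2"]] that by simp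
    also have "\<dots> = integral {x..y} (\<phi> \<circ> (+) 2)" by (rule integral_shift_Icc_real[symmetric])
    also have "\<phi> \<circ> (+) 2 = \<phi>" using per by (auto simp: fun_eq_iff add.commute)
    also have "integral {x..y} \<phi> = G y - G x" using integral_unique[OF G[OF that]] .
    finally show ?thesis .
  qed
  have "G 2 = G 0" using integral_unique[OF G[of 0 2]] z by simp
  then show ?thesis using *[of 0 x] *[of x 0] by (cases "0 \<le> x") (auto simp: algebra_simps)
qed

lemma cf_AE:
  assumes "AE x in lebesgue. f x = g x" shows "cf f k = cf g k"
proof -
  obtain N where N: "negligible N" "{x. \<not> f x = g x} \<subseteq> N"
    using assms unfolding eventually_ae_filter_negligible by blast
  have "integral {0..2} (\<lambda>x. f x * mode (- k) x) = integral {0..2} (\<lambda>x. g x * mode (- k) x)"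
  proof (rule integral_spike[OF N(1)])
    fix x assume "x \<in> {0..2} - N"
    then have "f x = g x" using N(2) by blast
    then show "g x * mode (- k) x = f x * mode (- k) x" by simp
  qed
  then show ?thesis by (simp add: cf_def)
qed

lemma period_shift:
  assumes "\<And>x. q (x + 1) = q x" shows "q (x + real n) = q x"
  using assms by (induction n) (auto simp: algebra_simps, metis add.assoc add.commute)

lemma L2_square_integrable:
  assumes "q \<in> L2" shows "(\<lambda>x. (cmod (q x))\<^sup>2) integrable_on {a..b}"
proof -
  let ?g = "\<lambda>x. (cmod (q x))\<^sup>2"
  have per: "q (x + 1) = q x" for x using assms by (simp add: L2_def)
  have base: "?g integrable_on {0..1}" using assms unfolding L2_def by (auto intro: set_lebesgue_integral_eq_integral(1))
  have sh: "?g integrable_on {u + real n..v + real n} \<longleftrightarrow> ?g integrable_on {u..v}" for u v n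
  proof -
    have "?g \<circ> (+) (real n) = ?g" using period_shift[of q, OF per] by (auto simp: fun_eq_iff add.commute)
    then show ?thesis using has_integral_shift_Icc_real[of ?g "real n" _ u v] unfolding integrable_on_def by simp
  qed
  have up: "?g integrable_on {0..real n}" for n
  proof (induction n)
    case (Suc n)
    have "?g integrable_on {real n..real (Suc n)}" using sh[of 0 n 1] base by (simp add: add.commute)
    then show ?case using Henstock_Kurzweil_Integration.integrable_combine[of 0 "real n" "real (Suc n)" ?g] Suc by simp
  next
    case 0 show ?case using integrable_on_refl[of ?g "0::real"] by simp
  qed
  obtain n :: nat where n: "\<bar>a\<bar> \<le> real n" "\<bar>b\<bar> \<le> real n"
    using real_arch_simple[of "max \<bar>a\<bar> \<bar>b\<bar>"] by auto
  have "?g integrable_on {- real n..real n}" using sh[of "- real n" n "real n"] up[of "2 * n"] by simp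
  then show ?thesis by (rule integrable_on_subinterval) (use n in auto)
qed

lemma L2_locint: "q \<in> L2 \<Longrightarrow> locint q"
  by (rule locint_square[OF _ L2_square_integrable]) (auto simp: L2_def)

lemma cf_decays:
  assumes "continuous_on UNIV f" "locint \<phi>" "\<And>k. cf \<phi> k = - of_real (pi\<^sup>2 * (real_of_int k)\<^sup>2) * cf f k"
  shows "decays (cf f)"
proof -
  let ?I = "integral {0..2} (\<lambda>x. cmod (\<phi> x))"
  let ?J = "integral {0..2} (\<lambda>x. cmod (f x))"
  have "(1 + (real_of_int k)\<^sup>2) * cmod (cf f k) \<le> ?J + ?I" for k
  proof -
    have "pi\<^sup>2 * (real_of_int k)\<^sup>2 * cmod (cf f k) = cmod (cf \<phi> k)" unfolding assms(3) by (simp add: norm_mult norm_power)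
    also have "\<dots> \<le> ?I" by (rule cf_bound[OF assms(2)])
    finally have "pi\<^sup>2 * ((real_of_int k)\<^sup>2 * cmod (cf f k)) \<le> ?I" by (simp add: mult.assoc)
    moreover have "1 * ((real_of_int k)\<^sup>2 * cmod (cf f k)) \<le> pi\<^sup>2 * ((real_of_int k)\<^sup>2 * cmod (cf f k))"
      using pi_squared_ge by (intro mult_right_mono) auto
    moreover have "cmod (cf f k) \<le> ?J" by (rule cf_bound[OF locint_cont[OF assms(1)]])
    ultimately show ?thesis by (simp add: algebra_simps)
  qed
  then show ?thesis unfolding decays_def by blast
qed

lemma ik_square:
  "\<i> * of_real (pi * real_of_int k) * (\<i> * of_real (pi * real_of_int k) * w) = - of_real (pi\<^sup>2 * (real_of_int k)\<^sup>2) * w"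
proof -
  have "\<i> * c * (\<i> * c * w) = (\<i> * \<i>) * (c * c) * w" for c by (simp only: mult_ac)
  then show ?thesis by (simp add: power2_eq_square)
qed

text \<open>Two integrations by parts turn the second derivative into the factor
  \<open>- \<pi>\<^sup>2 k\<^sup>2\<close>. As the coefficients of an integrable function are
  bounded, those of \<open>f\<close> decay, so the continuous \<open>f\<close> is the sum of its
  series and \<open>q * f\<close> becomes a convolution. The term \<open>b\<close> lets chains of
  root vectors be followed.\<close>

lemma hill_op_imp_seq:
  assumes q: "q \<in> L2" and b: "decays b" and h: "hill_op q f (\<lambda>x. z * f x + synth b x)"
  shows "decays (cf f)" "f = synth (cf f)" "hill_seq (cf q) (cf f) k = z * cf f k + b k"
proof -
  obtain f' f'' where per: "\<And>x. f (x + 2) = f x"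
    and f': "\<And>x. (f has_vector_derivative f' x) (at x)" and m: "f'' \<in> borel_measurable lebesgue"
    and sq: "\<And>a b. set_integrable lebesgue {a..b} (\<lambda>x. (cmod (f'' x))\<^sup>2)"
    and f'': "\<And>a b. a \<le> b \<Longrightarrow> (f'' has_integral (f' b - f' a)) {a..b}"
    and ae: "AE x in lebesgue. z * f x + synth b x = - f'' x + q x * f x"
    using h unfolding hill_op_def by auto
  have l'': "locint f''" by (rule locint_square[OF m]) (auto intro: set_lebesgue_integral_eq_integral(1) sq)
  have c: "continuous_on UNIV f" using f' by (meson continuous_at_imp_continuous_on has_vector_derivative_continuous)
  have c': "continuous_on UNIV f'" by (rule primitive_continuous[OF l'' f''])
  have int': "(f' has_integral (f y - f x)) {x..y}" if "x \<le> y" for x y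
    by (rule fundamental_theorem_of_calculus[OF that]) (auto intro: has_vector_derivative_at_within f')
  have per': "f' (x + 2) = f' x" for x
  proof -
    have "((f \<circ> (\<lambda>x. x + 2)) has_vector_derivative (1 *\<^sub>R f' (x + 2))) (at x)"
      by (rule vector_diff_chain_at) (auto intro!: derivative_eq_intros f')
    moreover have "f \<circ> (\<lambda>x. x + 2) = f" using per by auto
    ultimately show ?thesis using f' vector_derivative_unique_at by (metis scaleR_one)
  qed
  have per0: "f 2 = f 0" "f' 2 = f' 0" using per[of 0] per'[of 0] by auto
  have ck: "cf f'' k = - of_real (pi\<^sup>2 * (real_of_int k)\<^sup>2) * cf f k" for k
  proof -
    have "cf f'' k = \<i> * of_real (pi * real_of_int k) * cf f' k" by (rule cf_primitive[OF l'' f'' per0(2)])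
    also have "cf f' k = \<i> * of_real (pi * real_of_int k) * cf f k" by (rule cf_primitive[OF locint_cont[OF c'] int' per0(1)])
    finally show ?thesis unfolding ik_square .
  qed
  show d: "decays (cf f)" by (rule cf_decays[OF c l'' ck])
  show s: "f = synth (cf f)"
    by (rule continuous_eqI_cf[OF c synth_continuous[OF d] per]) (auto simp: cf_synth[OF d] synth_periodic)
  have lq: "locint q" by (rule L2_locint[OF q])
  have "cf (\<lambda>x. z * f x + 1 * synth b x) k = cf (\<lambda>x. (-1) * f'' x + 1 * (q x * f x)) k"
    by (rule cf_AE) (use ae in auto)
  then have "z * cf f k + b k = - cf f'' k + cf (\<lambda>x. q x * f x) k"
    unfolding cf_lin[OF locint_cont[OF c] locint_cont[OF synth_continuous[OF b]]]
      cf_lin[OF l'' locint_mult_cont[OF lq c]] by (simp add: cf_synth[OF b])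
  moreover have "cf (\<lambda>x. q x * f x) k = conv (cf q) (cf f) k"
    using cf_mult_synth[OF lq d, of k] s by metis
  ultimately show "hill_seq (cf q) (cf f) k = z * cf f k + b k"
    by (simp add: hill_seq_def ck)
qed

text \<open>The candidate \<open>\<phi>\<close> for the second derivative is read off the equation
  and integrated twice. The result has the same coefficients as \<open>synth a\<close>, hence is
  equal to it, and so \<open>synth a\<close> has the required derivatives.\<close>

lemma seq_imp_hill_op:
  assumes q: "q \<in> L2" and a: "decays a" and b: "decays b"
    and eq: "\<And>k. hill_seq (cf q) a k = z * a k + b k"
  shows "hill_op q (synth a) (\<lambda>x. z * synth a x + synth b x)"
proof -
  let ?f = "synth a"
  have lq: "locint q" by (rule L2_locint[OF q])
  have perq: "q (x + 2) = q x" for x using period_shift[of q x 2] q by (simp add: L2_def)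
  have ca: "continuous_on S ?f" and cb: "continuous_on S (synth b)" for S by (intro synth_continuous a b)+
  define \<phi> where "\<phi> x = q x * ?f x - (z * ?f x + synth b x)" for x
  have czb: "continuous_on UNIV (\<lambda>x. z * ?f x + synth b x)" by (intro continuous_intros ca cb)
  have l\<phi>: "locint \<phi>" unfolding \<phi>_def[abs_def]
    by (rule locint_diff[OF locint_mult_cont[OF lq ca] locint_cont[OF czb]])
  have per\<phi>: "\<phi> (x + 2) = \<phi> x" for x by (simp add: \<phi>_def perq synth_periodic)
  have c\<phi>: "cf \<phi> k = - of_real (pi\<^sup>2 * (real_of_int k)\<^sup>2) * a k" for k
  proof -
    have "cf (\<lambda>x. z * ?f x + 1 * synth b x) k = z * a k + 1 * b k"
      by (subst cf_lin) (auto simp: cf_synth a b intro: locint_cont ca cb)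
    moreover have "cf (\<lambda>x. 1 * (q x * ?f x) + (-1) * (z * ?f x + 1 * synth b x)) k
       = 1 * cf (\<lambda>x. q x * ?f x) k + (-1) * cf (\<lambda>x. z * ?f x + 1 * synth b x) k"
      by (rule cf_lin[OF locint_mult_cont[OF lq ca]]) (use locint_cont[OF czb] in simp)
    moreover have "\<phi> = (\<lambda>x. 1 * (q x * ?f x) + (-1) * (z * ?f x + 1 * synth b x))" by (simp add: \<phi>_def fun_eq_iff)
    ultimately have "cf \<phi> k = conv (cf q) a k - (z * a k + b k)" by (simp add: cf_mult_synth[OF lq a])
    moreover have "conv (cf q) a k = z * a k + b k - of_real (pi\<^sup>2 * (real_of_int k)\<^sup>2) * a k"
      using eq[of k] unfolding hill_seq_def by (simp add: eq_diff_eq add.commute)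
    ultimately show ?thesis by simp
  qed
  obtain G0 where G0: "\<And>x y. x \<le> y \<Longrightarrow> (\<phi> has_integral (G0 y - G0 x)) {x..y}" using primitive_exists[OF l\<phi>] by blast
  \<comment> \<open>\<open>cf G0 0\<close> is the mean of \<open>G0\<close> over a period; a
    primitive of \<open>G\<close> is periodic only if the mean of \<open>G\<close> vanishes.\<close>
  define G where "G x = G0 x - cf G0 0" for x
  have G: "(\<phi> has_integral (G y - G x)) {x..y}" if "x \<le> y" for x y using G0[OF that] by (simp add: G_def)
  have cG0: "continuous_on UNIV G0" by (rule primitive_continuous[OF l\<phi> G0])
  have cG: "continuous_on UNIV G" by (rule primitive_continuous[OF l\<phi> G])
  have "integral {0..2} \<phi> = 0" using c\<phi>[of 0] by (simp add: cf_def)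
  note perG = primitive_periodic[OF l\<phi> G per\<phi> this]
  have "integral {0..2} G = integral {0..2} G0 - 2 * cf G0 0"
    unfolding G_def[abs_def] by (subst integral_diff) (auto intro: integrable_continuous_real continuous_on_subset[OF cG0] simp: scaleR_conv_of_real)
  then have zG: "integral {0..2} G = 0" by (simp add: cf_def)
  obtain H0 where H0: "\<And>x y. x \<le> y \<Longrightarrow> (G has_integral (H0 y - H0 x)) {x..y}" using primitive_exists[OF locint_cont[OF cG]] by blast
  \<comment> \<open>The relation with \<open>\<phi>\<close> carries the factor
    \<open>k\<^sup>2\<close> and says nothing about the coefficient 0, which the free constant now
    adjusts.\<close>
  define H where "H x = H0 x + (a 0 - cf H0 0)" for x
  have H: "(G has_integral (H y - H x)) {x..y}" if "x \<le> y" for x y using H0[OF that] by (simp add: H_def)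
  have cH0: "continuous_on UNIV H0" by (rule primitive_continuous[OF locint_cont[OF cG] H0])
  have cH: "continuous_on UNIV H" by (rule primitive_continuous[OF locint_cont[OF cG] H])
  note perH = primitive_periodic[OF locint_cont[OF cG] H perG zG]
  have cfH: "cf H k = a k" for k
  proof (cases "k = 0")
    case True
    have "integral {0..2} H = integral {0..2} H0 + 2 * (a 0 - cf H0 0)"
      unfolding H_def[abs_def] by (subst integral_add) (auto intro: integrable_continuous_real continuous_on_subset[OF cH0] simp: scaleR_conv_of_real)
    then show ?thesis using True by (simp add: cf_def)
  next
    case False
    have "G 2 = G 0" "H 2 = H 0" using perG[of 0] perH[of 0] by auto
    have "cf \<phi> k = \<i> * of_real (pi * real_of_int k) * cf G k" by (rule cf_primitive[OF l\<phi> G \<open>G 2 = G 0\<close>])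
    also have "cf G k = \<i> * of_real (pi * real_of_int k) * cf H k" by (rule cf_primitive[OF locint_cont[OF cG] H \<open>H 2 = H 0\<close>])
    finally have "cf \<phi> k = - of_real (pi\<^sup>2 * (real_of_int k)\<^sup>2) * cf H k" unfolding ik_square .
    then show ?thesis using False by (simp add: c\<phi>)
  qed
  have Hf: "H = ?f"
    by (rule continuous_eqI_cf[OF cH ca perH]) (auto simp: cfH cf_synth[OF a] synth_periodic)
  have qm: "q \<in> borel_measurable lebesgue" using q by (simp add: L2_def)
  have cm: "g \<in> borel_measurable lebesgue" if "continuous_on UNIV g" for g :: "real \<Rightarrow> complex"
    using continuous_imp_measurable_on_sets_lebesgue[OF that] by simp
  have m\<phi>: "\<phi> \<in> borel_measurable lebesgue"
    unfolding \<phi>_def[abs_def] by (intro borel_measurable_diff borel_measurable_times qm cm ca czb)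
  have sq: "set_integrable lebesgue {u..v} (\<lambda>x. (cmod (\<phi> x))\<^sup>2)" for u v
  proof -
    have "bounded (?f ` {u..v})" "bounded ((\<lambda>x. z * ?f x + synth b x) ` {u..v})"
      by (intro compact_imp_bounded compact_continuous_image continuous_on_subset[OF czb] ca; simp)+
    then obtain A B where A: "\<And>x. x \<in> {u..v} \<Longrightarrow> cmod (?f x) \<le> A"
      and B: "\<And>x. x \<in> {u..v} \<Longrightarrow> cmod (z * ?f x + synth b x) \<le> B"
      unfolding bounded_iff by blast
    show ?thesis
    proof (rule measurable_bounded_by_integrable_imp_absolutely_integrable)
      show "(\<lambda>x. (cmod (\<phi> x))\<^sup>2) \<in> borel_measurable (lebesgue_on {u..v})"
        by (rule measurable_restrict_space1) (use m\<phi> in measurable)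
      have i: "(\<lambda>x. (2 * A\<^sup>2) *\<^sub>R (cmod (q x))\<^sup>2) integrable_on {u..v}"
        by (intro integrable_cmul L2_square_integrable q)
      show "(\<lambda>x. (2 * A\<^sup>2) *\<^sub>R (cmod (q x))\<^sup>2 + 2 * B\<^sup>2) integrable_on {u..v}"
        by (intro integrable_add i) auto
      fix x assume x: "x \<in> {u..v}"
      have "cmod (\<phi> x) \<le> cmod (q x) * A + B"
        unfolding \<phi>_def using A[OF x] B[OF x]
        by (intro order_trans[OF norm_triangle_ineq4] add_mono) (auto simp: norm_mult mult_left_mono)
      then have "(cmod (\<phi> x))\<^sup>2 \<le> (cmod (q x) * A + B)\<^sup>2" by (intro power_mono) auto
      also have "\<dots> \<le> 2 * (cmod (q x) * A)\<^sup>2 + 2 * B\<^sup>2"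
        using zero_le_power2[of "cmod (q x) * A - B"] by (simp add: power2_sum power2_diff)
      finally show "norm ((cmod (\<phi> x))\<^sup>2) \<le> (2 * A\<^sup>2) *\<^sub>R (cmod (q x))\<^sup>2 + 2 * B\<^sup>2"
        by (simp add: power_mult_distrib mult_ac)
    qed auto
  qed
  show ?thesis unfolding hill_op_def
  proof (rule conjI, (rule allI, rule synth_periodic), rule exI[of _ G], rule exI[of _ \<phi>], intro conjI allI impI)
    show "(?f has_vector_derivative G x) (at x)" for x using primitive_derivative[OF cG H] by (simp add: Hf)
    show "AE x in lebesgue. z * ?f x + synth b x = - \<phi> x + q x * ?f x" by (simp add: \<phi>_def)
  qed (use m\<phi> sq G in auto)
qed

text \<open>Moving \<open>x\<close> by 1 fixes the even modes and changes the sign of the odd ones,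
  so on a 1-periodic function the two halves of \<open>[0, 2]\<close> agree in the even case and
  cancel in the odd case.\<close>

lemma cf_fourier:
  assumes q: "q \<in> L2"
  shows "cf q (2 * m) = fourier q m" "cf q (2 * m + 1) = 0"
proof -
  have lq: "locint q" by (rule L2_locint[OF q])
  have per: "q (x + 1) = q x" for x using q by (simp add: L2_def)
  have mper: "mode (- (2 * m)) (x + 1) = mode (- (2 * m)) x" "mode (- (2 * m + 1)) (x + 1) = - mode (- (2 * m + 1)) x" for x m
  proof -
    have "mode (- (2 * m)) (x + 1) = mode (- (2 * m)) x * cis (2 * pi * real_of_int (- m))"
      by (simp add: mode_def cis_mult algebra_simps)
    then show 1: "mode (- (2 * m)) (x + 1) = mode (- (2 * m)) x" using cis_multiple_2pi[of "real_of_int (- m)"] by simp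
    have "mode (- (2 * m + 1)) (x + 1) = mode (- (2 * m)) (x + 1) * mode (- 1) (x + 1)" by (simp add: mode_mult)
    also have "mode (- 1) (x + 1) = - mode (- 1) x"
    proof -
      have "mode (- 1) (x + 1) = cis (- (pi * x)) * cis (- pi)" by (simp add: mode_def cis_mult algebra_simps)
      then show ?thesis by (simp add: mode_def complex_eq_iff)
    qed
    finally show "mode (- (2 * m + 1)) (x + 1) = - mode (- (2 * m + 1)) x" unfolding 1 using mode_mult[of "- (2 * m)" x "-1"] by simp
  qed
  have split: "integral {0..2} (\<lambda>x. q x * mode j x) = integral {0..1} (\<lambda>x. q x * mode j x) + integral {0..1} (\<lambda>x. q x * mode j (x + 1))" for j
  proof -
    have "integral {0..2} (\<lambda>x. q x * mode j x) = integral {0..1} (\<lambda>x. q x * mode j x) + integral {1..2} (\<lambda>x. q x * mode j x)"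
      by (rule Henstock_Kurzweil_Integration.integral_combine[symmetric]) (auto intro: cf_integrable lq)
    also have "integral {1..2} (\<lambda>x. q x * mode j x) = integral {0..1} ((\<lambda>x. q x * mode j x) \<circ> (+) 1)"
      using integral_shift_Icc_real[of 0 1 "\<lambda>x. q x * mode j x" 1] by simp
    also have "(\<lambda>x. q x * mode j x) \<circ> (+) 1 = (\<lambda>x. q x * mode j (x + 1))" using per by (auto simp: fun_eq_iff add.commute)
    finally show ?thesis .
  qed
  have "fourier q m = integral {0..1} (\<lambda>x. q x * mode (- (2 * m)) x)"
  proof -
    have "set_integrable lebesgue {0..1} (\<lambda>x. q x * mode (- (2 * m)) x)"
      by (rule locintD(1)[OF locint_mult_cont[OF lq]]) (intro continuous_intros)
    from set_lebesgue_integral_eq_integral(2)[OF this] show ?thesis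
      unfolding fourier_def mode_def by (simp add: mult_ac)
  qed
  then show "cf q (2 * m) = fourier q m" unfolding cf_def split mper by simp
  show "cf q (2 * m + 1) = 0" unfolding cf_def split mper by simp
qed

section \<open>Root spaces in finite dimension\<close>

locale complex_vector_space = vector_space scale
  for scale :: "complex \<Rightarrow> 'b::ab_group_add \<Rightarrow> 'b" (infixr "*c" 75)
begin

definition fin_dim :: "'b set \<Rightarrow> bool" where
  "fin_dim E \<longleftrightarrow> (\<exists>B. finite B \<and> E \<subseteq> span B)"

text \<open>Linearity is demanded on \<open>E\<close> only. The operator to which this applies is a
  total map on functions that behaves linearly just on the invariant space.\<close>

definition endo :: "'b set \<Rightarrow> ('b \<Rightarrow> 'b) \<Rightarrow> bool" where
  "endo E T \<longleftrightarrow> subspace E \<and> fin_dim E \<and> (\<forall>x\<in>E. T x \<in> E) \<and>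
     (\<forall>x\<in>E. \<forall>y\<in>E. T (x + y) = T x + T y) \<and> (\<forall>c. \<forall>x\<in>E. T (c *c x) = c *c T x)"

definition root_space :: "'b set \<Rightarrow> ('b \<Rightarrow> 'b) \<Rightarrow> complex \<Rightarrow> 'b set" where
  "root_space E T z = {x\<in>E. \<exists>k. ((\<lambda>x. T x - z *c x) ^^ k) x = 0}"

lemma fin_dim_basis:
  assumes "fin_dim U"
  obtains B where "finite B" "B \<subseteq> U" "independent B" "U \<subseteq> span B" "card B = dim U"
proof -
  obtain B where B: "B \<subseteq> U" "independent B" "U \<subseteq> span B" "card B = dim U" using basis_exists by blast
  moreover have "finite B" using assms B(1,2) independent_span_bound[of _ B] unfolding fin_dim_def by blast
  ultimately show ?thesis using that by blast
qed

lemma fin_dim_subset: "fin_dim E \<Longrightarrow> U \<subseteq> E \<Longrightarrow> fin_dim U"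
  unfolding fin_dim_def by blast

lemma independent_card_le:
  assumes "fin_dim E" "B \<subseteq> E" "independent B" shows "finite B \<and> card B \<le> dim E"
proof -
  obtain C where C: "finite C" "E \<subseteq> span C" "card C = dim E" using fin_dim_basis[OF assms(1)] by metis
  then show ?thesis using independent_span_bound[OF C(1) assms(3)] assms(2) by auto
qed

lemma dim_mono_fin:
  assumes "fin_dim E" "U \<subseteq> E" shows "dim U \<le> dim E"
proof -
  obtain B where "B \<subseteq> U" "independent B" "card B = dim U" using fin_dim_basis[OF fin_dim_subset[OF assms]] by metis
  then show ?thesis using independent_card_le[OF assms(1), of B] assms(2) by auto
qed

lemma dim_eq_subspace:
  assumes "fin_dim E" "subspace U" "U \<subseteq> E" "dim E \<le> dim U" shows "U = E"
proof (rule ccontr)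
  assume "U \<noteq> E"
  then obtain x where x: "x \<in> E" "x \<notin> U" using assms(3) by blast
  obtain B where B: "finite B" "B \<subseteq> U" "independent B" "U \<subseteq> span B" "card B = dim U"
    using fin_dim_basis[OF fin_dim_subset[OF assms(1,3)]] by metis
  have "span B \<subseteq> U" using B(2) assms(2) by (rule span_minimal)
  then have "x \<notin> span B" using x by blast
  then have "independent (insert x B)" "x \<notin> B" using B(3) span_base independent_insertI by blast+
  then have "card (insert x B) \<le> dim E" using independent_card_le[OF assms(1), of "insert x B"] x B assms(3) by blast
  then show False using B \<open>x \<notin> B\<close> assms(4) by simp
qed

lemma endoD:
  assumes "endo E T"
  shows "subspace E" "fin_dim E" "\<And>x. x \<in> E \<Longrightarrow> T x \<in> E" "\<And>x y. x \<in> E \<Longrightarrow> y \<in> E \<Longrightarrow> T (x + y) = T x + T y"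
    "\<And>c x. x \<in> E \<Longrightarrow> T (c *c x) = c *c T x" "T 0 = 0" "\<And>x y. x \<in> E \<Longrightarrow> y \<in> E \<Longrightarrow> T (x - y) = T x - T y"
proof -
  show 1: "subspace E" "fin_dim E" "\<And>x. x \<in> E \<Longrightarrow> T x \<in> E" "\<And>x y. x \<in> E \<Longrightarrow> y \<in> E \<Longrightarrow> T (x + y) = T x + T y"
    "\<And>c x. x \<in> E \<Longrightarrow> T (c *c x) = c *c T x" using assms by (auto simp: endo_def)
  show "T 0 = 0" using 1(5)[of 0 0] subspace_0[OF 1(1)] by simp
  show "T (x - y) = T x - T y" if "x \<in> E" "y \<in> E" for x y
    using 1(4)[of "x - y" y] subspace_diff[OF 1(1) that] that by simp
qed

lemma endo_shift:
  assumes "endo E T" shows "endo E (\<lambda>x. T x - z *c x)"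
  unfolding endo_def
proof (intro conjI ballI allI)
  note D = endoD[OF assms]
  show "subspace E" "fin_dim E" by (rule D)+
  show "T x - z *c x \<in> E" if "x \<in> E" for x using D(1,3) that by (intro subspace_diff subspace_scale) auto
  show "T (x + y) - z *c (x + y) = T x - z *c x + (T y - z *c y)" if "x \<in> E" "y \<in> E" for x y
    using D(4)[OF that] by (simp add: scale_right_distrib)
  show "T (c *c x) - z *c c *c x = c *c (T x - z *c x)" if "x \<in> E" for c x
    using D(5)[OF that] by (simp add: scale_right_diff_distrib mult.commute)
qed

lemma endo_pow:
  assumes "endo E T" shows "endo E (T ^^ k)"
proof (induction k)
  case 0 then show ?case using endoD(1,2)[OF assms] by (simp add: endo_def)
next
  case (Suc k)
  then show ?case using endoD[OF assms] unfolding endo_def by simp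
qed

lemma endo_subset:
  assumes "endo E T" "subspace U" "U \<subseteq> E" "\<And>x. x \<in> U \<Longrightarrow> T x \<in> U"
  shows "endo U T"
  using assms fin_dim_subset[OF endoD(2)[OF assms(1)] assms(3)] unfolding endo_def by blast

lemma endo_image_subspace:
  assumes "endo E T" and U: "subspace U" "U \<subseteq> E" shows "subspace (T ` U)"
proof (rule subspaceI)
  note D = endoD[OF assms(1)]
  show "0 \<in> T ` U" using D(6) subspace_0[OF U(1)] by force
  show "x + y \<in> T ` U" if xy: "x \<in> T ` U" "y \<in> T ` U" for x y
  proof -
    obtain u v where uv: "u \<in> U" "x = T u" "v \<in> U" "y = T v" using xy by blast
    then have "x + y = T (u + v)" using D(4)[OF subsetD[OF U(2)] subsetD[OF U(2)], of u v] by simp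
    then show ?thesis using subspace_add[OF U(1) uv(1,3)] by blast
  qed
  show "c *c x \<in> T ` U" if x: "x \<in> T ` U" for c x
  proof -
    obtain u where u: "u \<in> U" "x = T u" using x by blast
    then have "c *c x = T (c *c u)" using D(5)[OF subsetD[OF U(2)], of u c] by simp
    then show ?thesis using subspace_scale[OF U(1) u(1)] by blast
  qed
qed

lemma endo_kernel_subspace:
  assumes "endo E T" shows "subspace {x\<in>E. T x = 0}"
  by (rule subspaceI) (use endoD[OF assms] subspace_0 subspace_add subspace_scale in auto)

text \<open>Preimages of a basis of the image span all of \<open>I\<close> by injectivity, so the
  dimension of \<open>I\<close> is at most that of its image.\<close>

lemma endo_inj_surj:
  assumes T: "endo I T" and inj: "\<And>x. x \<in> I \<Longrightarrow> T x = 0 \<Longrightarrow> x = 0"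
  shows "T ` I = I"
proof (rule dim_eq_subspace[OF endoD(2)[OF T] endo_image_subspace[OF T endoD(1)[OF T] order_refl]])
  note D = endoD[OF T]
  show sub: "T ` I \<subseteq> I" using D(3) by blast
  obtain B where B: "finite B" "B \<subseteq> T ` I" "independent B" "T ` I \<subseteq> span B" "card B = dim (T ` I)"
    using fin_dim_basis[OF fin_dim_subset[OF D(2) sub]] by metis
  obtain C where C: "C \<subseteq> I" "T ` C = B" "finite C" "card C \<le> card B"
  proof -
    have g: "inv_into I T b \<in> I" "T (inv_into I T b) = b" if "b \<in> B" for b
      using B(2) that inv_into_into[of b T I] f_inv_into_f[of b T I] by auto
    have "T ` inv_into I T ` B = B" using g(2) by (force simp: image_image)
    then show ?thesis using that[of "inv_into I T ` B"] g(1) B(1) by (auto simp: card_image_le)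
  qed
  have CI: "span C \<subseteq> I" using C(1) D(1) by (rule span_minimal)
  have "span B \<subseteq> T ` span C"
  proof (rule span_minimal)
    show "B \<subseteq> T ` span C" using C(2) span_superset by blast
    show "subspace (T ` span C)" by (rule endo_image_subspace[OF T subspace_span CI])
  qed
  have "I \<subseteq> span C"
  proof
    fix x assume x: "x \<in> I"
    then obtain y where y: "y \<in> span C" "T x = T y" using B(4) \<open>span B \<subseteq> T ` span C\<close> by blast
    then have "T (x - y) = 0" using D(7)[OF x, of y] CI by auto
    moreover have "x - y \<in> I" using x y CI subspace_diff[OF D(1)] by blast
    ultimately have "x - y = 0" by (rule inj[rotated])
    then show "x \<in> span C" using y by simp
  qed
  then show "dim I \<le> dim (T ` I)" using dim_le_card[OF _ C(3), of I] C(4) B(5) by linarith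
qed

lemma dim_direct_sum:
  assumes E: "fin_dim E" and R: "subspace R" "R \<subseteq> E" and I: "subspace I" "I \<subseteq> E"
    and disj: "R \<inter> I = {0}" and sum: "\<And>x. x \<in> E \<Longrightarrow> \<exists>r\<in>R. \<exists>i\<in>I. x = r + i" and sE: "subspace E"
  shows "dim E = dim R + dim I"
proof -
  obtain A where A: "finite A" "A \<subseteq> R" "independent A" "R \<subseteq> span A" "card A = dim R"
    using fin_dim_basis[OF fin_dim_subset[OF E R(2)]] by metis
  obtain B where B: "finite B" "B \<subseteq> I" "independent B" "I \<subseteq> span B" "card B = dim I"
    using fin_dim_basis[OF fin_dim_subset[OF E I(2)]] by metis
  have sA: "span A = R" using A(2,4) span_minimal[OF _ R(1)] by blast
  have indep: "independent (A \<union> C)" if "C \<subseteq> B" for C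
  proof -
    have "finite C" using that B(1) finite_subset by blast
    then show ?thesis using that
    proof (induction C)
      case empty then show ?case using A by simp
    next
      case (insert c C)
      have cB: "c \<in> B" "C \<subseteq> B" using insert by auto
      have "c \<notin> span (A \<union> C)"
      proof
        assume "c \<in> span (A \<union> C)"
        then obtain r s where rs: "r \<in> R" "s \<in> span C" "c = r + s" unfolding span_Un sA by blast
        have "s \<in> I" using rs(2) cB(2) B(2) span_minimal[OF _ I(1)] by (meson subset_trans subsetD)
        then have "r \<in> I" using rs(3) cB(1) B(2) subspace_diff[OF I(1), of c s] by auto
        then have "r = 0" using disj rs(1) by blast
        then have "c \<in> span C" using rs by simp
        moreover have "C \<subseteq> B - {c}" using cB insert(2) by blast
        ultimately have "c \<in> span (B - {c})" using span_mono by blast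
        then show False using B(3) cB(1) dependent_def by blast
      qed
      then show ?case using insert.IH cB(2) independent_insertI[of c "A \<union> C"] by simp
    qed
  qed
  have AB: "A \<inter> B = {}"
  proof -
    have "0 \<notin> A" using A(3) dependent_zero by blast
    moreover have "x = 0" if "x \<in> A" "x \<in> B" for x
    proof -
      have "x \<in> R \<inter> I" using that A(2) B(2) by auto
      then show ?thesis unfolding disj by simp
    qed
    ultimately show ?thesis by blast
  qed
  have "dim E = card (A \<union> B)"
  proof (rule dim_unique[OF _ _ indep[OF order_refl] refl])
    show "A \<union> B \<subseteq> E" using A B R I by blast
    show "E \<subseteq> span (A \<union> B)"
    proof
      fix x assume "x \<in> E"
      then obtain r i where "r \<in> R" "i \<in> I" "x = r + i" using sum by blast
      then show "x \<in> span (A \<union> B)" using A(4) B(4) unfolding span_Un by blast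
    qed
  qed
  then show ?thesis using A B AB by (simp add: card_Un_disjoint)
qed

definition poly_op :: "('b \<Rightarrow> 'b) \<Rightarrow> complex poly \<Rightarrow> 'b \<Rightarrow> 'b" where
  "poly_op T p x = (\<Sum>i\<le>degree p. coeff p i *c (T ^^ i) x)"

lemma poly_op_bound: "degree p \<le> N \<Longrightarrow> poly_op T p x = (\<Sum>i\<le>N. coeff p i *c (T ^^ i) x)"
  unfolding poly_op_def by (rule sum.mono_neutral_left) (auto simp: coeff_eq_0)

lemma poly_op_in:
  assumes "endo E T" "x \<in> E" shows "poly_op T p x \<in> E"
  unfolding poly_op_def
  by (intro subspace_sum subspace_scale endoD(1)[OF assms(1)] endoD(3)[OF endo_pow[OF assms(1)]] assms(2))

lemma poly_op_factor:
  assumes T: "endo E T" and x: "x \<in> E"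
  shows "poly_op T ([:- z, 1:] * p) x = T (poly_op T p x) - z *c poly_op T p x"
proof -
  define N where "N = degree p"
  let ?t = "\<lambda>i. (T ^^ i) x"
  have tE: "?t i \<in> E" for i using endoD(3)[OF endo_pow[OF T] x] .
  have Tsum: "T (\<Sum>i\<in>F. c i *c ?t i) = (\<Sum>i\<in>F. c i *c ?t (Suc i))" for F :: "nat set" and c
  proof (induction F rule: infinite_finite_induct)
    case (insert i F)
    have "(\<Sum>i\<in>F. c i *c ?t i) \<in> E" by (intro subspace_sum subspace_scale endoD(1)[OF T] tE)
    then show ?case using insert endoD(4,5)[OF T] tE subspace_scale[OF endoD(1)[OF T]] by simp
  qed (use endoD(6)[OF T] in auto)
  have deg: "degree ([:- z, 1:] * p) \<le> Suc N"
    using degree_mult_le[of "[:- z, 1:]" p] by (simp add: N_def)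
  have co: "coeff ([:- z, 1:] * p) i = (case i of 0 \<Rightarrow> 0 | Suc j \<Rightarrow> coeff p j) - z * coeff p i" for i
    by (cases i) (simp_all add: mult_pCons_left)
  have "poly_op T ([:- z, 1:] * p) x = (\<Sum>i\<le>Suc N. ((case i of 0 \<Rightarrow> 0 | Suc j \<Rightarrow> coeff p j) - z * coeff p i) *c ?t i)"
    unfolding poly_op_bound[OF deg] co ..
  also have "\<dots> = (\<Sum>i\<le>Suc N. (case i of 0 \<Rightarrow> 0 | Suc j \<Rightarrow> coeff p j) *c ?t i) - z *c (\<Sum>i\<le>Suc N. coeff p i *c ?t i)"
    by (simp only: scale_left_diff_distrib sum_subtractf scale_sum_right scale_scale)
  also have "(\<Sum>i\<le>Suc N. (case i of 0 \<Rightarrow> 0 | Suc j \<Rightarrow> coeff p j) *c ?t i) = (\<Sum>i\<le>N. coeff p i *c ?t (Suc i))"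
    unfolding sum.atMost_Suc_shift by simp
  also have "(\<Sum>i\<le>Suc N. coeff p i *c ?t i) = poly_op T p x"
    by (rule poly_op_bound[symmetric]) (simp add: N_def)
  also have "(\<Sum>i\<le>N. coeff p i *c ?t (Suc i)) = T (poly_op T p x)"
    unfolding poly_op_def Tsum by (simp add: N_def)
  finally show ?thesis .
qed

text \<open>The iterates of \<open>x0\<close> are dependent, so a monic polynomial in
  \<open>T\<close> kills \<open>x0\<close>. Splitting off a root \<open>z\<close>, the remaining
  factor applied to \<open>x0\<close> is either an eigenvector for \<open>z\<close> or zero, in
  which case the degree has dropped.\<close>

lemma eigenvalue_exists:
  assumes T: "endo E T" and nz: "x0 \<in> E" "x0 \<noteq> 0"
  obtains z x where "x \<in> E" "x \<noteq> 0" "T x = z *c x"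
proof -
  let ?t = "\<lambda>i. (T ^^ i) x0"
  have tE: "?t i \<in> E" for i using endoD(3)[OF endo_pow[OF T] nz(1)] .
  have "\<exists>k. ?t k \<in> span (?t ` {..<k})"
  proof (rule ccontr)
    assume *: "\<not> ?thesis"
    have "independent (?t ` {..<k}) \<and> card (?t ` {..<k}) = k" for k
    proof (induction k)
      case (Suc k)
      have n: "?t k \<notin> span (?t ` {..<k})" using * by blast
      moreover have "?t k \<notin> ?t ` {..<k}" using n span_base[of "?t k" "?t ` {..<k}"] by argo
      ultimately show ?case using Suc by (simp add: lessThan_Suc independent_insertI)
    qed (simp add: independent_empty)
    from this[of "Suc (dim E)"] have "Suc (dim E) \<le> dim E"
      using independent_card_le[OF endoD(2)[OF T], of "?t ` {..<Suc (dim E)}"] tE by (metis image_subsetI)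
    then show False by simp
  qed
  then obtain k where k: "?t k \<in> span (?t ` {..<k})" by blast
  have "span (?t ` {..<k}) \<subseteq> {y. \<exists>c. y = (\<Sum>i<k. c i *c ?t i)}"
  proof (rule span_minimal)
    show "?t ` {..<k} \<subseteq> {y. \<exists>c. y = (\<Sum>i<k. c i *c ?t i)}"
    proof clarify
      fix j assume "j < k"
      then have "?t j = (\<Sum>i<k. (if i = j then 1 else 0) *c ?t i)"
        by (simp add: if_distrib[of "\<lambda>c. c *c _"] cong: if_cong)
      then show "\<exists>c. ?t j = (\<Sum>i<k. c i *c ?t i)" by (rule exI[of _ "\<lambda>i. if i = j then 1 else 0"])
    qed
    show "subspace {y. \<exists>c. y = (\<Sum>i<k. c i *c ?t i)}"
    proof (rule subspaceI; clarify)
      show "\<exists>c. 0 = (\<Sum>i<k. c i *c ?t i)" by (rule exI[of _ "\<lambda>_. 0"]) simp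
      show "\<exists>e. (\<Sum>i<k. c i *c ?t i) + (\<Sum>i<k. d i *c ?t i) = (\<Sum>i<k. e i *c ?t i)" for c d
        by (rule exI[of _ "\<lambda>i. c i + d i"]) (simp add: scale_left_distrib sum.distrib)
      show "\<exists>e. s *c (\<Sum>i<k. c i *c ?t i) = (\<Sum>i<k. e i *c ?t i)" for s c
        by (rule exI[of _ "\<lambda>i. s * c i"]) (simp add: scale_sum_right)
    qed
  qed
  then obtain c where c: "?t k = (\<Sum>i<k. c i *c ?t i)" using k by blast
  define p where "p = monom 1 k - (\<Sum>i<k. monom (c i) i)"
  have cp: "coeff p i = (if i = k then 1 else if i < k then - c i else 0)" for i
    by (simp add: p_def coeff_sum)
  have dk: "degree p \<le> k" by (rule degree_le) (simp add: cp)
  have "poly_op T p x0 = (\<Sum>i\<le>k. (if i = k then 1 else if i < k then - c i else 0) *c ?t i)"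
    unfolding poly_op_bound[OF dk] cp ..
  also have "\<dots> = (\<Sum>i<k. (- c i) *c ?t i) + ?t k"
    by (simp add: lessThan_Suc_atMost[symmetric])
  also have "\<dots> = 0" unfolding c by (simp add: sum_negf)
  finally have p0: "poly_op T p x0 = 0" "p \<noteq> 0" using cp[of k] by auto
  have "\<exists>z y. y \<in> E \<and> y \<noteq> 0 \<and> T y = z *c y" if "poly_op T p x = 0" "p \<noteq> 0" "x \<in> E" "x \<noteq> 0" for p x
    using that
  proof (induction "degree p" arbitrary: p rule: less_induct)
    case less
    show ?case
    proof (cases "degree p = 0")
      case True
      then obtain a where "p = [:a:]" using degree_0_id by (metis)
      then have "a *c x = 0" "a \<noteq> 0" using less by (auto simp: poly_op_def)
      then show ?thesis using less by simp
    next
      case False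
      then obtain z where "poly p z = 0" using fundamental_theorem_of_algebra[of p] by (auto simp: constant_degree)
      then obtain r where r: "p = [:- z, 1:] * r" by (auto simp: poly_eq_0_iff_dvd)
      then have r0: "r \<noteq> 0" using less(3) by auto
      have "degree p = degree [:- z, 1:] + degree r" unfolding r by (rule degree_mult_eq) (use r0 in auto)
      with r0 have rp: "r \<noteq> 0" "degree r < degree p" by auto
      let ?y = "poly_op T r x"
      have y: "?y \<in> E" by (rule poly_op_in[OF T less(4)])
      have e: "T ?y = z *c ?y" using poly_op_factor[OF T less(4), of z r] less(2) by (simp only: r) simp
      show ?thesis
      proof (cases "?y = 0")
        case True
        show ?thesis by (rule less.hyps[OF rp(2) True rp(1) less(4,5)])
      qed (use y e in blast)
    qed
  qed
  then show ?thesis using p0 nz that by blast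
qed

lemma root_space_subset: "root_space E T z \<subseteq> E"
  by (auto simp: root_space_def)

lemma power_zero_mono:
  assumes "endo E S" "(S ^^ k) x = 0" "k \<le> m" shows "(S ^^ m) x = 0"
proof -
  have "(S ^^ (m - k)) ((S ^^ k) x) = 0" using endoD(6)[OF endo_pow[OF assms(1)]] assms(2) by simp
  then show ?thesis using assms(3) by (metis comp_apply funpow_add le_add_diff_inverse2)
qed

text \<open>The kernels of the powers increase and their dimensions are bounded by that of
  \<open>E\<close>; at a power of maximal dimension the chain has stopped.\<close>

lemma root_space_stable:
  assumes T: "endo E T"
  obtains m where "root_space E T z = {x\<in>E. ((\<lambda>x. T x - z *c x) ^^ m) x = 0}"
proof -
  define S where "S x = T x - z *c x" for x
  have S: "endo E S" unfolding S_def[abs_def] by (rule endo_shift[OF T])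
  define N where "N k = {x\<in>E. (S ^^ k) x = 0}" for k
  have sN: "subspace (N k)" for k unfolding N_def by (rule endo_kernel_subspace[OF endo_pow[OF S]])
  have NE: "N k \<subseteq> E" for k by (auto simp: N_def)
  have mono: "N k \<subseteq> N m" if "k \<le> m" for k m
    using power_zero_mono[OF S _ that] by (auto simp: N_def)
  have "\<exists>m. \<forall>k. dim (N k) \<le> dim (N m)"
  proof -
    have "\<And>k. dim (N k) \<le> dim E" by (rule dim_mono_fin[OF endoD(2)[OF T] NE])
    then show ?thesis using ex_has_greatest_nat[of "\<lambda>_. True" 0 "\<lambda>k. dim (N k)" "Suc (dim E)"] by (auto simp: less_Suc_eq_le)
  qed
  then obtain m where m: "\<And>k. dim (N k) \<le> dim (N m)" by blast
  have "N k \<subseteq> N m" for k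
  proof -
    have "N m = N (max k m)"
      by (rule dim_eq_subspace[OF fin_dim_subset[OF endoD(2)[OF T] NE] sN mono]) (use m in auto)
    then show ?thesis using mono[of k "max k m"] by simp
  qed
  then have "root_space E T z = N m" unfolding root_space_def N_def S_def[abs_def] by blast
  then show ?thesis using that unfolding N_def S_def[abs_def] by blast
qed

lemma shift_commute:
  assumes T: "endo E T" and x: "x \<in> E"
  shows "((\<lambda>x. T x - z *c x) ^^ k) (((\<lambda>x. T x - w *c x) ^^ m) x) = ((\<lambda>x. T x - w *c x) ^^ m) (((\<lambda>x. T x - z *c x) ^^ k) x)"
proof -
  define S where "S x = T x - z *c x" for x
  define U where "U x = T x - w *c x" for x
  have S: "endo E S" and U: "endo E U" unfolding S_def[abs_def] U_def[abs_def] by (rule endo_shift[OF T])+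
  have 1: "S (U y) = U (S y)" if "y \<in> E" for y
  proof -
    have Ty: "T y \<in> E" by (rule endoD(3)[OF T that])
    have sc: "c *c y \<in> E" for c by (rule subspace_scale[OF endoD(1)[OF T] that])
    show ?thesis unfolding S_def U_def
      using endoD(7)[OF T Ty sc] endoD(5)[OF T that]
      by (simp add: scale_right_diff_distrib mult.commute algebra_simps)
  qed
  have 2: "S ((U ^^ m) y) = (U ^^ m) (S y)" if "y \<in> E" for y m
  proof (induction m)
    case (Suc m)
    have "S ((U ^^ Suc m) y) = U (S ((U ^^ m) y))" using 1[OF endoD(3)[OF endo_pow[OF U] that]] by simp
    then show ?case using Suc by simp
  qed simp
  have "(S ^^ k) ((U ^^ m) x) = (U ^^ m) ((S ^^ k) x)"
  proof (induction k)
    case (Suc k)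
    have "(S ^^ Suc k) ((U ^^ m) x) = S ((U ^^ m) ((S ^^ k) x))" using Suc by simp
    also have "\<dots> = (U ^^ m) (S ((S ^^ k) x))" by (rule 2[OF endoD(3)[OF endo_pow[OF S] x]])
    finally show ?case by simp
  qed simp
  then show ?thesis unfolding S_def[abs_def] U_def[abs_def] .
qed

lemma root_space_subspace:
  assumes "endo E T" shows "subspace (root_space E T z)"
  using root_space_stable[OF assms, of z] endo_kernel_subspace[OF endo_pow[OF endo_shift[OF assms]]] by metis

lemma root_space_invariant:
  assumes T: "endo E T" and x: "x \<in> root_space E T z"
  shows "((\<lambda>x. T x - w *c x) ^^ m) x \<in> root_space E T z"
proof -
  obtain k where xE: "x \<in> E" and k: "((\<lambda>x. T x - z *c x) ^^ k) x = 0" using x by (auto simp: root_space_def)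
  have "((\<lambda>x. T x - z *c x) ^^ k) (((\<lambda>x. T x - w *c x) ^^ m) x) = 0"
    using shift_commute[OF T xE, of k z m w] k endoD(6)[OF endo_pow[OF endo_shift[OF T]], of m w] by simp
  then show ?thesis using endoD(3)[OF endo_pow[OF endo_shift[OF T]] xE] by (auto simp: root_space_def)
qed

text \<open>On the kernel of \<open>T - w\<close> the operator \<open>T - z\<close> acts as the
  scalar \<open>w - z\<close>, whose powers never vanish. Hence \<open>T - w\<close> is injective on
  the root space of \<open>z\<close>, and so are its powers.\<close>

lemma root_space_disjoint:
  assumes T: "endo E T" and x: "x \<in> root_space E T z" and k: "((\<lambda>x. T x - w *c x) ^^ k) x = 0" and zw: "w \<noteq> z"
  shows "x = 0"
proof -
  define U where "U x = T x - w *c x" for x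
  define S where "S x = T x - z *c x" for x
  have U: "endo E U" unfolding U_def[abs_def] by (rule endo_shift[OF T])
  have S: "endo E S" unfolding S_def[abs_def] by (rule endo_shift[OF T])
  have base: "y = 0" if y: "y \<in> root_space E T z" "U y = 0" for y
  proof -
    obtain j where yE: "y \<in> E" and j: "(S ^^ j) y = 0" using y(1) by (auto simp: root_space_def S_def[abs_def])
    have Sy: "S y = (w - z) *c y" using y(2) by (simp add: S_def U_def scale_left_diff_distrib)
    have "(S ^^ i) y = (w - z) ^ i *c y" for i
    proof (induction i)
      case (Suc i)
      then show ?case using Sy endoD(5)[OF S yE] by (simp add: mult.commute)
    qed simp
    then have "(w - z) ^ j *c y = 0" using j by simp
    then show "y = 0" using zw by simp
  qed
  have "(U ^^ k) y = 0 \<Longrightarrow> y \<in> root_space E T z \<Longrightarrow> y = 0" for y k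
  proof (induction k arbitrary: y)
    case (Suc k)
    have "U y \<in> root_space E T z" using root_space_invariant[OF T Suc(3), of 1 w] by (simp add: U_def)
    moreover have "(U ^^ k) (U y) = 0" using Suc(2) by (simp add: funpow_swap1)
    ultimately have "U y = 0" using Suc.IH by blast
    then show ?case using base Suc(3) by blast
  qed simp
  then show ?thesis using k x unfolding U_def[abs_def] by blast
qed

text \<open>Fitting decomposition at one eigenvalue \<open>w\<close>: for a power \<open>m\<close>
  at which the kernels have stabilized, \<open>E\<close> is the direct sum of the kernel
  \<open>R\<close> and the image \<open>I\<close> of \<open>(T - w) ^^ m\<close>. \<open>I\<close>
  has smaller dimension and the same root spaces except that of \<open>w\<close>, so induction on
  the dimension applies.\<close>

theorem sum_dim_root_spaces:
  assumes "endo E T"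
  shows "finite {z. root_space E T z \<noteq> {0}} \<and> (\<Sum>z | root_space E T z \<noteq> {0}. dim (root_space E T z)) = dim E"
  using assms
proof (induction "dim E" arbitrary: E rule: less_induct)
  case less
  note T = less.prems
  have E0: "0 \<in> E" by (rule subspace_0[OF endoD(1)[OF T]])
  show ?case
  proof (cases "E = {0}")
    case True
    have "root_space E T z = {0}" for z
    proof -
      have "((\<lambda>x. T x - z *c x) ^^ 0) 0 = 0" by simp
      then show ?thesis unfolding root_space_def True by blast
    qed
    moreover have "dim E = 0" using dim_le_card[of E "{}"] True by simp
    ultimately show ?thesis by simp
  next
    case False
    then obtain x0 where "x0 \<in> E" "x0 \<noteq> 0" using E0 by blast
    then obtain w x where wx: "x \<in> E" "x \<noteq> 0" "T x = w *c x" using eigenvalue_exists[OF T] by blast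
    define S where "S x = T x - w *c x" for x
    have S: "endo E S" unfolding S_def[abs_def] by (rule endo_shift[OF T])
    define R where "R = root_space E T w"
    obtain m where m: "R = {x\<in>E. (S ^^ m) x = 0}"
      using root_space_stable[OF T, of w] unfolding R_def S_def[abs_def] by metis
    note Sm = endo_pow[OF S, of m]
    define I where "I = (S ^^ m) ` E"
    have sR: "subspace R" "R \<subseteq> E" unfolding R_def using root_space_subspace[OF T] root_space_subset by auto
    have sI: "subspace I" "I \<subseteq> E" unfolding I_def using endo_image_subspace[OF Sm endoD(1)[OF Sm] order_refl] endoD(3)[OF Sm] by auto
    have shiftI: "((\<lambda>x. T x - z *c x) ^^ k) y \<in> I" if yI: "y \<in> I" for y z k
    proof -
      obtain u where u: "u \<in> E" "y = (S ^^ m) u" using yI by (auto simp: I_def)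
      have "((\<lambda>x. T x - z *c x) ^^ k) y = (S ^^ m) (((\<lambda>x. T x - z *c x) ^^ k) u)"
        unfolding u(2) S_def[abs_def] by (rule shift_commute[OF T u(1)])
      then show ?thesis using endoD(3)[OF endo_pow[OF endo_shift[OF T]] u(1)] by (auto simp: I_def)
    qed
    have TI: "endo I T"
    proof (rule endo_subset[OF T sI])
      fix y assume y: "y \<in> I"
      have "T y = (T y - 0 *c y)" by simp
      then show "T y \<in> I" using shiftI[OF y, where z = 0 and k = 1] by simp
    qed
    have disj: "R \<inter> I = {0}"
    proof -
      have "y = 0" if "y \<in> R" "y \<in> I" for y
      proof -
        obtain u where u: "u \<in> E" "y = (S ^^ m) u" using \<open>y \<in> I\<close> by (auto simp: I_def)
        have "(S ^^ (m + m)) u = 0" using \<open>y \<in> R\<close> unfolding m u(2) by (simp add: funpow_add)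
        \<comment> \<open>A vector killed by the power \<open>m + m\<close> is already killed by the
          power \<open>m\<close>, because the kernels have stabilized.\<close>
        then have "u \<in> R" using u(1) unfolding R_def root_space_def S_def[abs_def] by blast
        then show "y = 0" unfolding m u(2) by blast
      qed
      then show ?thesis using subspace_0[OF sR(1)] subspace_0[OF sI(1)] by blast
    qed
    have SI: "endo I (S ^^ m)"
      by (rule endo_subset[OF Sm sI]) (use shiftI in \<open>auto simp: S_def[abs_def]\<close>)
    have onto: "(S ^^ m) ` I = I"
      by (rule endo_inj_surj[OF SI]) (use disj sI in \<open>auto simp: m\<close>)
    have sum: "\<exists>r\<in>R. \<exists>i\<in>I. y = r + i" if y: "y \<in> E" for y
    proof -
      have "(S ^^ m) y \<in> I" using y by (auto simp: I_def)
      then obtain i where i: "i \<in> I" "(S ^^ m) y = (S ^^ m) i" using onto by (metis imageE)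
      have "(S ^^ m) (y - i) = 0" using endoD(7)[OF Sm y, of i] i sI by auto
      moreover have "y - i \<in> E" using y i sI subspace_diff[OF endoD(1)[OF T]] by blast
      ultimately have "y - i \<in> R" by (simp add: m)
      then show ?thesis using i by (metis diff_add_cancel)
    qed
    have dE: "dim E = dim R + dim I"
      by (rule dim_direct_sum[OF endoD(2)[OF T] sR sI disj sum endoD(1)[OF T]])
    have xR: "x \<in> R"
    proof -
      have "((\<lambda>x. T x - w *c x) ^^ 1) x = 0" using wx(3) by simp
      then show ?thesis unfolding R_def root_space_def using wx(1) by blast
    qed
    have "dim R \<noteq> 0"
    proof
      assume "dim R = 0"
      obtain B where "finite B" "R \<subseteq> span B" "card B = dim R" using fin_dim_basis[OF fin_dim_subset[OF endoD(2)[OF T] sR(2)]] by metis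
      then have "x \<in> span {}" using \<open>dim R = 0\<close> xR by auto
      then show False using wx(2) by simp
    qed
    then have lt: "dim I < dim E" using dE by simp
    note IH = less.hyps[OF lt TI]
    have rI: "root_space E T z = root_space I T z" if "z \<noteq> w" for z
    proof
      show "root_space I T z \<subseteq> root_space E T z" using sI(2) by (auto simp: root_space_def)
      show "root_space E T z \<subseteq> root_space I T z"
      proof
        fix y assume y: "y \<in> root_space E T z"
        then obtain k where k: "y \<in> E" "((\<lambda>x. T x - z *c x) ^^ k) y = 0" by (auto simp: root_space_def)
        obtain r i where ri: "r \<in> R" "i \<in> I" "y = r + i" using sum[OF k(1)] by blast
        let ?U = "(\<lambda>x. T x - z *c x) ^^ k"
        have U: "endo E ?U" by (rule endo_pow[OF endo_shift[OF T]])
        have "?U r + ?U i = 0" using k(2) endoD(4)[OF U, of r i] ri sR(2) sI(2) by auto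
        then have e: "?U r = - ?U i" by (simp add: eq_neg_iff_add_eq_0)
        have "?U r \<in> R" unfolding R_def by (rule root_space_invariant[OF T]) (use ri in \<open>simp add: R_def\<close>)
        moreover have "?U r \<in> I" unfolding e by (rule subspace_neg[OF sI(1) shiftI[OF ri(2)]])
        ultimately have "?U r \<in> R \<inter> I" by blast
        then have "?U r = 0" unfolding disj by simp
        \<comment> \<open>The component of \<open>y\<close> in \<open>R\<close> is killed by a power
          of \<open>T - z\<close>, which is injective on the root space of \<open>w\<close>.\<close>
        then have "r = 0" using root_space_disjoint[OF T _ _ that] ri(1) by (auto simp: R_def)
        then show "y \<in> root_space I T z" using ri k by (auto simp: root_space_def)
      qed
    qed
    have wI: "root_space I T w = {0}"
    proof -
      have "root_space I T w \<subseteq> R \<inter> I" using sI(2) by (auto simp: root_space_def R_def)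
      then have "root_space I T w \<subseteq> {0}" unfolding disj .
      moreover have "0 \<in> root_space I T w" by (rule subspace_0[OF root_space_subspace[OF TI]])
      ultimately show ?thesis by blast
    qed
    have Rne: "R \<noteq> {0}" using xR wx(2) by blast
    have set: "{z. root_space E T z \<noteq> {0}} = insert w {z. root_space I T z \<noteq> {0}}"
    proof (rule set_eqI)
      fix z show "z \<in> {z. root_space E T z \<noteq> {0}} \<longleftrightarrow> z \<in> insert w {z. root_space I T z \<noteq> {0}}"
        using rI[of z] Rne unfolding R_def by (cases "z = w") simp_all
    qed
    have nw: "w \<notin> {z. root_space I T z \<noteq> {0}}" using wI by simp
    have "(\<Sum>z | root_space I T z \<noteq> {0}. dim (root_space E T z)) = (\<Sum>z | root_space I T z \<noteq> {0}. dim (root_space I T z))"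
      by (rule sum.cong[OF refl]) (use rI nw in force)
    then have "(\<Sum>z | root_space E T z \<noteq> {0}. dim (root_space E T z)) = dim E"
      unfolding set using nw IH dE by (simp add: R_def)
    then show ?thesis unfolding set using IH by simp
  qed
qed

end

text \<open>Distance of \<open>\<bar>j\<bar>\<close> from the cut at \<open>K + 1/2\<close>,
  increased by \<open>1/2\<close>, so that it counts 1, 2, 3, ... outward on both sides and its
  reciprocal never degenerates.\<close>

definition edge_dist :: "int \<Rightarrow> int \<Rightarrow> int" where
  "edge_dist K j = (if K < \<bar>j\<bar> then \<bar>j\<bar> - K else K + 1 - \<bar>j\<bar>)"

definition edge :: "int \<Rightarrow> int \<Rightarrow> real" where
  "edge K j = 1 / real_of_int (edge_dist K j)"

lemma edge_dist_ge: "1 \<le> edge_dist K j" by (simp add: edge_dist_def)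

lemma edge_pos: "0 < edge K j" using edge_dist_ge[of K j] by (simp add: edge_def)

lemma edge_le_1: "edge K j \<le> 1" using edge_dist_ge[of K j] by (simp add: edge_def)

text \<open>On one side of the cut a given distance belongs to at most two indices, one for each
  sign; the sum over both sides together would need a larger constant.\<close>

lemma edge_ell2: "ell2 (\<lambda>j. if P j then edge K j else 0) 2" if P: "(\<forall>j. P j \<longrightarrow> K < \<bar>j\<bar>) \<or> (\<forall>j. P j \<longrightarrow> \<bar>j\<bar> \<le> K)"
  unfolding ell2_def
proof (intro conjI allI impI)
  fix F :: "int set" assume F: "finite F"
  define s where "s j = nat (edge_dist K j)" for j
  have s_real: "real (s j) = real_of_int (edge_dist K j)" for j using edge_dist_ge[of K j] by (simp add: s_def)
  have s_ge: "Suc 0 \<le> s j" for j using edge_dist_ge[of K j] by (simp add: s_def)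
  let ?F = "{j\<in>F. P j}"
  have "(\<Sum>j\<in>F. (norm (if P j then edge K j else 0))\<^sup>2) = (\<Sum>j\<in>?F. 1 / (real (s j))\<^sup>2)"
  proof -
    have "(norm (if P j then edge K j else 0))\<^sup>2 = (if P j then 1 / (real (s j))\<^sup>2 else 0)" for j
      by (auto simp: edge_def s_real power_divide)
    then show ?thesis using F by (simp add: sum.inter_filter)
  qed
  also have "\<dots> \<le> 2 * (\<Sum>k\<in>s ` ?F. 1 / (real k)\<^sup>2)"
  proof (rule inverse_squares_two_to_one[where N = 1])
    fix k
    have "{j\<in>?F. s j = k} \<subseteq> {int k + K, - int k - K} \<or> {j\<in>?F. s j = k} \<subseteq> {K + 1 - int k, int k - K - 1}"
      using P
    proof
      assume h: "\<forall>j. P j \<longrightarrow> K < \<bar>j\<bar>"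
      have "j \<in> {int k + K, - int k - K}" if j: "P j" "s j = k" for j
      proof -
        have "K < \<bar>j\<bar>" using h j(1) by blast
        then have "int k = \<bar>j\<bar> - K" using j(2) by (auto simp: s_def edge_dist_def)
        then have "j = int k + K \<or> j = - int k - K" by linarith
        then show ?thesis by simp
      qed
      then show ?thesis by blast
    next
      assume h: "\<forall>j. P j \<longrightarrow> \<bar>j\<bar> \<le> K"
      have "j \<in> {K + 1 - int k, int k - K - 1}" if j: "P j" "s j = k" for j
      proof -
        have "\<not> K < \<bar>j\<bar>" using h j(1) by fastforce
        then have "int k = K + 1 - \<bar>j\<bar>" using j(2) by (auto simp: s_def edge_dist_def)
        then have "j = K + 1 - int k \<or> j = int k - K - 1" by linarith
        then show ?thesis by simp
      qed
      then show ?thesis by blast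
    qed
    moreover have "card {x, y} \<le> 2" for x y :: int by (simp add: card_insert_if)
    ultimately show "card {j\<in>?F. s j = k} \<le> 2"
      by (meson card_mono finite.emptyI finite.insertI order_trans)
  qed (use F s_ge in \<open>auto simp: s_ge\<close>)
  also have "(\<Sum>k\<in>s ` ?F. 1 / (real k)\<^sup>2) \<le> 2"
    by (rule inverse_squares_sum_le) (use F s_ge in \<open>auto simp: s_ge\<close>)
  finally show "(\<Sum>j\<in>F. (norm (if P j then edge K j else 0))\<^sup>2) \<le> 2\<^sup>2" by simp
qed simp

text \<open>Measures how far \<open>j\<^sup>2\<close> lies above \<open>K\<^sup>2 + K\<close>, the
  height at which the spectrum is cut. \<open>edge_low\<close> does the same from below; both grow
  at least like \<open>K\<close> times the distance to the cut.\<close>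

lemma edge_high:
  fixes j k K :: int
  assumes "1 \<le> K" "K < \<bar>j\<bar>"
  shows "K * (\<bar>j\<bar> - K) \<le> j\<^sup>2 - K\<^sup>2 - K"
proof -
  define s where "s = \<bar>j\<bar> - K"
  have s: "1 \<le> s" "\<bar>j\<bar> = K + s" using assms by (auto simp: s_def)
  have "j\<^sup>2 = (K + s)\<^sup>2" using s(2) by (metis power2_abs)
  then have "j\<^sup>2 - K\<^sup>2 - K - K * s = K * (s - 1) + s * s" by (simp add: power2_eq_square algebra_simps)
  moreover have "0 \<le> K * (s - 1) + s * s" using assms s by simp
  ultimately show ?thesis by (simp add: s_def)
qed

lemma edge_low:
  fixes k K :: int
  assumes "1 \<le> K" "\<bar>k\<bar> \<le> K"
  shows "K * (K + 1 - \<bar>k\<bar>) \<le> K\<^sup>2 + K - k\<^sup>2"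
proof -
  have "k\<^sup>2 = \<bar>k\<bar> * \<bar>k\<bar>" by (simp add: power2_eq_square)
  moreover have "\<bar>k\<bar> * \<bar>k\<bar> \<le> K * \<bar>k\<bar>" using assms by (intro mult_right_mono) auto
  ultimately show ?thesis by (simp add: power2_eq_square algebra_simps)
qed

text \<open>Inverts the commutator with \<open>- d\<^sup>2/dx\<^sup>2\<close> on matrices from the
  low to the high modes, where it multiplies by
  \<open>\<pi>\<^sup>2 (j\<^sup>2 - k\<^sup>2)\<close>.\<close>

definition rho :: "int \<Rightarrow> int \<Rightarrow> int \<Rightarrow> real" where
  "rho K j k = (if K < \<bar>j\<bar> \<and> \<bar>k\<bar> \<le> K then 1 / (pi\<^sup>2 * real_of_int (j\<^sup>2 - k\<^sup>2)) else 0)"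

lemma rho_le_gen:
  assumes "1 \<le> m" "m \<le> j\<^sup>2 - k\<^sup>2" shows "rho K j k \<le> 1 / (9 * real_of_int m)" "0 \<le> rho K j k"
proof -
  have "9 * real_of_int m \<le> pi\<^sup>2 * real_of_int (j\<^sup>2 - k\<^sup>2)"
    using assms pi_squared_ge by (intro mult_mono) (auto simp only: of_int_le_iff)
  moreover have "0 < 9 * real_of_int m" using assms by simp
  ultimately have "1 / (pi\<^sup>2 * real_of_int (j\<^sup>2 - k\<^sup>2)) \<le> 1 / (9 * real_of_int m)"
    by (intro frac_le) auto
  then show "rho K j k \<le> 1 / (9 * real_of_int m)" unfolding rho_def using assms by auto
  have "0 \<le> real_of_int (j\<^sup>2 - k\<^sup>2)" using assms by (simp only: of_int_0_le_iff)
  then show "0 \<le> rho K j k" unfolding rho_def by (simp del: of_int_diff)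
qed

context
  fixes K :: int
  assumes K: "1 \<le> K"
begin

lemma rho_nonneg: "0 \<le> rho K j k"
proof (cases "K < \<bar>j\<bar> \<and> \<bar>k\<bar> \<le> K")
  case True
  then have "k\<^sup>2 \<le> j\<^sup>2" using power2_abs abs_le_square_iff by (metis less_le order.trans)
  then have "0 \<le> real_of_int (j\<^sup>2 - k\<^sup>2)" by (simp only: of_int_0_le_iff)
  then show ?thesis by (simp add: rho_def del: of_int_diff)
qed (auto simp: rho_def)

lemma rho_high: "rho K j k \<le> (1 / (9 * real_of_int K)) * (if K < \<bar>j\<bar> then edge K j else 0)"
proof (cases "K < \<bar>j\<bar> \<and> \<bar>k\<bar> \<le> K")
  case True
  have "k\<^sup>2 \<le> K\<^sup>2" using True K by (simp add: abs_le_square_iff[symmetric])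
  then have "K * (\<bar>j\<bar> - K) \<le> j\<^sup>2 - k\<^sup>2" using edge_high[OF K, of j] True K by linarith
  moreover have "1 * 1 \<le> K * (\<bar>j\<bar> - K)" using True K by (intro mult_mono) auto
  ultimately have "rho K j k \<le> 1 / (9 * real_of_int (K * (\<bar>j\<bar> - K)))" by (intro rho_le_gen) auto
  then show ?thesis using True by (simp add: edge_def edge_dist_def)
qed (use K edge_pos[of K j] in \<open>auto simp: rho_def less_imp_le\<close>)

lemma rho_low: "rho K j k \<le> (1 / (9 * real_of_int K)) * (if \<bar>k\<bar> \<le> K then edge K k else 0)"
proof (cases "K < \<bar>j\<bar> \<and> \<bar>k\<bar> \<le> K")
  case True
  have "(K + 1)\<^sup>2 \<le> j\<^sup>2" using True K by (simp add: abs_le_square_iff[symmetric])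
  then have "K\<^sup>2 + K \<le> j\<^sup>2" using K by (simp add: power2_eq_square algebra_simps)
  then have "K * (K + 1 - \<bar>k\<bar>) \<le> j\<^sup>2 - k\<^sup>2" using edge_low[OF K, of k] True by linarith
  moreover have "1 * 1 \<le> K * (K + 1 - \<bar>k\<bar>)" using True K by (intro mult_mono) auto
  ultimately have "rho K j k \<le> 1 / (9 * real_of_int (K * (K + 1 - \<bar>k\<bar>)))" by (intro rho_le_gen) auto
  then show ?thesis using True by (simp add: edge_def edge_dist_def)
qed (use K edge_pos[of K k] in \<open>auto simp: rho_def less_imp_le\<close>)

lemma rho_ell2: "ell2 (\<lambda>i. rho K i k) (1 / real_of_int K)" "ell2 (\<lambda>l. rho K j l) (1 / real_of_int K)"
proof -
  have le: "(1 / (9 * real_of_int K)) * 2 \<le> 1 / real_of_int K"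
  proof -
    have "2 / 9 * (1 / real_of_int K) \<le> 1 * (1 / real_of_int K)" using K by (intro mult_right_mono) auto
    then show ?thesis by simp
  qed
  have "ell2 (\<lambda>i. rho K i k) ((1 / (9 * real_of_int K)) * 2)"
    by (rule ell2_scale[OF edge_ell2[of "\<lambda>j. K < \<bar>j\<bar>" K]]) (use rho_nonneg rho_high K edge_pos[of K] in \<open>auto simp: less_imp_le\<close>)
  then show "ell2 (\<lambda>i. rho K i k) (1 / real_of_int K)" by (rule ell2_mono[OF _ le])
  have "ell2 (\<lambda>l. rho K j l) ((1 / (9 * real_of_int K)) * 2)"
    by (rule ell2_scale[OF edge_ell2[of "\<lambda>j. \<bar>j\<bar> \<le> K" K]]) (use rho_nonneg rho_low K edge_pos[of K] in \<open>auto simp: less_imp_le\<close>)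
  then show "ell2 (\<lambda>l. rho K j l) (1 / real_of_int K)" by (rule ell2_mono[OF _ le])
qed

text \<open>There are \<open>2 * K + 1\<close> low modes, and
  \<open>j\<^sup>2 - l\<^sup>2 \<ge> 2 * K + 1\<close> across the cut, so the sum stays bounded
  uniformly in \<open>K\<close>.\<close>

lemma rho_sum: "(\<Sum>l\<in>{- K..K}. rho K j l) \<le> 1"
proof -
  have "(\<Sum>l\<in>{- K..K}. rho K j l) \<le> (\<Sum>l\<in>{- K..K}. 1 / (9 * real_of_int (2 * K + 1)))"
  proof (rule sum_mono)
    fix l assume l: "l \<in> {- K..K}"
    show "rho K j l \<le> 1 / (9 * real_of_int (2 * K + 1))"
    proof (cases "K < \<bar>j\<bar>")
      case True
      have "(K + 1)\<^sup>2 \<le> j\<^sup>2" "l\<^sup>2 \<le> K\<^sup>2" using True K l by (auto simp: abs_le_square_iff[symmetric])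
      then have "2 * K + 1 \<le> j\<^sup>2 - l\<^sup>2" by (simp add: power2_eq_square algebra_simps)
      then show ?thesis using K by (intro rho_le_gen(1)) auto
    qed (use K in \<open>auto simp: rho_def\<close>)
  qed
  also have "\<dots> = real (nat (2 * K + 1)) * (1 / (9 * real_of_int (2 * K + 1)))" using K by simp
  also have "real (nat (2 * K + 1)) = real_of_int (2 * K + 1)" using K by simp
  also have "real_of_int (2 * K + 1) * (1 / (9 * real_of_int (2 * K + 1))) \<le> 1" using K by (simp add: field_simps)
  finally show ?thesis .
qed

lemma rho_inverse:
  assumes "K < \<bar>j\<bar>" "\<bar>k\<bar> \<le> K" shows "pi\<^sup>2 * real_of_int (j\<^sup>2 - k\<^sup>2) * rho K j k = 1"
proof -
  have "k\<^sup>2 < j\<^sup>2" using assms by (metis abs_le_square_iff not_less order.strict_trans1)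
  then have "0 < real_of_int (j\<^sup>2 - k\<^sup>2)" by (simp only: of_int_0_less_iff)
  then show ?thesis using assms by (simp add: rho_def del: of_int_diff)
qed

text \<open>The unknown of the Riccati equation is rescaled as \<open>X = - rho * Y\<close>, which
  makes \<open>Y\<close> merely bounded. The four terms are, in order, the block of \<open>V\<close>
  from low to high modes, the high block times \<open>X\<close>, \<open>X\<close> times the low
  block, and the quadratic term through the block from high to low.\<close>

definition riccati_op :: "(int \<Rightarrow> complex) \<Rightarrow> (int \<times> int \<Rightarrow> complex) \<Rightarrow> int \<times> int \<Rightarrow> complex" where
  "riccati_op V Y = (\<lambda>(j, k). V (j - k) - conv V (\<lambda>i. of_real (rho K i k) * Y (i, k)) j
     + (\<Sum>l\<in>{- K..K}. of_real (rho K j l) * Y (j, l) * V (l - k))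
     - (\<Sum>l\<in>{- K..K}. of_real (rho K j l) * Y (j, l) * conv V (\<lambda>i. of_real (rho K i k) * Y (i, k)) l))"

lemma riccati_terms:
  assumes V: "ell2 V v" and Y: "\<And>p. cmod (Y p) \<le> M"
  shows "cmod (conv V (\<lambda>i. of_real (rho K i k) * Y (i, k)) j) \<le> v / real_of_int K * M"
    and "cmod (\<Sum>l\<in>{- K..K}. of_real (rho K j l) * Y (j, l) * V (l - k)) \<le> v / real_of_int K * M"
    and "0 \<le> C \<Longrightarrow> (\<And>l. cmod (g l) \<le> C) \<Longrightarrow> cmod (\<Sum>l\<in>{- K..K}. of_real (rho K j l) * Y (j, l) * g l) \<le> M * C"
proof -
  have M0: "0 \<le> M" using Y norm_ge_zero order_trans by blast
  have B: "ell2 (\<lambda>i. complex_of_real (rho K i k)) (1 / real_of_int K)"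
    using rho_ell2(1) by (simp add: ell2_def)
  show "cmod (conv V (\<lambda>i. of_real (rho K i k) * Y (i, k)) j) \<le> v / real_of_int K * M"
    using conv_B1(2)[OF V B, where y = "\<lambda>i. Y (i, k)" and D = M and k = j] Y by simp
  have "cmod (\<Sum>l\<in>{- K..K}. of_real (rho K j l) * Y (j, l) * V (l - k)) \<le> (\<Sum>l\<in>{- K..K}. M * (norm (rho K j l) * cmod (V (l - k))))"
  proof (rule sum_norm_le)
    fix l
    have "cmod (Y (j, l)) * (\<bar>rho K j l\<bar> * cmod (V (l - k))) \<le> M * (\<bar>rho K j l\<bar> * cmod (V (l - k)))"
      by (intro mult_right_mono Y) auto
    then show "cmod (of_real (rho K j l) * Y (j, l) * V (l - k)) \<le> M * (norm (rho K j l) * cmod (V (l - k)))"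
      by (simp add: norm_mult mult_ac)
  qed
  also have "\<dots> \<le> M * (1 / real_of_int K * v)"
    unfolding sum_distrib_left[symmetric]
  proof (intro mult_left_mono M0 ell2_CS_finite rho_ell2)
    show "ell2 (\<lambda>l. V (l - k)) v" by (rule ell2_reindex[OF V]) (auto simp: inj_def)
  qed simp
  finally show "cmod (\<Sum>l\<in>{- K..K}. of_real (rho K j l) * Y (j, l) * V (l - k)) \<le> v / real_of_int K * M"
    by (simp add: mult_ac)
  assume C: "0 \<le> C" "\<And>l. cmod (g l) \<le> C"
  have "cmod (\<Sum>l\<in>{- K..K}. of_real (rho K j l) * Y (j, l) * g l) \<le> (\<Sum>l\<in>{- K..K}. rho K j l * (M * C))"
    by (rule sum_norm_le) (auto simp: norm_mult rho_nonneg mult.assoc M0 C intro!: mult_mono Y)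
  also have "\<dots> \<le> 1 * (M * C)"
    unfolding sum_distrib_right[symmetric] by (intro mult_right_mono rho_sum) (use M0 C in auto)
  finally show "cmod (\<Sum>l\<in>{- K..K}. of_real (rho K j l) * Y (j, l) * g l) \<le> M * C" by simp
qed

lemma riccati_exists:
  assumes V: "ell2 V v" and large: "16 * (v + 1)\<^sup>2 \<le> real_of_int K"
  obtains X where "\<And>j k. cmod (X j k) \<le> 2 * v * rho K j k"
    "\<And>j k. K < \<bar>j\<bar> \<Longrightarrow> \<bar>k\<bar> \<le> K \<Longrightarrow> of_real (pi\<^sup>2 * real_of_int (j\<^sup>2 - k\<^sup>2)) * X j k + V (j - k) + conv V (\<lambda>i. X i k) j
       = (\<Sum>l\<in>{- K..K}. X j l * V (l - k)) + (\<Sum>l\<in>{- K..K}. X j l * conv V (\<lambda>i. X i k) l)"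
proof -
  have v0: "0 \<le> v" using V by (rule ell2_nonneg)
  have K0: "0 < real_of_int K" using K by simp
  have sq: "16 * v\<^sup>2 + 32 * v + 16 \<le> real_of_int K" using large by (simp add: power2_sum)
  have v2: "0 \<le> v\<^sup>2" by simp
  define b where "b = v / real_of_int K"
  have b0: "0 \<le> b" using v0 K0 by (simp add: b_def)
  \<comment> \<open>Half of the left side is the Lipschitz constant on the ball of radius
    \<open>2 * v\<close>: the two linear terms give \<open>b\<close> each and the quadratic one
    twice \<open>2 * v * b\<close>.\<close>
  have b1: "b * (4 + 8 * v) \<le> 1"
  proof -
    have "v * (4 + 8 * v) = 8 * v\<^sup>2 + 4 * v" by (simp add: power2_eq_square algebra_simps)
    then have "v * (4 + 8 * v) \<le> real_of_int K" using sq v0 v2 by linarith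
    then show ?thesis using K0 by (simp add: b_def field_simps)
  qed
  let ?S = "{Y :: int \<times> int \<Rightarrow> complex. \<forall>p. cmod (Y p) \<le> 2 * v}"
  obtain Y where Y: "Y \<in> ?S" "riccati_op V Y = Y"
  proof (rule sup_contraction_fixpoint[where F = "riccati_op V" and \<rho> = "\<lambda>p :: int \<times> int. 2 * v" and R = "2 * v"])
    fix Y assume "Y \<in> ?S"
    then have Y: "cmod (Y p) \<le> 2 * v" for p by blast
    note t = riccati_terms[OF V Y, folded b_def]
    have "cmod (riccati_op V Y (j, k)) \<le> 2 * v" for j k
    proof -
      have "cmod (riccati_op V Y (j, k)) \<le> v + b * (2 * v) + b * (2 * v) + 2 * v * (b * (2 * v))"
        unfolding riccati_op_def prod.case
        by (intro order_trans[OF norm_triangle_ineq4] order_trans[OF norm_triangle_ineq] add_mono t ell2_point[OF V] mult_nonneg_nonneg b0)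
          (use v0 in auto)
      also have "\<dots> = v + v * (b * (4 + 4 * v))" by (simp add: algebra_simps)
      also have "\<dots> \<le> v + v * 1"
      proof (intro add_left_mono mult_left_mono v0)
        have "b * (4 + 8 * v) = b * (4 + 4 * v) + 4 * (b * v)" by (simp add: algebra_simps)
        then show "b * (4 + 4 * v) \<le> 1" using b1 mult_nonneg_nonneg[OF b0 v0] by linarith
      qed
      finally show ?thesis by simp
    qed
    then show "riccati_op V Y \<in> ?S" by auto
  next
    fix Y Z :: "int \<times> int \<Rightarrow> complex" and D and p :: "int \<times> int"
    assume YZ: "Y \<in> ?S" "Z \<in> ?S" and D: "0 \<le> (D::real)" "\<And>p. cmod (Y p - Z p) \<le> D"
    have Y: "cmod (Y p) \<le> 2 * v" and Z: "cmod (Z p) \<le> 2 * v" for p using YZ by blast+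
    obtain j k where p: "p = (j, k)" by force
    define W where "W p = Y p - Z p" for p
    have W: "cmod (W p) \<le> D" for p using D by (simp add: W_def)
    note tY = riccati_terms[OF V Y, folded b_def] and tZ = riccati_terms[OF V Z, folded b_def]
      and tW = riccati_terms[OF V W, folded b_def]
    let ?c = "\<lambda>U l. conv V (\<lambda>i. of_real (rho K i k) * U (i, k)) l"
    have B: "ell2 (\<lambda>i. complex_of_real (rho K i k)) (1 / real_of_int K)"
      using rho_ell2(1) by (simp add: ell2_def)
    have c: "?c Y l - ?c Z l = ?c W l" for l
      using conv_B_diff[OF V B bounded_seqI[of "\<lambda>i. Y (i, k)"] bounded_seqI[of "\<lambda>i. Z (i, k)"], OF Y Z, of l]
      by (simp add: W_def)
    \<comment> \<open>The quadratic term is telescoped by changing one factor at a time.\<close>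
    have "riccati_op V Y p - riccati_op V Z p = - (?c Y j - ?c Z j)
       + (\<Sum>l\<in>{- K..K}. of_real (rho K j l) * W (j, l) * V (l - k))
       - ((\<Sum>l\<in>{- K..K}. of_real (rho K j l) * W (j, l) * ?c Y l) + (\<Sum>l\<in>{- K..K}. of_real (rho K j l) * Z (j, l) * (?c Y l - ?c Z l)))"
      unfolding p riccati_op_def prod.case W_def
      by (simp add: algebra_simps sum.distrib sum_subtractf)
    also have "cmod \<dots> \<le> b * D + b * D + (D * (b * (2 * v)) + 2 * v * (b * D))"
      unfolding c
      by (intro order_trans[OF norm_triangle_ineq4] order_trans[OF norm_triangle_ineq] add_mono tW(2) tW(3) tZ(3) tY(1) tW(1) mult_nonneg_nonneg b0)
        (use v0 D tW(1) in auto)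
    also have "\<dots> = D * (b * (4 + 8 * v)) / 2" by (simp add: algebra_simps)
    also have "\<dots> \<le> D / 2" using b1 D mult_left_mono[OF b1 D(1)] by simp
    finally show "cmod (riccati_op V Y p - riccati_op V Z p) \<le> D / 2" .
  qed (use v0 in auto)
  then have Yb: "cmod (Y p) \<le> 2 * v" for p by blast
  define X where "X j k = - of_real (rho K j k) * Y (j, k)" for j k
  show ?thesis
  proof (rule that[of X])
    show "cmod (X j k) \<le> 2 * v * rho K j k" for j k
      using mult_right_mono[OF Yb[of "(j, k)"] rho_nonneg[of j k]] by (simp add: X_def norm_mult rho_nonneg mult.commute)
    fix j k assume jk: "K < \<bar>j\<bar>" "\<bar>k\<bar> \<le> K"
    have cX: "conv V (\<lambda>i. X i k) l = - conv V (\<lambda>i. of_real (rho K i k) * Y (i, k)) l" for l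
      unfolding conv_def X_def by (simp add: infsum_uminus)
    have "of_real (pi\<^sup>2 * real_of_int (j\<^sup>2 - k\<^sup>2)) * X j k = - of_real (pi\<^sup>2 * real_of_int (j\<^sup>2 - k\<^sup>2) * rho K j k) * Y (j, k)"
      by (simp add: X_def)
    also have "\<dots> = - riccati_op V Y (j, k)" unfolding rho_inverse[OF jk] Y(2) by simp
    finally show "of_real (pi\<^sup>2 * real_of_int (j\<^sup>2 - k\<^sup>2)) * X j k + V (j - k) + conv V (\<lambda>i. X i k) j
       = (\<Sum>l\<in>{- K..K}. X j l * V (l - k)) + (\<Sum>l\<in>{- K..K}. X j l * conv V (\<lambda>i. X i k) l)"
      unfolding riccati_op_def prod.case unfolding cX unfolding X_def by (simp add: sum_negf)
  qed
qed

end

lemma has_sum_sum_finite: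
  fixes f :: "'k \<Rightarrow> 'i \<Rightarrow> complex"
  assumes "finite I" "\<And>k. k \<in> I \<Longrightarrow> (f k has_sum s k) A"
  shows "((\<lambda>i. \<Sum>k\<in>I. f k i) has_sum (\<Sum>k\<in>I. s k)) A"
  using assms by (induction I rule: finite_induct) (simp_all add: has_sum_add)

lemma conv_sum:
  assumes "finite I" "\<And>k. k \<in> I \<Longrightarrow> (\<lambda>i. V (m - i) * G k i) summable_on UNIV"
  shows "conv V (\<lambda>i. \<Sum>k\<in>I. u k * G k i) m = (\<Sum>k\<in>I. u k * conv V (G k) m)"
proof -
  have "conv V (\<lambda>i. \<Sum>k\<in>I. u k * G k i) m = (\<Sum>\<^sub>\<infinity>i. \<Sum>k\<in>I. u k * (V (m - i) * G k i))"
    unfolding conv_def by (intro infsum_cong) (simp add: sum_distrib_left mult_ac)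
  also have "\<dots> = (\<Sum>k\<in>I. \<Sum>\<^sub>\<infinity>i. u k * (V (m - i) * G k i))"
    by (intro infsumI has_sum_sum_finite assms(1) has_sum_infsum summable_on_cmult_right assms(2))
  also have "\<dots> = (\<Sum>k\<in>I. u k * conv V (G k) m)"
    unfolding conv_def by (intro sum.cong refl infsum_cmult_right assms)
  finally show ?thesis .
qed

section \<open>Counting eigenvalues\<close>

text \<open>The graph of \<open>X\<close> over the modes \<open>\<bar>k\<bar> \<le> K\<close> is an invariant subspace of the Hill operator; all root
  vectors to the left of \<open>Re z = \<pi>\<^sup>2 (K\<^sup>2 + K)\<close> lie in it.\<close>

locale riccati_graph =
  fixes V :: "int \<Rightarrow> complex" and v :: real and K :: int and X :: "int \<Rightarrow> int \<Rightarrow> complex"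
  assumes V: "ell2 V v" and K: "1 \<le> K" and large: "16 * (v + 1)\<^sup>2 \<le> real_of_int K"
    and X_le: "\<And>j k. cmod (X j k) \<le> 2 * v * rho K j k"
    and X_eq: "\<And>j k. K < \<bar>j\<bar> \<Longrightarrow> \<bar>k\<bar> \<le> K \<Longrightarrow> of_real (pi\<^sup>2 * real_of_int (j\<^sup>2 - k\<^sup>2)) * X j k + V (j - k) + conv V (\<lambda>i. X i k) j
       = (\<Sum>l\<in>{- K..K}. X j l * V (l - k)) + (\<Sum>l\<in>{- K..K}. X j l * conv V (\<lambda>i. X i k) l)"
begin

definition graph_basis :: "int \<Rightarrow> int \<Rightarrow> complex" where
  "graph_basis k i = (if i = k then 1 else 0) + X i k"

text \<open>Only the low modes of \<open>u\<close> enter, and they are kept unchanged. Hence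
  membership in the graph can be written \<open>a = ext a\<close>, without a separate type of low
  sequences.\<close>

definition ext :: "(int \<Rightarrow> complex) \<Rightarrow> int \<Rightarrow> complex" where
  "ext u i = (\<Sum>k\<in>{- K..K}. u k * graph_basis k i)"

definition bound :: real where
  "bound = pi\<^sup>2 * (real_of_int K * real_of_int K + real_of_int K)"

lemma v0: "0 \<le> v" using V by (rule ell2_nonneg)

lemma large': "16 * v * v + 32 * v + 16 \<le> real_of_int K"
  using large by (simp add: power2_eq_square algebra_simps)

lemma K0: "0 < real_of_int K" using K by simp

lemma X_zero: "\<not> (K < \<bar>j\<bar> \<and> \<bar>k\<bar> \<le> K) \<Longrightarrow> X j k = 0"
  using X_le[of j k] by (auto simp: rho_def)

lemma ext_low: "\<bar>i\<bar> \<le> K \<Longrightarrow> ext u i = u i"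
proof -
  assume i: "\<bar>i\<bar> \<le> K"
  have "ext u i = (\<Sum>k\<in>{- K..K}. if i = k then u k else 0)"
    unfolding ext_def graph_basis_def using i by (intro sum.cong refl) (simp add: X_zero)
  also have "\<dots> = u i" using i by (subst sum.delta') (auto simp: abs_le_iff)
  finally show ?thesis .
qed

lemma ext_high: "K < \<bar>i\<bar> \<Longrightarrow> ext u i = (\<Sum>k\<in>{- K..K}. X i k * u k)"
  unfolding ext_def graph_basis_def by (intro sum.cong) (auto simp: mult.commute)

lemma ext_cong: "(\<And>k. \<bar>k\<bar> \<le> K \<Longrightarrow> u k = w k) \<Longrightarrow> ext u = ext w"
  unfolding ext_def by (intro ext sum.cong refl) (auto simp: abs_le_iff)

lemma ext_ext: "ext (ext u) = ext u"
  by (rule ext_cong) (rule ext_low)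

lemma ext_lin: "ext (\<lambda>k. s * u k + t * w k) i = s * ext u i + t * ext w i"
  unfolding ext_def by (simp add: sum_distrib_left sum.distrib algebra_simps)

lemma X_decays: "decays (\<lambda>i. X i k)"
  unfolding decays_def
proof (intro exI allI)
  fix i
  show "(1 + (real_of_int i)\<^sup>2) * cmod (X i k) \<le> 2 * v * (2 + (real_of_int K)\<^sup>2)"
  proof (cases "K < \<bar>i\<bar> \<and> \<bar>k\<bar> \<le> K")
    case True
    have k2: "k\<^sup>2 \<le> K\<^sup>2" using True K by (simp add: abs_le_square_iff[symmetric])
    have "K * 1 \<le> K * (\<bar>i\<bar> - K)" using True K by (intro mult_left_mono) auto
    then have "1 \<le> i\<^sup>2 - k\<^sup>2" using edge_high[OF K, of i] True K k2 by linarith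
    define m where "m = real_of_int (i\<^sup>2 - k\<^sup>2)"
    have m1: "1 \<le> m" using \<open>1 \<le> i\<^sup>2 - k\<^sup>2\<close> unfolding m_def by (simp only: of_int_1_le_iff)
    have i2: "(real_of_int i)\<^sup>2 = m + (real_of_int k)\<^sup>2" by (simp add: m_def)
    have "real_of_int (k\<^sup>2) \<le> real_of_int (K\<^sup>2)" using k2 by (simp only: of_int_le_iff)
    then have "1 + (real_of_int i)\<^sup>2 \<le> (1 + (real_of_int K)\<^sup>2) * 1 + m" unfolding i2 by simp
    also have "\<dots> \<le> (1 + (real_of_int K)\<^sup>2) * m + m" using m1 by (intro add_right_mono mult_left_mono) auto
    finally have le: "1 + (real_of_int i)\<^sup>2 \<le> (2 + (real_of_int K)\<^sup>2) * m" by (simp add: algebra_simps)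
    have "rho K i k \<le> 1 / (9 * real_of_int (i\<^sup>2 - k\<^sup>2))" by (rule rho_le_gen(1)) (use \<open>1 \<le> i\<^sup>2 - k\<^sup>2\<close> in auto)
    also have "\<dots> \<le> 1 / m" unfolding m_def[symmetric] using m1 by (intro frac_le) auto
    finally have "cmod (X i k) \<le> 2 * v * (1 / m)" using X_le[of i k] v0 by (meson mult_left_mono order_trans mult_nonneg_nonneg zero_le_numeral)
    then have "(1 + (real_of_int i)\<^sup>2) * cmod (X i k) \<le> ((2 + (real_of_int K)\<^sup>2) * m) * (2 * v * (1 / m))"
      using le m1 v0 by (intro mult_mono) auto
    also have "\<dots> = 2 * v * (2 + (real_of_int K)\<^sup>2)" using m1 by simp
    finally show ?thesis .
  qed (use v0 in \<open>auto simp: X_zero\<close>)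
qed

lemma graph_basis_decays: "decays (graph_basis k)"
proof -
  have "finite {i. (if i = k then 1 else 0 :: complex) \<noteq> 0}" by (rule finite_subset[of _ "{k}"]) auto
  from decays_add[OF decays_finite_support[OF this] X_decays[of k]] show ?thesis by (simp add: graph_basis_def[abs_def])
qed

lemma decays_sum:
  assumes "finite I" "\<And>k. k \<in> I \<Longrightarrow> decays (a k)" shows "decays (\<lambda>i. \<Sum>k\<in>I. u k * a k i)"
  using assms
proof (induction I rule: finite_induct)
  case (insert k I)
  have "decays (\<lambda>i. u k * a k i + (\<Sum>k\<in>I. u k * a k i))"
    by (intro decays_add decays_scale insert) auto
  then show ?case using insert by simp
qed simp

lemma ext_decays: "decays (ext u)"
  unfolding ext_def[abs_def] by (intro decays_sum graph_basis_decays) auto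

lemma conv_summable_decays: "decays a \<Longrightarrow> (\<lambda>i. V (m - i) * a i) summable_on UNIV"
  using conv_summable(1)[OF V] decays_ell2 by metis

lemma conv_graph_basis: "conv V (graph_basis k) m = V (m - k) + conv V (\<lambda>i. X i k) m"
proof -
  have d: "((\<lambda>i. V (m - i) * (if i = k then 1 else 0)) has_sum V (m - k)) UNIV"
    by (rule has_sum_finite_neutralI[where B = "{k}"]) auto
  have "conv V (graph_basis k) m = (\<Sum>\<^sub>\<infinity>i. V (m - i) * (if i = k then 1 else 0) + V (m - i) * X i k)"
    unfolding conv_def graph_basis_def by (intro infsum_cong) (simp add: distrib_left)
  also have "\<dots> = (\<Sum>\<^sub>\<infinity>i. V (m - i) * (if i = k then 1 else 0)) + (\<Sum>\<^sub>\<infinity>i. V (m - i) * X i k)"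
    by (intro infsum_add conv_summable_decays[OF X_decays] has_sum_imp_summable[OF d])
  also have "(\<Sum>\<^sub>\<infinity>i. V (m - i) * (if i = k then 1 else 0)) = V (m - k)" using infsumI[OF d] .
  finally show ?thesis by (simp add: conv_def)
qed

lemma conv_ext: "conv V (ext u) m = (\<Sum>k\<in>{- K..K}. u k * (V (m - k) + conv V (\<lambda>i. X i k) m))"
  unfolding ext_def[abs_def] conv_graph_basis[symmetric]
  by (rule conv_sum) (auto intro: conv_summable_decays graph_basis_decays)

text \<open>For a high mode \<open>j\<close> the claim is the Riccati equation applied to the vector
  \<open>u\<close>; for low modes it is trivial.\<close>

lemma hill_ext: "hill_seq V (ext u) = ext (hill_seq V (ext u))"
proof (rule HOL.ext)
  fix j
  show "hill_seq V (ext u) j = ext (hill_seq V (ext u)) j"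
  proof (cases "\<bar>j\<bar> \<le> K")
    case False
    then have j: "K < \<bar>j\<bar>" by simp
    let ?I = "{- K..K}" and ?c = "\<lambda>k m. conv V (\<lambda>i. X i k) m"
    have low: "hill_seq V (ext u) l = of_real (pi\<^sup>2 * (real_of_int l)\<^sup>2) * u l + (\<Sum>k\<in>?I. u k * (V (l - k) + ?c k l))" if "l \<in> ?I" for l
      using that by (simp add: hill_seq_def ext_low conv_ext abs_le_iff)
    have "ext (hill_seq V (ext u)) j = (\<Sum>l\<in>?I. X j l * (of_real (pi\<^sup>2 * (real_of_int l)\<^sup>2) * u l + (\<Sum>k\<in>?I. u k * (V (l - k) + ?c k l))))"
      unfolding ext_high[OF j] by (intro sum.cong refl) (simp only: low)
    also have "\<dots> = (\<Sum>l\<in>?I. X j l * (of_real (pi\<^sup>2 * (real_of_int l)\<^sup>2) * u l)) + (\<Sum>l\<in>?I. \<Sum>k\<in>?I. u k * (X j l * V (l - k) + X j l * ?c k l))"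
      by (simp add: distrib_left sum.distrib sum_distrib_left mult_ac)
    also have "(\<Sum>l\<in>?I. \<Sum>k\<in>?I. u k * (X j l * V (l - k) + X j l * ?c k l)) = (\<Sum>k\<in>?I. u k * (\<Sum>l\<in>?I. X j l * V (l - k) + X j l * ?c k l))"
      by (subst sum.swap) (simp add: sum_distrib_left)
    also have "\<dots> = (\<Sum>k\<in>?I. u k * (of_real (pi\<^sup>2 * real_of_int (j\<^sup>2 - k\<^sup>2)) * X j k + V (j - k) + ?c k j))"
    proof (intro sum.cong refl)
      fix k assume "k \<in> ?I"
      then have "\<bar>k\<bar> \<le> K" by auto
      then show "u k * (\<Sum>l\<in>?I. X j l * V (l - k) + X j l * ?c k l) = u k * (of_real (pi\<^sup>2 * real_of_int (j\<^sup>2 - k\<^sup>2)) * X j k + V (j - k) + ?c k j)"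
        unfolding X_eq[OF j \<open>\<bar>k\<bar> \<le> K\<close>] by (simp add: sum.distrib)
    qed
    also have "(\<Sum>l\<in>?I. X j l * (of_real (pi\<^sup>2 * (real_of_int l)\<^sup>2) * u l)) + \<dots>
       = (\<Sum>k\<in>?I. of_real (pi\<^sup>2 * (real_of_int j)\<^sup>2) * (X j k * u k) + u k * (V (j - k) + ?c k j))"
      unfolding sum.distrib[symmetric] by (intro sum.cong refl) (simp add: algebra_simps)
    also have "\<dots> = hill_seq V (ext u) j"
      unfolding hill_seq_def ext_high[OF j] conv_ext by (simp add: sum.distrib sum_distrib_left)
    finally show ?thesis by simp
  qed (simp add: ext_low)
qed

text \<open>This is the operator induced on the quotient by the graph: the diagonal, plus the high
  block of \<open>V\<close>, minus \<open>X\<close> times the block of \<open>V\<close> from high to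
  low modes. To the left of the cut its divisors are so large that \<open>h\<close>, the diagonal
  part of the equation, is at most half of itself.\<close>

lemma high_kernel_zero:
  assumes y: "decays y" "\<And>k. \<bar>k\<bar> \<le> K \<Longrightarrow> y k = 0" and z: "Re z \<le> bound"
    and eq: "\<And>j. K < \<bar>j\<bar> \<Longrightarrow> (z - of_real (pi\<^sup>2 * (real_of_int j)\<^sup>2)) * y j = conv V y j - (\<Sum>l\<in>{- K..K}. X j l * conv V y l)"
  shows "y j = 0"
proof -
  define d where "d j = z - complex_of_real (pi\<^sup>2 * (real_of_int j)\<^sup>2)" for j
  define B where "B j = (if K < \<bar>j\<bar> then 1 / d j else 0)" for j
  define h where "h j = (if K < \<bar>j\<bar> then d j * y j else 0)" for j
  have dge: "9 * (real_of_int K * real_of_int (edge_dist K j)) \<le> cmod (d j)" if j: "K < \<bar>j\<bar>" for j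
  proof -
    have "real_of_int (K * (\<bar>j\<bar> - K)) \<le> real_of_int (j\<^sup>2 - K\<^sup>2 - K)" using edge_high[OF K j] by (simp only: of_int_le_iff)
    then have e: "real_of_int K * real_of_int (edge_dist K j) \<le> (real_of_int j)\<^sup>2 - (real_of_int K * real_of_int K + real_of_int K)"
      using j by (simp add: edge_dist_def power2_eq_square)
    have "9 * (real_of_int K * real_of_int (edge_dist K j)) \<le> pi\<^sup>2 * (real_of_int K * real_of_int (edge_dist K j))"
      using pi_squared_ge K edge_dist_ge[of K j] by (intro mult_right_mono) auto
    also have "\<dots> \<le> pi\<^sup>2 * ((real_of_int j)\<^sup>2 - (real_of_int K * real_of_int K + real_of_int K))"
      using e by (intro mult_left_mono) auto
    also have "\<dots> \<le> \<bar>Re z - pi\<^sup>2 * (real_of_int j)\<^sup>2\<bar>" using z unfolding bound_def right_diff_distrib by linarith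
    also have "\<dots> \<le> cmod (d j)" unfolding d_def by (rule cmod_le_Re)
    finally show ?thesis .
  qed
  have dpos: "d j \<noteq> 0" if "K < \<bar>j\<bar>" for j
  proof -
    have "0 < real_of_int K * real_of_int (edge_dist K j)" using K0 edge_dist_ge[of K j] by (intro mult_pos_pos) auto
    then show ?thesis using dge[OF that] by auto
  qed
  have yB: "y = (\<lambda>j. B j * h j)" using y(2) dpos by (auto simp: B_def h_def fun_eq_iff)
  have Bl: "ell2 B (1 / real_of_int K)"
  proof -
    have "ell2 B ((1 / (9 * real_of_int K)) * 2)"
    proof (rule ell2_scale[OF edge_ell2[of "\<lambda>j. K < \<bar>j\<bar>" K]])
      fix j show "norm (B j) \<le> (1 / (9 * real_of_int K)) * norm (if K < \<bar>j\<bar> then edge K j else 0)"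
      proof (cases "K < \<bar>j\<bar>")
        case True
        have "0 < real_of_int K * real_of_int (edge_dist K j)" using K0 edge_dist_ge[of K j] by (intro mult_pos_pos) auto
        then have "1 / cmod (d j) \<le> 1 / (9 * (real_of_int K * real_of_int (edge_dist K j)))"
          using dge[OF True] by (intro frac_le) auto
        then show ?thesis using True edge_dist_ge[of K j] by (simp add: B_def norm_divide edge_def mult.assoc)
      qed (simp add: B_def)
    qed (use K in auto)
    then show ?thesis by (rule ell2_mono) (use K0 in \<open>simp add: field_simps\<close>)
  qed
  obtain A where A: "ell2 y A" using y(1) by (rule decays_ell2)
  define s where "s = v / real_of_int K"
  have s: "0 \<le> s" "s * (1 + 2 * v) \<le> 1 / 2"
  proof -
    show "0 \<le> s" using v0 K0 by (simp add: s_def)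
    have "v * (1 + 2 * v) = v + 2 * (v * v)" by (simp add: algebra_simps)
    then have "v * (1 + 2 * v) \<le> real_of_int K / 2" using large' v0 mult_nonneg_nonneg[OF v0 v0] by linarith
    then show "s * (1 + 2 * v) \<le> 1 / 2" using K0 by (simp add: s_def field_simps)
  qed
  have sumX: "cmod (\<Sum>l\<in>{- K..K}. X j l * g l) \<le> 2 * v * C" if "0 \<le> C" "\<And>l. cmod (g l) \<le> C" for j g C
  proof -
    have "cmod (\<Sum>l\<in>{- K..K}. X j l * g l) \<le> (\<Sum>l\<in>{- K..K}. (2 * v * rho K j l) * C)"
      by (rule sum_norm_le) (auto simp: norm_mult intro!: mult_mono X_le that v0 mult_nonneg_nonneg rho_nonneg[OF K])
    also have "\<dots> = 2 * v * C * (\<Sum>l\<in>{- K..K}. rho K j l)" by (simp add: sum_distrib_left mult_ac)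
    also have "\<dots> \<le> 2 * v * C * 1" using v0 that by (intro mult_left_mono rho_sum[OF K]) auto
    finally show ?thesis by simp
  qed
  have hb: "cmod (h j) \<le> C + 2 * v * C" if C: "\<And>l. cmod (conv V y l) \<le> C" for C j
  proof -
    have C0: "0 \<le> C" using C norm_ge_zero order_trans by blast
    show ?thesis
    proof (cases "K < \<bar>j\<bar>")
      case True
      have "cmod (h j) \<le> cmod (conv V y j) + cmod (\<Sum>l\<in>{- K..K}. X j l * conv V y l)"
        using True eq[OF True] by (simp add: h_def d_def norm_triangle_ineq4)
      then show ?thesis using C[of j] sumX[where g = "conv V y" and j = j, OF C0 C] by linarith
    qed (use C0 v0 in \<open>simp add: h_def\<close>)
  qed
  have "cmod (h j) \<le> 2 * 0" for j
  proof (rule half_absorb[where X = "\<lambda>j. cmod (h j)" and i = j])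
    show "cmod (h i) \<le> v * A + 2 * v * (v * A)" for i by (rule hb) (rule conv_summable(2)[OF V A])
    fix C i assume C: "\<And>i. cmod (h i) \<le> C"
    have C0: "0 \<le> C" using C norm_ge_zero order_trans by blast
    have "cmod (conv V y l) \<le> s * C" for l
      using conv_B1(2)[OF V Bl, where y = h and D = C and k = l, OF C] yB by (simp add: s_def)
    then have "cmod (h i) \<le> s * C + 2 * v * (s * C)" by (rule hb)
    also have "\<dots> = s * (1 + 2 * v) * C" by (simp add: algebra_simps)
    also have "\<dots> \<le> 1 / 2 * C" by (intro mult_right_mono s C0)
    finally show "cmod (h i) \<le> 0 + C / 2" by simp
  qed
  then have "h j = 0" by simp
  then show ?thesis using fun_cong[OF yB, of j] by simp
qed

text \<open>The difference \<open>y = a - ext a\<close> has no low modes and represents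
  \<open>a\<close> modulo the graph. Since the graph is invariant and contains \<open>b\<close>,
  what is left for \<open>y\<close> is the kernel equation of the quotient operator.\<close>

lemma root_in_graph:
  assumes a: "decays a" and b: "b = ext b" and z: "Re z \<le> bound"
    and eq: "\<And>k. hill_seq V a k = z * a k + b k"
  shows "a = ext a"
proof -
  define y where "y k = 1 * a k + (-1) * ext a k" for k
  have yd: "decays y" unfolding y_def by (intro decays_add decays_scale a ext_decays)
  have y0: "y k = 0" if "\<bar>k\<bar> \<le> K" for k using that by (simp add: y_def ext_low)
  have hy: "hill_seq V y k = hill_seq V a k - hill_seq V (ext a) k" for k
    unfolding y_def using hill_seq_lin[OF V a ext_decays, of 1 "-1" a k] by simp
  have "y j = 0" for j
  proof (rule high_kernel_zero[OF yd y0 z])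
    fix j assume j: "K < \<bar>j\<bar>"
    let ?I = "{- K..K}"
    have low: "hill_seq V (ext a) l = z * a l + b l - conv V y l" if "l \<in> ?I" for l
    proof -
      have "conv V y l = hill_seq V y l" using y0[of l] that by (simp add: hill_seq_def abs_le_iff)
      then show ?thesis using hy[of l] eq[of l] by simp
    qed
    have "hill_seq V (ext a) j = (\<Sum>l\<in>?I. X j l * hill_seq V (ext a) l)"
      using hill_ext[of a] ext_high[OF j] by metis
    also have "\<dots> = (\<Sum>l\<in>?I. X j l * (z * a l + b l - conv V y l))"
      by (intro sum.cong refl) (simp only: low)
    also have "\<dots> = z * (\<Sum>l\<in>?I. X j l * a l) + (\<Sum>l\<in>?I. X j l * b l) - (\<Sum>l\<in>?I. X j l * conv V y l)"
      by (simp add: algebra_simps sum.distrib sum_subtractf sum_distrib_left)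
    also have "(\<Sum>l\<in>?I. X j l * a l) = ext a j" using ext_high[OF j] by simp
    also have "(\<Sum>l\<in>?I. X j l * b l) = b j" using ext_high[OF j, of b] b by metis
    finally have e: "hill_seq V (ext a) j = z * ext a j + b j - (\<Sum>l\<in>?I. X j l * conv V y l)" .
    have yj: "y j = a j - ext a j" by (simp add: y_def)
    have "hill_seq V y j = z * y j + (\<Sum>l\<in>?I. X j l * conv V y l)"
      unfolding hy e eq yj by (simp add: algebra_simps)
    then show "(z - of_real (pi\<^sup>2 * (real_of_int j)\<^sup>2)) * y j = conv V y j - (\<Sum>l\<in>?I. X j l * conv V y l)"
      unfolding hill_seq_def by (simp add: algebra_simps)
  qed
  then show ?thesis by (simp add: y_def fun_eq_iff)
qed

text \<open>To the right of the cut the divisors of the low modes are large, and on the graph the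
  high modes are determined by the low ones through \<open>X\<close>. Combined with
  \<open>root_in_graph\<close>, which reaches up to the same line, this shows that the line itself
  carries no eigenvalue.\<close>

lemma graph_no_eigenvalue:
  assumes a: "a = ext a" and z: "bound \<le> Re z" and eq: "\<And>k. hill_seq V a k = z * a k"
  shows "a k = 0"
proof -
  have ad: "decays a" using ext_decays a by metis
  define d where "d j = z - complex_of_real (pi\<^sup>2 * (real_of_int j)\<^sup>2)" for j
  define h where "h j = (if \<bar>j\<bar> \<le> K then d j * a j else 0)" for j
  have dge: "9 * (real_of_int K * real_of_int (edge_dist K j)) \<le> cmod (d j)" if j: "\<bar>j\<bar> \<le> K" for j
  proof -
    have "real_of_int (K * (K + 1 - \<bar>j\<bar>)) \<le> real_of_int (K\<^sup>2 + K - j\<^sup>2)" using edge_low[OF K j] by (simp only: of_int_le_iff)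
    then have e: "real_of_int K * real_of_int (edge_dist K j) \<le> (real_of_int K * real_of_int K + real_of_int K) - (real_of_int j)\<^sup>2"
      using j by (simp add: edge_dist_def power2_eq_square)
    have "9 * (real_of_int K * real_of_int (edge_dist K j)) \<le> pi\<^sup>2 * (real_of_int K * real_of_int (edge_dist K j))"
      using pi_squared_ge K edge_dist_ge[of K j] by (intro mult_right_mono) auto
    also have "\<dots> \<le> pi\<^sup>2 * ((real_of_int K * real_of_int K + real_of_int K) - (real_of_int j)\<^sup>2)"
      using e by (intro mult_left_mono) auto
    also have "\<dots> \<le> \<bar>Re z - pi\<^sup>2 * (real_of_int j)\<^sup>2\<bar>" using z unfolding bound_def right_diff_distrib by linarith
    also have "\<dots> \<le> cmod (d j)" unfolding d_def by (rule cmod_le_Re)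
    finally show ?thesis .
  qed
  have ah: "d j * a j = conv V a j" if "\<bar>j\<bar> \<le> K" for j
    using eq[of j] unfolding hill_seq_def d_def by (simp add: algebra_simps)
  have epos: "0 < edge K j" "edge K j \<le> 1" for j by (rule edge_pos edge_le_1)+
  have alow: "cmod (a j) \<le> (C / (9 * real_of_int K)) * edge K j" if C: "\<And>i. cmod (h i) \<le> C" and j: "\<bar>j\<bar> \<le> K" for C j
  proof -
    have p: "0 < real_of_int (edge_dist K j)" using edge_dist_ge[of K j] by simp
    have "9 * (real_of_int K * real_of_int (edge_dist K j)) * cmod (a j) \<le> cmod (d j) * cmod (a j)"
      using dge[OF j] by (intro mult_right_mono) auto
    also have "\<dots> \<le> C" using C[of j] j by (simp add: h_def norm_mult)
    finally show ?thesis using p K0 by (simp add: edge_def field_simps)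
  qed
  obtain A where A: "ell2 a A" using ad by (rule decays_ell2)
  have "cmod (h j) \<le> 2 * 0" for j
  proof (rule half_absorb[where X = "\<lambda>j. cmod (h j)" and i = j])
    show "cmod (h i) \<le> v * A" for i
      using conv_summable(2)[OF V A, of i] ah[of i] ell2_nonneg[OF V] ell2_nonneg[OF A] by (auto simp: h_def)
    fix C i assume C: "\<And>i. cmod (h i) \<le> C"
    have C0: "0 \<le> C" using C norm_ge_zero order_trans by blast
    \<comment> \<open>The \<open>2 * K + 1 \<le> 3 * K\<close> summands each contain two factors
      \<open>1 / (9 * K)\<close>, one from \<open>X\<close> and one from the low modes, so one power
      of \<open>1 / K\<close> survives.\<close>
    have ahigh: "cmod (a j) \<le> (C * v / (9 * real_of_int K)) * edge K j" if j: "K < \<bar>j\<bar>" for j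
    proof -
      have "a j = (\<Sum>l\<in>{- K..K}. X j l * a l)" using ext_high[OF j, of a] a by metis
      also have "cmod \<dots> \<le> (\<Sum>l\<in>{- K..K}. (2 * v * ((1 / (9 * real_of_int K)) * edge K j)) * (C / (9 * real_of_int K)))"
      proof (rule sum_norm_le)
        fix l assume "l \<in> {- K..K}"
        then have l: "\<bar>l\<bar> \<le> K" by auto
        have "C / (9 * real_of_int K) * edge K l \<le> C / (9 * real_of_int K) * 1"
          using C0 K0 epos(2)[of l] by (intro mult_left_mono) auto
        then have "cmod (a l) \<le> C / (9 * real_of_int K)" using alow[OF C l] by simp
        moreover have "cmod (X j l) \<le> 2 * v * ((1 / (9 * real_of_int K)) * edge K j)"
          using X_le[of j l] mult_left_mono[OF rho_high[OF K, of j l], of "2 * v"] v0 j by simp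
        ultimately show "cmod (X j l * a l) \<le> (2 * v * ((1 / (9 * real_of_int K)) * edge K j)) * (C / (9 * real_of_int K))"
          unfolding norm_mult using v0 K0 epos(1)[of j] by (intro mult_mono) auto
      qed
      also have "\<dots> = real_of_int (2 * K + 1) * ((2 * v * ((1 / (9 * real_of_int K)) * edge K j)) * (C / (9 * real_of_int K)))"
        using K by simp
      also have "\<dots> \<le> (3 * real_of_int K) * ((2 * v * ((1 / (9 * real_of_int K)) * edge K j)) * (C / (9 * real_of_int K)))"
        using K v0 C0 epos(1)[of j] by (intro mult_right_mono) auto
      also have "\<dots> = (2 / 3) * ((C * v / (9 * real_of_int K)) * edge K j)" using K0 by (simp add: field_simps)
      also have "\<dots> \<le> 1 * ((C * v / (9 * real_of_int K)) * edge K j)"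
        using v0 C0 K0 epos(1)[of j] by (intro mult_right_mono) auto
      finally show ?thesis by simp
    qed
    let ?e = "\<lambda>j. (if \<bar>j\<bar> \<le> K then edge K j else 0) + (if K < \<bar>j\<bar> then edge K j else 0)"
    have "ell2 ?e (2 + 2)"
      by (intro ell2_add edge_ell2) auto
    then have "ell2 a ((C * (1 + v) / (9 * real_of_int K)) * (2 + 2))"
    proof (rule ell2_scale)
      fix j
      have "?e j = edge K j" by auto
      moreover have "cmod (a j) \<le> (C * (1 + v) / (9 * real_of_int K)) * edge K j"
      proof (cases "\<bar>j\<bar> \<le> K")
        case True
        have "C / (9 * real_of_int K) * edge K j \<le> (C * (1 + v) / (9 * real_of_int K)) * edge K j"
          using C0 v0 K0 epos(1)[of j] by (intro mult_right_mono divide_right_mono) (auto simp: algebra_simps)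
        then show ?thesis using alow[OF C True] by linarith
      next
        case False
        have "(C * v / (9 * real_of_int K)) * edge K j \<le> (C * (1 + v) / (9 * real_of_int K)) * edge K j"
          using C0 v0 K0 epos(1)[of j] by (intro mult_right_mono divide_right_mono) (auto simp: algebra_simps)
        then show ?thesis using ahigh[of j] False by linarith
      qed
      ultimately show "norm (a j) \<le> (C * (1 + v) / (9 * real_of_int K)) * norm (?e j)"
        using epos(1)[of j] by simp
    qed (use C0 v0 K0 in auto)
    from conv_summable(2)[OF V this] have c: "cmod (conv V a i) \<le> v * ((C * (1 + v) / (9 * real_of_int K)) * (2 + 2))" .
    have "v * (1 + v) * 4 = 4 * v + 4 * (v * v)" by (simp add: algebra_simps)
    then have "v * (1 + v) * 4 \<le> 9 * real_of_int K / 2" using large' v0 mult_nonneg_nonneg[OF v0 v0] K0 by linarith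
    then have "v * (1 + v) * 4 * C \<le> 9 * real_of_int K / 2 * C" by (rule mult_right_mono[OF _ C0])
    then have "v * ((C * (1 + v) / (9 * real_of_int K)) * (2 + 2)) \<le> C / 2"
      using K0 by (simp add: field_simps)
    then have "cmod (conv V a i) \<le> C / 2" using c by linarith
    then show "cmod (h i) \<le> 0 + C / 2" using ah[of i] C0 by (auto simp: h_def)
  qed
  then have h0: "cmod (h i) \<le> 0" for i by simp
  have low0: "a l = 0" if "\<bar>l\<bar> \<le> K" for l using alow[OF h0 that] by simp
  have "ext a k = 0" unfolding ext_def by (rule sum.neutral) (use low0 in \<open>auto simp: abs_le_iff\<close>)
  then show ?thesis using a by metis
qed

end

lemma riccati_graph_exists:
  assumes "ell2 V v" "1 \<le> K" "16 * (v + 1)\<^sup>2 \<le> real_of_int K"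
  obtains X where "riccati_graph V v K X"
proof -
  obtain X where "\<And>j k. cmod (X j k) \<le> 2 * v * rho K j k"
    "\<And>j k. K < \<bar>j\<bar> \<Longrightarrow> \<bar>k\<bar> \<le> K \<Longrightarrow> of_real (pi\<^sup>2 * real_of_int (j\<^sup>2 - k\<^sup>2)) * X j k + V (j - k) + conv V (\<lambda>i. X i k) j
       = (\<Sum>l\<in>{- K..K}. X j l * V (l - k)) + (\<Sum>l\<in>{- K..K}. X j l * conv V (\<lambda>i. X i k) l)"
    using riccati_exists[OF assms(2,1,3)] by blast
  then show ?thesis using that[of X] assms by (simp add: riccati_graph_def)
qed

section \<open>Transfer from sequences to functions\<close>

interpretation cfs: complex_vector_space "\<lambda>(c::complex) (f::real \<Rightarrow> complex) x. c * f x"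
  by (simp add: complex_vector_space_def cfun.vector_space_axioms)

lemma sum_fun_app: "(\<Sum>k\<in>I. g k) x = (\<Sum>k\<in>I. (g k :: real \<Rightarrow> complex) x)"
  by (induction I rule: infinite_finite_induct) auto

lemma synth_zero: "synth (\<lambda>_. 0) = 0" "synth 0 = 0"
  by (simp_all add: synth_def fun_eq_iff)

lemma cf_synth_fun: "decays a \<Longrightarrow> cf (synth a) = a"
  using cf_synth by blast

lemma synth_eq_zero: "decays a \<Longrightarrow> synth a = 0 \<Longrightarrow> a = (\<lambda>_. 0)"
  using synth_inj[of a "\<lambda>_. 0"] by (simp add: synth_zero)

lemma root_kernel_Suc: "f \<in> root_kernel q z (Suc k) \<longleftrightarrow> (\<exists>v\<in>root_kernel q z k. hill_op q f (\<lambda>x. z * f x + v x))"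
  by simp

context riccati_graph
begin

definition graphE :: "(real \<Rightarrow> complex) set" where
  "graphE = synth ` {a. a = ext a}"

text \<open>Multiplicities are dimensions of spaces of functions, so the restricted operator is
  carried over to functions. On the graph its values are again in the graph, so the series summed
  here converges.\<close>

definition graphT :: "(real \<Rightarrow> complex) \<Rightarrow> real \<Rightarrow> complex" where
  "graphT f = synth (hill_seq V (cf f))"

lemma graphE_cases:
  assumes "f \<in> graphE" obtains a where "a = ext a" "decays a" "f = synth a" "cf f = a"
proof -
  obtain a where a: "a = ext a" "f = synth a" using assms by (auto simp: graphE_def)
  have d: "decays a" using ext_decays a(1) by metis
  show ?thesis using that[OF a(1) d a(2)] cf_synth_fun[OF d] a(2) by blast
qed

lemma synth_ext: "synth (ext u) x = (\<Sum>k\<in>{- K..K}. u k * synth (graph_basis k) x)"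
proof -
  have "((\<lambda>i. \<Sum>k\<in>{- K..K}. u k * (graph_basis k i * mode i x)) has_sum (\<Sum>k\<in>{- K..K}. u k * synth (graph_basis k) x)) UNIV"
    unfolding synth_def
    by (intro has_sum_sum_finite has_sum_cmult_right has_sum_infsum synth_summable graph_basis_decays) auto
  then have "(\<Sum>\<^sub>\<infinity>i. \<Sum>k\<in>{- K..K}. u k * (graph_basis k i * mode i x)) = (\<Sum>k\<in>{- K..K}. u k * synth (graph_basis k) x)"
    by (rule infsumI)
  then show ?thesis unfolding synth_def ext_def by (simp add: sum_distrib_right mult.assoc)
qed

lemma graphE_comb: "a = ext a \<Longrightarrow> b = ext b \<Longrightarrow> (\<lambda>k. s * a k + t * b k) = ext (\<lambda>k. s * a k + t * b k)"
  by (rule HOL.ext) (simp add: ext_lin)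

lemma hill_graph: "a = ext a \<Longrightarrow> hill_seq V a = ext (hill_seq V a)"
  using hill_ext[of a] by simp

lemma graph_endo: "cfs.endo graphE graphT"
  unfolding cfs.endo_def
proof (intro conjI ballI allI)
  show "cfun.subspace graphE"
  proof (rule cfun.subspaceI)
    have "(\<lambda>_. 0) = ext (\<lambda>_. 0)" by (simp add: ext_def fun_eq_iff)
    then show "0 \<in> graphE" unfolding graphE_def using synth_zero(1) by (metis (mono_tags) image_eqI mem_Collect_eq)
    show "f + g \<in> graphE" if fg: "f \<in> graphE" "g \<in> graphE" for f g
    proof -
      obtain a where a: "a = ext a" "decays a" "f = synth a" using fg(1) by (rule graphE_cases)
      obtain b where b: "b = ext b" "decays b" "g = synth b" using fg(2) by (rule graphE_cases)
      have "f + g = synth (\<lambda>k. 1 * a k + 1 * b k)"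
        unfolding a(3) b(3) fun_eq_iff using synth_lin[OF a(2) b(2), of 1 1] by simp
      then show ?thesis unfolding graphE_def using graphE_comb[OF a(1) b(1), of 1 1] by blast
    qed
    show "(\<lambda>x. c * f x) \<in> graphE" if f: "f \<in> graphE" for c f
    proof -
      obtain a where a: "a = ext a" "decays a" "f = synth a" using f by (rule graphE_cases)
      have "(\<lambda>x. c * f x) = synth (\<lambda>k. c * a k + 0 * a k)"
        unfolding a(3) fun_eq_iff using synth_lin[OF a(2) a(2), of c 0] by simp
      then show ?thesis unfolding graphE_def using graphE_comb[OF a(1) a(1), of c 0] by blast
    qed
  qed
  show "cfs.fin_dim graphE"
    unfolding cfs.fin_dim_def
  proof (intro exI conjI)
    show "finite ((\<lambda>k. synth (graph_basis k)) ` {- K..K})" by simp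
    show "graphE \<subseteq> cfun.span ((\<lambda>k. synth (graph_basis k)) ` {- K..K})"
    proof
      fix f assume "f \<in> graphE"
      then obtain a where a: "a = ext a" "decays a" "f = synth a" by (rule graphE_cases)
      have "f = (\<Sum>k\<in>{- K..K}. (\<lambda>x. a k * synth (graph_basis k) x))"
        unfolding fun_eq_iff sum_fun_app a(3) using synth_ext[of a] a(1) by simp
      also have "\<dots> \<in> cfun.span ((\<lambda>k. synth (graph_basis k)) ` {- K..K})"
        by (intro cfun.span_sum cfun.span_scale cfun.span_base) auto
      finally show "f \<in> cfun.span ((\<lambda>k. synth (graph_basis k)) ` {- K..K})" .
    qed
  qed
  show "graphT f \<in> graphE" if f: "f \<in> graphE" for f
  proof -
    obtain a where a: "a = ext a" "decays a" "f = synth a" "cf f = a" using f by (rule graphE_cases)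
    show ?thesis unfolding graphT_def graphE_def a(4) using hill_graph[OF a(1)] by blast
  qed
  have hd: "decays (hill_seq V a)" if "a = ext a" for a using ext_decays hill_graph[OF that] by metis
  show "graphT (f + g) = graphT f + graphT g" if fg: "f \<in> graphE" "g \<in> graphE" for f g
  proof -
    obtain a where a: "a = ext a" "decays a" "f = synth a" "cf f = a" using fg(1) by (rule graphE_cases)
    obtain b where b: "b = ext b" "decays b" "g = synth b" "cf g = b" using fg(2) by (rule graphE_cases)
    have s: "f + g = synth (\<lambda>k. 1 * a k + 1 * b k)"
      unfolding a(3) b(3) fun_eq_iff using synth_lin[OF a(2) b(2), of 1 1] by simp
    have "cf (f + g) = (\<lambda>k. 1 * a k + 1 * b k)"
      unfolding s by (intro cf_synth_fun decays_add decays_scale a b)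
    then have h: "hill_seq V (cf (f + g)) = (\<lambda>k. 1 * hill_seq V a k + 1 * hill_seq V b k)"
      using hill_seq_lin[OF V a(2) b(2), of 1 1] by auto
    show ?thesis unfolding graphT_def h a(4) b(4) unfolding fun_eq_iff
      using synth_lin[OF hd[OF a(1)] hd[OF b(1)], of 1 1] by simp
  qed
  show "graphT (\<lambda>x. c * f x) = (\<lambda>x. c * graphT f x)" if f: "f \<in> graphE" for c f
  proof -
    obtain a where a: "a = ext a" "decays a" "f = synth a" "cf f = a" using f by (rule graphE_cases)
    have s: "(\<lambda>x. c * f x) = synth (\<lambda>k. c * a k + 0 * a k)"
      unfolding a(3) fun_eq_iff using synth_lin[OF a(2) a(2), of c 0] by simp
    have "cf (\<lambda>x. c * f x) = (\<lambda>k. c * a k + 0 * a k)"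
      unfolding s by (intro cf_synth_fun decays_add decays_scale a)
    then have h: "hill_seq V (cf (\<lambda>x. c * f x)) = (\<lambda>k. c * hill_seq V a k + 0 * hill_seq V a k)"
      using hill_seq_lin[OF V a(2) a(2), of c 0] by auto
    show ?thesis unfolding graphT_def h a(4) unfolding fun_eq_iff
      using synth_lin[OF hd[OF a(1)] hd[OF a(1)], of c 0] by simp
  qed
qed

lemma graph_dim: "cfun.dim graphE = nat (2 * K + 1)"
proof -
  let ?\<psi> = "\<lambda>k. synth (graph_basis k)"
  let ?B = "?\<psi> ` {- K..K}"
  have zero: "w k = 0" if "(\<Sum>k\<in>{- K..K}. (\<lambda>x. w k * ?\<psi> k x)) = 0" "k \<in> {- K..K}" for w k
  proof -
    have "synth (ext w) = 0" using that(1) unfolding fun_eq_iff sum_fun_app synth_ext by simp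
    then have "ext w = (\<lambda>_. 0)" using synth_eq_zero[OF ext_decays] by blast
    then show ?thesis using ext_low[of k w] that(2) by (simp add: abs_le_iff)
  qed
  have inj: "inj_on ?\<psi> {- K..K}"
  proof (rule inj_onI)
    fix k l assume kl: "k \<in> {- K..K}" "l \<in> {- K..K}" and eq: "?\<psi> k = ?\<psi> l"
    have "graph_basis k = graph_basis l" using synth_inj[OF graph_basis_decays graph_basis_decays eq] .
    then have "graph_basis k k = graph_basis l k" by simp
    then show "k = l" using kl by (simp add: graph_basis_def X_zero abs_le_iff split: if_splits)
  qed
  have "cfun.independent ?B"
  proof (rule ccontr)
    assume "\<not> cfun.independent ?B"
    then obtain u v where u: "v \<in> ?B" "u v \<noteq> 0" "(\<Sum>v\<in>?B. (\<lambda>x. u v * v x)) = 0"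
      using cfun.dependent_finite[of ?B] by auto
    then obtain k where k: "k \<in> {- K..K}" "v = ?\<psi> k" by blast
    have "(\<Sum>k\<in>{- K..K}. (\<lambda>x. u (?\<psi> k) * ?\<psi> k x)) = 0"
      using u(3) by (simp add: sum.reindex[OF inj] o_def)
    from zero[OF this k(1)] show False using u(2) k(2) by simp
  qed
  moreover have "?B \<subseteq> graphE"
  proof -
    have "graph_basis k = ext (graph_basis k)" if "k \<in> {- K..K}" for k
    proof -
      have "graph_basis k = ext (\<lambda>i. if i = k then 1 else 0)"
        using that by (auto simp: ext_def fun_eq_iff if_distrib[of "\<lambda>c. c * _"] cong: if_cong)
      then show ?thesis using ext_ext by metis
    qed
    then show ?thesis unfolding graphE_def by blast
  qed
  moreover have "graphE \<subseteq> cfun.span ?B"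
  proof
    fix f assume "f \<in> graphE"
    then obtain a where a: "a = ext a" "decays a" "f = synth a" by (rule graphE_cases)
    have "f = (\<Sum>k\<in>{- K..K}. (\<lambda>x. a k * synth (graph_basis k) x))"
      unfolding fun_eq_iff sum_fun_app a(3) using synth_ext[of a] a(1) by simp
    also have "\<dots> \<in> cfun.span ?B" by (intro cfun.span_sum cfun.span_scale cfun.span_base) auto
    finally show "f \<in> cfun.span ?B" .
  qed
  moreover have "card ?B = nat (2 * K + 1)" using card_image[OF inj] K by simp
  ultimately show ?thesis using cfun.dim_unique by blast
qed

definition graphS :: "complex \<Rightarrow> (real \<Rightarrow> complex) \<Rightarrow> real \<Rightarrow> complex" where
  "graphS z f = graphT f - (\<lambda>x. z * f x)"

lemma graphS_app: "graphS z f x = graphT f x - z * f x"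
  by (simp add: graphS_def)

lemma graphS_endo: "cfs.endo graphE (graphS z)"
  unfolding graphS_def[abs_def] by (rule cfs.endo_shift[OF graph_endo])

lemma root_space_graph: "cfs.root_space graphE graphT z = {f\<in>graphE. \<exists>k. (graphS z ^^ k) f = 0}"
  unfolding cfs.root_space_def graphS_def[abs_def] ..

text \<open>Chains of root vectors are followed one link at a time: by \<open>root_in_graph\<close>
  a preimage of a vector in the graph lies in the graph, where \<open>L - z\<close> is
  \<open>graphS z\<close>.\<close>

lemma root_kernel_graph:
  assumes q: "q \<in> L2" "cf q = V" and z: "Re z \<le> bound"
  shows "root_kernel q z k = {f\<in>graphE. (graphS z ^^ k) f = 0}"
proof (induction k)
  case 0
  have "0 \<in> graphE" using cfun.subspace_0[OF cfs.endoD(1)[OF graph_endo]] .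
  then show ?case by auto
next
  case (Suc k)
  let ?S = "graphS z"
  have "f \<in> root_kernel q z (Suc k) \<longleftrightarrow> f \<in> graphE \<and> (?S ^^ k) (?S f) = 0" for f
  proof
    assume "f \<in> root_kernel q z (Suc k)"
    then obtain v where v: "v \<in> graphE" "(?S ^^ k) v = 0" "hill_op q f (\<lambda>x. z * f x + v x)"
      unfolding root_kernel_Suc Suc by blast
    obtain b where b: "b = ext b" "decays b" "v = synth b" using v(1) by (rule graphE_cases)
    note h = hill_op_imp_seq[OF q(1) b(2) v(3)[unfolded b(3)], unfolded q(2)]
    have a: "cf f = ext (cf f)" by (rule root_in_graph[OF h(1) b(1) z h(3)])
    have fE: "f \<in> graphE" unfolding graphE_def using a h(2) by blast
    have "?S f = v"
    proof
      fix x
      have "hill_seq V (cf f) = (\<lambda>k. z * cf f k + 1 * b k)" using h(3) by auto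
      then have "graphT f x = z * synth (cf f) x + 1 * synth b x"
        unfolding graphT_def using synth_lin[OF h(1) b(2), of z 1] by simp
      then show "?S f x = v x" unfolding graphS_app using fun_cong[OF h(2), of x] b(3) by simp
    qed
    then show "f \<in> graphE \<and> (?S ^^ k) (?S f) = 0" using fE v(2) by simp
  next
    assume f: "f \<in> graphE \<and> (?S ^^ k) (?S f) = 0"
    obtain a where a: "a = ext a" "decays a" "f = synth a" "cf f = a" using f graphE_cases by metis
    have vE: "?S f \<in> graphE" using cfs.endoD(3)[OF graphS_endo] f by blast
    then obtain b where b: "b = ext b" "decays b" "?S f = synth b" "cf (?S f) = b" by (rule graphE_cases)
    have hd: "decays (hill_seq V a)" using ext_decays hill_graph[OF a(1)] by metis
    have "?S f = synth (\<lambda>k. 1 * hill_seq V a k + (- z) * a k)"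
      unfolding fun_eq_iff graphS_app graphT_def a(4) using synth_lin[OF hd a(2), of 1 "- z"] a(3) by simp
    then have "synth b = synth (\<lambda>k. 1 * hill_seq V a k + (- z) * a k)" using b(3) by simp
    then have "b = (\<lambda>k. 1 * hill_seq V a k + (- z) * a k)"
      by (rule synth_inj[OF b(2), rotated]) (intro decays_add decays_scale hd a(2))
    then have "hill_seq (cf q) a k = z * a k + b k" for k by (simp add: q(2))
    from seq_imp_hill_op[OF q(1) a(2) b(2) this] have "hill_op q f (\<lambda>x. z * f x + ?S f x)"
      unfolding b(3) a(3)[symmetric] .
    moreover have "?S f \<in> root_kernel q z k" unfolding Suc using vE f by simp
    ultimately show "f \<in> root_kernel q z (Suc k)" unfolding root_kernel_Suc by blast
  qed
  then show ?case unfolding funpow_Suc_right comp_apply by blast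
qed

lemma root_union_graph:
  assumes "q \<in> L2" "cf q = V" "Re z \<le> bound"
  shows "(\<Union>k. root_kernel q z k) = cfs.root_space graphE graphT z"
  unfolding root_kernel_graph[OF assms] root_space_graph by blast

lemma root_space_right_zero:
  assumes z: "bound \<le> Re z" shows "cfs.root_space graphE graphT z = {0}"
proof -
  let ?S = "graphS z"
  have base: "f = 0" if f: "f \<in> graphE" "?S f = 0" for f
  proof -
    obtain a where a: "a = ext a" "decays a" "f = synth a" "cf f = a" using f(1) by (rule graphE_cases)
    have hd: "decays (hill_seq V a)" using ext_decays hill_graph[OF a(1)] by metis
    have "synth (hill_seq V a) = synth (\<lambda>k. z * a k + 0 * a k)"
      using f(2) unfolding fun_eq_iff graphS_app graphT_def a(4) using synth_lin[OF a(2) a(2), of z 0] a(3) by simp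
    then have "hill_seq V a = (\<lambda>k. z * a k + 0 * a k)"
      by (rule synth_inj[OF hd, rotated]) (intro decays_add decays_scale a(2))
    then have "a k = 0" for k by (intro graph_no_eigenvalue[OF a(1) z]) simp
    then have "a = (\<lambda>_. 0)" by blast
    then show ?thesis using a(3) synth_zero by simp
  qed
  have "f = 0" if "f \<in> graphE" "(?S ^^ k) f = 0" for f k
    using that
  proof (induction k arbitrary: f)
    case (Suc k)
    have "?S f \<in> graphE" by (rule cfs.endoD(3)[OF graphS_endo Suc.prems(1)])
    moreover have "(?S ^^ k) (?S f) = 0" using Suc.prems(2) unfolding funpow_Suc_right comp_apply .
    ultimately have "?S f = 0" by (rule Suc.IH)
    then show ?case by (rule base[OF Suc.prems(1)])
  qed simp
  moreover have "0 \<in> cfs.root_space graphE graphT z"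
    using cfun.subspace_0[OF cfs.root_space_subspace[OF graph_endo]] .
  ultimately show ?thesis unfolding root_space_graph by blast
qed

lemma root_space_dim_zero:
  "cfun.dim (cfs.root_space graphE graphT z) = 0 \<longleftrightarrow> cfs.root_space graphE graphT z = {0}"
proof
  let ?R = "cfs.root_space graphE graphT z"
  assume d: "cfun.dim ?R = 0"
  obtain B where "finite B" "?R \<subseteq> cfun.span B" "card B = cfun.dim ?R"
    using cfs.fin_dim_basis[OF cfs.fin_dim_subset[OF cfs.endoD(2)[OF graph_endo] cfs.root_space_subset]] by metis
  then have "?R \<subseteq> {0}" using d by auto
  then show "?R = {0}" using cfun.subspace_0[OF cfs.root_space_subspace[OF graph_endo]] by blast
next
  assume "cfs.root_space graphE graphT z = {0}"
  then show "cfun.dim (cfs.root_space graphE graphT z) = 0"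
    using cfun.dim_le_card[of "{0}" "{}"] by simp
qed

text \<open>All root spaces up to the line are root spaces of the restriction, all root spaces of
  the restriction lie to the left of the line, and their dimensions add up to that of the
  graph.\<close>

lemma count_eigenvalues:
  assumes q: "q \<in> L2" "cf q = V"
  shows "finite {z. Re z < bound \<and> algebraic_mult q z \<noteq> 0}"
    and "(\<Sum>z | Re z < bound \<and> algebraic_mult q z \<noteq> 0. algebraic_mult q z) = nat (2 * K + 1)"
    and "Re z = bound \<Longrightarrow> algebraic_mult q z = 0"
proof -
  let ?R = "\<lambda>z. cfs.root_space graphE graphT z"
  have am: "algebraic_mult q z = cfun.dim (?R z)" if "Re z \<le> bound" for z
    unfolding algebraic_mult_def root_union_graph[OF q that] ..
  have set: "{z. Re z < bound \<and> algebraic_mult q z \<noteq> 0} = {z. ?R z \<noteq> {0}}"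
    using am root_space_dim_zero root_space_right_zero by (metis (no_types, lifting) less_imp_le not_less)
  show "finite {z. Re z < bound \<and> algebraic_mult q z \<noteq> 0}"
    unfolding set using cfs.sum_dim_root_spaces[OF graph_endo] by blast
  have "(\<Sum>z | Re z < bound \<and> algebraic_mult q z \<noteq> 0. algebraic_mult q z) = (\<Sum>z | ?R z \<noteq> {0}. cfun.dim (?R z))"
  proof (rule sum.cong[OF set])
    fix z assume "z \<in> {z. ?R z \<noteq> {0}}"
    then have "Re z \<le> bound" using set by (metis (mono_tags, lifting) less_imp_le mem_Collect_eq)
    then show "algebraic_mult q z = cfun.dim (?R z)" by (rule am)
  qed
  then show "(\<Sum>z | Re z < bound \<and> algebraic_mult q z \<noteq> 0. algebraic_mult q z) = nat (2 * K + 1)"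
    using cfs.sum_dim_root_spaces[OF graph_endo] graph_dim by simp
  show "algebraic_mult q z = 0" if "Re z = bound"
  proof -
    have "?R z = {0}" using root_space_right_zero[of z] that by simp
    then have "cfun.dim (?R z) = 0" by (rule root_space_dim_zero[THEN iffD2])
    then show ?thesis using am[of z] that by simp
  qed
qed

lemma root_union_fin_dim:
  assumes "q \<in> L2" "cf q = V" "Re z \<le> bound"
  shows "cfs.fin_dim (\<Union>k. root_kernel q z k)" "cfun.subspace (\<Union>k. root_kernel q z k)"
  unfolding root_union_graph[OF assms]
  using cfs.fin_dim_subset[OF cfs.endoD(2)[OF graph_endo] cfs.root_space_subset] cfs.root_space_subspace[OF graph_endo] by auto

end

section \<open>Positions of the eigenvalues in the ordered list\<close>

definition strip_bound :: "nat \<Rightarrow> real" where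
  "strip_bound K = pi\<^sup>2 * (real K * real K + real K)"

lemma strip_bound_unbounded: "real K \<le> strip_bound K"
proof -
  have "1 * real K \<le> pi\<^sup>2 * real K" using pi_squared_ge by (intro mult_right_mono) auto
  also have "\<dots> \<le> strip_bound K" unfolding strip_bound_def by (intro mult_left_mono) auto
  finally show ?thesis by simp
qed

lemma riccati_graph_nat:
  assumes "ell2 (cf q) v" "16 * (v + 1)\<^sup>2 \<le> real K"
  obtains X where "riccati_graph (cf q) v (int K) X" "riccati_graph.bound (int K) = strip_bound K"
proof -
  have v0: "0 \<le> v" using assms(1) by (rule ell2_nonneg)
  have "1 \<le> (v + 1)\<^sup>2" using v0 by simp
  then have "1 \<le> int K" using assms(2) by linarith
  moreover have "16 * (v + 1)\<^sup>2 \<le> real_of_int (int K)" using assms(2) by simp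
  ultimately obtain X where X: "riccati_graph (cf q) v (int K) X" using riccati_graph_exists[OF assms(1)] by blast
  moreover have "riccati_graph.bound (int K) = strip_bound K"
    unfolding riccati_graph.bound_def[OF X] strip_bound_def by simp
  ultimately show ?thesis using that by blast
qed

lemma count_strip:
  assumes q: "q \<in> L2" and v: "ell2 (cf q) v" and K: "16 * (v + 1)\<^sup>2 \<le> real K"
  shows "finite {z. Re z < strip_bound K \<and> algebraic_mult q z \<noteq> 0}"
    and "(\<Sum>z | Re z < strip_bound K \<and> algebraic_mult q z \<noteq> 0. algebraic_mult q z) = 2 * K + 1"
    and "Re z = strip_bound K \<Longrightarrow> algebraic_mult q z = 0"
proof -
  obtain X where X: "riccati_graph (cf q) v (int K) X" and b: "riccati_graph.bound (int K) = strip_bound K"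
    by (rule riccati_graph_nat[OF v K])
  have "nat (2 * int K + 1) = 2 * K + 1" by simp
  then show "finite {z. Re z < strip_bound K \<and> algebraic_mult q z \<noteq> 0}"
    "(\<Sum>z | Re z < strip_bound K \<and> algebraic_mult q z \<noteq> 0. algebraic_mult q z) = 2 * K + 1"
    "Re z = strip_bound K \<Longrightarrow> algebraic_mult q z = 0"
    using riccati_graph.count_eigenvalues[OF X q refl] unfolding b by auto
qed

lemma root_union_fin:
  assumes q: "q \<in> L2" and v: "ell2 (cf q) v"
  shows "cfs.fin_dim (\<Union>k. root_kernel q z k)" "cfun.subspace (\<Union>k. root_kernel q z k)"
proof -
  obtain K where K: "max (16 * (v + 1)\<^sup>2) (Re z) \<le> real K" using real_arch_simple by blast
  obtain X where X: "riccati_graph (cf q) v (int K) X" and b: "riccati_graph.bound (int K) = strip_bound K"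
    by (rule riccati_graph_nat[OF v]) (use K in auto)
  have "Re z \<le> riccati_graph.bound (int K)" using K strip_bound_unbounded[of K] unfolding b by linarith
  then show "cfs.fin_dim (\<Union>k. root_kernel q z k)" "cfun.subspace (\<Union>k. root_kernel q z k)"
    using riccati_graph.root_union_fin_dim[OF X q refl] by auto
qed

text \<open>An eigenvalue of multiplicity \<open>m\<close> is replaced by \<open>m\<close> numbered
  copies. This makes the order strict and total, so that a position in the list is a rank.\<close>

definition pair_less :: "complex \<times> nat \<Rightarrow> complex \<times> nat \<Rightarrow> bool" where
  "pair_less p p' \<longleftrightarrow> (fst p = fst p' \<and> snd p < snd p') \<or> (fst p \<noteq> fst p' \<and> lex_le (fst p) (fst p'))"

lemma pair_less_irrefl: "\<not> pair_less p p"
  by (simp add: pair_less_def)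

lemma pair_less_trans: "pair_less p p' \<Longrightarrow> pair_less p' p'' \<Longrightarrow> pair_less p p''"
  by (auto simp: pair_less_def lex_le_def complex_eq_iff)

lemma pair_less_total: "p \<noteq> p' \<Longrightarrow> pair_less p p' \<or> pair_less p' p"
  by (cases p; cases p') (auto simp: pair_less_def lex_le_def complex_eq_iff)

lemma pair_less_Re: "pair_less p p' \<Longrightarrow> Re (fst p) \<le> Re (fst p')"
  by (auto simp: pair_less_def lex_le_def)

text \<open>The rank of a copy is the number of its predecessors, finite because the half planes
  contain finitely many copies. Ranks are injective and leave no holes, and every number occurs
  since the counts \<open>2 * K + 1\<close> are unbounded.\<close>

lemma listing_exists:
  fixes m :: "complex \<Rightarrow> nat" and b :: "nat \<Rightarrow> real"
  assumes fin: "\<And>K. K0 \<le> K \<Longrightarrow> finite {z. Re z < b K \<and> m z \<noteq> 0}"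
    and sum: "\<And>K. K0 \<le> K \<Longrightarrow> (\<Sum>z | Re z < b K \<and> m z \<noteq> 0. m z) = 2 * K + 1"
    and b: "\<And>K. real K \<le> b K"
  obtains \<mu> where "\<And>k. lex_le (\<mu> k) (\<mu> (Suc k))" "\<And>z. finite {k. \<mu> k = z} \<and> card {k. \<mu> k = z} = m z"
proof -
  define P where "P = {p :: complex \<times> nat. snd p < m (fst p)}"
  define D where "D p = {p'\<in>P. pair_less p' p}" for p
  define rank where "rank p = card (D p)" for p
  have seg: "finite {p\<in>P. Re (fst p) < b K} \<and> card {p\<in>P. Re (fst p) < b K} = 2 * K + 1" if "K0 \<le> K" for K
  proof -
    have e: "{p\<in>P. Re (fst p) < b K} = Sigma {z. Re z < b K \<and> m z \<noteq> 0} (\<lambda>z. {..<m z})"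
      by (auto simp: P_def)
    show ?thesis unfolding e using fin[OF that] sum[OF that] by simp
  qed
  have finD: "finite (D p)" for p
  proof -
    obtain K where K: "max (real K0) (Re (fst p) + 1) \<le> real K" using real_arch_simple by blast
    have "K0 \<le> K" "Re (fst p) < b K" using K b[of K] by auto
    have "D p \<subseteq> {p\<in>P. Re (fst p) < b K}"
    proof
      fix p' assume "p' \<in> D p"
      then have "p' \<in> P" "pair_less p' p" by (auto simp: D_def)
      then show "p' \<in> {p\<in>P. Re (fst p) < b K}" using pair_less_Re[of p' p] \<open>Re (fst p) < b K\<close> by simp
    qed
    then show ?thesis using seg[OF \<open>K0 \<le> K\<close>] finite_subset by blast
  qed
  have rank_less: "rank p < rank p'" if "pair_less p p'" "p \<in> P" for p p'
    unfolding rank_def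
  proof (rule psubset_card_mono[OF finD])
    have "D p \<subseteq> D p'" unfolding D_def using pair_less_trans[OF _ that(1)] by blast
    moreover have "p \<in> D p'" "p \<notin> D p" using that pair_less_irrefl by (auto simp: D_def)
    ultimately show "D p \<subset> D p'" by blast
  qed
  have inj: "inj_on rank P"
  proof (rule inj_onI)
    fix p p' assume "p \<in> P" "p' \<in> P" "rank p = rank p'"
    then show "p = p'" using pair_less_total[of p p'] rank_less[of p p'] rank_less[of p' p] by auto
  qed
  have down: "{..<rank p} \<subseteq> rank ` P" for p
  proof -
    have DP: "D p \<subseteq> P" by (auto simp: D_def)
    have "rank ` D p \<subseteq> {..<rank p}" using rank_less[OF _ subsetD[OF DP], of _ p] unfolding D_def by blast
    moreover have "card (rank ` D p) = card {..<rank p}"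
      using card_image[OF inj_on_subset[OF inj DP]] by (simp add: rank_def)
    ultimately have "rank ` D p = {..<rank p}" by (intro card_subset_eq) auto
    then show ?thesis using DP by blast
  qed
  have surj: "rank ` P = UNIV"
  proof (rule ccontr)
    assume "rank ` P \<noteq> UNIV"
    then obtain k where k: "k \<notin> rank ` P" by blast
    have "rank ` P \<subseteq> {..<k}"
    proof
      fix r assume "r \<in> rank ` P"
      then obtain p where p: "p \<in> P" "r = rank p" by blast
      have "r \<noteq> k" using k p by blast
      moreover have "\<not> k < r" using down[of p] k p by blast
      ultimately show "r \<in> {..<k}" by simp
    qed
    then have fP: "finite P" "card P \<le> k" using finite_imageD[OF _ inj] card_image[OF inj] card_mono[of "{..<k}" "rank ` P"]
      by (auto intro: finite_subset)
    have "card {p\<in>P. Re (fst p) < b (max K0 k)} \<le> card P" by (intro card_mono fP) auto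
    then show False using seg[of "max K0 k"] fP by simp
  qed
  define \<iota> where "\<iota> = inv_into P rank"
  have \<iota>: "\<iota> k \<in> P" "rank (\<iota> k) = k" for k
    using surj inv_into_into[of k rank P] f_inv_into_f[of k rank P] by (auto simp: \<iota>_def)
  have \<iota>r: "\<iota> (rank p) = p" if "p \<in> P" for p using inv_into_f_f[OF inj that] by (simp add: \<iota>_def)
  define \<mu> where "\<mu> k = fst (\<iota> k)" for k
  show ?thesis
  proof (rule that[of \<mu>])
    fix k
    have "\<iota> k \<noteq> \<iota> (Suc k)" using \<iota>(2) by (metis n_not_Suc_n)
    moreover have "\<not> pair_less (\<iota> (Suc k)) (\<iota> k)" using rank_less[OF _ \<iota>(1), of "Suc k" "\<iota> k"] \<iota>(2) by force
    ultimately have "pair_less (\<iota> k) (\<iota> (Suc k))" using pair_less_total by blast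
    then show "lex_le (\<mu> k) (\<mu> (Suc k))" by (auto simp: pair_less_def \<mu>_def lex_le_def)
  next
    fix z
    have "{k. \<mu> k = z} = rank ` ({z} \<times> {..<m z})"
    proof
      show "{k. \<mu> k = z} \<subseteq> rank ` ({z} \<times> {..<m z})"
      proof clarify
        fix k assume "z = \<mu> k"
        have "\<iota> k \<in> {\<mu> k} \<times> {..<m (\<mu> k)}" using \<iota>(1)[of k] by (cases "\<iota> k") (auto simp: \<mu>_def P_def)
        then show "k \<in> rank ` ({\<mu> k} \<times> {..<m (\<mu> k)})" using \<iota>(2)[of k] by (metis imageI)
      qed
      show "rank ` ({z} \<times> {..<m z}) \<subseteq> {k. \<mu> k = z}"
        using \<iota>r by (auto simp: \<mu>_def P_def)
    qed
    moreover have "inj_on rank ({z} \<times> {..<m z})" by (rule inj_on_subset[OF inj]) (auto simp: P_def)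
    ultimately show "finite {k. \<mu> k = z} \<and> card {k. \<mu> k = z} = m z" by (simp add: card_image card_cartesian_product)
  qed
qed

lemma periodic_eigenvalue_lists:
  assumes q: "q \<in> L2" and v: "ell2 (cf q) v"
  shows "lists_periodic_eigenvalues q (periodic_eigenvalue q)"
proof -
  obtain K0 :: nat where K0: "16 * (v + 1)\<^sup>2 \<le> real K0" using real_arch_simple by blast
  obtain \<mu> where "\<And>k. lex_le (\<mu> k) (\<mu> (Suc k))" "\<And>z. finite {k. \<mu> k = z} \<and> card {k. \<mu> k = z} = algebraic_mult q z"
  proof (rule listing_exists[where b = strip_bound and m = "algebraic_mult q" and ?K0.0 = K0])
    fix K assume "K0 \<le> K"
    then have "16 * (v + 1)\<^sup>2 \<le> real K" using K0 by linarith
    from count_strip(1,2)[OF q v this]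
    show "finite {z. Re z < strip_bound K \<and> algebraic_mult q z \<noteq> 0}"
      "(\<Sum>z | Re z < strip_bound K \<and> algebraic_mult q z \<noteq> 0. algebraic_mult q z) = 2 * K + 1" by auto
  qed (use strip_bound_unbounded in auto)
  then have l: "lists_periodic_eigenvalues q \<mu>" by (simp add: lists_periodic_eigenvalues_def)
  then have "\<exists>!\<mu>. lists_periodic_eigenvalues q \<mu>" using lists_periodic_eigenvalues_unique by blast
  then show ?thesis unfolding periodic_eigenvalue_def by (rule theI')
qed

context
  fixes q :: "real \<Rightarrow> complex" and v :: real
  assumes q: "q \<in> L2" and v: "ell2 (cf q) v"
begin

private lemma lists:
  "lex_le (periodic_eigenvalue q k) (periodic_eigenvalue q (Suc k))"
  "finite {k. periodic_eigenvalue q k = z}" "card {k. periodic_eigenvalue q k = z} = algebraic_mult q z"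
  using periodic_eigenvalue_lists[OF q v] by (auto simp: lists_periodic_eigenvalues_def)

text \<open>The real parts in the list do not decrease, so these positions form an initial segment;
  its length is the count \<open>2 * K + 1\<close>.\<close>

lemma periodic_eigenvalue_below:
  assumes K: "16 * (v + 1)\<^sup>2 \<le> real K"
  shows "{k. Re (periodic_eigenvalue q k) < strip_bound K} = {..2 * K}"
proof -
  let ?\<mu> = "periodic_eigenvalue q" and ?Z = "{z. Re z < strip_bound K \<and> algebraic_mult q z \<noteq> 0}"
  let ?A = "{k. Re (?\<mu> k) < strip_bound K}"
  note c = count_strip[OF q v K]
  have mono: "Re (?\<mu> i) \<le> Re (?\<mu> j)" if "i \<le> j" for i j
    using that
  proof (induction rule: dec_induct)
    case (step n)
    then show ?case using lists(1)[of n] by (auto simp: lex_le_def)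
  qed simp
  have nz: "algebraic_mult q (?\<mu> k) \<noteq> 0" for k
    using lists(2,3)[of "?\<mu> k"] by (metis (mono_tags, lifting) card_eq_0_iff empty_iff mem_Collect_eq)
  have A: "?A = (\<Union>z\<in>?Z. {k. ?\<mu> k = z})" using nz by auto
  have "card ?A = (\<Sum>z\<in>?Z. card {k. ?\<mu> k = z})"
    unfolding A by (rule card_UN_disjoint[OF c(1)]) (use lists(2) in auto)
  then have card: "card ?A = 2 * K + 1" using c(2) lists(3) by simp
  have fin: "finite ?A" unfolding A using c(1) lists(2) by blast
  have down: "i \<in> ?A" if "i \<le> j" "j \<in> ?A" for i j using mono[OF that(1)] that(2) by simp
  show ?thesis
  proof -
    have ne: "?A \<noteq> {}" using card by force
    have "?A = {..Max ?A}"
    proof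
      show "?A \<subseteq> {..Max ?A}" using Max_ge[OF fin] by auto
      show "{..Max ?A} \<subseteq> ?A" using down Max_in[OF fin ne] by blast
    qed
    then have "Max ?A = 2 * K" using card by (metis card_atMost Suc_eq_plus1 Suc_inject)
    then show ?thesis using \<open>?A = {..Max ?A}\<close> by simp
  qed
qed

lemma algebraic_mult_periodic_eigenvalue: "algebraic_mult q (periodic_eigenvalue q k) \<noteq> 0"
  using lists(2,3)[of "periodic_eigenvalue q k"] by (metis (mono_tags, lifting) card_eq_0_iff empty_iff mem_Collect_eq)

context
  fixes n :: nat
  assumes n: "16 * (v + 1)\<^sup>2 + 1 \<le> real n"
begin

text \<open>The additional 1 in the assumption makes the counting available at \<open>n - 1\<close>
  as well, which bounds the strip from the left.\<close>

private lemma n_large: "2 \<le> n" "16 * (v + 1)\<^sup>2 \<le> real n" "16 * (v + 1)\<^sup>2 \<le> real (n - 1)"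
proof -
  have "1 \<le> (v + 1)\<^sup>2" using ell2_nonneg[OF v] by simp
  then show "2 \<le> n" "16 * (v + 1)\<^sup>2 \<le> real n" "16 * (v + 1)\<^sup>2 \<le> real (n - 1)" using n by auto
qed

lemma strip_positions:
  assumes "strip_bound (n - 1) \<le> Re (periodic_eigenvalue q k)" "Re (periodic_eigenvalue q k) < strip_bound n"
  shows "k = 2 * n - 1 \<or> k = 2 * n"
proof -
  have "k \<in> {..2 * n}" using periodic_eigenvalue_below[OF n_large(2)] assms(2) by blast
  moreover have "k \<notin> {..2 * (n - 1)}" unfolding periodic_eigenvalue_below[OF n_large(3), symmetric] using assms(1) by simp
  ultimately show ?thesis by auto
qed

lemma lambda_strip:
  "strip_bound (n - 1) < Re (lambda_minus n q)" "Re (lambda_minus n q) < strip_bound n"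
  "strip_bound (n - 1) < Re (lambda_plus n q)" "Re (lambda_plus n q) < strip_bound n"
proof -
  have "2 * n - 1 \<in> {..2 * n}" "2 * n \<in> {..2 * n}" "2 * n - 1 \<notin> {..2 * (n - 1)}" "2 * n \<notin> {..2 * (n - 1)}"
    using n_large(1) by auto
  then have *: "Re (periodic_eigenvalue q (2 * n - 1)) < strip_bound n" "Re (periodic_eigenvalue q (2 * n)) < strip_bound n"
    "\<not> Re (periodic_eigenvalue q (2 * n - 1)) < strip_bound (n - 1)" "\<not> Re (periodic_eigenvalue q (2 * n)) < strip_bound (n - 1)"
    unfolding periodic_eigenvalue_below[OF n_large(2), symmetric] periodic_eigenvalue_below[OF n_large(3), symmetric] by simp_all
  have "Re (periodic_eigenvalue q k) \<noteq> strip_bound (n - 1)" for k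
    using count_strip(3)[OF q v n_large(3)] algebraic_mult_periodic_eigenvalue by blast
  then show "strip_bound (n - 1) < Re (lambda_minus n q)" "Re (lambda_minus n q) < strip_bound n"
    "strip_bound (n - 1) < Re (lambda_plus n q)" "Re (lambda_plus n q) < strip_bound n"
    using * unfolding lambda_minus_def lambda_plus_def by (metis less_linear)+
qed

lemma strip_bound_in_strip:
  assumes "strip_bound (n - 1) \<le> Re z" "Re z \<le> strip_bound n" shows "in_strip (int n) z"
proof -
  have "real (n - 1) = real n - 1" using n_large(1) by simp
  then have "strip_bound (n - 1) = pi\<^sup>2 * (real n)\<^sup>2 - pi\<^sup>2 * real n"
    by (simp add: strip_bound_def power2_eq_square algebra_simps)
  moreover have "strip_bound n = pi\<^sup>2 * (real n)\<^sup>2 + pi\<^sup>2 * real n"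
    by (simp add: strip_bound_def power2_eq_square algebra_simps)
  ultimately show ?thesis unfolding in_strip_def using assms n_large(1) by (auto simp: abs_le_iff)
qed

lemma lambda_in_strip: "in_strip (int n) (lambda_minus n q)" "in_strip (int n) (lambda_plus n q)"
  using lambda_strip by (auto intro!: strip_bound_in_strip less_imp_le)

text \<open>The strip has room for the positions \<open>2 * n - 1\<close> and \<open>2 * n\<close>
  only, so a multiplicity of at least 2 occupies both.\<close>

lemma double_eigenvalue:
  assumes z: "strip_bound (n - 1) \<le> Re z" "Re z < strip_bound n" and m: "2 \<le> algebraic_mult q z"
  shows "lambda_minus n q = z" "lambda_plus n q = z"
proof -
  have "{k. periodic_eigenvalue q k = z} \<subseteq> {2 * n - 1, 2 * n}" using strip_positions z by blast
  moreover have "card {2 * n - 1, 2 * n} \<le> card {k. periodic_eigenvalue q k = z}"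
    using m lists(3)[of z] n_large(1) by (simp add: card_insert_if)
  ultimately have "{k. periodic_eigenvalue q k = z} = {2 * n - 1, 2 * n}" by (intro card_seteq) auto
  then show "lambda_minus n q = z" "lambda_plus n q = z" unfolding lambda_minus_def lambda_plus_def by blast+
qed

lemma algebraic_mult_double:
  assumes "lambda_minus n q = lambda_plus n q" shows "2 \<le> algebraic_mult q (lambda_minus n q)"
proof -
  have "{2 * n - 1, 2 * n} \<subseteq> {k. periodic_eigenvalue q k = lambda_minus n q}"
    using assms by (auto simp: lambda_minus_def lambda_plus_def)
  then have "card {2 * n - 1, 2 * n} \<le> algebraic_mult q (lambda_minus n q)"
    using card_mono[OF lists(2)] lists(3) by metis
  moreover have "card {2 * n - 1, 2 * n} = 2" using n_large(1) by (simp add: card_insert_if)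
  ultimately show ?thesis by simp
qed

end

lemma root_kernel_one: "f \<in> root_kernel q z 1 \<longleftrightarrow> hill_op q f (\<lambda>x. z * f x)"
  by simp

lemma eigen_function_iff:
  "hill_op q f (\<lambda>x. z * f x) \<longleftrightarrow> (\<exists>a. decays a \<and> f = synth a \<and> (\<forall>k. hill_seq (cf q) a k = z * a k))"
proof
  assume "hill_op q f (\<lambda>x. z * f x)"
  then have "hill_op q f (\<lambda>x. z * f x + synth (\<lambda>_. 0) x)" by (simp add: synth_zero)
  from hill_op_imp_seq[OF q _ this] show "\<exists>a. decays a \<and> f = synth a \<and> (\<forall>k. hill_seq (cf q) a k = z * a k)" by auto
next
  assume "\<exists>a. decays a \<and> f = synth a \<and> (\<forall>k. hill_seq (cf q) a k = z * a k)"
  then obtain a where a: "decays a" "f = synth a" "\<And>k. hill_seq (cf q) a k = z * a k" by blast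
  have "hill_op q (synth a) (\<lambda>x. z * synth a x + synth (\<lambda>_. 0) x)"
    by (rule seq_imp_hill_op[OF q a(1)]) (use a(3) in auto)
  then show "hill_op q f (\<lambda>x. z * f x)" using a(2) by (simp add: synth_zero)
qed

lemma eigen_sequence_exists:
  assumes "algebraic_mult q z \<noteq> 0"
  obtains a where "decays a" "\<And>k. hill_seq (cf q) a k = z * a k" "a \<noteq> (\<lambda>_. 0)"
proof -
  have "\<exists>f. f \<in> root_kernel q z 1 \<and> f \<noteq> 0"
  proof (rule ccontr)
    assume "\<not> ?thesis"
    then have 1: "root_kernel q z 1 \<subseteq> {0}" by blast
    have "root_kernel q z k \<subseteq> {0}" for k
    proof (induction k)
      case (Suc k)
      have "f = 0" if f: "f \<in> root_kernel q z (Suc k)" for f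
      proof -
        obtain w where "w \<in> root_kernel q z k" "hill_op q f (\<lambda>x. z * f x + w x)" using f unfolding root_kernel_Suc by blast
        then have "hill_op q f (\<lambda>x. z * f x)" using Suc by auto
        then show ?thesis using 1 root_kernel_one by blast
      qed
      then show ?case by blast
    qed (simp add: zero_fun_def)
    then have "(\<Union>k. root_kernel q z k) \<subseteq> cfun.span {}" by auto
    then have "algebraic_mult q z \<le> card ({} :: (real \<Rightarrow> complex) set)"
      unfolding algebraic_mult_def by (rule cfun.dim_le_card) simp
    then show False using assms by simp
  qed
  then obtain f where f: "hill_op q f (\<lambda>x. z * f x)" "f \<noteq> 0" using root_kernel_one by blast
  then obtain a where a: "decays a" "f = synth a" "\<And>k. hill_seq (cf q) a k = z * a k" unfolding eigen_function_iff by blast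
  moreover have "a \<noteq> (\<lambda>_. 0)" using a(2) f(2) synth_zero by blast
  ultimately show ?thesis using that by blast
qed

lemma independent_pair:
  assumes a: "decays a" and b: "decays b" and indep: "\<And>s t. (\<And>k. s * a k + t * b k = 0) \<Longrightarrow> s = 0 \<and> t = 0"
  shows "cfun.independent {synth a, synth b}" "synth a \<noteq> synth b"
proof -
  have zero: "s = 0 \<and> t = 0" if st: "\<And>x. s * synth a x + t * synth b x = 0" for s t
  proof -
    have "synth (\<lambda>k. s * a k + t * b k) = 0" unfolding fun_eq_iff using st by (simp add: synth_lin[OF a b])
    then have "(\<lambda>k. s * a k + t * b k) = (\<lambda>_. 0)" by (intro synth_eq_zero decays_add decays_scale a b)
    then show ?thesis by (intro indep) (metis)
  qed
  show ne: "synth a \<noteq> synth b" using zero[of 1 "-1"] by auto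
  show "cfun.independent {synth a, synth b}"
  proof (rule ccontr)
    assume "\<not> cfun.independent {synth a, synth b}"
    then obtain u w where u: "w \<in> {synth a, synth b}" "u w \<noteq> 0" "(\<Sum>w\<in>{synth a, synth b}. (\<lambda>x. u w * w x)) = 0"
      using cfun.dependent_finite[of "{synth a, synth b}"] by auto
    have "(\<lambda>x. u (synth a) * synth a x) + (\<lambda>x. u (synth b) * synth b x) = 0" using u(3) ne by simp
    then have "u (synth a) * synth a x + u (synth b) * synth b x = 0" for x unfolding fun_eq_iff by simp
    then show False using zero[of "u (synth a)" "u (synth b)"] u(1,2) by auto
  qed
qed

lemma algebraic_mult_ge_2:
  assumes a: "decays a" "\<And>k. hill_seq (cf q) a k = z * a k" and b: "decays b" "\<And>k. hill_seq (cf q) b k = z * b k"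
    and indep: "\<And>s t. (\<And>k. s * a k + t * b k = 0) \<Longrightarrow> s = 0 \<and> t = 0"
  shows "2 \<le> algebraic_mult q z"
proof -
  have "synth a \<in> root_kernel q z 1" "synth b \<in> root_kernel q z 1"
    unfolding root_kernel_one eigen_function_iff using a b by blast+
  then have sub: "{synth a, synth b} \<subseteq> (\<Union>k. root_kernel q z k)" by blast
  have "card {synth a, synth b} \<le> algebraic_mult q z"
    unfolding algebraic_mult_def
    using cfs.independent_card_le[OF root_union_fin(1)[OF q v] sub independent_pair(1)[OF a(1) b(1) indep]] by simp
  then show ?thesis using independent_pair(2)[OF a(1) b(1) indep] by simp
qed

text \<open>Either the kernels grow at the second step, which yields a chain of length two, or they
  have stabilized at the first, and then the whole root space consists of eigenvectors.\<close>

lemma double_root_cases: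
  assumes m: "2 \<le> algebraic_mult q z"
  obtains (jordan) a1 a2 where "decays a1" "\<And>k. hill_seq (cf q) a1 k = z * a1 k" "a1 \<noteq> (\<lambda>_. 0)"
      "decays a2" "\<And>k. hill_seq (cf q) a2 k = z * a2 k + a1 k"
  | (double) a b where "decays a" "\<And>k. hill_seq (cf q) a k = z * a k" "decays b" "\<And>k. hill_seq (cf q) b k = z * b k"
     "\<And>s t. (\<And>k. s * a k + t * b k = 0) \<Longrightarrow> s = 0 \<and> t = 0"
proof (cases "root_kernel q z (Suc 1) \<subseteq> root_kernel q z 1")
  case False
  then obtain f where f: "f \<in> root_kernel q z (Suc 1)" "f \<notin> root_kernel q z 1" by blast
  obtain w where w: "w \<in> root_kernel q z 1" "hill_op q f (\<lambda>x. z * f x + w x)" using f(1) unfolding root_kernel_Suc[of _ _ _ 1] by blast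
  obtain a1 where a1: "decays a1" "w = synth a1" "\<And>k. hill_seq (cf q) a1 k = z * a1 k"
    using w(1) unfolding root_kernel_one eigen_function_iff by blast
  have "a1 \<noteq> (\<lambda>_. 0)"
  proof
    assume "a1 = (\<lambda>_. 0)"
    then have "w = 0" using a1(2) synth_zero by simp
    then show False using w(2) f(2) unfolding root_kernel_one by simp
  qed
  moreover note h = hill_op_imp_seq[OF q a1(1) w(2)[unfolded a1(2)]]
  ultimately show ?thesis using jordan[OF a1(1,3) _ h(1,3)] by blast
next
  case True
  have "root_kernel q z k \<subseteq> root_kernel q z 1" for k
  proof (induction k)
    case 0
    have "0 \<in> root_kernel q z 1" unfolding root_kernel_one eigen_function_iff
      by (intro exI[of _ "\<lambda>_. 0"]) (auto simp: synth_zero hill_seq_def conv_def)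
    then show ?case by auto
  next
    case (Suc k)
    have "root_kernel q z (Suc k) \<subseteq> root_kernel q z (Suc 1)" using Suc unfolding subset_iff root_kernel_Suc by blast
    then show ?case using True by blast
  qed
  then have U: "(\<Union>k. root_kernel q z k) = root_kernel q z 1" by blast
  obtain B where B: "finite B" "B \<subseteq> root_kernel q z 1" "cfun.independent B" "card B = algebraic_mult q z"
    using cfs.fin_dim_basis[OF root_union_fin(1)[OF q v, of z]] unfolding U algebraic_mult_def by metis
  then obtain f g where fg: "f \<in> B" "g \<in> B" "f \<noteq> g" using m by (metis card_le_Suc0_iff_eq not_less_eq_eq numeral_2_eq_2)
  obtain a where a: "decays a" "f = synth a" "\<And>k. hill_seq (cf q) a k = z * a k"
    using fg(1) B(2) unfolding root_kernel_one[symmetric] using root_kernel_one eigen_function_iff by blast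
  obtain b where b: "decays b" "g = synth b" "\<And>k. hill_seq (cf q) b k = z * b k"
    using fg(2) B(2) using root_kernel_one eigen_function_iff by blast
  have "s = 0 \<and> t = 0" if st: "\<And>k. s * a k + t * b k = 0" for s t
  proof -
    have "s * f x + t * g x = 0" for x
      unfolding a(2) b(2) using synth_lin[OF a(1) b(1), of s t x] st by (simp add: synth_def)
    then have z0: "(\<Sum>w\<in>{f, g}. (\<lambda>x. (if w = f then s else t) * w x)) = 0"
      using fg(3) by (auto simp: fun_eq_iff)
    have "(if w = f then s else t) = 0" if "w \<in> {f, g}" for w
      by (rule cfun.independentD[OF B(3) _ _ z0 that]) (use fg in auto)
    from this[of f] this[of g] show ?thesis using fg(3) by auto
  qed
  then show ?thesis using double[OF a(1,3) b(1,3)] by blast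
qed

text \<open>\<open>defect_bound\<close> needs a vector \<open>a2\<close> with
  \<open>(L - z) a2 = a1\<close>. For distinct eigenvalues a multiple of \<open>a1\<close> serves,
  for a Jordan block the second vector of the chain; in the remaining case of two independent
  eigenvectors the whole reduced matrix is zero.\<close>

lemma gap_defect:
  assumes n: "16 * (v + 1)\<^sup>2 + 1 \<le> real n"
  defines "z \<equiv> lambda_minus n q"
  defines "g \<equiv> defect (cf q) (int n) z" and "M \<equiv> max (cmod (coefC (cf q) (int n) z)) (cmod (coefC (reflect (cf q)) (int n) z))"
  shows "2 * cmod g \<le> 2 * v / real n * (cmod g + M) + 2 * cmod (gap_length n q)"
    and "g\<^sup>2 = coefC (cf q) (int n) z * coefC (reflect (cf q)) (int n) z"
proof -
  have v0: "0 \<le> v" using v by (rule ell2_nonneg)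
  have "(v + 1)\<^sup>2 = v\<^sup>2 + 2 * v + 1" by (simp add: power2_sum)
  then have "16 * (v\<^sup>2 + 2 * v + 1) + 1 \<le> real n" using n by simp
  moreover have "0 \<le> v\<^sup>2" by simp
  ultimately have "4 * v \<le> real n" using v0 by argo
  then have n4: "4 * v \<le> real_of_int (int n)" by simp
  then have n2: "2 * v \<le> real_of_int (int n)" using v0 by linarith
  note s = lambda_in_strip[OF n]
  have amz: "algebraic_mult q z \<noteq> 0" "algebraic_mult q (lambda_plus n q) \<noteq> 0"
    unfolding z_def lambda_minus_def lambda_plus_def by (rule algebraic_mult_periodic_eigenvalue)+
  obtain a0 where a0: "decays a0" "\<And>k. hill_seq (cf q) a0 k = z * a0 k" "a0 \<noteq> (\<lambda>_. 0)"
    using eigen_sequence_exists[OF amz(1)] by blast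
  show "g\<^sup>2 = coefC (cf q) (int n) z * coefC (reflect (cf q)) (int n) z"
    unfolding g_def by (rule defect_square[OF v _ n2 a0]) (use s in \<open>simp add: z_def\<close>)
  have main: "2 * cmod g \<le> 2 * v / real n * (cmod g + M) + 2 * cmod (gap_length n q)"
    if "decays a1" "\<And>k. hill_seq (cf q) a1 k = lambda_plus n q * a1 k" "a1 \<noteq> (\<lambda>_. 0)"
      "decays a2" "\<And>k. hill_seq (cf q) a2 k = z * a2 k + a1 k" for a1 a2
    using defect_bound[OF v s(1) s(2) n4 a0[unfolded z_def] that(1-4) that(5)[unfolded z_def]]
    unfolding g_def M_def z_def gap_length_def by simp
  show "2 * cmod g \<le> 2 * v / real n * (cmod g + M) + 2 * cmod (gap_length n q)"
  proof (cases "lambda_minus n q = lambda_plus n q")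
    case False
    obtain a1 where a1: "decays a1" "\<And>k. hill_seq (cf q) a1 k = lambda_plus n q * a1 k" "a1 \<noteq> (\<lambda>_. 0)"
      using eigen_sequence_exists[OF amz(2)] by blast
    \<comment> \<open>Since \<open>(L - z) a1\<close> is \<open>lambda_plus n q - z\<close> times
      \<open>a1\<close>, dividing by this number produces the required \<open>a2\<close>.\<close>
    define c where "c = 1 / (lambda_plus n q - z)"
    have c: "c * (lambda_plus n q - z) = 1" using False by (simp add: c_def z_def)
    have "hill_seq (cf q) (\<lambda>k. c * a1 k) k = z * (c * a1 k) + a1 k" for k
    proof -
      have "hill_seq (cf q) (\<lambda>k. c * a1 k) k = c * (lambda_plus n q * a1 k)"
        using hill_seq_lin[OF v a1(1) a1(1), of c 0 k] a1(2)[of k] by simp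
      also have "\<dots> = z * (c * a1 k) + (c * (lambda_plus n q - z)) * a1 k" by (simp add: algebra_simps)
      finally show ?thesis by (simp add: c)
    qed
    then show ?thesis by (rule main[OF a1 decays_scale[OF a1(1)]])
  next
    case True
    have "2 \<le> algebraic_mult q z" unfolding z_def by (rule algebraic_mult_double[OF n True])
    then show ?thesis
    proof (rule double_root_cases)
      fix a1 a2 assume "decays a1" "\<And>k. hill_seq (cf q) a1 k = z * a1 k" "a1 \<noteq> (\<lambda>_. 0)"
        "decays a2" "\<And>k. hill_seq (cf q) a2 k = z * a2 k + a1 k"
      then show ?thesis using main[of a1 a2] True z_def by simp
    next
      fix a b assume ab: "decays a" "\<And>k. hill_seq (cf q) a k = z * a k" "decays b" "\<And>k. hill_seq (cf q) b k = z * b k"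
        and i: "\<And>s t. (\<And>k. s * a k + t * b k = 0) \<Longrightarrow> s = 0 \<and> t = 0"
      have sz: "in_strip (int n) z" using s(1) by (simp add: z_def)
      have "g = 0" "M = 0" using defect_double[OF v sz n2 ab i] by (auto simp: g_def M_def)
      then show ?thesis by simp
    qed
  qed
qed

end

section \<open>Potentials with a double eigenvalue\<close>

definition with_modes :: "(int \<Rightarrow> complex) \<Rightarrow> int \<Rightarrow> complex \<Rightarrow> complex \<Rightarrow> int \<Rightarrow> complex" where
  "with_modes V n s t = V(2 * n := s, - (2 * n) := t)"

lemma with_modes_simps:
  assumes "n \<noteq> 0"
  shows "with_modes V n s t (2 * n) = s" "with_modes V n s t (- (2 * n)) = t" "with_modes V n s t 0 = V 0"
  using assms by (auto simp: with_modes_def)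

text \<open>Two replaced entries add at most \<open>2 * M\<^sup>2\<close> to the sum of squares. The
  constant \<open>sqrt 3\<close> is not rounded up, because twice its square is the 6 that
  determines the final constant 256.\<close>

lemma ellw_with_modes:
  assumes W: "submult_weight W" and V: "ellw W V M" and "W (2 * n) * cmod s \<le> M" "W (2 * n) * cmod t \<le> M"
  shows "ellw W (with_modes V n s t) (sqrt 3 * M)"
  unfolding ell2_def
proof (intro conjI allI impI)
  have M: "0 \<le> M" using V by (rule ell2_nonneg)
  then show "0 \<le> sqrt 3 * M" by simp
  fix F :: "int set" assume F: "finite F"
  let ?E = "{2 * n, - (2 * n)}"
  have Wn: "0 \<le> W (2 * n)" "W (- (2 * n)) = W (2 * n)" using submultD(2)[OF W, of "2 * n"] submultD(4)[OF W, of "2 * n"] by auto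
  have pt: "(norm (W j * cmod (with_modes V n s t j)))\<^sup>2 \<le> (norm (W j * cmod (V j)))\<^sup>2 + (if j \<in> ?E then M\<^sup>2 else 0)" for j
  proof (cases "j \<in> ?E")
    case True
    then have "norm (W j * cmod (with_modes V n s t j)) \<le> M" using assms(3,4) Wn by (auto simp: with_modes_def abs_mult)
    then have "(norm (W j * cmod (with_modes V n s t j)))\<^sup>2 \<le> M\<^sup>2" by (intro power_mono) auto
    then show ?thesis using True by (simp add: add_increasing)
  qed (auto simp: with_modes_def)
  have "(\<Sum>j\<in>F. if j \<in> ?E then M\<^sup>2 else 0) = (\<Sum>j\<in>F \<inter> ?E. M\<^sup>2)" by (rule sum.inter_restrict[OF F, symmetric])
  also have "\<dots> = real (card (F \<inter> ?E)) * M\<^sup>2" by simp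
  also have "\<dots> \<le> 2 * M\<^sup>2"
  proof (rule mult_right_mono)
    have "card (F \<inter> ?E) \<le> card ?E" by (rule card_mono) auto
    also have "\<dots> \<le> 2" by (simp add: card_insert_if)
    finally show "real (card (F \<inter> ?E)) \<le> 2" by simp
  qed simp
  finally have e: "(\<Sum>j\<in>F. if j \<in> ?E then M\<^sup>2 else 0) \<le> 2 * M\<^sup>2" .
  have "(\<Sum>j\<in>F. (norm (W j * cmod (with_modes V n s t j)))\<^sup>2)
      \<le> (\<Sum>j\<in>F. (norm (W j * cmod (V j)))\<^sup>2 + (if j \<in> ?E then M\<^sup>2 else 0))" by (rule sum_mono[OF pt])
  also have "\<dots> \<le> M\<^sup>2 + 2 * M\<^sup>2" unfolding sum.distrib using V F e unfolding ell2_def by (intro add_mono) auto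
  also have "\<dots> = (sqrt 3 * M)\<^sup>2" by (simp add: power_mult_distrib)
  finally show "(\<Sum>j\<in>F. (norm (W j * cmod (with_modes V n s t j)))\<^sup>2) \<le> (sqrt 3 * M)\<^sup>2" .
qed

lemma ell2_with_modes_diff:
  assumes "cmod (s - s') \<le> D" "cmod (t - t') \<le> D" "n \<noteq> 0"
  shows "ell2 (\<lambda>j. with_modes V n s t j - with_modes V n s' t' j) (2 * D)"
  unfolding ell2_def
proof (intro conjI allI impI)
  have D: "0 \<le> D" using assms(1) norm_ge_zero order_trans by blast
  then show "0 \<le> 2 * D" by simp
  fix F :: "int set" assume F: "finite F"
  let ?E = "{2 * n, - (2 * n)}"
  have "(\<Sum>j\<in>F. (norm (with_modes V n s t j - with_modes V n s' t' j))\<^sup>2)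
     = (\<Sum>j\<in>F \<inter> ?E. (norm (with_modes V n s t j - with_modes V n s' t' j))\<^sup>2)"
    using F by (intro sum.mono_neutral_right) (auto simp: with_modes_def)
  also have "\<dots> \<le> (\<Sum>j\<in>?E. (norm (with_modes V n s t j - with_modes V n s' t' j))\<^sup>2)"
    by (intro sum_mono2) auto
  also have "\<dots> = (cmod (s - s'))\<^sup>2 + (cmod (t - t'))\<^sup>2"
    using assms(3) with_modes_simps[OF assms(3)] by simp
  also have "\<dots> \<le> D\<^sup>2 + D\<^sup>2" by (intro add_mono power_mono assms(1,2)) auto
  also have "\<dots> \<le> (2 * D)\<^sup>2" by (simp add: power_mult_distrib)
  finally show "(\<Sum>j\<in>F. (norm (with_modes V n s t j - with_modes V n s' t' j))\<^sup>2) \<le> (2 * D)\<^sup>2" .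
qed

lemma in_strip_near:
  assumes "2 \<le> n" "cmod x \<le> real_of_int n"
  shows "in_strip n (of_real (pi\<^sup>2 * (real_of_int n)\<^sup>2) + x)"
proof -
  have "\<bar>Re x\<bar> \<le> real_of_int n" using abs_Re_le_cmod[of x] assms(2) by linarith
  also have "\<dots> \<le> pi\<^sup>2 * real_of_int n" using mult_right_mono[of 1 "pi\<^sup>2" "real_of_int n"] pi_squared_ge assms(1) by simp
  finally show ?thesis using assms(1) by (simp add: in_strip_def)
qed

text \<open>Since all three coefficients of the block vanish, changing only the modes \<open>\<plusminus>n\<close> of a potential turns
  its \<open>n\<close>-th pair of eigenvalues into a geometrically double one.\<close>

lemma double_neighbour:
  assumes W: "submult_weight W" and V: "ellw W V M" and n: "2 \<le> n" "64 * M \<le> real_of_int n"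
  obtains z s t where "in_strip n z" "cmod (z - of_real (pi\<^sup>2 * (real_of_int n)\<^sup>2)) \<le> 2 * M" "ell2 (with_modes V n s t) (2 * M)"
    "coefC (with_modes V n s t) n z = 0" "coefC (reflect (with_modes V n s t)) n z = 0" "defect (with_modes V n s t) n z = 0"
    "W (2 * n) * cmod s \<le> 6 * M\<^sup>2 / real_of_int n" "W (2 * n) * cmod t \<le> 6 * M\<^sup>2 / real_of_int n"
proof -
  define r where "r = real_of_int n"
  have M: "0 \<le> M" using V by (rule ell2_nonneg)
  have r: "2 \<le> r" "64 * M \<le> r" using n by (auto simp: r_def)
  have n0: "n \<noteq> 0" using n by simp
  note wm = with_modes_simps[OF n0, of V]
  define W2 where "W2 = W (2 * n)"
  have W2: "1 \<le> W2" using submultD(1)[OF W] by (simp add: W2_def)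
  have "sqrt 3 \<le> sqrt (2\<^sup>2)" by (subst real_sqrt_le_iff) simp
  then have s3: "sqrt 3 * M \<le> 2 * M" using M by (intro mult_right_mono) auto
  have Mr: "6 * M\<^sup>2 / r \<le> M / 8"
  proof -
    have "6 * M\<^sup>2 / r = 6 * M * (M / r)" by (simp add: power2_eq_square)
    also have "\<dots> \<le> 6 * M * (1 / 64)" using r M by (intro mult_left_mono) (auto simp: field_simps)
    finally show ?thesis using M by simp
  qed
  \<comment> \<open>Three unknowns are solved for together: coordinate 0 is the shift of
    \<open>z\<close> from \<open>\<pi>\<^sup>2 n\<^sup>2\<close>, coordinates 1 and 2 are the new
    coefficients at \<open>2 * n\<close> and \<open>- (2 * n)\<close>. The latter are expected to be
    as small as the corrections they cancel, including the weight.\<close>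
  define \<rho> where "\<rho> i = (if i = 0 then 2 * M else if i \<le> 2 then 6 * M\<^sup>2 / r / W2 else 0)" for i :: nat
  define P where "P x = with_modes V n (x 1) (x 2)" for x :: "nat \<Rightarrow> complex"
  define Z where "Z x = of_real (pi\<^sup>2 * (real_of_int n)\<^sup>2) + x 0" for x :: "nat \<Rightarrow> complex"
  \<comment> \<open>As \<open>P x\<close> has the entries \<open>x 1\<close> and \<open>x 2\<close>
    at the two modes, a fixed point is exactly a common zero of the defect and both coefficients
    \<open>coefC\<close>; subtracting the entry leaves the second-order part, which
    contracts.\<close>
  define F where "F x i = (if i = 0 then coefA (P x) n (Z x) else if i = 1 then - (coefC (P x) n (Z x) - P x (2 * n))
     else if i = 2 then - (coefC (reflect (P x)) n (Z x) - P x (- (2 * n))) else 0)" for x and i :: nat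
  define S where "S = {x. \<forall>i. cmod (x i) \<le> \<rho> i}"
  have S: "W2 * cmod (x 1) \<le> 6 * M\<^sup>2 / r" "W2 * cmod (x 2) \<le> 6 * M\<^sup>2 / r" "cmod (x 0) \<le> 2 * M" if "x \<in> S" for x
  proof -
    have "cmod (x 1) \<le> \<rho> 1" "cmod (x 2) \<le> \<rho> 2" "cmod (x 0) \<le> \<rho> 0" using that by (auto simp: S_def)
    then show "W2 * cmod (x 1) \<le> 6 * M\<^sup>2 / r" "W2 * cmod (x 2) \<le> 6 * M\<^sup>2 / r" "cmod (x 0) \<le> 2 * M"
      using W2 by (auto simp: \<rho>_def pos_le_divide_eq mult.commute simp del: divide_divide_eq_left)
  qed
  have Pw: "ellw W (P x) (sqrt 3 * M)" if "x \<in> S" for x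
    unfolding P_def using S(1,2)[OF that] Mr M by (intro ellw_with_modes[OF W V]) (auto simp: W2_def)
  have P2: "ell2 (P x) (2 * M)" if "x \<in> S" for x
    using ell2_mono[OF ellw_ell2[OF W Pw[OF that]] s3] .
  have Zs: "in_strip n (Z x)" if "x \<in> S" for x
    unfolding Z_def using S(3)[OF that] r M n by (intro in_strip_near) (auto simp: r_def)
  have vn: "2 * (sqrt 3 * M) \<le> real_of_int n" "2 * (2 * M) \<le> real_of_int n" using s3 r M unfolding r_def by linarith+
  have v2: "2 * (sqrt 3 * M)\<^sup>2 / real_of_int n = 6 * M\<^sup>2 / r" by (simp add: power_mult_distrib r_def)
  note cb = coef_bounds[OF W Pw Zs vn(1), unfolded v2]
  have "\<exists>x\<in>S. F x = x"
  proof (rule sup_contraction_fixpoint[where \<rho> = \<rho> and R = "2 * M + 6 * M\<^sup>2 / r / W2", folded S_def])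
    show "0 \<le> \<rho> i" for i using M r W2 by (simp add: \<rho>_def)
    show "\<rho> i \<le> 2 * M + 6 * M\<^sup>2 / r / W2" for i using M r W2 by (simp add: \<rho>_def)
    show "F x \<in> S" if x: "x \<in> S" for x
      unfolding S_def mem_Collect_eq
    proof (rule allI)
      fix i :: nat
      have c1: "cmod (coefA (P x) n (Z x)) \<le> 2 * M"
      proof -
        have "cmod (coefA (P x) n (Z x) - P x 0) \<le> W 0 * cmod (coefA (P x) n (Z x) - P x 0)"
          using mult_right_mono[OF submultD(1)[OF W, of 0] norm_ge_zero] by simp
        also have "\<dots> \<le> M / 8" using cb(1)[OF x x] Mr by linarith
        finally have 1: "cmod (coefA (P x) n (Z x) - V 0) \<le> M / 8" by (simp add: P_def wm)
        have "cmod (V 0) \<le> M" by (rule ell2_point[OF ellw_ell2[OF W V]])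
        then show ?thesis using 1 norm_triangle_sub[of "coefA (P x) n (Z x)" "V 0"] M by linarith
      qed
      have c2: "cmod (coefC (P x) n (Z x) - P x (2 * n)) \<le> 6 * M\<^sup>2 / r / W2"
        using cb(2)[OF x x] W2 by (simp add: W2_def pos_le_divide_eq mult.commute del: divide_divide_eq_left)
      have c3: "cmod (coefC (reflect (P x)) n (Z x) - P x (- (2 * n))) \<le> 6 * M\<^sup>2 / r / W2"
        using cb(3)[OF x x] W2 by (simp add: W2_def pos_le_divide_eq mult.commute del: divide_divide_eq_left)
      show "cmod (F x i) \<le> \<rho> i" using c1 c2 c3 by (auto simp: F_def \<rho>_def norm_minus_commute)
    qed
    show "cmod (F x i - F y i) \<le> D / 2" if x: "x \<in> S" and y: "y \<in> S" and D: "0 \<le> D" and xy: "\<And>i. cmod (x i - y i) \<le> D"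
      for x y :: "nat \<Rightarrow> complex" and D i
    proof -
      have d: "ell2 (\<lambda>j. P x j - P y j) (2 * D)" unfolding P_def by (rule ell2_with_modes_diff[OF xy xy n0])
      have zz: "Z x - Z y = x 0 - y 0" by (simp add: Z_def)
      let ?e = "6 * (2 * M) / r * (2 * D) + 4 * (2 * M)\<^sup>2 / r\<^sup>2 * cmod (Z x - Z y)"
      note cp = coef_perturb[OF P2[OF x] P2[OF y] Zs[OF x] Zs[OF y] vn(2) d, folded r_def]
      have Mr1: "M / r \<le> 1 / 64" "0 \<le> M / r" using r M by (auto simp: field_simps)
      have "?e \<le> D / 2"
      proof -
        have "(M / r)\<^sup>2 \<le> (1 / 64)\<^sup>2" using Mr1 by (intro power_mono) auto
        moreover have "16 * (1 / 64 :: real)\<^sup>2 \<le> 1 / 64" by (simp add: power2_eq_square)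
        ultimately have "16 * (M / r)\<^sup>2 \<le> 1 / 64" by linarith
        then have "16 * (M / r)\<^sup>2 * cmod (x 0 - y 0) \<le> 1 / 64 * D" using xy D by (intro mult_mono) auto
        moreover have "(24 * D) * (M / r) \<le> (24 * D) * (1 / 64)" using Mr1 D by (intro mult_left_mono) auto
        moreover have "?e = (24 * D) * (M / r) + 16 * (M / r)\<^sup>2 * cmod (x 0 - y 0)"
          unfolding zz by (simp add: power_divide power_mult_distrib)
        ultimately show ?thesis using D by linarith
      qed
      note le = order_trans[OF cp(1) this] order_trans[OF cp(2) this] order_trans[OF cp(3) this]
      have "P x 0 = P y 0" by (simp add: P_def wm)
      then have 0: "cmod (coefA (P x) n (Z x) - coefA (P y) n (Z y)) \<le> D / 2" using le(1) by simp
      show ?thesis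
      proof -
        consider "i = 0" | "i = 1" | "i = 2" | "2 < i" by linarith
        then show ?thesis
        proof cases
          case 1 then show ?thesis using 0 by (simp add: F_def)
        next
          case 2
          then have "F x i - F y i = - ((coefC (P x) n (Z x) - P x (2 * n)) - (coefC (P y) n (Z y) - P y (2 * n)))" by (simp add: F_def)
          then show ?thesis using le(2) by (simp only: norm_minus_cancel)
        next
          case 3
          then have "F x i - F y i = - ((coefC (reflect (P x)) n (Z x) - P x (- (2 * n))) - (coefC (reflect (P y)) n (Z y) - P y (- (2 * n))))"
            by (simp add: F_def)
          then show ?thesis using le(3) by (simp only: norm_minus_cancel)
        next
          case 4 then show ?thesis using D by (simp add: F_def)
        qed
      qed
    qed
  qed blast
  then obtain x where x: "x \<in> S" "F x = x" by blast
  have f0: "coefA (P x) n (Z x) = x 0" using fun_cong[OF x(2), of 0] by (simp add: F_def)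
  have f1: "- (coefC (P x) n (Z x) - P x (2 * n)) = x 1" using fun_cong[OF x(2), of 1] by (simp add: F_def)
  have f2: "- (coefC (reflect (P x)) n (Z x) - P x (- (2 * n))) = x 2" using fun_cong[OF x(2), of 2] by (simp add: F_def)
  show ?thesis
  proof (rule that[of "Z x" "x 1" "x 2", folded P_def])
    show "in_strip n (Z x)" "ell2 (P x) (2 * M)" using Zs P2 x(1) by auto
    show "cmod (Z x - of_real (pi\<^sup>2 * (real_of_int n)\<^sup>2)) \<le> 2 * M" using S(3)[OF x(1)] by (simp add: Z_def)
    show "coefC (P x) n (Z x) = 0" using f1 by (simp add: P_def wm)
    show "coefC (reflect (P x)) n (Z x) = 0" using f2 by (simp add: P_def wm)
    show "defect (P x) n (Z x) = 0" using f0 by (simp add: defect_def Z_def)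
    show "W (2 * n) * cmod (x 1) \<le> 6 * M\<^sup>2 / real_of_int n" "W (2 * n) * cmod (x 2) \<le> 6 * M\<^sup>2 / real_of_int n"
      using S[OF x(1)] by (auto simp: W2_def r_def)
  qed
qed

section \<open>Norm and Fourier coefficients of square integrable functions\<close>

lemma L2_norm_square: "q \<in> L2 \<Longrightarrow> (L2_norm q)\<^sup>2 = integral {0..1} (\<lambda>x. (cmod (q x))\<^sup>2)"
proof -
  assume q: "q \<in> L2"
  have "(LINT x:{0..1}|lebesgue. (cmod (q x))\<^sup>2) = integral {0..1} (\<lambda>x. (cmod (q x))\<^sup>2)"
    using q unfolding L2_def by (auto intro: set_lebesgue_integral_eq_integral(2))
  moreover have "0 \<le> integral {0..1} (\<lambda>x. (cmod (q x))\<^sup>2)" using L2_square_integrable[OF q] by (intro integral_nonneg) auto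
  ultimately show ?thesis by (simp add: L2_norm_def)
qed

lemma L2_norm_nonneg: "0 \<le> L2_norm q"
  unfolding L2_norm_def set_lebesgue_integral_def
  by (intro real_sqrt_ge_zero Bochner_Integration.integral_nonneg) auto

lemma L2I:
  assumes "q \<in> borel_measurable lebesgue" "\<And>x. q (x + 1) = q x" "g integrable_on {0..1}" "\<And>x. (cmod (q x))\<^sup>2 \<le> g x"
  shows "q \<in> L2"
proof -
  have "(\<lambda>x. (cmod (q x))\<^sup>2) absolutely_integrable_on {0..1}"
  proof (rule measurable_bounded_by_integrable_imp_absolutely_integrable[OF _ _ assms(3)])
    have "(\<lambda>x. (cmod (q x))\<^sup>2) \<in> borel_measurable lebesgue" using assms(1) by measurable
    then show "(\<lambda>x. (cmod (q x))\<^sup>2) \<in> borel_measurable (lebesgue_on {0..1})" by (rule measurable_restrict_space1)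
  qed (use assms(4) in auto)
  then show ?thesis using assms(1,2) by (simp add: L2_def)
qed

lemma norm_add_square_le: "(cmod (a + b))\<^sup>2 \<le> 2 * (cmod a)\<^sup>2 + 2 * (cmod b)\<^sup>2"
proof -
  have "(cmod (a + b))\<^sup>2 \<le> (cmod a + cmod b)\<^sup>2" by (intro power_mono norm_triangle_ineq) auto
  moreover have "0 \<le> (cmod a - cmod b)\<^sup>2" by simp
  ultimately show ?thesis unfolding power2_sum power2_diff by linarith
qed

lemma L2_add:
  assumes p: "p \<in> L2" and q: "q \<in> L2"
  shows "(\<lambda>x. p x + q x) \<in> L2" "(L2_norm (\<lambda>x. p x + q x))\<^sup>2 \<le> 2 * (L2_norm p)\<^sup>2 + 2 * (L2_norm q)\<^sup>2"
proof -
  note i = L2_square_integrable[OF p, of 0 1] L2_square_integrable[OF q, of 0 1]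
  have g: "((\<lambda>x. 2 * (cmod (p x))\<^sup>2 + 2 * (cmod (q x))\<^sup>2) has_integral (2 * (L2_norm p)\<^sup>2 + 2 * (L2_norm q)\<^sup>2)) {0..1}"
    unfolding L2_norm_square[OF p] L2_norm_square[OF q] by (intro has_integral_add has_integral_mult_right integrable_integral i)
  show L: "(\<lambda>x. p x + q x) \<in> L2"
    by (rule L2I[OF _ _ has_integral_integrable[OF g] norm_add_square_le]) (use p q in \<open>auto simp: L2_def\<close>)
  show "(L2_norm (\<lambda>x. p x + q x))\<^sup>2 \<le> 2 * (L2_norm p)\<^sup>2 + 2 * (L2_norm q)\<^sup>2"
    unfolding L2_norm_square[OF L]
    by (rule has_integral_le[OF integrable_integral[OF L2_square_integrable[OF L]] g]) (rule norm_add_square_le)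
qed

lemma L2_continuous:
  assumes c: "continuous_on UNIV h" and p: "\<And>x. h (x + 1) = h x" and B: "\<And>x. cmod (h x) \<le> B"
  shows "h \<in> L2" "L2_norm h \<le> B"
proof -
  have B0: "0 \<le> B" using B[of 0] norm_ge_zero order_trans by blast
  have B2: "(cmod (h x))\<^sup>2 \<le> B\<^sup>2" for x using B by (intro power_mono) auto
  have g: "((\<lambda>x::real. B\<^sup>2) has_integral B\<^sup>2) {0..1}" using has_integral_const_real[of "B\<^sup>2" 0 1] by simp
  have "h \<in> borel_measurable borel" using c by (rule borel_measurable_continuous_onI)
  then have "h \<in> borel_measurable lebesgue" by (intro measurable_completion) simp
  then show L: "h \<in> L2" by (rule L2I[where g = "\<lambda>_. B\<^sup>2"]) (use p B2 has_integral_integrable[OF g] in auto)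
  have "(L2_norm h)\<^sup>2 \<le> B\<^sup>2" unfolding L2_norm_square[OF L]
    by (rule has_integral_le[OF integrable_integral[OF L2_square_integrable[OF L]] g]) (rule B2)
  then show "L2_norm h \<le> B" using B0 by (rule power2_le_imp_le)
qed

text \<open>Expands the nonnegative integral of \<open>(\<bar>q\<bar> - m)\<^sup>2\<close> over a
  unit interval, with \<open>m\<close> the mean of \<open>\<bar>q\<bar>\<close>.\<close>

lemma L2_integral_norm:
  assumes q: "q \<in> L2" shows "integral {0..1} (\<lambda>x. cmod (q x)) \<le> L2_norm q"
proof -
  define m where "m = integral {0..1} (\<lambda>x. cmod (q x))"
  have i1: "((\<lambda>x. cmod (q x)) has_integral m) {0..1}" unfolding m_def by (intro integrable_integral locintD(3) L2_locint q)
  have i2: "((\<lambda>x. (cmod (q x))\<^sup>2) has_integral (L2_norm q)\<^sup>2) {0..1}"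
    unfolding L2_norm_square[OF q] by (intro integrable_integral L2_square_integrable q)
  have i3: "((\<lambda>x::real. m\<^sup>2) has_integral m\<^sup>2) {0..1}" using has_integral_const_real[of "m\<^sup>2" 0 1] by simp
  have "((\<lambda>x. ((cmod (q x))\<^sup>2 - (2 * m) * cmod (q x)) + m\<^sup>2) has_integral (((L2_norm q)\<^sup>2 - (2 * m) * m) + m\<^sup>2)) {0..1}"
    by (intro has_integral_add has_integral_diff has_integral_mult_right i1 i2 i3)
  moreover have "0 \<le> ((cmod (q x))\<^sup>2 - (2 * m) * cmod (q x)) + m\<^sup>2" for x
    using zero_le_power2[of "cmod (q x) - m"] unfolding power2_diff by (simp add: algebra_simps)
  ultimately have "0 \<le> ((L2_norm q)\<^sup>2 - (2 * m) * m) + m\<^sup>2" using has_integral_nonneg by blast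
  then have "m\<^sup>2 \<le> (L2_norm q)\<^sup>2" by (simp add: power2_eq_square)
  then show ?thesis unfolding m_def[symmetric] using L2_norm_nonneg by (rule power2_le_imp_le)
qed

lemma integral_two_periods:
  assumes q: "q \<in> L2" shows "integral {0..2} (\<lambda>x. (cmod (q x))\<^sup>2) = 2 * (L2_norm q)\<^sup>2"
proof -
  let ?g = "\<lambda>x. (cmod (q x))\<^sup>2"
  have per: "q (x + 1) = q x" for x using q by (simp add: L2_def)
  have "integral {0..2} ?g = integral {0..1} ?g + integral {1..2} ?g"
    by (rule Henstock_Kurzweil_Integration.integral_combine[symmetric]) (auto intro: L2_square_integrable q)
  also have "integral {1..2} ?g = integral {0..1} (?g \<circ> (+) 1)"
    using integral_shift_Icc_real[of 0 1 ?g 1] by simp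
  also have "?g \<circ> (+) 1 = ?g" using per by (auto simp: fun_eq_iff add.commute)
  finally show ?thesis by (simp add: L2_norm_square[OF q])
qed

text \<open>\<open>P\<close> is the partial sum over \<open>F\<close>. Pairing either
  \<open>q\<close> or \<open>P\<close> itself with \<open>P\<close> over \<open>[0, 2]\<close> gives
  \<open>2 * S\<close>, so the integral of \<open>\<bar>q - P\<bar>\<^sup>2\<close> is
  \<open>2 * (L2_norm q)\<^sup>2 - 2 * S\<close>.\<close>

lemma bessel:
  assumes q: "q \<in> L2" shows "ell2 (cf q) (L2_norm q)"
  unfolding ell2_def
proof (intro conjI allI impI L2_norm_nonneg)
  fix F :: "int set" assume F: "finite F"
  define P where "P x = (\<Sum>k\<in>F. cf q k * mode k x)" for x
  define S where "S = (\<Sum>k\<in>F. (cmod (cf q k))\<^sup>2)"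
  have lq: "locint q" by (rule L2_locint[OF q])
  have cP: "continuous_on UNIV P" unfolding P_def by (intro continuous_intros)
  have lP: "locint P" by (rule locint_cont[OF cP])
  have cfP: "cf P k = cf q k" if "k \<in> F" for k
  proof -
    have "cf P k = (\<Sum>j\<in>F. cf (\<lambda>x. cf q j * mode j x) k)" unfolding P_def
      by (rule cf_sum[OF F]) (intro locint_cont continuous_intros)
    also have "\<dots> = (\<Sum>j\<in>F. cf q j * (if k - j = 0 then 1 else 0))"
      using cf_mult_mode[of "\<lambda>_. 1"] cf_one by simp
    also have "\<dots> = (\<Sum>j\<in>F. if j = k then cf q j else 0)" by (intro sum.cong) auto
    also have "\<dots> = cf q k" using F that by simp
    finally show ?thesis .
  qed
  have key: "((\<lambda>x. \<phi> x * cnj (P x)) has_integral of_real (2 * S)) {0..2}" if "locint \<phi>" "\<And>k. k \<in> F \<Longrightarrow> cf \<phi> k = cf q k" for \<phi>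
  proof -
    have cm: "cnj (mode k x) = mode (- k) x" for k x by (simp add: mode_def cis_cnj)
    have e: "\<phi> x * cnj (P x) = (\<Sum>k\<in>F. cnj (cf q k) * (\<phi> x * mode (- k) x))" for x
      unfolding P_def by (simp add: sum_distrib_left cm mult_ac)
    have i: "((\<lambda>x. \<phi> x * mode (- k) x) has_integral (2 * cf \<phi> k)) {0..2}" for k
      unfolding cf_def using integrable_integral[OF cf_integrable[OF that(1)]] by simp
    have "((\<lambda>x. \<phi> x * cnj (P x)) has_integral (\<Sum>k\<in>F. cnj (cf q k) * (2 * cf \<phi> k))) {0..2}" unfolding e
      by (intro has_integral_sum F has_integral_mult_right i)
    moreover have "(\<Sum>k\<in>F. cnj (cf q k) * (2 * cf \<phi> k)) = of_real (2 * S)"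
      unfolding S_def of_real_mult of_real_sum sum_distrib_left
      using that(2) by (intro sum.cong refl) (simp add: complex_norm_square del: of_real_power)
    ultimately show ?thesis by simp
  qed
  have Re: "((\<lambda>x. Re (\<phi> x * cnj (P x))) has_integral (2 * S)) {0..2}" if "locint \<phi>" "\<And>k. k \<in> F \<Longrightarrow> cf \<phi> k = cf q k" for \<phi>
    using has_integral_linear[OF key[OF that] bounded_linear_Re] by (simp add: o_def)
  have "((\<lambda>x. ((cmod (q x))\<^sup>2 - 2 * Re (q x * cnj (P x))) + Re (P x * cnj (P x))) has_integral
      ((2 * (L2_norm q)\<^sup>2 - 2 * (2 * S)) + 2 * S)) {0..2}"
    by (intro has_integral_add has_integral_diff has_integral_mult_right Re lq lP cfP refl)
      (use integrable_integral[OF L2_square_integrable[OF q, of 0 2]] integral_two_periods[OF q] in simp)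
  moreover have "0 \<le> ((cmod (q x))\<^sup>2 - 2 * Re (q x * cnj (P x))) + Re (P x * cnj (P x))" for x
  proof -
    have "((cmod (q x))\<^sup>2 - 2 * Re (q x * cnj (P x))) + Re (P x * cnj (P x)) = (cmod (q x - P x))\<^sup>2"
      unfolding cmod_power2 by (simp add: power2_eq_square algebra_simps)
    then show ?thesis by simp
  qed
  ultimately have "0 \<le> (2 * (L2_norm q)\<^sup>2 - 2 * (2 * S)) + 2 * S" using has_integral_nonneg by blast
  then show "(\<Sum>k\<in>F. (norm (cf q k))\<^sup>2) \<le> (L2_norm q)\<^sup>2" by (simp add: S_def)
qed

text \<open>Index \<open>k\<close> stands for the mode \<open>e\<^sup>i\<^sup>\<pi>\<^sup>k\<^sup>x\<close>, so a weight on the 1-periodic modes lives on the even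
  indices; geometric means at the odd ones keep it submultiplicative.\<close>

definition half_weight :: "(int \<Rightarrow> real) \<Rightarrow> int \<Rightarrow> real" where
  "half_weight w k = sqrt (w (k div 2) * w ((k + 1) div 2))"

lemma submult_half_weight:
  assumes w: "submult_weight w" shows "submult_weight (half_weight w)"
proof -
  note s = submultD[OF w]
  have le: "w (i + j) \<le> w i * w j" for i j using w by (simp add: submult_weight_def)
  have "half_weight w (- k) = half_weight w k" for k
  proof -
    have "(- k) div 2 = - ((k + 1) div 2)" "(- k + 1) div 2 = - (k div 2)" by presburger+
    then show ?thesis by (simp add: half_weight_def s(4) mult.commute)
  qed
  moreover have "1 \<le> half_weight w k" for k
    unfolding half_weight_def using mult_mono[OF s(1) s(1), of "k div 2" "(k + 1) div 2"] s(2)[of "k div 2"] by simp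
  moreover have "half_weight w (j + k) \<le> half_weight w j * half_weight w k" for j k
  proof -
    have "w ((j + k) div 2) * w ((j + k + 1) div 2) \<le> w (j div 2) * w ((j + 1) div 2) * (w (k div 2) * w ((k + 1) div 2))"
    proof (cases "even j \<or> even k")
      case True
      then have e: "(j + k) div 2 = j div 2 + k div 2" "(j + k + 1) div 2 = (j + 1) div 2 + (k + 1) div 2" by (auto elim!: evenE)
      have "w ((j + k) div 2) * w ((j + k + 1) div 2) \<le> (w (j div 2) * w (k div 2)) * (w ((j + 1) div 2) * w ((k + 1) div 2))"
        unfolding e by (intro mult_mono le) (auto intro!: less_imp_le mult_pos_pos s(2))
      then show ?thesis by (simp only: mult_ac)
    next
      case False
      \<comment> \<open>For two odd indices the lower half of the sum is a lower half plus an upper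
        half, so the factors have to be paired crosswise.\<close>
      then have e: "(j + k) div 2 = j div 2 + (k + 1) div 2" "(j + k + 1) div 2 = (j + 1) div 2 + k div 2" by presburger+
      have "w ((j + k) div 2) * w ((j + k + 1) div 2) \<le> (w (j div 2) * w ((k + 1) div 2)) * (w ((j + 1) div 2) * w (k div 2))"
        unfolding e by (intro mult_mono le) (auto intro!: less_imp_le mult_pos_pos s(2))
      then show ?thesis by (simp only: mult_ac)
    qed
    then show ?thesis unfolding half_weight_def real_sqrt_mult[symmetric] by (rule real_sqrt_le_mono)
  qed
  ultimately show ?thesis by (simp add: submult_weight_def normalized_weight_def)
qed

lemma half_weight_even: "submult_weight w \<Longrightarrow> half_weight w (2 * m) = w m"
  using submultD(2)[of w m] by (simp add: half_weight_def)

lemma ellw_half_weight: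
  assumes w: "submult_weight w" and a: "ellw w a M" and V: "\<And>m. V (2 * m) = a m" "\<And>m. V (2 * m + 1) = 0"
  shows "ellw (half_weight w) V M"
  unfolding ell2_def
proof (intro conjI allI impI)
  show "0 \<le> M" using a by (rule ell2_nonneg)
  fix F :: "int set" assume F: "finite F"
  let ?g = "\<lambda>j. (norm (half_weight w j * cmod (V j)))\<^sup>2"
  have "sum ?g F = sum ?g {j\<in>F. even j}"
  proof (rule sum.mono_neutral_right[OF F])
    show "\<forall>j\<in>F - {j\<in>F. even j}. ?g j = 0"
    proof
      fix j assume "j \<in> F - {j\<in>F. even j}"
      then obtain m where "j = 2 * m + 1" by (auto elim: oddE)
      then show "?g j = 0" using V(2) by simp
    qed
  qed auto
  also have "\<dots> = sum ?g ((*) 2 ` ((\<lambda>j. j div 2) ` {j\<in>F. even j}))" by (intro sum.cong) (force simp: image_image)+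
  also have "\<dots> = (\<Sum>m\<in>(\<lambda>j. j div 2) ` {j\<in>F. even j}. ?g (2 * m))"
    by (subst sum.reindex) (auto simp: inj_on_def)
  also have "\<dots> \<le> M\<^sup>2" using a F unfolding ell2_def by (simp add: half_weight_even[OF w] V(1))
  finally show "sum ?g F \<le> M\<^sup>2" .
qed

lemma H_weighted_ellw:
  assumes "q \<in> H_weighted w" "normalized_weight w"
  shows "ellw w (fourier q) (weighted_norm w (fourier q))"
proof -
  have s: "(\<lambda>n. (norm (w n * cmod (fourier q n)))\<^sup>2) summable_on UNIV"
    using assms(1) by (simp add: H_weighted_def power_mult_distrib)
  show ?thesis using ell2I_summable[OF s] by (simp add: weighted_norm_def power_mult_distrib)
qed

section \<open>Changing a potential in two modes\<close>

definition two_modes :: "int \<Rightarrow> complex \<Rightarrow> complex \<Rightarrow> real \<Rightarrow> complex" where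
  "two_modes n \<alpha> \<beta> x = \<alpha> * mode (2 * n) x + \<beta> * mode (- (2 * n)) x"

lemma mode_even_periodic: "mode (2 * n) (x + 1) = mode (2 * n) x"
  using cis_multiple_2pi[of "real_of_int n"]
  by (simp add: mode_def cis_mult[symmetric] distrib_left mult.assoc mult.left_commute)

lemma two_modes_continuous: "continuous_on S (two_modes n \<alpha> \<beta>)"
  unfolding two_modes_def[abs_def] by (intro continuous_intros)

lemma two_modes_le: "cmod (two_modes n \<alpha> \<beta> x) \<le> cmod \<alpha> + cmod \<beta>"
  unfolding two_modes_def by (rule norm_triangle_le) (simp add: norm_mult)

lemma two_modes_L2: "two_modes n \<alpha> \<beta> \<in> L2" "L2_norm (two_modes n \<alpha> \<beta>) \<le> cmod \<alpha> + cmod \<beta>"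
proof -
  have per: "two_modes n \<alpha> \<beta> (x + 1) = two_modes n \<alpha> \<beta> x" for x
    unfolding two_modes_def using mode_even_periodic[of n x] mode_even_periodic[of "- n" x] by simp
  show "two_modes n \<alpha> \<beta> \<in> L2" "L2_norm (two_modes n \<alpha> \<beta>) \<le> cmod \<alpha> + cmod \<beta>"
    by (rule L2_continuous[OF two_modes_continuous per two_modes_le])+
qed

lemma cf_two_modes:
  "cf (two_modes n \<alpha> \<beta>) k = \<alpha> * (if k = 2 * n then 1 else 0) + \<beta> * (if k = - (2 * n) then 1 else 0)"
proof -
  have m: "cf (mode j) k = (if k = j then 1 else 0)" for j
    using cf_mult_mode[of "\<lambda>_. 1" 1 j k] cf_one by simp
  show ?thesis unfolding two_modes_def[abs_def]
    by (subst cf_lin) (auto intro!: locint_cont continuous_intros simp: m)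
qed

lemma cf_add_two_modes:
  assumes q: "q \<in> L2" and n: "n \<noteq> 0"
  shows "cf (\<lambda>x. q x + two_modes n (s - cf q (2 * n)) (t - cf q (- (2 * n))) x) = with_modes (cf q) n s t"
proof
  fix k
  have "cf (\<lambda>x. 1 * q x + 1 * two_modes n (s - cf q (2 * n)) (t - cf q (- (2 * n))) x) k = with_modes (cf q) n s t k"
    by (subst cf_lin[OF L2_locint[OF q] locint_cont[OF two_modes_continuous]])
      (use n in \<open>auto simp: cf_two_modes with_modes_def\<close>)
  then show "cf (\<lambda>x. q x + two_modes n (s - cf q (2 * n)) (t - cf q (- (2 * n))) x) k = with_modes (cf q) n s t k" by simp
qed

text \<open>A vanishing reduced matrix allows arbitrary amplitudes on the block, and eigenvectors
  are determined by them; so the eigenspace has dimension exactly 2.\<close>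

lemma geometric_mult_double:
  assumes q: "q \<in> L2" and v: "ell2 (cf q) v" and z: "in_strip n z" and vn: "2 * v \<le> real_of_int n"
    and c: "coefC (cf q) n z = 0" "coefC (reflect (cf q)) n z = 0" "defect (cf q) n z = 0"
  shows "geometric_mult q z = 2" "2 \<le> algebraic_mult q z"
proof -
  have d: "z - of_real (pi\<^sup>2 * (real_of_int n)\<^sup>2) - coefA (cf q) n z = 0" using c(3) by (simp add: defect_def)
  have n2: "2 \<le> n" using z by (simp add: in_strip_def)
  obtain a where a: "decays a" "\<And>k. hill_seq (cf q) a k = z * a k" "a (- n) = 1" "a n = 0"
    by (rule eigen_of_block[OF v z vn, of 1 0]) (use d c in auto)
  obtain b where b: "decays b" "\<And>k. hill_seq (cf q) b k = z * b k" "b (- n) = 0" "b n = 1"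
    by (rule eigen_of_block[OF v z vn, of 0 1]) (use d c in auto)
  have indep: "s = 0 \<and> t = 0" if "\<And>k. s * a k + t * b k = 0" for s t
    using that[of n] that[of "- n"] a(3,4) b(3,4) by simp
  show "2 \<le> algebraic_mult q z" by (rule algebraic_mult_ge_2[OF q v a(1,2) b(1,2) indep])
  let ?E = "{f. hill_op q f (\<lambda>x. z * f x)}"
  note ip = independent_pair[OF q v a(1) b(1) indep]
  have sub: "{synth a, synth b} \<subseteq> ?E" using a b eigen_function_iff[OF q v] by blast
  have span: "?E \<subseteq> cfun.span {synth a, synth b}"
  proof
    fix f assume "f \<in> ?E"
    then obtain e where e: "decays e" "f = synth e" "\<And>k. hill_seq (cf q) e k = z * e k" using eigen_function_iff[OF q v] by blast
    define g where "g k = 1 * e k + (- 1) * (e (- n) * a k + e n * b k)" for k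
    have dab: "decays (\<lambda>k. e (- n) * a k + e n * b k)" by (intro decays_add decays_scale a(1) b(1))
    have dg: "decays g" unfolding g_def[abs_def] by (intro decays_add decays_scale dab e(1))
    have "hill_seq (cf q) g k = z * g k" for k
      unfolding g_def[abs_def] hill_seq_lin[OF v e(1) dab] hill_seq_lin[OF v a(1) b(1)] a(2) b(2) e(3)
      by (simp add: algebra_simps)
    then have g0: "g k = 0" for k
      by (rule block_eigen_zero[OF v z vn dg]) (auto simp: g_def a b)
    have "e k = g k + (e (- n) * a k + e n * b k)" for k unfolding g_def by (simp only: mult_1_left mult_minus1 diff_add_cancel uminus_add_conv_diff add_uminus_conv_diff)
    then have "e = (\<lambda>k. e (- n) * a k + e n * b k)" unfolding g0 add_0_left by (rule ext)
    then have "f x = e (- n) * synth a x + e n * synth b x" for x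
      using e(2) synth_lin[OF a(1) b(1), of "e (- n)" "e n" x] by simp
    then have "f = (\<lambda>x. e (- n) * synth a x) + (\<lambda>x. e n * synth b x)" by (simp add: fun_eq_iff)
    moreover have "(\<lambda>x. e (- n) * synth a x) + (\<lambda>x. e n * synth b x) \<in> cfun.span {synth a, synth b}"
      by (intro cfun.span_add cfun.span_scale cfun.span_base) auto
    ultimately show "f \<in> cfun.span {synth a, synth b}" by simp
  qed
  have "cfun.dim ?E = card {synth a, synth b}" by (rule cfun.dim_unique[OF sub span ip(1) refl])
  then show "geometric_mult q z = 2" using ip(2) by (simp add: geometric_mult_def)
qed

definition double_gap :: "nat \<Rightarrow> (real \<Rightarrow> complex) \<Rightarrow> bool" where
  "double_gap n p \<longleftrightarrow> lambda_plus n p = lambda_minus n p \<and> geometric_mult p (lambda_plus n p) = 2"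

text \<open>The threshold \<open>16 * (2 * M + 1)\<^sup>2 + 1\<close> is the one for counting the
  eigenvalues of the changed potential, whose coefficients have norm at most \<open>2 * M\<close>.
  Its double eigenvalue lies inside the strip of \<open>n\<close> and so takes both positions
  belonging to \<open>n\<close>.\<close>

lemma double_potential:
  assumes q: "q \<in> L2" and W: "submult_weight W" and V: "ellw W (cf q) M" and n: "16 * (2 * M + 1)\<^sup>2 + 1 \<le> real n"
  obtains z s t where "in_strip (int n) z" "ell2 (with_modes (cf q) (int n) s t) (2 * M)"
    "coefC (with_modes (cf q) (int n) s t) (int n) z = 0" "coefC (reflect (with_modes (cf q) (int n) s t)) (int n) z = 0"
    "defect (with_modes (cf q) (int n) s t) (int n) z = 0"
    "W (2 * int n) * cmod s \<le> 6 * M\<^sup>2 / real n" "W (2 * int n) * cmod t \<le> 6 * M\<^sup>2 / real n"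
    "double_gap n (\<lambda>x. q x + two_modes (int n) (s - cf q (2 * int n)) (t - cf q (- (2 * int n))) x)"
proof -
  have M: "0 \<le> M" using V by (rule ell2_nonneg)
  have "16 * (4 * M\<^sup>2 + 4 * M + 1) + 1 \<le> real n" using n by (simp add: power2_sum power_mult_distrib)
  moreover have "0 \<le> M\<^sup>2" by simp
  ultimately have n64: "64 * M \<le> real n" "17 \<le> real n" using M by argo+
  then have n2: "64 * M \<le> real_of_int (int n)" "2 \<le> int n" "int n \<noteq> 0" by auto
  obtain z s t where z: "in_strip (int n) z" "cmod (z - of_real (pi\<^sup>2 * (real_of_int (int n))\<^sup>2)) \<le> 2 * M"
    and e: "ell2 (with_modes (cf q) (int n) s t) (2 * M)"
    and c: "coefC (with_modes (cf q) (int n) s t) (int n) z = 0" "coefC (reflect (with_modes (cf q) (int n) s t)) (int n) z = 0"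
    "defect (with_modes (cf q) (int n) s t) (int n) z = 0"
    and st: "W (2 * int n) * cmod s \<le> 6 * M\<^sup>2 / real_of_int (int n)" "W (2 * int n) * cmod t \<le> 6 * M\<^sup>2 / real_of_int (int n)"
    by (rule double_neighbour[OF W V n2(2,1)])
  define p where "p = (\<lambda>x. q x + two_modes (int n) (s - cf q (2 * int n)) (t - cf q (- (2 * int n))) x)"
  have p: "p \<in> L2" unfolding p_def by (rule L2_add(1)[OF q two_modes_L2(1)])
  have cfp: "cf p = with_modes (cf q) (int n) s t" unfolding p_def by (rule cf_add_two_modes[OF q n2(3)])
  have vp: "ell2 (cf p) (2 * M)" using e by (simp add: cfp)
  have gm: "geometric_mult p z = 2" "2 \<le> algebraic_mult p z"
    by (rule geometric_mult_double[OF p vp z(1)]; use n64 M c in \<open>simp add: cfp\<close>)+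
  have re: "\<bar>Re z - pi\<^sup>2 * (real n)\<^sup>2\<bar> \<le> 2 * M" using cmod_le_Re[of z "pi\<^sup>2 * (real n)\<^sup>2"] z(2) by simp
  have lt: "2 * M < pi\<^sup>2 * real n"
  proof -
    have "2 * M < 1 * real n" using n64 M by linarith
    also have "\<dots> \<le> pi\<^sup>2 * real n" using pi_squared_ge by (intro mult_right_mono) auto
    finally show ?thesis .
  qed
  have sb: "strip_bound (n - 1) = pi\<^sup>2 * (real n)\<^sup>2 - pi\<^sup>2 * real n" "strip_bound n = pi\<^sup>2 * (real n)\<^sup>2 + pi\<^sup>2 * real n"
    using n64(2) unfolding strip_bound_def by (auto simp: of_nat_diff power2_eq_square algebra_simps)
  have "strip_bound (n - 1) \<le> Re z" "Re z < strip_bound n" using re lt unfolding sb by linarith+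
  note de = double_eigenvalue[OF p vp n this gm(2)]
  show ?thesis
    by (rule that[OF z(1) e c]) (use st de gm(1) in \<open>auto simp: p_def[symmetric] double_gap_def\<close>)
qed

section \<open>Mean value estimate for the alternate gap lengths\<close>

lemma L2_norm_scale: "L2_norm (\<lambda>x. of_real t * h x) = \<bar>t\<bar> * L2_norm h"
proof -
  have "(LINT x:{0..1}|lebesgue. (cmod (of_real t * h x))\<^sup>2) = t\<^sup>2 * (LINT x:{0..1}|lebesgue. (cmod (h x))\<^sup>2)"
    by (simp add: norm_mult power_mult_distrib)
  then show ?thesis by (simp add: L2_norm_def real_sqrt_mult)
qed

lemma L2_scale: "h \<in> L2 \<Longrightarrow> (\<lambda>x. of_real t * h x) \<in> L2"
proof (rule L2I[where g = "\<lambda>x. t\<^sup>2 * (cmod (h x))\<^sup>2"])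
  assume h: "h \<in> L2"
  have "h \<in> borel_measurable lebesgue" using h by (simp add: L2_def)
  then show "(\<lambda>x. of_real t * h x) \<in> borel_measurable lebesgue" by measurable
  show "of_real t * h (x + 1) = of_real t * h x" for x using h by (simp add: L2_def)
  show "(\<lambda>x. t\<^sup>2 * (cmod (h x))\<^sup>2) integrable_on {0..1}"
    using integrable_cmul[OF L2_square_integrable[OF h], of "t\<^sup>2" 0 1] by simp
qed (simp add: norm_mult power_mult_distrib)

lemma pairing:
  assumes g: "g \<in> L2" and h: "continuous_on UNIV h" and B: "\<And>x. cmod (h x) \<le> B"
  shows "set_integrable lebesgue {0..1} (\<lambda>x. g x * h x)" "cmod (LINT x:{0..1}|lebesgue. g x * h x) \<le> L2_norm g * B"
proof -
  have B0: "0 \<le> B" using B[of 0] norm_ge_zero order_trans by blast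
  have l: "locint (\<lambda>x. g x * h x)" by (rule locint_mult_cont[OF L2_locint[OF g] h])
  show i: "set_integrable lebesgue {0..1} (\<lambda>x. g x * h x)" by (rule locintD(1)[OF l])
  have "cmod (LINT x:{0..1}|lebesgue. g x * h x) = cmod (integral {0..1} (\<lambda>x. g x * h x))"
    using set_lebesgue_integral_eq_integral(2)[OF i] by simp
  also have "\<dots> \<le> integral {0..1} (\<lambda>x. cmod (g x) * B)"
    by (rule integral_norm_bound_integral[OF locintD(2)[OF l]])
      (auto simp: norm_mult intro!: mult_left_mono B integrable_on_mult_left locintD(3) L2_locint g)
  also have "\<dots> = integral {0..1} (\<lambda>x. cmod (g x)) * B" by simp
  also have "\<dots> \<le> L2_norm g * B" by (intro mult_right_mono L2_integral_norm g B0)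
  finally show "cmod (LINT x:{0..1}|lebesgue. g x * h x) \<le> L2_norm g * B" .
qed

text \<open>The functional is differentiated along the segment from \<open>q\<close> in the
  direction \<open>h\<close>. As \<open>h\<close> is bounded, the deviation of the gradient from
  \<open>T\<close> is paired with it by the supremum of \<open>h\<close> and the mean of the
  deviation, which its \<open>L2\<close> norm dominates.\<close>

lemma gradient_mean_value:
  assumes f: "\<And>q. q \<in> L2 \<Longrightarrow> has_gradient f q (G q)" and q: "q \<in> L2" and h: "h \<in> L2" "continuous_on UNIV h"
    and B: "\<And>x. cmod (h x) \<le> B" and T: "T \<in> L2"
    and c: "\<And>\<tau>. 0 \<le> \<tau> \<Longrightarrow> \<tau> \<le> 1 \<Longrightarrow> L2_norm (\<lambda>x. G (\<lambda>x. q x + of_real \<tau> * h x) x - T x) \<le> c"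
  shows "cmod (f (\<lambda>x. q x + h x) - f q - (LINT x:{0..1}|lebesgue. T x * h x)) \<le> c * B"
proof -
  define Q where "Q \<tau> = (\<lambda>x. q x + of_real \<tau> * h x)" for \<tau>
  have Q: "Q \<tau> \<in> L2" for \<tau> unfolding Q_def by (intro L2_add(1) q L2_scale h(1))
  define I where "I \<tau> = (LINT x:{0..1}|lebesgue. G (Q \<tau>) x * h x)" for \<tau>
  define J where "J = (LINT x:{0..1}|lebesgue. T x * h x)"
  have GL: "G (Q \<tau>) \<in> L2" for \<tau> using f[OF Q] by (simp add: has_gradient_def)
  have B0: "0 \<le> B" using B[of 0] norm_ge_zero order_trans by blast
  have IJ: "cmod (I \<tau> - J) \<le> c * B" if "0 \<le> \<tau>" "\<tau> \<le> 1" for \<tau>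
  proof -
    have D: "(\<lambda>x. G (Q \<tau>) x - T x) \<in> L2"
      using L2_add(1)[OF GL[of \<tau>] L2_scale[OF T, of "-1"]] by simp
    have "I \<tau> - J = (LINT x:{0..1}|lebesgue. G (Q \<tau>) x * h x - T x * h x)"
      unfolding I_def J_def
      by (rule set_integral_diff(2)[OF pairing(1)[OF GL h(2) B] pairing(1)[OF T h(2) B], symmetric])
    also have "\<dots> = (LINT x:{0..1}|lebesgue. (G (Q \<tau>) x - T x) * h x)" by (simp add: algebra_simps)
    finally have "cmod (I \<tau> - J) \<le> L2_norm (\<lambda>x. G (Q \<tau>) x - T x) * B" using pairing(2)[OF D h(2) B] by simp
    also have "\<dots> \<le> c * B" using c[OF that] B0 unfolding Q_def by (intro mult_right_mono) auto
    finally show ?thesis .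
  qed
  have der: "((\<lambda>\<tau>. f (Q \<tau>)) has_vector_derivative I \<tau>) (at \<tau>)" for \<tau>
    unfolding has_vector_derivative_def has_derivative_at_alt
  proof (intro conjI allI impI)
    show "bounded_linear (\<lambda>y. y *\<^sub>R I \<tau>)" by (rule bounded_linear_scaleR_left)
    fix e :: real assume e: "0 < e"
    define N where "N = L2_norm h + 1"
    have N: "0 < N" "L2_norm h \<le> N" using L2_norm_nonneg[of h] by (auto simp: N_def)
    have "0 < e / N" using e N by simp
    then obtain d where d: "0 < d" and df: "\<And>k. k \<in> L2 \<Longrightarrow> L2_norm k < d \<Longrightarrow>
        cmod (f (\<lambda>x. Q \<tau> x + k x) - f (Q \<tau>) - (LINT x:{0..1}|lebesgue. G (Q \<tau>) x * k x)) \<le> e / N * L2_norm k"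
      using f[OF Q[of \<tau>]] unfolding has_gradient_def by meson
    show "\<exists>d>0. \<forall>y. norm (y - \<tau>) < d \<longrightarrow> norm (f (Q y) - f (Q \<tau>) - (y - \<tau>) *\<^sub>R I \<tau>) \<le> e * norm (y - \<tau>)"
    proof (intro exI[of _ "d / N"] conjI allI impI)
      show "0 < d / N" using d N by simp
      fix y assume y: "norm (y - \<tau>) < d / N"
      let ?k = "\<lambda>x. of_real (y - \<tau>) * h x"
      have kn: "L2_norm ?k \<le> \<bar>y - \<tau>\<bar> * N" unfolding L2_norm_scale using N by (intro mult_left_mono) auto
      also have "\<dots> < d" using y N by (simp add: pos_less_divide_eq)
      finally have "cmod (f (\<lambda>x. Q \<tau> x + ?k x) - f (Q \<tau>) - (LINT x:{0..1}|lebesgue. G (Q \<tau>) x * ?k x)) \<le> e / N * L2_norm ?k"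
        by (rule df[OF L2_scale[OF h(1)]])
      also have "(\<lambda>x. Q \<tau> x + ?k x) = Q y" by (simp add: Q_def fun_eq_iff algebra_simps)
      also have "(LINT x:{0..1}|lebesgue. G (Q \<tau>) x * ?k x) = (y - \<tau>) *\<^sub>R I \<tau>"
        unfolding I_def scaleR_conv_of_real set_integral_mult_right[symmetric] by (simp add: mult.left_commute)
      also have "e / N * L2_norm ?k \<le> e / N * (\<bar>y - \<tau>\<bar> * N)" using kn e N by (intro mult_left_mono) auto
      also have "\<dots> = e * norm (y - \<tau>)" using N by simp
      finally show "norm (f (Q y) - f (Q \<tau>) - (y - \<tau>) *\<^sub>R I \<tau>) \<le> e * norm (y - \<tau>)" .
    qed
  qed
  \<comment> \<open>Subtracting \<open>\<tau> *\<^sub>R J\<close> leaves a curve whose derivative is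
    only the deviation of the gradient from \<open>T\<close>.\<close>
  have d2: "((\<lambda>\<tau>. f (Q \<tau>) - \<tau> *\<^sub>R J) has_derivative (\<lambda>y. y *\<^sub>R (I \<tau> - J))) (at \<tau> within {0..1})" for \<tau>
  proof -
    have "((\<lambda>\<tau>. \<tau> *\<^sub>R J) has_vector_derivative J) (at \<tau>)"
      using has_vector_derivative_scaleR[OF DERIV_ident has_vector_derivative_const[of J "at \<tau>"]] by simp
    from has_vector_derivative_diff[OF der this] show ?thesis
      unfolding has_vector_derivative_def by (rule has_derivative_at_withinI)
  qed
  have "norm ((f (Q 1) - 1 *\<^sub>R J) - (f (Q 0) - 0 *\<^sub>R J)) \<le> c * B * norm (1 - 0 :: real)"
  proof (rule differentiable_bound[OF _ d2])
    show "onorm (\<lambda>y. y *\<^sub>R (I \<tau> - J)) \<le> c * B" if "\<tau> \<in> {0..1}" for \<tau>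
      using IJ[of \<tau>] that by (intro onorm_le) (auto simp: mult.commute mult_left_mono)
  qed auto
  moreover have "Q 1 = (\<lambda>x. q x + h x)" "Q 0 = q" by (simp_all add: Q_def)
  ultimately show ?thesis by (simp add: J_def algebra_simps)
qed

lemma integral_mode_period: "integral {0..1} (mode (2 * m)) = (if m = 0 then 1 else 0)"
proof (cases "m = 0")
  case False
  have "((\<lambda>x. \<i> * of_real (pi * real_of_int (2 * m)) * mode (2 * m) x) has_integral (mode (2 * m) 1 - mode (2 * m) 0)) {0..1}"
    by (rule fundamental_theorem_of_calculus) (simp, rule has_vector_derivative_at_within[OF mode_deriv])
  moreover have "mode (2 * m) 1 = 1" using mode_even_periodic[of m 0] by simp
  ultimately have "(mode (2 * m) has_integral 0) {0..1}"
    using has_integral_mult_right[of "\<lambda>x. \<i> * of_real (pi * real_of_int (2 * m)) * mode (2 * m) x" 0 "{0..1}" "1 / (\<i> * of_real (pi * real_of_int (2 * m)))"] False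
    by (simp add: mult.assoc[symmetric])
  then show ?thesis using False by (simp add: integral_unique)
qed (simp add: mode_def[abs_def] scaleR_conv_of_real)

lemma cosine_pairing:
  fixes n :: nat and \<xi> :: real
  defines "T \<equiv> \<lambda>x. complex_of_real (cos (2 * real n * pi * (x + \<xi>)))"
  defines "\<theta> \<equiv> 2 * real n * pi * \<xi>"
  assumes n: "1 \<le> n"
  shows "T \<in> L2" "(LINT x:{0..1}|lebesgue. T x * two_modes (int n) \<alpha> \<beta> x) = (\<alpha> * cis (- \<theta>) + \<beta> * cis \<theta>) / 2"
proof -
  have T: "T x = cis \<theta> / 2 * mode (2 * int n) x + cis (- \<theta>) / 2 * mode (- (2 * int n)) x" for x
  proof -
    have "T x = (cis (2 * real n * pi * (x + \<xi>)) + cis (- (2 * real n * pi * (x + \<xi>)))) / 2"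
      unfolding T_def by (simp add: complex_eq_iff)
    moreover have "cis (2 * real n * pi * (x + \<xi>)) = cis \<theta> * mode (2 * int n) x"
      "cis (- (2 * real n * pi * (x + \<xi>))) = cis (- \<theta>) * mode (- (2 * int n)) x"
      by (simp_all add: mode_def cis_mult \<theta>_def algebra_simps)
    ultimately show ?thesis by (simp add: add_divide_distrib)
  qed
  then have T2: "T = two_modes (int n) (cis \<theta> / 2) (cis (- \<theta>) / 2)" by (simp add: two_modes_def fun_eq_iff)
  show L: "T \<in> L2" unfolding T2 by (rule two_modes_L2(1))
  let ?m = "\<lambda>k. mode (2 * k)"
  have e: "T x * two_modes (int n) \<alpha> \<beta> x = cis \<theta> / 2 * \<alpha> * ?m (2 * int n) x + (cis \<theta> / 2 * \<beta> + cis (- \<theta>) / 2 * \<alpha>) * ?m 0 x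
      + cis (- \<theta>) / 2 * \<beta> * ?m (- (2 * int n)) x" for x
  proof -
    have m: "?m (2 * int n) x = mode (2 * int n) x * mode (2 * int n) x" "?m 0 x = mode (2 * int n) x * mode (- (2 * int n)) x"
      "?m (- (2 * int n)) x = mode (- (2 * int n)) x * mode (- (2 * int n)) x"
      unfolding mode_mult by (simp_all add: algebra_simps)
    show ?thesis unfolding m T two_modes_def by (simp add: algebra_simps)
  qed
  have i: "(?m k has_integral (if k = 0 then 1 else 0)) {0..1}" for k
    using integrable_integral[OF integrable_continuous_real[OF continuous_mode[of "{0..1}" "2 * k"]]]
    unfolding integral_mode_period .
  have "(LINT x:{0..1}|lebesgue. T x * two_modes (int n) \<alpha> \<beta> x) = integral {0..1} (\<lambda>x. T x * two_modes (int n) \<alpha> \<beta> x)"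
    by (rule set_lebesgue_integral_eq_integral(2)[OF pairing(1)[OF L two_modes_continuous two_modes_le]])
  also have "\<dots> = cis \<theta> / 2 * \<alpha> * (if 2 * int n = 0 then 1 else 0) + (cis \<theta> / 2 * \<beta> + cis (- \<theta>) / 2 * \<alpha>) * (if 0 = (0::int) then 1 else 0)
      + cis (- \<theta>) / 2 * \<beta> * (if - (2 * int n) = 0 then 1 else 0)"
    unfolding e by (intro integral_unique has_integral_add has_integral_mult_right i)
  also have "\<dots> = (\<alpha> * cis (- \<theta>) + \<beta> * cis \<theta>) / 2" using n by (simp add: add_divide_distrib mult.commute)
  finally show "(LINT x:{0..1}|lebesgue. T x * two_modes (int n) \<alpha> \<beta> x) = (\<alpha> * cis (- \<theta>) + \<beta> * cis \<theta>) / 2" .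
qed

text \<open>The mean value estimate runs from \<open>q\<close> to a potential at which condition (a)
  makes the functional vanish. All potentials on the segment stay in one ball of radius
  \<open>R\<close>, so \<open>C\<close> depends on \<open>q\<close> and \<open>B\<close> but not on
  \<open>n\<close> or the added modes.\<close>

lemma alternate_gap_near_double:
  assumes \<delta>: "alternate_gap_lengths \<delta>" and q: "q \<in> L2"
  obtains C \<theta> where "0 \<le> C"
    "\<And>n \<alpha> \<beta>. 1 \<le> n \<Longrightarrow> cmod \<alpha> + cmod \<beta> \<le> B \<Longrightarrow>
      double_gap n (\<lambda>x. q x + two_modes (int n) \<alpha> \<beta> x) \<Longrightarrow>
      cmod (\<delta> n q + (\<alpha> * cis (- \<theta> n) + \<beta> * cis (\<theta> n)) / 2) \<le> C / real n * (cmod \<alpha> + cmod \<beta>)"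
proof -
  obtain G \<xi> where G: "\<forall>n\<ge>1. cont_diff_with_gradient (\<delta> n) (G n)"
    and van: "\<forall>n\<ge>1. \<forall>q\<in>L2. double_gap n q \<longrightarrow> \<delta> n q = 0"
    and bd: "\<forall>R. \<exists>C. \<forall>n\<ge>1. \<forall>q\<in>L2. L2_norm q \<le> R \<longrightarrow>
           L2_norm (\<lambda>x. G n q x - complex_of_real (cos (2 * real n * pi * (x + \<xi> n)))) \<le> C / real n"
    using \<delta> unfolding alternate_gap_lengths_def double_gap_def[symmetric] by (elim exE conjE) (rule that)
  define R where "R = sqrt (2 * (L2_norm q)\<^sup>2 + 2 * B\<^sup>2)"
  obtain C where C: "\<And>n q. 1 \<le> n \<Longrightarrow> q \<in> L2 \<Longrightarrow> L2_norm q \<le> R \<Longrightarrow>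
           L2_norm (\<lambda>x. G n q x - complex_of_real (cos (2 * real n * pi * (x + \<xi> n)))) \<le> C / real n"
    using spec[OF bd, of R] by (elim exE) (rule that, blast)
  define \<theta> where "\<theta> n = 2 * real n * pi * \<xi> n" for n
  show ?thesis
  proof (rule that[of "\<bar>C\<bar>" \<theta>])
    fix n :: nat and \<alpha> \<beta>
    let ?h = "two_modes (int n) \<alpha> \<beta>"
    assume n: "1 \<le> n" and B: "cmod \<alpha> + cmod \<beta> \<le> B"
      and p: "double_gap n (\<lambda>x. q x + ?h x)"
    have h: "?h \<in> L2" by (rule two_modes_L2(1))
    have "\<delta> n (\<lambda>x. q x + ?h x) = 0" using van n L2_add(1)[OF q h] p by blast
    moreover have "cmod (\<delta> n (\<lambda>x. q x + ?h x) - \<delta> n q -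
       (LINT x:{0..1}|lebesgue. complex_of_real (cos (2 * real n * pi * (x + \<xi> n))) * ?h x)) \<le> C / real n * (cmod \<alpha> + cmod \<beta>)"
    proof (rule gradient_mean_value[OF _ q h two_modes_continuous two_modes_le cosine_pairing(1)[OF n]])
      show "has_gradient (\<delta> n) q (G n q)" if "q \<in> L2" for q
        using G[rule_format, OF n] that unfolding cont_diff_with_gradient_def by blast
      fix \<tau> :: real assume \<tau>: "0 \<le> \<tau>" "\<tau> \<le> 1"
      note s = L2_scale[OF h, of \<tau>]
      have "L2_norm (\<lambda>x. of_real \<tau> * ?h x) \<le> 1 * L2_norm ?h" unfolding L2_norm_scale
        using \<tau> L2_norm_nonneg by (intro mult_right_mono) auto
      also have "\<dots> \<le> B" using two_modes_L2(2)[of "int n" \<alpha> \<beta>] B by simp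
      finally have hB: "L2_norm (\<lambda>x. of_real \<tau> * ?h x) \<le> B" .
      have "(L2_norm (\<lambda>x. q x + of_real \<tau> * ?h x))\<^sup>2 \<le> 2 * (L2_norm q)\<^sup>2 + 2 * (L2_norm (\<lambda>x. of_real \<tau> * ?h x))\<^sup>2"
        by (rule L2_add(2)[OF q s])
      also have "\<dots> \<le> 2 * (L2_norm q)\<^sup>2 + 2 * B\<^sup>2" using hB L2_norm_nonneg by (intro add_left_mono mult_left_mono power_mono) auto
      finally have "L2_norm (\<lambda>x. q x + of_real \<tau> * ?h x) \<le> R" unfolding R_def by (rule real_le_rsqrt)
      then show "L2_norm (\<lambda>x. G n (\<lambda>x. q x + of_real \<tau> * ?h x) x - complex_of_real (cos (2 * real n * pi * (x + \<xi> n)))) \<le> C / real n"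
        by (rule C[OF n L2_add(1)[OF q s]])
    qed
    ultimately have "cmod (- \<delta> n q - (\<alpha> * cis (- \<theta> n) + \<beta> * cis (\<theta> n)) / 2) \<le> C / real n * (cmod \<alpha> + cmod \<beta>)"
      unfolding cosine_pairing(2)[OF n] \<theta>_def by simp
    moreover have "- \<delta> n q - (\<alpha> * cis (- \<theta> n) + \<beta> * cis (\<theta> n)) / 2 = - (\<delta> n q + (\<alpha> * cis (- \<theta> n) + \<beta> * cis (\<theta> n)) / 2)" by simp
    ultimately have "cmod (\<delta> n q + (\<alpha> * cis (- \<theta> n) + \<beta> * cis (\<theta> n)) / 2) \<le> C / real n * (cmod \<alpha> + cmod \<beta>)"
      by (simp only: norm_minus_cancel)
    also have "\<dots> \<le> \<bar>C\<bar> / real n * (cmod \<alpha> + cmod \<beta>)" by (intro mult_right_mono divide_right_mono) auto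
    finally show "cmod (\<delta> n q + (\<alpha> * cis (- \<theta> n) + \<beta> * cis (\<theta> n)) / 2) \<le> \<bar>C\<bar> / real n * (cmod \<alpha> + cmod \<beta>)" .
  qed simp
qed

lemma ell2D: "ell2 a A \<Longrightarrow> finite F \<Longrightarrow> (\<Sum>j\<in>F. (norm (a j))\<^sup>2) \<le> A\<^sup>2"
  by (simp add: ell2_def)

section \<open>Alternate gap lengths\<close>

lemma trunc_ell2:
  assumes "ellw w a M"
  shows "ellw w (trunc N a) (weighted_norm w (trunc N a))"
proof -
  have "ellw w (trunc N a) M" by (rule ell2_le[OF assms]) (simp add: trunc_def)
  from ell2I_summable[OF ell2_summable[OF this]] show ?thesis
    by (simp add: weighted_norm_def power_mult_distrib)
qed

lemma symmetric_tail_sum: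
  assumes a: "ellw w (a :: int \<Rightarrow> complex) M" and F: "finite F" "F \<subseteq> {N..}" and N: "1 \<le> N"
  shows "(\<Sum>n\<in>F. (w (int n) * cmod (a (int n)))\<^sup>2 + (w (- int n) * cmod (a (- int n)))\<^sup>2)
    \<le> (weighted_norm w (trunc N a))\<^sup>2"
proof -
  let ?g = "\<lambda>k. (norm (w k * cmod (trunc N a k)))\<^sup>2"
  have disj: "int ` F \<inter> (\<lambda>n. - int n) ` F = {}" using F(2) N by force
  have "(\<Sum>n\<in>F. (w (int n) * cmod (a (int n)))\<^sup>2 + (w (- int n) * cmod (a (- int n)))\<^sup>2)
    = (\<Sum>n\<in>F. ?g (int n)) + (\<Sum>n\<in>F. ?g (- int n))"
    unfolding sum.distrib[symmetric] using F(2) by (intro sum.cong refl) (auto simp: trunc_def)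
  also have "\<dots> = sum ?g (int ` F) + sum ?g ((\<lambda>n. - int n) ` F)" by (simp add: sum.reindex inj_on_def)
  also have "\<dots> = sum ?g (int ` F \<union> (\<lambda>n. - int n) ` F)" using F(1) disj by (intro sum.union_disjoint[symmetric]) auto
  also have "\<dots> \<le> (weighted_norm w (trunc N a))\<^sup>2"
    by (rule ell2D[OF trunc_ell2[OF a]]) (use F(1) in simp)
  finally show ?thesis .
qed

lemma sum3_square_le:
  fixes a b c :: real
  shows "(a + b + c)\<^sup>2 \<le> 4 * a\<^sup>2 + 4 * b\<^sup>2 + 2 * c\<^sup>2"
proof -
  have "0 \<le> (a + b - c)\<^sup>2 + 2 * (a - b)\<^sup>2" by simp
  then show ?thesis by (simp add: power2_eq_square algebra_simps)
qed

text \<open>The added modes are the new coefficients minus the old ones, hence of weighted size at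
  most \<open>x + k\<close> and \<open>y + k\<close> with \<open>k = 6 * M\<^sup>2 / n\<close>. The
  cosine halves their sum; the error of the gradient and the splitting of the square are paid for by
  the room that this leaves.\<close>

lemma alternate_gap_bound:
  assumes \<delta>: "alternate_gap_lengths \<delta>" and w: "submult_weight w" and q: "q \<in> L2" and a: "ellw w (fourier q) M"
  shows "\<forall>\<^sub>F n in sequentially. (w (int n))\<^sup>2 * (cmod (\<delta> n q))\<^sup>2 \<le>
    4 * ((w (int n) * cmod (fourier q (int n)))\<^sup>2 + (w (- int n) * cmod (fourier q (- int n)))\<^sup>2) + 128 * M ^ 4 * (1 / (real n)\<^sup>2)"
proof -
  have M: "0 \<le> M" using a by (rule ell2_nonneg)
  define W where "W = half_weight w"
  have W: "submult_weight W" unfolding W_def by (rule submult_half_weight[OF w])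
  have V: "ellw W (cf q) M" unfolding W_def by (rule ellw_half_weight[OF w a cf_fourier[OF q]])
  obtain C \<theta> where C: "0 \<le> C" and est: "\<And>n \<alpha> \<beta>. 1 \<le> n \<Longrightarrow> cmod \<alpha> + cmod \<beta> \<le> 4 * M \<Longrightarrow>
      double_gap n (\<lambda>x. q x + two_modes (int n) \<alpha> \<beta> x) \<Longrightarrow>
      cmod (\<delta> n q + (\<alpha> * cis (- \<theta> n) + \<beta> * cis (\<theta> n)) / 2) \<le> C / real n * (cmod \<alpha> + cmod \<beta>)"
    using alternate_gap_near_double[OF \<delta> q, of "4 * M"] by blast
  obtain N0 where N0: "16 * (2 * M + 1)\<^sup>2 + 1 + 6 * C + 6 * M \<le> real N0" using real_arch_simple by blast
  show ?thesis
  proof (rule eventually_sequentiallyI[of N0])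
    fix n assume "N0 \<le> n"
    then have "16 * (2 * M + 1)\<^sup>2 + 1 + 6 * C + 6 * M \<le> real n" using N0 by linarith
    moreover have "0 \<le> (2 * M + 1)\<^sup>2" by simp
    ultimately have n: "16 * (2 * M + 1)\<^sup>2 + 1 \<le> real n" "6 * C \<le> real n" "6 * M \<le> real n" "1 \<le> real n"
      using C M by linarith+
    obtain s t where st: "W (2 * int n) * cmod s \<le> 6 * M\<^sup>2 / real n" "W (2 * int n) * cmod t \<le> 6 * M\<^sup>2 / real n"
      and p: "double_gap n (\<lambda>x. q x + two_modes (int n) (s - cf q (2 * int n)) (t - cf q (- (2 * int n))) x)"
      by (rule double_potential[OF q W V n(1)]) (rule that, assumption+)
    define \<alpha> where "\<alpha> = s - cf q (2 * int n)"
    define \<beta> where "\<beta> = t - cf q (- (2 * int n))"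
    have Ww: "W (2 * int n) = w (int n)" unfolding W_def by (rule half_weight_even[OF w])
    have w1: "1 \<le> w (int n)" "w (- int n) = w (int n)" using submultD(1,4)[OF w] by auto
    have c: "cf q (2 * int n) = fourier q (int n)" "cf q (- (2 * int n)) = fourier q (- int n)"
      using cf_fourier(1)[OF q, of "int n"] cf_fourier(1)[OF q, of "- int n"] by auto
    define x where "x = w (int n) * cmod (fourier q (int n))"
    define y where "y = w (- int n) * cmod (fourier q (- int n))"
    define k where "k = 6 * M\<^sup>2 / real n"
    have ab: "w (int n) * cmod \<alpha> \<le> x + k" "w (int n) * cmod \<beta> \<le> y + k"
    proof -
      have "w (int n) * cmod \<alpha> \<le> w (int n) * (cmod s + cmod (fourier q (int n)))"
        unfolding \<alpha>_def c using w1 by (intro mult_left_mono norm_triangle_ineq4) auto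
      then show "w (int n) * cmod \<alpha> \<le> x + k" using st(1) unfolding Ww x_def k_def by (simp add: distrib_left)
      have "w (int n) * cmod \<beta> \<le> w (int n) * (cmod t + cmod (fourier q (- int n)))"
        unfolding \<beta>_def c using w1 by (intro mult_left_mono norm_triangle_ineq4) auto
      then show "w (int n) * cmod \<beta> \<le> y + k" using st(2) unfolding Ww y_def k_def w1(2) by (simp add: distrib_left)
    qed
    have xy: "x \<le> M" "y \<le> M"
      using ell2_point[OF a, of "int n"] ell2_point[OF a, of "- int n"] w1 by (auto simp: x_def y_def abs_mult)
    have kM: "k \<le> M"
    proof -
      have "6 * M * M \<le> real n * M" using n(3) M by (intro mult_right_mono) auto
      then show ?thesis using n(4) by (simp add: k_def pos_divide_le_eq power2_eq_square mult.commute)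
    qed
    have "cmod \<alpha> \<le> w (int n) * cmod \<alpha>" "cmod \<beta> \<le> w (int n) * cmod \<beta>"
      using mult_right_mono[OF w1(1), of "cmod \<alpha>"] mult_right_mono[OF w1(1), of "cmod \<beta>"] by auto
    then have "cmod \<alpha> + cmod \<beta> \<le> 4 * M" using ab xy kM by linarith
    then have e: "cmod (\<delta> n q + (\<alpha> * cis (- \<theta> n) + \<beta> * cis (\<theta> n)) / 2) \<le> C / real n * (cmod \<alpha> + cmod \<beta>)"
      by (rule est[rotated]) (use n(4) p in \<open>auto simp: \<alpha>_def \<beta>_def\<close>)
    have "cmod ((\<alpha> * cis (- \<theta> n) + \<beta> * cis (\<theta> n)) / 2) \<le> (cmod \<alpha> + cmod \<beta>) / 2"
      using norm_triangle_ineq[of "\<alpha> * cis (- \<theta> n)" "\<beta> * cis (\<theta> n)"] by (simp add: norm_divide norm_mult)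
    then have "cmod (\<delta> n q) \<le> C / real n * (cmod \<alpha> + cmod \<beta>) + (cmod \<alpha> + cmod \<beta>) / 2"
      using e norm_triangle_ineq4[of "\<delta> n q + (\<alpha> * cis (- \<theta> n) + \<beta> * cis (\<theta> n)) / 2" "(\<alpha> * cis (- \<theta> n) + \<beta> * cis (\<theta> n)) / 2"]
      unfolding add_diff_cancel_right' by linarith
    \<comment> \<open>\<open>n \<ge> 6 * C\<close> reduces the gradient error to \<open>1/6\<close>,
      so that the total factor is \<open>1/6 + 1/2 = 2/3\<close>.\<close>
    also have "\<dots> \<le> 1 / 6 * (cmod \<alpha> + cmod \<beta>) + (cmod \<alpha> + cmod \<beta>) / 2"
      using n(2,4) by (intro add_right_mono mult_right_mono) (auto simp: pos_divide_le_eq)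
    finally have "cmod (\<delta> n q) \<le> 2 / 3 * (cmod \<alpha> + cmod \<beta>)" by simp
    then have "w (int n) * cmod (\<delta> n q) \<le> w (int n) * (2 / 3 * (cmod \<alpha> + cmod \<beta>))"
      using w1(1) by (intro mult_left_mono) auto
    also have "\<dots> = 2 / 3 * (w (int n) * cmod \<alpha> + w (int n) * cmod \<beta>)" by (simp add: distrib_left)
    also have "\<dots> \<le> 2 / 3 * (x + y + 2 * k)" using add_mono[OF ab] by (intro mult_left_mono) auto
    finally have "(w (int n) * cmod (\<delta> n q))\<^sup>2 \<le> (2 / 3 * (x + y + 2 * k))\<^sup>2" using w1(1) by (intro power_mono) auto
    also have "\<dots> = 4 / 9 * (x + y + 2 * k)\<^sup>2" by (simp only: power_mult_distrib) (simp add: power2_eq_square)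
    also have "\<dots> \<le> 4 / 9 * (4 * x\<^sup>2 + 4 * y\<^sup>2 + 2 * (2 * k)\<^sup>2)" by (intro mult_left_mono sum3_square_le) auto
    also have "\<dots> \<le> 4 * (x\<^sup>2 + y\<^sup>2) + 32 / 9 * k\<^sup>2" by (simp add: power_mult_distrib)
    \<comment> \<open>With \<open>k = 6 * M\<^sup>2 / n\<close> the constant is exactly 128; the
      tail of the inverse squares is at most \<open>2 / N\<close>, which makes it 256.\<close>
    also have "32 / 9 * k\<^sup>2 = 128 * M ^ 4 * (1 / (real n)\<^sup>2)" by (simp add: k_def power_divide power_mult_distrib)
    finally show "(w (int n))\<^sup>2 * (cmod (\<delta> n q))\<^sup>2 \<le>
      4 * ((w (int n) * cmod (fourier q (int n)))\<^sup>2 + (w (- int n) * cmod (fourier q (- int n)))\<^sup>2) + 128 * M ^ 4 * (1 / (real n)\<^sup>2)"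
      by (simp add: x_def y_def power_mult_distrib)
  qed
qed

lemma alternate_gap_sum_bound:
  assumes \<delta>: "alternate_gap_lengths \<delta>" and w: "submult_weight w" and q: "q \<in> H_weighted w"
  shows "\<forall>\<^sub>F N in sequentially.
           (\<lambda>n. (w (int n))\<^sup>2 * (cmod (\<delta> n q))\<^sup>2) summable_on {N..} \<and>
           (\<Sum>\<^sub>\<infinity>n\<in>{N..}. (w (int n))\<^sup>2 * (cmod (\<delta> n q))\<^sup>2)
             \<le> 4 * (weighted_norm w (trunc N (fourier q)))\<^sup>2
                + 256 / real N * (weighted_norm w (fourier q)) ^ 4"
proof -
  let ?f = "\<lambda>n. (w (int n))\<^sup>2 * (cmod (\<delta> n q))\<^sup>2" and ?M = "weighted_norm w (fourier q)"
  have qL: "q \<in> L2" using q by (simp add: H_weighted_def)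
  have a: "ellw w (fourier q) ?M" using H_weighted_ellw[OF q] w by (simp add: submult_weight_def)
  obtain N0 where N0: "\<And>n. N0 \<le> n \<Longrightarrow> ?f n \<le>
    4 * ((w (int n) * cmod (fourier q (int n)))\<^sup>2 + (w (- int n) * cmod (fourier q (- int n)))\<^sup>2) + 128 * ?M ^ 4 * (1 / (real n)\<^sup>2)"
    using alternate_gap_bound[OF \<delta> w qL a] unfolding eventually_sequentially by blast
  show ?thesis
  proof (rule eventually_sequentiallyI[of "max N0 1"])
    fix N assume "max N0 1 \<le> N"
    then have N: "N0 \<le> N" "1 \<le> N" by auto
    let ?R = "4 * (weighted_norm w (trunc N (fourier q)))\<^sup>2 + 256 / real N * ?M ^ 4"
    have fin: "sum ?f F \<le> ?R" if F: "finite F" "F \<subseteq> {N..}" for F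
    proof -
      have "sum ?f F \<le> (\<Sum>n\<in>F. 4 * ((w (int n) * cmod (fourier q (int n)))\<^sup>2 + (w (- int n) * cmod (fourier q (- int n)))\<^sup>2) + 128 * ?M ^ 4 * (1 / (real n)\<^sup>2))"
        using F N by (intro sum_mono N0) auto
      also have "\<dots> = 4 * (\<Sum>n\<in>F. (w (int n) * cmod (fourier q (int n)))\<^sup>2 + (w (- int n) * cmod (fourier q (- int n)))\<^sup>2)
          + 128 * ?M ^ 4 * (\<Sum>n\<in>F. 1 / (real n)\<^sup>2)"
        by (simp only: sum.distrib sum_distrib_left distrib_left)
      also have "\<dots> \<le> 4 * (weighted_norm w (trunc N (fourier q)))\<^sup>2 + 128 * ?M ^ 4 * (2 / real N)"
        using F N by (intro add_mono mult_left_mono symmetric_tail_sum[OF a] inverse_squares_tail_le) auto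
      finally show ?thesis by simp
    qed
    have "?f summable_on {N..}"
      by (rule nonneg_bdd_above_summable_on) (auto intro!: bdd_aboveI2[where M = ?R] fin)
    moreover from this have "infsum ?f {N..} \<le> ?R" by (rule infsum_le_finite_sums) (rule fin)
    ultimately show "?f summable_on {N..} \<and> infsum ?f {N..} \<le> ?R" by blast
  qed
qed

lemma norm_cis_combination_ge:
  "\<bar>cmod a - cmod b\<bar> \<le> cmod (a * cis (- \<theta>) + b * cis \<theta>)"
proof -
  have "\<bar>cmod (a * cis (- \<theta>)) - cmod (- (b * cis \<theta>))\<bar> \<le> cmod (a * cis (- \<theta>) - - (b * cis \<theta>))"
    by (rule norm_triangle_ineq3)
  then show ?thesis by (simp add: norm_mult)
qed

text \<open>Unless \<open>M \<le> 16 * \<gamma>\<close>, the bound on \<open>g\<close> gives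
  \<open>g \<le> M / 4\<close>, so \<open>m = g\<^sup>2 / M \<le> M / 16\<close>. Then
  \<open>M - m\<close> is nearly \<open>M\<close>, and the estimate by \<open>\<delta>\<close> with
  small errors proportional to \<open>M\<close> can be solved for \<open>M\<close>.\<close>

lemma block_lower_bound:
  fixes M m g \<gamma> \<delta> D e \<eta> \<kappa> :: real
  assumes nn: "0 \<le> m" "0 \<le> g" "0 \<le> \<gamma>" "0 \<le> \<delta>" "m \<le> M"
    and g2: "g\<^sup>2 = M * m" and g: "2 * g \<le> 2 * \<eta> * (g + M) + 2 * \<gamma>" and \<eta>: "0 \<le> \<eta>" "\<eta> \<le> 1 / 16"
    and D: "D \<le> M + e" and e: "e \<le> (D + g) / 32" and \<kappa>: "\<kappa> \<le> 1 / 32"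
    and d: "M - m \<le> 2 * \<delta> + 2 * e + \<kappa> * D" and D0: "0 \<le> D"
  shows "M \<le> 16 * (\<gamma> + \<delta>)"
proof (cases "M \<le> 16 * \<gamma>")
  case False
  have "\<eta> * (g + M) \<le> 1 / 16 * (g + M)" using \<eta> nn by (intro mult_right_mono) auto
  moreover have "2 * g \<le> 2 * (\<eta> * (g + M)) + 2 * \<gamma>" using g by (simp only: mult.assoc)
  ultimately have "2 * g \<le> 2 * (1 / 16 * (g + M)) + 2 * \<gamma>" by linarith
  then have g4: "g \<le> M / 4" using False nn by argo
  have M: "0 < M" using False nn by linarith
  have "M * m \<le> (M / 4)\<^sup>2" unfolding g2[symmetric] using g4 nn by (intro power_mono) auto
  then have "M * m \<le> M * (M / 16)" by (simp add: power2_eq_square)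
  then have m: "m \<le> M / 16" using M by simp
  have "\<kappa> * D \<le> 1 / 32 * D" using \<kappa> D0 by (rule mult_right_mono)
  then show ?thesis using d e D g4 m nn by argo
qed (use nn in simp)

text \<open>\<open>q\<close> is compared with its double neighbour, whose coefficients
  \<open>coefC\<close> vanish: hence \<open>c1\<close> and \<open>c2\<close> are
  \<open>- \<alpha>\<close> and \<open>- \<beta>\<close> up to \<open>e\<close>, and
  \<open>\<delta> n q\<close> controls the combination of these with unknown phases. Unequal moduli
  rule out cancellation there, and the gap length makes them unequal.\<close>

lemma alternate_gap_lower:
  assumes \<delta>: "alternate_gap_lengths \<delta>" and q: "q \<in> L2"
  shows "\<forall>\<^sub>F n in sequentially. in_strip (int n) (lambda_minus n q) \<and>
      cmod (coefC (cf q) (int n) (lambda_minus n q)) \<le> 16 * (cmod (gap_length n q) + cmod (\<delta> n q)) \<and>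
      cmod (coefC (reflect (cf q)) (int n) (lambda_minus n q)) \<le> 16 * (cmod (gap_length n q) + cmod (\<delta> n q))"
proof -
  define v where "v = L2_norm q"
  have V: "ell2 (cf q) v" unfolding v_def by (rule bessel[OF q])
  have v: "0 \<le> v" using V by (rule ell2_nonneg)
  obtain C \<theta> where C: "0 \<le> C" and est: "\<And>n \<alpha> \<beta>. 1 \<le> n \<Longrightarrow> cmod \<alpha> + cmod \<beta> \<le> 4 * v \<Longrightarrow>
      double_gap n (\<lambda>x. q x + two_modes (int n) \<alpha> \<beta> x) \<Longrightarrow>
      cmod (\<delta> n q + (\<alpha> * cis (- \<theta> n) + \<beta> * cis (\<theta> n)) / 2) \<le> C / real n * (cmod \<alpha> + cmod \<beta>)"
    using alternate_gap_near_double[OF \<delta> q, of "4 * v"] by blast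
  obtain N0 where N0: "16 * (2 * v + 1)\<^sup>2 + 1 + 128 * C + 1536 * v \<le> real N0" using real_arch_simple by blast
  show ?thesis
  proof (rule eventually_sequentiallyI[of N0])
    fix n assume "N0 \<le> n"
    then have "16 * (2 * v + 1)\<^sup>2 + 1 + 128 * C + 1536 * v \<le> real n" using N0 by linarith
    moreover have "0 \<le> (2 * v + 1)\<^sup>2" by simp
    ultimately have n: "16 * (2 * v + 1)\<^sup>2 + 1 \<le> real n" "128 * C \<le> real n" "1536 * v \<le> real n" "1 \<le> real n"
      using C v by linarith+
    have "16 * (v + 1)\<^sup>2 \<le> 16 * (2 * v + 1)\<^sup>2" using v by (intro mult_left_mono power_mono) auto
    then have n1: "16 * (v + 1)\<^sup>2 + 1 \<le> real n" using n(1) by linarith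
    define z where "z = lambda_minus n q"
    define r where "r = real n"
    have z: "in_strip (int n) z" unfolding z_def by (rule lambda_in_strip(1)[OF q V n1])
    obtain z' s t where z': "in_strip (int n) z'" and pv: "ell2 (with_modes (cf q) (int n) s t) (2 * v)"
      and cp: "coefC (with_modes (cf q) (int n) s t) (int n) z' = 0" "coefC (reflect (with_modes (cf q) (int n) s t)) (int n) z' = 0"
        "defect (with_modes (cf q) (int n) s t) (int n) z' = 0"
      and st: "1 * cmod s \<le> 6 * v\<^sup>2 / real n" "1 * cmod t \<le> 6 * v\<^sup>2 / real n"
      and p: "double_gap n (\<lambda>x. q x + two_modes (int n) (s - cf q (2 * int n)) (t - cf q (- (2 * int n))) x)"
      by (rule double_potential[OF q submult_one _ n(1)]) (use V in simp, rule that, assumption+)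
    define \<alpha> where "\<alpha> = s - cf q (2 * int n)"
    define \<beta> where "\<beta> = t - cf q (- (2 * int n))"
    define D where "D = max (cmod \<alpha>) (cmod \<beta>)"
    define c1 where "c1 = coefC (cf q) (int n) z"
    define c2 where "c2 = coefC (reflect (cf q)) (int n) z"
    define M where "M = max (cmod c1) (cmod c2)"
    define g where "g = defect (cf q) (int n) z"
    have n0: "int n \<noteq> 0" using n(4) by auto
    have r: "1 \<le> r" "1536 * v \<le> r" "128 * C \<le> r" using n by (auto simp: r_def)
    have D0: "0 \<le> D" by (simp add: D_def le_max_iff_disj)
    have vr: "v / r \<le> 1 / 1536" "0 \<le> v / r" using r v by (auto simp: pos_divide_le_eq)
    note wm = with_modes_simps[OF n0, of "cf q"]
    \<comment> \<open>Seen this way, the two potentials differ only in the prescribed entries at the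
      two modes.\<close>
    have Vid: "cf q = with_modes (cf q) (int n) (cf q (2 * int n)) (cf q (- (2 * int n)))" by (simp add: with_modes_def)
    have dD: "ell2 (\<lambda>j. cf q j - with_modes (cf q) (int n) s t j) (2 * D)"
      by (subst (1) Vid, rule ell2_with_modes_diff[OF _ _ n0]) (auto simp: D_def \<alpha>_def \<beta>_def norm_minus_commute)
    define e where "e = 6 * (2 * v) / r * (2 * D) + 4 * (2 * v)\<^sup>2 / r\<^sup>2 * cmod (z - z')"
    have v2: "2 * (2 * v) \<le> real_of_int (int n)" using r v by (simp add: r_def)
    note per = coef_perturb[OF ell2_mono[OF V] pv z z' v2 dD, unfolded cp wm of_int_of_nat_eq, folded r_def, folded e_def]
    have vv: "v \<le> 2 * v" using v by simp
    have eA: "cmod ((coefA (cf q) (int n) z - cf q 0) - (coefA (with_modes (cf q) (int n) s t) (int n) z' - cf q 0)) \<le> e"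
      by (rule per(1)[OF vv])
    have e1: "cmod (c1 + \<alpha>) \<le> e" using per(2)[OF vv] by (simp add: c1_def \<alpha>_def add_diff_eq diff_add_eq)
    have e2: "cmod (c2 + \<beta>) \<le> e" using per(3)[OF vv] by (simp add: c2_def \<beta>_def add_diff_eq diff_add_eq)
    \<comment> \<open>The defect vanishes for the neighbour at \<open>z'\<close>, so
      \<open>z - z'\<close> is the defect \<open>g\<close> at \<open>z\<close> plus a difference of
      second-order parts.\<close>
    have zz: "cmod (z - z') \<le> cmod g + e"
    proof -
      have "z - z' = g + ((coefA (cf q) (int n) z - cf q 0) - (coefA (with_modes (cf q) (int n) s t) (int n) z' - cf q 0))"
        using cp(3) unfolding g_def defect_def by (simp add: algebra_simps)
      then show ?thesis using norm_triangle_ineq[of g] eA by (metis add_left_mono order_trans)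
    qed
    \<comment> \<open>\<open>e\<close> contains \<open>cmod (z - z')\<close>, which was just bounded
      through \<open>e\<close> again; its coefficient is below \<open>1/100\<close> for large
      \<open>n\<close> and is absorbed.\<close>
    have e: "e \<le> (D + cmod g) / 32"
    proof -
      have "e = 24 * (v / r) * D + 16 * (v / r)\<^sup>2 * cmod (z - z')"
        by (simp add: e_def power_mult_distrib power_divide)
      also have "\<dots> \<le> 24 * (1 / 1536) * D + 16 * (1 / 1536)\<^sup>2 * (cmod g + e)"
        using vr D0 zz by (intro add_mono mult_mono power_mono mult_nonneg_nonneg) auto
      finally have "e \<le> D / 64 + 16 * (1 / 1536)\<^sup>2 * (cmod g + e)" by simp
      moreover have "16 * (1 / 1536)\<^sup>2 * (cmod g + e) \<le> 1 / 100 * (cmod g + e)"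
        using order_trans[OF norm_ge_zero zz] by (intro mult_right_mono) (auto simp: power2_eq_square)
      ultimately show ?thesis using D0 norm_ge_zero[of g] by argo
    qed
    have a1: "cmod \<alpha> \<le> cmod c1 + e" "cmod \<beta> \<le> cmod c2 + e"
      using e1 e2 norm_triangle_ineq4[of "c1 + \<alpha>" c1] norm_triangle_ineq4[of "c2 + \<beta>" c2] by auto
    have DM: "D \<le> M + e" using a1 by (auto simp: D_def M_def)
    have ab: "cmod \<alpha> + cmod \<beta> \<le> 4 * v"
    proof -
      have "6 * v\<^sup>2 / real n = 6 * v * (v / r)" by (simp add: r_def power2_eq_square)
      also have "\<dots> \<le> 6 * v * (1 / 1536)" using vr v by (intro mult_left_mono) auto
      finally have "cmod s \<le> v" "cmod t \<le> v" using st v by auto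
      moreover have "cmod (cf q (2 * int n)) \<le> v" "cmod (cf q (- (2 * int n))) \<le> v" by (rule ell2_point[OF V])+
      ultimately show ?thesis unfolding \<alpha>_def \<beta>_def
        using norm_triangle_ineq4[of s "cf q (2 * int n)"] norm_triangle_ineq4[of t "cf q (- (2 * int n))"] by linarith
    qed
    have est': "cmod (\<delta> n q + (\<alpha> * cis (- \<theta> n) + \<beta> * cis (\<theta> n)) / 2) \<le> C / r * (cmod \<alpha> + cmod \<beta>)"
      using est[OF _ ab] n(4) p by (auto simp: \<alpha>_def \<beta>_def r_def)
    \<comment> \<open>The left side is the difference of the moduli of \<open>c1\<close> and
      \<open>c2\<close>, the only lower bound for the combination that is valid for every phase
      \<open>\<theta> n\<close>.\<close>
    have Mm: "M - min (cmod c1) (cmod c2) \<le> 2 * cmod (\<delta> n q) + 2 * e + (4 * C / r) * D"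
    proof -
      define T where "T = \<alpha> * cis (- \<theta> n) + \<beta> * cis (\<theta> n)"
      define S where "S = c1 * cis (- \<theta> n) + c2 * cis (\<theta> n)"
      have "M - min (cmod c1) (cmod c2) \<le> cmod S" unfolding S_def
        using norm_cis_combination_ge[of c1 c2 "\<theta> n"] by (auto simp: M_def)
      also have "S = ((c1 + \<alpha>) * cis (- \<theta> n) + (c2 + \<beta>) * cis (\<theta> n)) - T"
        by (simp add: S_def T_def algebra_simps)
      also have "cmod \<dots> \<le> (e + e) + cmod T"
        using e1 e2 by (intro order_trans[OF norm_triangle_ineq4] add_right_mono norm_triangle_le add_mono) (auto simp: norm_mult)
      also have "cmod T \<le> 2 * (cmod (\<delta> n q) + C / r * (cmod \<alpha> + cmod \<beta>))"
      proof -
        have "cmod (T / 2) \<le> cmod (\<delta> n q + T / 2) + cmod (\<delta> n q)"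
          using norm_triangle_ineq4[of "\<delta> n q + T / 2" "\<delta> n q"] by simp
        then show ?thesis using est' by (simp add: T_def[symmetric] norm_divide)
      qed
      also have "C / r * (cmod \<alpha> + cmod \<beta>) \<le> C / r * (2 * D)"
        using C r by (intro mult_left_mono) (auto simp: D_def)
      finally show ?thesis by simp
    qed
    have gd: "2 * cmod g \<le> 2 * v / real n * (cmod g + M) + 2 * cmod (gap_length n q)" "g\<^sup>2 = c1 * c2"
      using gap_defect[OF q V n1] unfolding g_def c1_def c2_def z_def M_def by auto
    have "M \<le> 16 * (cmod (gap_length n q) + cmod (\<delta> n q))"
    proof (rule block_lower_bound[where m = "min (cmod c1) (cmod c2)" and g = "cmod g" and \<eta> = "v / r" and \<kappa> = "4 * C / r" and D = D and e = e])
      have "(cmod g)\<^sup>2 = cmod c1 * cmod c2" using gd(2) by (metis norm_mult norm_power)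
      then show "(cmod g)\<^sup>2 = M * min (cmod c1) (cmod c2)" by (auto simp: M_def max_def min_def)
      show "2 * cmod g \<le> 2 * (v / r) * (cmod g + M) + 2 * cmod (gap_length n q)" using gd(1) by (simp add: r_def)
      show "v / r \<le> 1 / 16" using vr by linarith
      show "4 * C / r \<le> 1 / 32" using r by (simp add: pos_divide_le_eq)
    qed (use vr DM e Mm D0 in \<open>auto simp: M_def\<close>)
    then show "in_strip (int n) (lambda_minus n q) \<and>
      cmod (coefC (cf q) (int n) (lambda_minus n q)) \<le> 16 * (cmod (gap_length n q) + cmod (\<delta> n q)) \<and>
      cmod (coefC (reflect (cf q)) (int n) (lambda_minus n q)) \<le> 16 * (cmod (gap_length n q) + cmod (\<delta> n q))"
      using z unfolding M_def c1_def c2_def z_def by simp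
  qed
qed

section \<open>Regularity of the potential\<close>

lemma sum_even_tail_le:
  fixes g :: "nat \<Rightarrow> real"
  assumes g: "\<And>G. finite G \<Longrightarrow> G \<subseteq> {N..} \<Longrightarrow> sum g G \<le> T" and F: "finite (F :: int set)"
  shows "(\<Sum>k\<in>{k\<in>F. even k \<and> 2 * int N \<le> \<bar>k\<bar>}. g (nat \<bar>k\<bar> div 2)) \<le> 2 * T"
proof -
  let ?s = "\<lambda>k::int. nat \<bar>k\<bar> div 2"
  let ?E = "{k\<in>F. even k \<and> 2 * int N \<le> \<bar>k\<bar>}"
  define P where "P = {k\<in>?E. 0 \<le> k}"
  define M where "M = {k\<in>?E. k < 0}"
  have part: "(\<Sum>k\<in>A. g (?s k)) \<le> T" if A: "A = P \<or> A = M" for A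
  proof -
    have "inj_on ?s A" using A by (auto simp: P_def M_def inj_on_def elim!: evenE)
    then have "(\<Sum>k\<in>A. g (?s k)) = sum g (?s ` A)" by (simp add: sum.reindex)
    also have "\<dots> \<le> T" using A F by (intro g) (auto simp: P_def M_def)
    finally show ?thesis .
  qed
  have "?E = P \<union> M" by (auto simp: P_def M_def)
  moreover have "(\<Sum>k\<in>P \<union> M. g (?s k)) = (\<Sum>k\<in>P. g (?s k)) + (\<Sum>k\<in>M. g (?s k))"
    using F by (intro sum.union_disjoint) (auto simp: P_def M_def)
  ultimately show ?thesis using part[of P] part[of M] by simp
qed

lemma ell2_tail:
  assumes N: "1 \<le> N"
  shows "ell2 (\<lambda>k::int. if even k \<and> 2 * int N \<le> \<bar>k\<bar> then 2 / \<bar>real_of_int k\<bar> else 0) (2 / sqrt (real N))"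
  unfolding ell2_def
proof (intro conjI allI impI)
  fix F :: "int set" assume F: "finite F"
  let ?E = "{k\<in>F. even k \<and> 2 * int N \<le> \<bar>k\<bar>}" and ?s = "\<lambda>k::int. nat \<bar>k\<bar> div 2"
  have s: "(2 / \<bar>real_of_int k\<bar>)\<^sup>2 = 1 / (real (?s k))\<^sup>2" if ev: "even k" for k
  proof -
    obtain m where m: "k = 2 * m" using ev by (rule evenE)
    have "nat \<bar>2 * m\<bar> div 2 = nat \<bar>m\<bar>" by (simp add: abs_mult nat_mult_distrib)
    then show ?thesis by (simp add: m abs_mult power_divide)
  qed
  have "(\<Sum>k\<in>F. (norm (if even k \<and> 2 * int N \<le> \<bar>k\<bar> then 2 / \<bar>real_of_int k\<bar> else 0))\<^sup>2) = (\<Sum>k\<in>?E. 1 / (real (?s k))\<^sup>2)"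
  proof (rule sum.mono_neutral_cong_right[OF F])
    fix k assume "k \<in> ?E"
    then show "(norm (if even k \<and> 2 * int N \<le> \<bar>k\<bar> then 2 / \<bar>real_of_int k\<bar> else 0))\<^sup>2 = 1 / (real (?s k))\<^sup>2"
      using s[of k] by (simp del: power_divide)
  qed auto
  also have "\<dots> \<le> 2 * (2 / real N)"
    by (rule sum_even_tail_le[OF inverse_squares_tail_le F]) (use N in auto)
  also have "\<dots> = (2 / sqrt (real N))\<^sup>2" by (simp add: power_divide)
  finally show "(\<Sum>k\<in>F. (norm (if even k \<and> 2 * int N \<le> \<bar>k\<bar> then 2 / \<bar>real_of_int k\<bar> else 0))\<^sup>2) \<le> (2 / sqrt (real N))\<^sup>2" .
qed simp

text \<open>Indexes the block coefficients like the Fourier coefficients that they approximate: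
  \<open>2 * n\<close> for \<open>V\<close>, \<open>- (2 * n)\<close> for its reflection. It is
  meant for even \<open>k\<close> with \<open>\<bar>k\<bar> \<ge> 2 * N\<close>.\<close>

definition tail_coef :: "(nat \<Rightarrow> complex) \<Rightarrow> (int \<Rightarrow> complex) \<Rightarrow> int \<Rightarrow> complex" where
  "tail_coef z V k = (if 0 \<le> k then coefC V (k div 2) (z (nat (k div 2))) else coefC (reflect V) (- k div 2) (z (nat (- k div 2))))"

context
  fixes z :: "nat \<Rightarrow> complex" and N :: nat
  assumes z: "\<And>n. N \<le> n \<Longrightarrow> in_strip (int n) (z n)" and N: "1 \<le> N"
begin

private definition tail :: "int \<Rightarrow> bool" where "tail k \<longleftrightarrow> even k \<and> 2 * int N \<le> \<bar>k\<bar>"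

private lemma tail_cases:
  assumes "tail k"
  obtains n where "N \<le> n" "k = 2 * int n" | n where "N \<le> n" "k = - (2 * int n)"
proof -
  obtain m where m: "k = 2 * m" using assms by (auto simp: tail_def elim: evenE)
  have "N \<le> nat \<bar>m\<bar>" using assms by (simp add: tail_def m abs_mult)
  then show ?thesis using that(1)[of "nat \<bar>m\<bar>"] that(2)[of "nat \<bar>m\<bar>"] m by (cases "0 \<le> m") auto
qed

lemma tail_coef_bound:
  assumes W: "submult_weight W" and U: "ellw W U u" and uN: "2 * u \<le> real N" and k: "even k" "2 * int N \<le> \<bar>k\<bar>"
  shows "W k * cmod (tail_coef z U k - U k) \<le> 4 * u\<^sup>2 / \<bar>real_of_int k\<bar>"
proof -
  have "tail k" using k by (simp add: tail_def)
  then show ?thesis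
  proof (cases rule: tail_cases)
    case (1 n)
    then have "2 * u \<le> real_of_int (int n)" using uN by simp
    from coef_bounds(2)[OF W U z[OF 1(1)] this] show ?thesis using 1 by (simp add: tail_coef_def)
  next
    case (2 n)
    then have "2 * u \<le> real_of_int (int n)" using uN by simp
    from coef_bounds(3)[OF W U z[OF 2(1)] this] show ?thesis using 2 N submultD(4)[OF W, of "2 * int n"]
      by (simp add: tail_coef_def)
  qed
qed

text \<open>Both potentials are evaluated at the same points \<open>z\<close>, so only their
  difference enters, with the factor \<open>1 / n\<close> that \<open>\<bar>k\<bar> / 2 = n\<close>
  cancels.\<close>

lemma tail_coef_perturb:
  assumes U: "ell2 U u" and U': "ell2 U' u" and uN: "2 * u \<le> real N" and k: "even k" "2 * int N \<le> \<bar>k\<bar>"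
    and d: "ell2 (\<lambda>j. U j - U' j) d"
  shows "\<bar>real_of_int k\<bar> / 2 * cmod ((tail_coef z U k - U k) - (tail_coef z U' k - U' k)) \<le> 6 * u * d"
proof -
  have "tail k" using k by (simp add: tail_def)
  then show ?thesis
  proof (cases rule: tail_cases)
    case (1 n)
    then have "2 * u \<le> real_of_int (int n)" using uN by simp
    from coef_perturb(2)[OF U U' z[OF 1(1)] z[OF 1(1)] this d]
    show ?thesis using 1 N by (simp add: tail_coef_def pos_le_divide_eq mult.commute)
  next
    case (2 n)
    then have "2 * u \<le> real_of_int (int n)" using uN by simp
    from coef_perturb(3)[OF U U' z[OF 2(1)] z[OF 2(1)] this d]
    show ?thesis using 2 N by (simp add: tail_coef_def pos_le_divide_eq mult.commute)
  qed
qed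

text \<open>The tail of \<open>V\<close> is determined by the rest of \<open>V\<close> and by its block coefficients through a
  contraction, which also leaves invariant the balls of the weighted spaces. So \<open>V\<close> inherits the decay of these coefficients.\<close>

lemma bootstrap:
  assumes W: "submult_weight W" and V: "ell2 V R" and R: "1 \<le> R" and RN: "4096 * R\<^sup>2 \<le> real N"
    and d: "ellw W (\<lambda>k. if even k \<and> 2 * int N \<le> \<bar>k\<bar> then tail_coef z V k else V k) R"
  shows "ellw W V (2 * R)"
proof -
  \<comment> \<open>The second-order part is at most
    \<open>4 * (2 * R)\<^sup>2 / \<bar>k\<bar>\<close> for potentials of norm \<open>2 * R\<close>;
    multiplied by \<open>\<bar>k\<bar> / 2\<close> this is \<open>8 * R\<^sup>2\<close>.\<close>
  define \<kappa> where "\<kappa> = 8 * R\<^sup>2"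
  define D where "D k = (if tail k then tail_coef z V k else V k)" for k
  \<comment> \<open>The unknown correction is written as \<open>\<xi>\<close> divided by
    \<open>n = \<bar>k\<bar> / 2\<close>. The factor \<open>1 / n\<close> is square summable, so a
    merely bounded \<open>\<xi>\<close> already gives a correction in the weighted space.\<close>
  define X where "X \<xi> k = (if tail k then \<xi> k * of_real (2 / \<bar>real_of_int k\<bar>) else 0)" for \<xi> :: "int \<Rightarrow> complex" and k
  define U where "U \<xi> k = D k + X \<xi> k" for \<xi> k
  define F where "F \<xi> k = (if tail k then - of_real (\<bar>real_of_int k\<bar> / 2) * (tail_coef z (U \<xi>) k - U \<xi> k) else 0)" for \<xi> k
  have s64: "64 * R \<le> sqrt (real N)"
    using RN by (intro real_le_rsqrt) (simp add: power_mult_distrib)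
  have sN: "0 < sqrt (real N)" using N by simp
  have \<kappa>0: "0 \<le> \<kappa>" by (simp add: \<kappa>_def)
  \<comment> \<open>On the tail the sequence \<open>2 / \<bar>k\<bar>\<close> has norm at most
    \<open>2 / sqrt N\<close>, small enough that the correction adds at most
    \<open>R\<close>.\<close>
  have small: "\<kappa> * (2 / sqrt (real N)) \<le> R"
  proof -
    have "16 * R\<^sup>2 \<le> R * (64 * R)" by (simp add: power2_eq_square)
    also have "\<dots> \<le> R * sqrt (real N)" using s64 R by (intro mult_left_mono) auto
    finally show ?thesis using sN by (simp add: \<kappa>_def pos_divide_le_eq)
  qed
  have dW: "ellw W D R" using d by (simp add: D_def[abs_def] tail_def)
  have d1: "ell2 D R" by (rule ellw_ell2[OF W dW])
  have kpos: "0 < \<bar>real_of_int k\<bar>" if "tail k" for k using that N by (auto simp: tail_def)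
  have tl: "ell2 (\<lambda>k. if tail k then 2 / \<bar>real_of_int k\<bar> else 0) (2 / sqrt (real N))"
    using ell2_tail[OF N] by (simp add: tail_def)
  have Xw: "ellw Y (X \<xi>) R" if Y: "submult_weight Y" and \<xi>: "\<And>k. Y k * cmod (\<xi> k) \<le> \<kappa>" for Y \<xi>
  proof -
    have "ellw Y (X \<xi>) (\<kappa> * (2 / sqrt (real N)))"
    proof (rule ell2_scale[OF tl \<kappa>0])
      fix k
      have "Y k * cmod (\<xi> k) * (2 / \<bar>real_of_int k\<bar>) \<le> \<kappa> * (2 / \<bar>real_of_int k\<bar>)" by (intro mult_right_mono \<xi>) auto
      then show "norm (Y k * cmod (X \<xi> k)) \<le> \<kappa> * norm (if tail k then 2 / \<bar>real_of_int k\<bar> else 0)"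
        using submultD(2)[OF Y, of k] by (simp add: X_def norm_mult norm_divide abs_mult)
    qed
    then show ?thesis using small by (rule ell2_mono)
  qed
  have Uw: "ellw Y (U \<xi>) (2 * R)" if Y: "submult_weight Y" and dY: "ellw Y D R" and \<xi>: "\<And>k. Y k * cmod (\<xi> k) \<le> \<kappa>" for Y \<xi>
  proof -
    have "ell2 (\<lambda>k. Y k * cmod (D k) + Y k * cmod (X \<xi> k)) (R + R)" by (rule ell2_add[OF dY Xw[OF Y \<xi>]])
    then have "ellw Y (U \<xi>) (R + R)"
    proof (rule ell2_le)
      fix k
      have "Y k * cmod (U \<xi> k) \<le> Y k * (cmod (D k) + cmod (X \<xi> k))" unfolding U_def
        using submultD(2)[OF Y, of k] by (intro mult_left_mono norm_triangle_ineq) auto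
      then show "norm (Y k * cmod (U \<xi> k)) \<le> norm (Y k * cmod (D k) + Y k * cmod (X \<xi> k))"
        using submultD(2)[OF Y, of k] by (simp add: distrib_left abs_mult)
    qed
    then show ?thesis by simp
  qed
  have RN2: "2 * (2 * R) \<le> real N"
  proof -
    have "4 * R \<le> 4096 * R\<^sup>2" using R by (simp add: power2_eq_square mult_le_cancel_right1)
    then show ?thesis using RN by linarith
  qed
  have Fb: "Y k * cmod (F \<xi> k) \<le> \<kappa>" if Y: "submult_weight Y" and dY: "ellw Y D R" and \<xi>: "\<And>k. Y k * cmod (\<xi> k) \<le> \<kappa>" for Y \<xi> k
  proof (cases "tail k")
    case True
    then have k: "even k" "2 * int N \<le> \<bar>k\<bar>" by (auto simp: tail_def)
    have "Y k * cmod (tail_coef z (U \<xi>) k - U \<xi> k) \<le> 4 * (2 * R)\<^sup>2 / \<bar>real_of_int k\<bar>"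
      by (rule tail_coef_bound[OF Y Uw[OF Y dY \<xi>] RN2 k])
    then have "\<bar>real_of_int k\<bar> * (Y k * cmod (tail_coef z (U \<xi>) k - U \<xi> k)) \<le> 16 * R\<^sup>2"
      using kpos[OF True] by (simp add: pos_le_divide_eq power_mult_distrib mult.commute)
    then show ?thesis using True by (simp add: F_def norm_mult \<kappa>_def mult_ac)
  qed (simp add: F_def \<kappa>0)
  have contr: "cmod (F x i - F y i) \<le> E / 2"
    if x: "\<And>k. cmod (x k) \<le> \<kappa>" and y: "\<And>k. cmod (y k) \<le> \<kappa>" and E: "0 \<le> E" and xy: "\<And>i. cmod (x i - y i) \<le> E"
    for x y :: "int \<Rightarrow> complex" and E i
  proof (cases "tail i")
    case True
    then have k: "even i" "2 * int N \<le> \<bar>i\<bar>" by (auto simp: tail_def)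
    have "ellw (\<lambda>_. 1) D R" using d1 by simp
    then have u: "ell2 (U x) (2 * R)" "ell2 (U y) (2 * R)"
      using Uw[OF submult_one, of x] Uw[OF submult_one, of y] x y by simp_all
    have dd: "ell2 (\<lambda>j. U x j - U y j) (E * (2 / sqrt (real N)))"
    proof (rule ell2_scale[OF tl E])
      fix j
      have "U x j - U y j = (if tail j then (x j - y j) * of_real (2 / \<bar>real_of_int j\<bar>) else 0)"
        by (simp add: U_def X_def left_diff_distrib diff_divide_distrib)
      then have "norm (U x j - U y j) = (if tail j then cmod (x j - y j) * (2 / \<bar>real_of_int j\<bar>) else 0)"
        by (simp only: norm_mult norm_of_real norm_zero if_distrib[of norm] abs_divide abs_abs abs_numeral)
      then show "norm (U x j - U y j) \<le> E * norm (if tail j then 2 / \<bar>real_of_int j\<bar> else 0)"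
        using mult_right_mono[OF xy[of j], of "2 / \<bar>real_of_int j\<bar>"] by simp
    qed
    have "F x i - F y i = - of_real (\<bar>real_of_int i\<bar> / 2) * ((tail_coef z (U x) i - U x i) - (tail_coef z (U y) i - U y i))"
      using True by (simp add: F_def algebra_simps)
    then have "cmod (F x i - F y i) = \<bar>real_of_int i\<bar> / 2 * cmod ((tail_coef z (U x) i - U x i) - (tail_coef z (U y) i - U y i))"
      by (simp only: norm_mult norm_minus_cancel norm_of_real abs_divide abs_abs abs_numeral)
    also have "\<dots> \<le> 6 * (2 * R) * (E * (2 / sqrt (real N)))"
      by (rule tail_coef_perturb[OF u RN2 k dd])
    also have "\<dots> = 24 * R * E / sqrt (real N)" by simp
    also have "\<dots> \<le> E / 2"
    proof -
      have "24 * R * E \<le> 32 * R * E" using R E by (intro mult_right_mono) auto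
      also have "\<dots> \<le> E / 2 * sqrt (real N)" using mult_right_mono[OF s64 E] by (simp add: mult.commute)
      finally show ?thesis using sN by (simp add: pos_divide_le_eq)
    qed
    finally show ?thesis .
  qed (use E in \<open>simp add: F_def\<close>)
  define S where "S = {\<xi> :: int \<Rightarrow> complex. \<forall>k. cmod (\<xi> k) \<le> \<kappa>}"
  define SW where "SW = {\<xi> :: int \<Rightarrow> complex. \<forall>k. cmod (\<xi> k) \<le> \<kappa> / W k}"
  have SW: "\<xi> \<in> SW \<longleftrightarrow> (\<forall>k. W k * cmod (\<xi> k) \<le> \<kappa>)" for \<xi>
    using submultD(2)[OF W] by (simp add: SW_def pos_le_divide_eq mult.commute)
  have Wle: "\<kappa> / W k \<le> \<kappa>" for k
    using mult_left_mono[OF submultD(1)[OF W, of k] \<kappa>0] submultD(2)[OF W, of k] by (simp add: pos_divide_le_eq)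
  have sub: "SW \<subseteq> S" unfolding SW_def S_def using Wle order_trans by blast
  have "\<exists>\<xi>\<in>SW. F \<xi> = \<xi>"
  proof (rule sup_contraction_fixpoint[where \<rho> = "\<lambda>k. \<kappa> / W k" and R = \<kappa>, folded SW_def])
    show "0 \<le> \<kappa> / W k" for k using \<kappa>0 submultD(2)[OF W, of k] by simp
    show "\<kappa> / W k \<le> \<kappa>" for k by (rule Wle)
    show "F \<xi> \<in> SW" if "\<xi> \<in> SW" for \<xi> using that Fb[OF W dW, of \<xi>] unfolding SW by blast
    show "cmod (F x i - F y i) \<le> E / 2" if "x \<in> SW" "y \<in> SW" "0 \<le> E" "\<And>i. cmod (x i - y i) \<le> E"
      for x y :: "int \<Rightarrow> complex" and E i
      by (rule contr[OF _ _ that(3,4)]) (use sub that(1,2) in \<open>auto simp: S_def\<close>)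
  qed blast
  then obtain \<xi> where \<xi>: "\<xi> \<in> SW" "F \<xi> = \<xi>" by blast
  \<comment> \<open>The correction that the given potential actually has. It is a fixed point too,
    but so far only known to be bounded without the weight.\<close>
  define \<eta> where "\<eta> k = (if tail k then - of_real (\<bar>real_of_int k\<bar> / 2) * (tail_coef z V k - V k) else 0)" for k
  have U\<eta>: "U \<eta> = V"
  proof
    fix k
    show "U \<eta> k = V k"
    proof (cases "tail k")
      case True
      have "\<eta> k * of_real (2 / \<bar>real_of_int k\<bar>) = - (tail_coef z V k - V k)"
        using True kpos[OF True] by (simp add: \<eta>_def)
      then show ?thesis using True by (simp add: U_def D_def X_def)
    qed (simp add: U_def D_def X_def)
  qed
  have F\<eta>: "F \<eta> = \<eta>"
  proof
    show "F \<eta> k = \<eta> k" for k unfolding F_def U\<eta> by (simp add: \<eta>_def)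
  qed
  have "cmod (\<eta> k) \<le> \<kappa>" for k
  proof (cases "tail k")
    case True
    then have k: "even k" "2 * int N \<le> \<bar>k\<bar>" by (auto simp: tail_def)
    have "1 * cmod (tail_coef z V k - V k) \<le> 4 * R\<^sup>2 / \<bar>real_of_int k\<bar>"
      by (rule tail_coef_bound[OF submult_one _ _ k]) (use V RN2 R in auto)
    then have "\<bar>real_of_int k\<bar> * cmod (tail_coef z V k - V k) \<le> 4 * R\<^sup>2"
      using kpos[OF True] by (simp add: pos_le_divide_eq mult.commute)
    also have "\<dots> \<le> 16 * R\<^sup>2" by simp
    finally show ?thesis using True by (simp add: \<eta>_def norm_mult \<kappa>_def)
  qed (simp add: \<eta>_def \<kappa>0)
  then have \<eta>S: "\<eta> \<in> S" by (simp add: S_def)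
  \<comment> \<open>Uniqueness in the unweighted ball transfers the weighted bound from
    \<open>\<xi>\<close> to \<open>\<eta>\<close>.\<close>
  have "\<eta> = \<xi>"
  proof (rule sup_contraction_unique[where F = F and S = S and D = "2 * \<kappa>", OF _ \<eta>S F\<eta> _ \<xi>(2)])
    show "\<xi> \<in> S" using \<xi>(1) sub by blast
    then have "cmod (\<eta> i) \<le> \<kappa>" "cmod (\<xi> i) \<le> \<kappa>" for i using \<eta>S by (auto simp: S_def)
    then show "cmod (\<eta> i - \<xi> i) \<le> 2 * \<kappa>" for i using norm_triangle_ineq4[of "\<eta> i" "\<xi> i"] by (smt (verit))
    show "cmod (F x i - F y i) \<le> E / 2" if "x \<in> S" "y \<in> S" "0 \<le> E" "\<And>i. cmod (x i - y i) \<le> E"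
      for x y :: "int \<Rightarrow> complex" and E i
      by (rule contr[OF _ _ that(3,4)]) (use that(1,2) in \<open>auto simp: S_def\<close>)
  qed
  then have "U \<xi> = V" using U\<eta> by simp
  moreover have "ellw W (U \<xi>) (2 * R)" using Uw[OF W dW] \<xi>(1) unfolding SW by blast
  ultimately show ?thesis by simp
qed

end

text \<open>The cut-off \<open>N\<close> has to be large compared with the weighted norm of the low
  modes, which itself grows with \<open>N\<close>. The circle is broken by fixing \<open>R\<close>
  from quantities that do not involve the weight, then \<open>N\<close> from \<open>R\<close>, and
  only then a rate \<open>\<epsilon>\<close> so small that the weight is at most 2 up to
  \<open>N\<close>.\<close>

lemma regularity:
  fixes u :: "real \<Rightarrow> int \<Rightarrow> real" and w :: "int \<Rightarrow> real"
  assumes \<delta>: "alternate_gap_lengths \<delta>" and q: "q \<in> L2"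
    and sum: "(\<lambda>n. (w (int n))\<^sup>2 * (cmod (gap_length n q) + cmod (\<delta> n q))\<^sup>2) summable_on {1..}"
    and u: "\<And>\<epsilon>. 0 < \<epsilon> \<Longrightarrow> \<epsilon> \<le> \<eta> \<Longrightarrow> submult_weight (u \<epsilon>)"
    and ue: "\<And>\<epsilon> m. 0 < \<epsilon> \<Longrightarrow> \<epsilon> \<le> \<eta> \<Longrightarrow> u \<epsilon> m \<le> exp (\<epsilon> * \<bar>real_of_int m\<bar>)"
    and uw: "\<And>\<epsilon> n. 0 < \<epsilon> \<Longrightarrow> \<epsilon> \<le> \<eta> \<Longrightarrow> K \<le> n \<Longrightarrow> u \<epsilon> (int n) \<le> w (int n)"
    and \<eta>: "0 < \<eta>"
  obtains \<epsilon> M where "0 < \<epsilon>" "\<epsilon> \<le> \<eta>" "ellw (u \<epsilon>) (fourier q) M"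
proof -
  define h where "h n = 16 * (cmod (gap_length n q) + cmod (\<delta> n q))" for n
  define z where "z n = lambda_minus n q" for n
  define v where "v = L2_norm q"
  have V: "ell2 (cf q) v" unfolding v_def by (rule bessel[OF q])
  have v: "0 \<le> v" using V by (rule ell2_nonneg)
  obtain N0 where N0: "\<And>n. N0 \<le> n \<Longrightarrow> in_strip (int n) (z n)" "\<And>n. N0 \<le> n \<Longrightarrow> cmod (coefC (cf q) (int n) (z n)) \<le> h n"
      "\<And>n. N0 \<le> n \<Longrightarrow> cmod (coefC (reflect (cf q)) (int n) (z n)) \<le> h n"
    using alternate_gap_lower[OF \<delta> q] unfolding eventually_sequentially z_def h_def by blast
  let ?f = "\<lambda>n. (w (int n))\<^sup>2 * (cmod (gap_length n q) + cmod (\<delta> n q))\<^sup>2"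
  define S where "S = infsum ?f {1..}"
  have S: "sum (\<lambda>n. (w (int n) * h n)\<^sup>2) G \<le> 256 * S" if "finite G" "G \<subseteq> {1..}" for G
  proof -
    have "sum ?f G \<le> S" unfolding S_def using that by (intro finite_sum_le_infsum sum) auto
    moreover have "sum (\<lambda>n. (w (int n) * h n)\<^sup>2) G = 256 * sum ?f G"
      unfolding sum_distrib_left by (intro sum.cong refl) (simp only: h_def power_mult_distrib, simp)
    ultimately show ?thesis by simp
  qed
  have S0: "0 \<le> S" unfolding S_def by (intro infsum_nonneg) auto
  \<comment> \<open>\<open>h\<close> contains the factor 16, whose square is 256, and each
    \<open>n\<close> accounts for the two indices \<open>2 * n\<close> and
    \<open>- (2 * n)\<close>.\<close>
  define R0 where "R0 = sqrt (512 * S)"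
  define R where "R = 2 * v + R0 + 1"
  have R0: "0 \<le> R0" using S0 by (simp add: R0_def)
  obtain N :: nat where "max (max (real N0) (real K)) (max 1 (4096 * R\<^sup>2)) \<le> real N" using real_arch_simple by blast
  then have N: "N0 \<le> N" "K \<le> N" "1 \<le> N" "4096 * R\<^sup>2 \<le> real N" by auto
  \<comment> \<open>Makes \<open>exp (\<epsilon> * N) \<le> 2\<close>, so that the low modes have
    weighted norm at most \<open>2 * v\<close>.\<close>
  define \<epsilon> where "\<epsilon> = min \<eta> (ln 2 / real N)"
  have \<epsilon>: "0 < \<epsilon>" "\<epsilon> \<le> \<eta>" using \<eta> N(3) by (auto simp: \<epsilon>_def)
  have "\<epsilon> \<le> ln 2 / real N" by (simp add: \<epsilon>_def)
  then have \<epsilon>N: "\<epsilon> * real N \<le> ln 2" using N(3) by (simp add: pos_le_divide_eq)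
  note us = u[OF \<epsilon>]
  define W where "W = half_weight (u \<epsilon>)"
  have W: "submult_weight W" unfolding W_def by (rule submult_half_weight[OF us])
  have W2: "W (2 * m) = u \<epsilon> m" for m unfolding W_def by (rule half_weight_even[OF us])
  define B where "B k = (if even k \<and> 2 * int N \<le> \<bar>k\<bar> then w (int (nat \<bar>k\<bar> div 2)) * h (nat \<bar>k\<bar> div 2) else 0)" for k :: int
  have B: "ell2 B R0"
    unfolding ell2_def
  proof (intro conjI allI impI R0)
    fix F :: "int set" assume F: "finite F"
    have "(\<Sum>k\<in>F. (norm (B k))\<^sup>2) = (\<Sum>k\<in>{k\<in>F. even k \<and> 2 * int N \<le> \<bar>k\<bar>}. (\<lambda>n. (w (int n) * h n)\<^sup>2) (nat \<bar>k\<bar> div 2))"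
      using F by (intro sum.mono_neutral_cong_right) (auto simp: B_def)
    also have "\<dots> \<le> 2 * (256 * S)" using N(3) by (intro sum_even_tail_le S F) auto
    also have "\<dots> = R0\<^sup>2" using S0 by (simp add: R0_def)
    finally show "(\<Sum>k\<in>F. (norm (B k))\<^sup>2) \<le> R0\<^sup>2" .
  qed
  have A: "ell2 (\<lambda>k. 2 * cmod (cf q k)) (2 * v)" by (rule ell2_scale[OF V]) auto
  have "ellw W (\<lambda>k. if even k \<and> 2 * int N \<le> \<bar>k\<bar> then tail_coef z (cf q) k else cf q k) (2 * v + R0)"
  proof (rule ell2_le[OF ell2_add[OF A B]])
    fix k
    have Wk: "0 \<le> W k" using submultD(2)[OF W, of k] by simp
    show "norm (W k * cmod (if even k \<and> 2 * int N \<le> \<bar>k\<bar> then tail_coef z (cf q) k else cf q k)) \<le> norm (2 * cmod (cf q k) + B k)"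
    proof (cases "even k \<and> 2 * int N \<le> \<bar>k\<bar>")
      case True
      obtain m where m: "k = 2 * m" using True by (auto elim: evenE)
      define n where "n = nat \<bar>m\<bar>"
      have n: "N \<le> n" using True by (simp add: m n_def abs_mult)
      have s: "nat \<bar>k\<bar> div 2 = n" by (simp add: m n_def abs_mult nat_mult_distrib)
      have "u \<epsilon> m = u \<epsilon> (int n)" using submultD(4)[OF us, of m] by (cases "0 \<le> m") (auto simp: n_def)
      then have 1: "W k \<le> w (int n)" using uw[OF \<epsilon>, of n] n N(2) by (simp add: m W2)
      have "cmod (tail_coef z (cf q) k) \<le> h n"
      proof -
        have "- (2 * m) div 2 = - m" by presburger
        then show ?thesis using N0(2,3)[of n] n N(1) by (auto simp: tail_coef_def m n_def)
      qed
      then have "W k * cmod (tail_coef z (cf q) k) \<le> w (int n) * h n"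
        using 1 Wk by (intro mult_mono) auto
      also have "\<dots> \<le> 2 * cmod (cf q k) + B k" using True by (simp add: B_def s)
      also have "\<dots> \<le> norm (2 * cmod (cf q k) + B k)" unfolding real_norm_def by (rule abs_ge_self)
      finally show ?thesis unfolding if_P[OF True] using Wk by (simp only: real_norm_def abs_mult abs_norm_cancel abs_of_nonneg)
    next
      case False
      have "W k * cmod (cf q k) \<le> 2 * cmod (cf q k)"
      proof (cases "even k")
        case True
        then obtain m where m: "k = 2 * m" by (auto elim: evenE)
        have "W k \<le> exp (\<epsilon> * \<bar>real_of_int m\<bar>)" unfolding m W2 by (rule ue[OF \<epsilon>])
        also have "\<dots> \<le> exp (ln 2)"
        proof (subst exp_le_cancel_iff)
          have "\<bar>m\<bar> \<le> int N" using False True by (simp add: m abs_mult)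
          then have "\<bar>real_of_int m\<bar> \<le> real N" by linarith
          then have "\<epsilon> * \<bar>real_of_int m\<bar> \<le> \<epsilon> * real N" using \<epsilon>(1) by (intro mult_left_mono) auto
          then show "\<epsilon> * \<bar>real_of_int m\<bar> \<le> ln 2" using \<epsilon>N by linarith
        qed
        finally show ?thesis by (intro mult_right_mono) auto
      next
        case False
        then obtain m where "k = 2 * m + 1" by (auto elim: oddE)
        then show ?thesis using cf_fourier(2)[OF q, of m] by simp
      qed
      then show ?thesis using False Wk by (auto simp: B_def abs_mult)
    qed
  qed
  then have d: "ellw W (\<lambda>k. if even k \<and> 2 * int N \<le> \<bar>k\<bar> then tail_coef z (cf q) k else cf q k) R"
    by (rule ell2_mono) (simp add: R_def)
  have "ellw W (cf q) (2 * R)"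
  proof (rule bootstrap[OF _ N(3) W _ _ N(4) d])
    show "in_strip (int n) (z n)" if "N \<le> n" for n using N0(1) that N(1) by simp
    show "ell2 (cf q) R" by (rule ell2_mono[OF V]) (use v R0 in \<open>simp add: R_def\<close>)
    show "1 \<le> R" using v R0 by (simp add: R_def)
  qed
  then have "ell2 (\<lambda>m. W (2 * m) * cmod (cf q (2 * m))) (2 * R)" by (rule ell2_reindex) (simp add: inj_def)
  then have "ellw (u \<epsilon>) (fourier q) (2 * R)" by (simp add: W2 cf_fourier(1)[OF q])
  then show ?thesis by (rule that[OF \<epsilon>])
qed

section \<open>Weights for the two growth regimes\<close>

lemma submult_radial_weight:
  fixes f :: "nat \<Rightarrow> real"
  assumes f0: "\<And>m. 0 \<le> f m" and mono: "\<And>m n. m \<le> n \<Longrightarrow> f m \<le> f n" and sub: "\<And>m n. f (m + n) \<le> f m + f n"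
  shows "submult_weight (\<lambda>k. exp (f (nat \<bar>k\<bar>)))"
proof -
  have "f (nat \<bar>j + k\<bar>) \<le> f (nat \<bar>j\<bar>) + f (nat \<bar>k\<bar>)" for j k
    by (rule order_trans[OF mono sub]) auto
  then show ?thesis using f0 by (simp add: submult_weight_def normalized_weight_def exp_add[symmetric])
qed

text \<open>Below a rate \<open>c\<close> smaller than the lower limit, the pure exponentials are
  submultiplicative weights that \<open>w\<close> eventually dominates.\<close>

lemma exponential_regularity:
  assumes \<delta>: "alternate_gap_lengths \<delta>" and q: "q \<in> L2" and w: "exponential_weight w"
    and sum: "(\<lambda>n. (w (int n))\<^sup>2 * (cmod (gap_length n q) + cmod (\<delta> n q))\<^sup>2) summable_on {1..}"
  obtains \<epsilon> M where "0 < \<epsilon>" "\<And>n. cmod (fourier q n) \<le> M * exp (- (\<epsilon> * \<bar>real_of_int n\<bar>))"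
proof -
  have lim: "liminf (\<lambda>n. ereal (ln (w (int n)) / real n)) > 0" and sw: "submult_weight w" using w by (auto simp: exponential_weight_def)
  obtain c where c: "0 < c" "ereal c < liminf (\<lambda>n. ereal (ln (w (int n)) / real n))"
    using ereal_dense2[OF lim] by auto
  obtain N1 where N1: "\<And>n. N1 \<le> n \<Longrightarrow> c < ln (w (int n)) / real n"
    using less_LiminfD[OF c(2)] unfolding eventually_sequentially by auto
  define u where "u \<epsilon> k = exp (\<epsilon> * real (nat \<bar>k\<bar>))" for \<epsilon> and k :: int
  obtain \<epsilon> M where \<epsilon>: "0 < \<epsilon>" and M: "ellw (u \<epsilon>) (fourier q) M"
  proof (rule regularity[OF \<delta> q sum, where u = u and \<eta> = c and K = "max N1 1"])
    fix \<epsilon> :: real assume \<epsilon>: "0 < \<epsilon>" "\<epsilon> \<le> c"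
    show "submult_weight (u \<epsilon>)" unfolding u_def[abs_def]
      by (rule submult_radial_weight) (use \<epsilon> in \<open>auto simp: distrib_left\<close>)
    show "u \<epsilon> m \<le> exp (\<epsilon> * \<bar>real_of_int m\<bar>)" for m by (simp add: u_def)
    fix n assume n: "max N1 1 \<le> n"
    have "\<epsilon> * real n \<le> c * real n" using \<epsilon> by (intro mult_right_mono) auto
    also have "\<dots> \<le> ln (w (int n))" using N1[of n] n by (simp add: pos_less_divide_eq)
    finally have "exp (\<epsilon> * real n) \<le> exp (ln (w (int n)))" by simp
    then show "u \<epsilon> (int n) \<le> w (int n)" using submultD(2)[OF sw, of "int n"] by (simp add: u_def)
  qed (use c(1) that in auto)
  have "cmod (fourier q n) \<le> M * exp (- (\<epsilon> * \<bar>real_of_int n\<bar>))" for n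
    using ell2_point[OF M, of n] by (simp add: u_def exp_minus field_simps)
  then show ?thesis using \<epsilon> that by blast
qed

lemma monoseq_to_zero_antimono:
  fixes f :: "nat \<Rightarrow> real"
  assumes "monoseq f" "f \<longlonglongrightarrow> 0" "\<And>n. 0 \<le> f n" "m \<le> n"
  shows "f n \<le> f m"
  using assms(1) unfolding monoseq_iff
proof
  assume "incseq f"
  then have "f n \<le> 0" using incseq_le[OF _ assms(2)] by blast
  then show ?thesis using assms(3)[of m] by linarith
next
  assume "decseq f" then show ?thesis using assms(4) by (simp add: decseq_def)
qed

text \<open>\<open>w\<close> need not be submultiplicative. It is replaced by
  \<open>exp (n * min \<epsilon> (\<phi> n))\<close> with \<open>\<phi> n = ln (w n) / n\<close>: a
  nonincreasing rate makes the exponent subadditive, and since \<open>\<phi>\<close> tends to 0 the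
  minimum is eventually \<open>\<phi>\<close>, so no decay is lost.\<close>

lemma strictly_subexponential_regularity:
  assumes \<delta>: "alternate_gap_lengths \<delta>" and q: "q \<in> L2" and w: "strictly_subexponential w"
    and sum: "(\<lambda>n. (w (int n))\<^sup>2 * (cmod (gap_length n q) + cmod (\<delta> n q))\<^sup>2) summable_on {1..}"
  shows "q \<in> H_weighted w"
proof -
  define \<phi> where "\<phi> n = ln (w (int n)) / real n" for n
  have w1: "1 \<le> w k" "w (- k) = w k" for k using w by (auto simp: strictly_subexponential_def normalized_weight_def)
  have lim: "\<phi> \<longlonglongrightarrow> 0" and wmono: "mono_on {0..} w" using w by (auto simp: strictly_subexponential_def \<phi>_def[abs_def])
  obtain N where N: "monoseq (\<lambda>n. \<phi> (n + N))" using w by (auto simp: strictly_subexponential_def \<phi>_def)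
  have \<phi>0: "0 \<le> \<phi> n" for n using w1(1)[of "int n"] by (simp add: \<phi>_def)
  have dec': "\<phi> (n + N) \<le> \<phi> (m + N)" if "m \<le> n" for m n
    by (rule monoseq_to_zero_antimono[OF N LIMSEQ_ignore_initial_segment[OF lim] \<phi>0 that])
  define K where "K = max N 1"
  have dec: "\<phi> n \<le> \<phi> m" if "K \<le> m" "m \<le> n" for m n using dec'[of "m - N" "n - N"] that by (simp add: K_def)
  \<comment> \<open>Monotonicity of \<open>\<phi>\<close> is known only from \<open>K\<close> on, so
    the rate is frozen below \<open>K\<close>; the cap \<open>\<epsilon>\<close> provides the slow
    exponential growth required by \<open>regularity\<close>.\<close>
  define \<psi> where "\<psi> \<epsilon> n = min \<epsilon> (\<phi> (max n K))" for \<epsilon> n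
  have \<psi>0: "0 \<le> \<psi> \<epsilon> n" if "0 < \<epsilon>" for \<epsilon> n using that \<phi>0 by (simp add: \<psi>_def)
  have \<psi>dec: "\<psi> \<epsilon> n \<le> \<psi> \<epsilon> m" if "m \<le> n" for \<epsilon> m n
    using dec[of "max m K" "max n K"] that unfolding \<psi>_def by (intro min.mono) auto
  define f where "f \<epsilon> n = real n * \<psi> \<epsilon> n" for \<epsilon> n
  have f_alt: "f \<epsilon> n = min (\<epsilon> * real n) (real n * \<phi> (max n K))" for \<epsilon> n
    unfolding f_def \<psi>_def by (simp add: min_mult_distrib_left mult.commute)
  have n\<phi>: "real n * \<phi> n = ln (w (int n))" if "1 \<le> n" for n using that by (simp add: \<phi>_def)
  \<comment> \<open>From \<open>K\<close> on, \<open>n * \<phi> n\<close> is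
    \<open>ln (w n)\<close>, so here the monotonicity of \<open>w\<close> itself enters, while the
    rate alone decreases.\<close>
  have mono_inner: "real m * \<phi> (max m K) \<le> real n * \<phi> (max n K)" if "m \<le> n" for m n
  proof (cases "n \<le> K")
    case True
    then show ?thesis using that \<phi>0 by (simp add: mult_right_mono)
  next
    case False
    define m' where "m' = max m K"
    have m': "1 \<le> m'" "m \<le> m'" "m' \<le> n" using that False by (auto simp: m'_def K_def)
    have "real m * \<phi> m' \<le> real m' * \<phi> m'" using m' \<phi>0 by (intro mult_right_mono) auto
    also have "\<dots> = ln (w (int m'))" by (rule n\<phi>[OF m'(1)])
    also have "\<dots> \<le> ln (w (int n))" using m' mono_onD[OF wmono, of "int m'" "int n"] w1(1)[of "int m'"] by simp
    also have "\<dots> = real n * \<phi> n" using m' by (intro n\<phi>[symmetric]) auto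
    finally show ?thesis using False by (simp add: m'_def)
  qed
  define u where "u \<epsilon> k = exp (f \<epsilon> (nat \<bar>k\<bar>))" for \<epsilon> and k :: int
  obtain \<epsilon> M where \<epsilon>: "0 < \<epsilon>" and M: "ellw (u \<epsilon>) (fourier q) M"
  proof (rule regularity[OF \<delta> q sum, where u = u and \<eta> = 1 and K = K])
    fix \<epsilon> :: real assume \<epsilon>: "0 < \<epsilon>" "\<epsilon> \<le> 1"
    show "submult_weight (u \<epsilon>)" unfolding u_def[abs_def]
    proof (rule submult_radial_weight)
      show "0 \<le> f \<epsilon> m" for m using \<psi>0[OF \<epsilon>(1)] by (simp add: f_def)
      show "f \<epsilon> m \<le> f \<epsilon> n" if "m \<le> n" for m n
        unfolding f_alt using \<epsilon> that by (intro min.mono mono_inner mult_left_mono) auto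
      show "f \<epsilon> (m + n) \<le> f \<epsilon> m + f \<epsilon> n" for m n
        unfolding f_def of_nat_add distrib_right by (intro add_mono mult_left_mono \<psi>dec) auto
    qed
    show "u \<epsilon> m \<le> exp (\<epsilon> * \<bar>real_of_int m\<bar>)" for m by (simp add: u_def f_alt)
    fix n assume n: "K \<le> n"
    then have "f \<epsilon> n \<le> ln (w (int n))" using n\<phi>[of n] by (simp add: f_alt max_absorb1 K_def)
    then have "exp (f \<epsilon> n) \<le> exp (ln (w (int n)))" by simp
    then show "u \<epsilon> (int n) \<le> w (int n)" using w1(1)[of "int n"] by (simp add: u_def)
  qed (use that in auto)
  obtain K' where K': "\<And>n. K' \<le> n \<Longrightarrow> \<phi> n \<le> \<epsilon>"
    using order_tendstoD(2)[OF lim \<epsilon>] unfolding eventually_sequentially by (meson less_imp_le)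
  define K2 where "K2 = max K K'"
  define c where "c = w (int K2)"
  have c: "1 \<le> c" using w1 by (simp add: c_def)
  \<comment> \<open>Beyond \<open>K2\<close> the two weights coincide; below it \<open>w\<close> is
    at most its value at \<open>K2\<close>, and \<open>u \<ge> 1\<close>.\<close>
  have "w k \<le> c * u \<epsilon> k" for k
  proof -
    define n where "n = nat \<bar>k\<bar>"
    have wk: "w k = w (int n)" using w1(2)[of k] by (cases "0 \<le> k") (auto simp: n_def)
    show ?thesis
    proof (cases "n \<le> K2")
      case True
      have "w (int n) \<le> c" unfolding c_def using True by (intro mono_onD[OF wmono]) auto
      also have "\<dots> \<le> c * u \<epsilon> k" using c \<psi>0[OF \<epsilon>] by (simp add: u_def f_def)
      finally show ?thesis by (simp add: wk)
    next
      case False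
      then have n: "K \<le> n" "K' \<le> n" "1 \<le> n" by (auto simp: K2_def K_def)
      have "f \<epsilon> n = real n * \<phi> n" using n K'[of n] by (simp add: f_def \<psi>_def max_absorb1 min_absorb2)
      then have "u \<epsilon> k = w (int n)" using n\<phi>[OF n(3)] w1(1)[of "int n"] by (simp add: u_def n_def[symmetric])
      then show ?thesis using c w1(1)[of "int n"] by (simp add: wk mult_le_cancel_right1)
    qed
  qed
  then have wu: "w k \<le> c * u \<epsilon> k" for k .
  have "ellw w (fourier q) (c * M)"
  proof (rule ell2_scale[OF M])
    show "0 \<le> c" using c by simp
    fix k
    have "0 \<le> w k" "0 \<le> u \<epsilon> k" using order_trans[OF zero_le_one w1(1)[of k]] by (simp_all add: u_def)
    then show "norm (w k * cmod (fourier q k)) \<le> c * norm (u \<epsilon> k * cmod (fourier q k))"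
      using mult_right_mono[OF wu[of k], of "cmod (fourier q k)"] by (simp add: abs_mult mult.assoc)
  qed
  from ell2_summable[OF this] show ?thesis using q by (simp add: H_weighted_def power_mult_distrib)
qed

text \<open>Within a bounded interval, the sets with vanishing integral include the half lines and
  form a Dynkin class, hence contain all Borel sets; completion adds the Lebesgue sets. A density
  with zero integral over every measurable set vanishes almost everywhere.\<close>

lemma AE_zero_of_interval_integrals:
  assumes \<phi>: "locint \<phi>" and z: "\<And>a b. integral {a..b} \<phi> = 0"
  shows "AE x in lebesgue. \<phi> x = 0"
proof -
  have on: "AE x in lebesgue. x \<in> {- real n..real n} \<longrightarrow> \<phi> x = 0" for n
  proof -
    let ?J = "{- real n..real n}"
    define \<psi> where "\<psi> x = indicat_real ?J x *\<^sub>R \<phi> x" for x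
    define \<mu> where "\<mu> A = (LINT x:A|lebesgue. \<psi> x)" for A
    have i: "integrable lebesgue \<psi>" using locintD(1)[OF \<phi>, of "- real n" "real n"] by (simp add: set_integrable_def \<psi>_def[abs_def])
    have iA: "set_integrable lebesgue A \<psi>" if "A \<in> sets lebesgue" for A
      unfolding set_integrable_def by (rule integrable_mult_indicator[OF that i])
    have iv: "(LINT x:{a..b}|lebesgue. \<phi> x) = 0" for a b
      using set_lebesgue_integral_eq_integral(2)[OF locintD(1)[OF \<phi>]] z by simp
    have U: "\<mu> UNIV = 0"
      using iv[of "- real n" "real n"] by (simp add: \<mu>_def \<psi>_def set_lebesgue_integral_def)
    have borel: "\<mu> A = 0" if "A \<in> sets borel" for A
    proof -
      have sb: "sets (borel :: real measure) = sigma_sets UNIV (range (\<lambda>a. {..a}))"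
        unfolding borel_eq_atMost by simp
      have leb: "A \<in> sets lebesgue" if "A \<in> sigma_sets UNIV (range (\<lambda>a::real. {..a}))" for A
        using that unfolding sb[symmetric] by simp
      show ?thesis
      proof (rule sigma_sets_induct_disjoint[OF _ _ that[unfolded sb], where P = "\<lambda>A. \<mu> A = 0"])
        show "Int_stable (range (\<lambda>a::real. {..a}))" by (auto simp: Int_stable_def)
        show "\<mu> {} = 0" by (simp add: \<mu>_def set_lebesgue_integral_def)
        fix A assume "A \<in> range (\<lambda>a::real. {..a})"
        then obtain a where "A = {..a}" by blast
        moreover have "indicat_real {..a} x *\<^sub>R \<psi> x = indicat_real {- real n..min a (real n)} x *\<^sub>R \<phi> x" for x
          by (auto simp: \<psi>_def indicator_def)
        ultimately show "\<mu> A = 0" using iv[of "- real n" "min a (real n)"] by (simp add: \<mu>_def set_lebesgue_integral_def)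
      next
        fix A assume A: "A \<in> sigma_sets UNIV (range (\<lambda>a::real. {..a}))" "\<mu> A = 0"
        have "\<mu> (A \<union> (UNIV - A)) = \<mu> A + \<mu> (UNIV - A)"
          unfolding \<mu>_def by (intro set_integral_Un iA) (use leb[OF A(1)] in auto)
        then show "\<mu> (UNIV - A) = 0" using A(2) U by simp
      next
        fix A :: "nat \<Rightarrow> real set"
        assume A: "disjoint_family A" "range A \<subseteq> sigma_sets UNIV (range (\<lambda>a. {..a}))" "\<And>i. \<mu> (A i) = 0"
        have m: "A i \<in> sets lebesgue" for i using A(2) by (intro leb) auto
        have "\<mu> (\<Union>i. A i) = (\<Sum>i. \<mu> (A i))"
          unfolding \<mu>_def by (rule lebesgue_integral_countable_add[OF m _ iA])
            (use A(1) m in \<open>auto simp: disjoint_family_on_def\<close>)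
        then show "\<mu> (\<Union>i. A i) = 0" using A(3) by simp
      qed simp
    qed
    have all: "\<mu> A = 0" if Al: "A \<in> sets lebesgue" for A
    proof -
      obtain S N N' where S: "A = S \<union> N" "N \<subseteq> N'" "N' \<in> null_sets lborel" "S \<in> sets lborel"
        using sets_completionE[OF Al] by blast
      have "AE x in lebesgue. x \<notin> N'" using S(3) by (intro AE_completion AE_not_in)
      then have "AE x in lebesgue. indicat_real A x *\<^sub>R \<psi> x = indicat_real S x *\<^sub>R \<psi> x"
        by (rule eventually_mono) (use S in \<open>auto simp: indicator_def\<close>)
      then have "\<mu> A = \<mu> S" unfolding \<mu>_def set_lebesgue_integral_def
        using iA[OF Al] iA[of S] S(4) by (intro integral_cong_AE) (auto simp: set_integrable_def)
      then show ?thesis using borel S(4) by simp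
    qed
    have Jm: "?J \<in> sets lebesgue" by simp
    interpret finite_measure "lebesgue_on ?J" by (rule finite_measure_lebesgue_on) auto
    have "AE x in lebesgue_on ?J. \<phi> x = 0"
    proof (rule density_zero)
      show "integrable (lebesgue_on ?J) \<phi>" using i by (simp add: integrable_restrict_space \<psi>_def[abs_def])
      fix A assume "A \<in> sets (lebesgue_on ?J)"
      then have A: "A \<in> sets lebesgue" using Jm by (simp add: sets_restrict_space_iff)
      have "set_lebesgue_integral (lebesgue_on ?J) A \<phi> = \<mu> A"
        unfolding set_lebesgue_integral_def \<mu>_def by (simp add: integral_restrict_space \<psi>_def mult.commute)
      then show "set_lebesgue_integral (lebesgue_on ?J) A \<phi> = 0" using all[OF A] by simp
    qed
    then show ?thesis by (simp add: AE_restrict_space_iff)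
  qed
  then have "AE x in lebesgue. \<forall>n. x \<in> {- real n..real n} \<longrightarrow> \<phi> x = 0" unfolding AE_all_countable by blast
  then show ?thesis
  proof (rule eventually_mono)
    fix x assume *: "\<forall>n. x \<in> {- real n..real n} \<longrightarrow> \<phi> x = 0"
    obtain n where "\<bar>x\<bar> \<le> real n" using real_arch_simple by blast
    then show "\<phi> x = 0" using * by (auto simp: abs_le_iff)
  qed
qed

text \<open>Uniqueness is known for continuous functions only, so it is applied to a primitive
  \<open>G\<close> of the difference: its coefficients other than 0 vanish, \<open>G\<close> is
  constant, and the difference integrates to 0 over every interval.\<close>

lemma AE_eq_of_cf:
  assumes f: "locint f" "\<And>x. f (x + 2) = f x" and g: "locint g" "\<And>x. g (x + 2) = g x" and e: "\<And>k. cf f k = cf g k"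
  shows "AE x in lebesgue. f x = g x"
proof -
  define \<phi> where "\<phi> x = f x - g x" for x
  have \<phi>: "locint \<phi>" unfolding \<phi>_def by (rule locint_diff[OF f(1) g(1)])
  have cf0: "cf \<phi> k = 0" for k using cf_lin[OF f(1) g(1), of 1 "-1" k] e[of k] by (simp add: \<phi>_def[abs_def])
  have per: "\<phi> (x + 2) = \<phi> x" for x by (simp add: \<phi>_def f g)
  obtain G where G: "\<And>x y. x \<le> y \<Longrightarrow> (\<phi> has_integral (G y - G x)) {x..y}" using primitive_exists[OF \<phi>] by blast
  have z: "integral {0..2} \<phi> = 0" using cf0[of 0] by (simp add: cf_def)
  have Gper: "G (x + 2) = G x" for x by (rule primitive_periodic[OF \<phi> G per z])
  have cG: "continuous_on UNIV G" by (rule primitive_continuous[OF \<phi> G])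
  have G20: "G 2 = G 0" using Gper[of 0] by (simp only: add_0_left)
  define c where "c = cf G 0"
  have "G = (\<lambda>_. c)"
  proof (rule continuous_eqI_cf[OF cG _ Gper])
    fix k
    have "cf \<phi> k = \<i> * of_real (pi * real_of_int k) * cf G k"
      by (rule cf_primitive[OF \<phi> G G20])
    then have "k \<noteq> 0 \<Longrightarrow> cf G k = 0" using cf0[of k] by simp
    moreover have "cf (\<lambda>_. c) k = c * cf (\<lambda>_. 1) k"
      using cf_lin[of "\<lambda>_. 1" "\<lambda>_. 1" c 0 k] by (simp add: locint_cont)
    ultimately show "cf G k = cf (\<lambda>_. c) k" by (simp add: cf_one c_def)
  qed auto
  then have G0: "G y - G x = 0" for x y by simp
  have "integral {a..b} \<phi> = 0" for a b
    using integral_unique[OF G[of a b]] G0 by (cases "a \<le> b") auto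
  then have "AE x in lebesgue. \<phi> x = 0" by (rule AE_zero_of_interval_integrals[OF \<phi>])
  then show ?thesis by (simp add: \<phi>_def)
qed

section \<open>Exponential decay and analyticity\<close>

lemma decays_exponential:
  assumes c: "0 < c" and a: "\<And>k. cmod (a k) \<le> M * exp (- (c * \<bar>real_of_int k\<bar>))"
  shows "decays a"
  unfolding decays_def
proof (intro exI allI)
  fix k :: int
  define x where "x = c * \<bar>real_of_int k\<bar>"
  have x: "0 \<le> x" using c by (simp add: x_def)
  have M: "0 \<le> M" using order_trans[OF norm_ge_zero a[of 0]] by simp
  have "1 + x + x\<^sup>2 / 2 \<le> exp x" by (rule exp_lower_Taylor_quadratic[OF x])
  then have e: "1 \<le> exp x" "x\<^sup>2 \<le> 2 * exp x" using x zero_le_power2[of x] by linarith+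
  have "(real_of_int k)\<^sup>2 = x\<^sup>2 / c\<^sup>2" using c by (simp add: x_def power_mult_distrib)
  also have "\<dots> \<le> 2 * exp x / c\<^sup>2" using e(2) by (intro divide_right_mono) auto
  finally have k2: "(real_of_int k)\<^sup>2 \<le> 2 * exp x / c\<^sup>2" .
  have "(1 + 2 / c\<^sup>2) * exp x = exp x + 2 * exp x / c\<^sup>2" by (simp add: distrib_right)
  then have k: "1 + (real_of_int k)\<^sup>2 \<le> (1 + 2 / c\<^sup>2) * exp x" using e(1) k2 by linarith
  have "(1 + (real_of_int k)\<^sup>2) * cmod (a k) \<le> ((1 + 2 / c\<^sup>2) * exp x) * (M * exp (- x))"
    using k a[of k] by (intro mult_mono) (auto simp: x_def)
  also have "\<dots> = (1 + 2 / c\<^sup>2) * M" by (simp add: exp_minus)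
  finally show "(1 + (real_of_int k)\<^sup>2) * cmod (a k) \<le> (1 + 2 / c\<^sup>2) * M" .
qed

text \<open>Every mode is expanded at \<open>x0\<close>. For
  \<open>\<bar>x - x0\<bar> < c / (2 * pi)\<close> the expansion of the mode \<open>k\<close> costs
  at most \<open>exp (c / 2 * \<bar>k\<bar>)\<close>, half of the available decay, so the double
  series converges absolutely and can be summed over \<open>k\<close> first.\<close>

lemma synth_power_series:
  assumes c: "0 < c" and a: "\<And>k. cmod (a k) \<le> M * exp (- (c * \<bar>real_of_int k\<bar>))"
  shows "\<exists>b r. r > 0 \<and> (\<forall>x. \<bar>x - x0\<bar> < r \<longrightarrow> (\<lambda>m. b m * complex_of_real (x - x0) ^ m) sums synth a x)"
proof (intro exI conjI allI impI)
  let ?e = "\<lambda>k. \<i> * complex_of_real (pi * real_of_int k)"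
  let ?b = "\<lambda>m. \<Sum>\<^sub>\<infinity>k. a k * mode k x0 * (?e k ^ m / fact m)"
  show "0 < c / (2 * pi)" using c by simp
  fix x assume x: "\<bar>x - x0\<bar> < c / (2 * pi)"
  define y where "y = x - x0"
  have y: "pi * \<bar>y\<bar> \<le> c / 2" using x by (simp add: y_def pos_less_divide_eq mult_ac)
  have M: "0 \<le> M" using order_trans[OF norm_ge_zero a[of 0]] by simp
  define g where "g k m = a k * mode k x0 * ((?e k * of_real y) ^ m /\<^sub>R fact m)" for k and m :: nat
  have gk: "(g k has_sum a k * mode k x) UNIV" "((\<lambda>m. cmod (g k m)) has_sum cmod (a k) * exp (pi * \<bar>real_of_int k\<bar> * \<bar>y\<bar>)) UNIV" for k
  proof -
    have n: "cmod (?e k * of_real y) = pi * \<bar>real_of_int k\<bar> * \<bar>y\<bar>" by (simp add: norm_mult abs_mult)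
    have m: "mode k x = mode k x0 * exp (?e k * of_real y)"
      by (simp add: mode_def cis_conv_exp exp_add[symmetric] y_def algebra_simps)
    have "((\<lambda>m. (?e k * of_real y) ^ m /\<^sub>R fact m) has_sum exp (?e k * of_real y)) UNIV"
      by (rule norm_summable_imp_has_sum[OF summable_norm_exp exp_converges])
    from has_sum_cmult_right[OF this, of "a k * mode k x0"] show "(g k has_sum a k * mode k x) UNIV"
      unfolding g_def m by (simp add: mult.assoc)
    have r: "((\<lambda>m. (pi * \<bar>real_of_int k\<bar> * \<bar>y\<bar>) ^ m /\<^sub>R fact m) has_sum exp (pi * \<bar>real_of_int k\<bar> * \<bar>y\<bar>)) UNIV"
      by (rule norm_summable_imp_has_sum[OF summable_norm_exp exp_converges])
    have "cmod (g k m) = cmod (a k) * ((pi * \<bar>real_of_int k\<bar> * \<bar>y\<bar>) ^ m /\<^sub>R fact m)" for m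
      unfolding g_def norm_mult[of "a k * mode k x0"] norm_scaleR norm_power n by (simp add: norm_mult)
    then show "((\<lambda>m. cmod (g k m)) has_sum cmod (a k) * exp (pi * \<bar>real_of_int k\<bar> * \<bar>y\<bar>)) UNIV"
      using has_sum_cmult_right[OF r, of "cmod (a k)"] by simp
  qed
  have "(\<lambda>p. norm (case p of (k, m) \<Rightarrow> g k m)) summable_on UNIV \<times> UNIV"
    unfolding Infinite_Sum.abs_summable_on_Sigma_iff
  proof (intro conjI ballI)
    fix k :: int
    show "(\<lambda>m. norm (case (k, m) of (k, m) \<Rightarrow> g k m)) summable_on UNIV" using has_sum_imp_summable[OF gk(2)] by simp
  next
    define d where "d k = complex_of_real (M * exp (- (c / 2 * \<bar>real_of_int k\<bar>)))" for k
    have "decays d" by (rule decays_exponential[of "c / 2" _ M]) (use c M in \<open>auto simp: d_def norm_mult\<close>)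
    then have "(\<lambda>k. norm (d k)) summable_on UNIV" by (rule decays_abs_summable)
    then show "(\<lambda>k. norm (\<Sum>\<^sub>\<infinity>m. norm (case (k, m) of (k, m) \<Rightarrow> g k m))) summable_on UNIV"
    proof (rule Infinite_Sum.abs_summable_on_comparison_test)
      fix k :: int
      have "cmod (a k) * exp (pi * \<bar>real_of_int k\<bar> * \<bar>y\<bar>) \<le> M * exp (- (c * \<bar>real_of_int k\<bar>)) * exp (c / 2 * \<bar>real_of_int k\<bar>)"
      proof (rule mult_mono[OF a])
        show "exp (pi * \<bar>real_of_int k\<bar> * \<bar>y\<bar>) \<le> exp (c / 2 * \<bar>real_of_int k\<bar>)"
          using mult_right_mono[OF y, of "\<bar>real_of_int k\<bar>"] by (simp add: mult_ac)
      qed (use M in auto)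
      also have "\<dots> = M * exp (- (c / 2 * \<bar>real_of_int k\<bar>))" by (simp add: mult.assoc exp_add[symmetric])
      finally have "cmod (a k) * exp (pi * \<bar>real_of_int k\<bar> * \<bar>y\<bar>) \<le> cmod (d k)" using M by (simp add: d_def norm_mult)
      then show "norm (\<Sum>\<^sub>\<infinity>m. norm (case (k, m) of (k, m) \<Rightarrow> g k m)) \<le> norm (d k)"
        using infsumI[OF gk(2), of k] by simp
    qed
  qed
  then have s: "(\<lambda>(k, m). g k m) summable_on UNIV \<times> UNIV" by (rule Infinite_Sum.abs_summable_summable)
  then have s': "(\<lambda>(m, k). g k m) summable_on UNIV \<times> UNIV" by (subst summable_on_swap) (simp add: case_prod_unfold)
  have col: "(\<Sum>\<^sub>\<infinity>k. g k m) = ?b m * of_real y ^ m" for m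
  proof -
    have "g k m = (a k * mode k x0 * (?e k ^ m / fact m)) * of_real y ^ m" for k
      unfolding g_def by (simp add: scaleR_conv_of_real power_mult_distrib divide_inverse mult_ac)
    then have "(\<Sum>\<^sub>\<infinity>k. g k m) = (\<Sum>\<^sub>\<infinity>k. (a k * mode k x0 * (?e k ^ m / fact m)) * of_real y ^ m)" by (intro infsum_cong)
    then show ?thesis unfolding infsum_cmult_left' .
  qed
  have "(\<lambda>m. \<Sum>\<^sub>\<infinity>k. g k m) summable_on UNIV" using summable_on_Sigma_banach[OF s'] by simp
  then have "((\<lambda>m. \<Sum>\<^sub>\<infinity>k. g k m) has_sum (\<Sum>\<^sub>\<infinity>m. \<Sum>\<^sub>\<infinity>k. g k m)) UNIV" by (rule has_sum_infsum)
  also have "(\<Sum>\<^sub>\<infinity>m. \<Sum>\<^sub>\<infinity>k. g k m) = (\<Sum>\<^sub>\<infinity>k. \<Sum>\<^sub>\<infinity>m. g k m)" by (rule infsum_swap_banach[OF s, symmetric])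
  also have "\<dots> = synth a x" unfolding synth_def using infsumI[OF gk(1)] by simp
  finally show "(\<lambda>m. ?b m * complex_of_real (x - x0) ^ m) sums synth a x"
    unfolding col y_def by (rule has_sum_imp_sums)
qed

lemma analytic_of_exponential_decay:
  assumes q: "q \<in> L2" and c: "0 < c" and a: "\<And>n. cmod (fourier q n) \<le> M * exp (- (c * \<bar>real_of_int n\<bar>))"
  shows "analytic_circle q"
proof -
  have M: "0 \<le> M" using order_trans[OF norm_ge_zero a[of 0]] by simp
  \<comment> \<open>The rate is halved because the Fourier coefficient of index \<open>m\<close>
    sits at the index \<open>2 * m\<close>.\<close>
  have V: "cmod (cf q k) \<le> M * exp (- (c / 2 * \<bar>real_of_int k\<bar>))" for k
  proof (cases "even k")
    case True
    then obtain m where "k = 2 * m" by (auto elim: evenE)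
    then show ?thesis using a[of m] cf_fourier(1)[OF q, of m] by (simp add: abs_mult)
  next
    case False
    then obtain m where "k = 2 * m + 1" by (auto elim: oddE)
    then show ?thesis using M cf_fourier(2)[OF q, of m] by simp
  qed
  have d: "decays (cf q)" by (rule decays_exponential[OF _ V]) (use c in simp)
  have per: "q (x + 1) = q x" for x using q by (simp add: L2_def)
  have per2: "q (x + 2) = q x" for x using period_shift[where q = q and n = 2 and x = x] per by simp
  show ?thesis unfolding analytic_circle_def
  proof (rule exI[of _ "synth (cf q)"], intro conjI allI)
    fix x
    \<comment> \<open>The modes with odd index are not 1-periodic, but their coefficients
      vanish.\<close>
    have "cf q k * mode k (x + 1) = cf q k * mode k x" for k
    proof (cases "even k")
      case True
      then obtain m where "k = 2 * m" by (auto elim: evenE)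
      then show ?thesis using mode_even_periodic[of m x] by simp
    next
      case False
      then obtain m where "k = 2 * m + 1" by (auto elim: oddE)
      then show ?thesis using cf_fourier(2)[OF q, of m] by simp
    qed
    then show "synth (cf q) (x + 1) = synth (cf q) x" unfolding synth_def by (intro infsum_cong)
  next
    show "\<exists>b r. r > 0 \<and> (\<forall>x. \<bar>x - x0\<bar> < r \<longrightarrow> (\<lambda>k. b k * complex_of_real (x - x0) ^ k) sums synth (cf q) x)" for x0
      by (rule synth_power_series[OF _ V]) (use c in simp)
  next
    show "AE x in lebesgue. q x = synth (cf q) x"
      by (rule AE_eq_of_cf[OF L2_locint[OF q] per2 locint_cont[OF synth_continuous[OF d]] synth_periodic])
        (simp add: cf_synth[OF d])
  qed
qed

theorem theorem4:
  fixes \<delta> :: "nat \<Rightarrow> (real \<Rightarrow> complex) \<Rightarrow> complex"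
  assumes "alternate_gap_lengths \<delta>"
  shows
    "(\<forall>w q. submult_weight w \<and> q \<in> H_weighted w \<longrightarrow>
        (\<forall>\<^sub>F N in sequentially.
           (\<lambda>n. (w (int n))\<^sup>2 * (cmod (\<delta> n q))\<^sup>2) summable_on {N..} \<and>
           (\<Sum>\<^sub>\<infinity>n\<in>{N..}. (w (int n))\<^sup>2 * (cmod (\<delta> n q))\<^sup>2)
             \<le> 4 * (weighted_norm w (trunc N (fourier q)))\<^sup>2
                + 256 / real N * (weighted_norm w (fourier q)) ^ 4)) \<and>
     (\<forall>w q. normalized_weight w \<and> q \<in> L2 \<and>
        (\<lambda>n. (w (int n))\<^sup>2 * (cmod (gap_length n q) + cmod (\<delta> n q))\<^sup>2) summable_on {1..} \<longrightarrow>
        (strictly_subexponential w \<longrightarrow> q \<in> H_weighted w) \<and>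
        (exponential_weight w \<longrightarrow> analytic_circle q))"
proof (intro conjI allI impI)
  fix w q assume "submult_weight w \<and> q \<in> H_weighted w"
  then show "\<forall>\<^sub>F N in sequentially.
           (\<lambda>n. (w (int n))\<^sup>2 * (cmod (\<delta> n q))\<^sup>2) summable_on {N..} \<and>
           (\<Sum>\<^sub>\<infinity>n\<in>{N..}. (w (int n))\<^sup>2 * (cmod (\<delta> n q))\<^sup>2)
             \<le> 4 * (weighted_norm w (trunc N (fourier q)))\<^sup>2
                + 256 / real N * (weighted_norm w (fourier q)) ^ 4"
    by (elim conjE) (rule alternate_gap_sum_bound[OF assms])
next
  fix w q assume h: "normalized_weight w \<and> q \<in> L2 \<and>
        (\<lambda>n. (w (int n))\<^sup>2 * (cmod (gap_length n q) + cmod (\<delta> n q))\<^sup>2) summable_on {1..}"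
  show "q \<in> H_weighted w" if "strictly_subexponential w"
    using h that by (elim conjE) (rule strictly_subexponential_regularity[OF assms])
  show "analytic_circle q" if w: "exponential_weight w"
  proof -
    have q: "q \<in> L2" using h by blast
    obtain \<epsilon> M where "0 < \<epsilon>" "\<And>n. cmod (fourier q n) \<le> M * exp (- (\<epsilon> * \<bar>real_of_int n\<bar>))"
      using exponential_regularity[OF assms q w] h by blast
    then show ?thesis by (rule analytic_of_exponential_decay[OF q])
  qed
qed

end
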